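(* Let $(M,d)$, $(P_t)_{t\ge 0}$, $a$, $b$, $J$, $p,p_*,\beta,\beta_*$ and $Q_\delta$ be as in the context. Assume that for any $f\in C_b^{\mathrm{Lip}}(M)$, $t>0$ and $x\in M$ the limit $$\mathscr{L}P_tf(x):=\lim_{s\to 0}\frac{P_{t+s}f(x)-P_tf(x)}{s}$$ exists. Then the following three conditions are equivalent. (1) For all $\mu_0,\mu_1\in\mathscr{P}(M)$ and $0\le s<t$, $$W_p(P_s^*\mu_0,P_t^*\mu_1)^\beta\le\left(\frac{1}{J([s,t])}\int_{[s,t]}\frac{J(dr)}{a(r)}\right)^{-\beta}W_p(\mu_0,\mu_1)^\beta+J([s,t])^\beta .$$ (2)$^*$ For all $t>0$, $x\in M$ and all $f$ of the form $f=Q_\delta\tilde f$ with $\delta>0$ and $\tilde f\in C_b^{\mathrm{Lip}}(M)$, $$|\nabla P_tf|(x)^{\beta_*}\le a(t)^{\beta_*}\left(P_t(|\nabla f|^{p_*})(x)^{\beta_*/p_*}-b(t)^{\beta_*}|\mathscr{L}P_tf(x)|^{\beta_*}\right).$$ (3) For any minimal geodesic $\gamma:[0,1]\to M$, $0\le s\le t$ and $f\in C_b^{\mathrm{Lip}}(M)$, with $\xi(r):=rt+(1-r)s$, $$|P_tf(\gamma(1))-P_sf(\gamma(0))|\le\int_0^1\left(a(\xi(r))^\beta d(\gamma(0),\gamma(1))^\beta+\left(\frac{t-s}{b(\xi(r))}\right)^\beta\right)^{1/\beta}P_{\xi(r)}(|\nabla f|^{p_*})(\gamma(r))^{1/p_*}\,dr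 .$$
   Context: $(M,d)$ is a Polish metric space whose metric is geodesic: any $x,y\in M$ are joined by a minimal geodesic, i.e. a curve $\gamma:[0,1]\to M$ with $\gamma(0)=x$, $\gamma(1)=y$, $d(\gamma(s),\gamma(t))=|s-t|\,d(x,y)$. $\mathscr{P}(M)$ is the set of Borel probability measures on $M$. $(P_t)_{t\ge0}$ is a semigroup of Markov kernels $P_t(x,\cdot)\in\mathscr{P}(M)$ on $M$ with infinitesimal generator $\mathscr{L}$; $P_tf(x)=\int f(y)P_t(x,dy)$ for bounded measurable $f$, and $P_t^*\mu=\int P_t(x,\cdot)\mu(dx)$. $C_b^{\mathrm{Lip}}(M)$ is the set of bounded Lipschitz functions. For a function $f$, $|\nabla f|(x)=\limsup_{y\to x}|f(y)-f(x)|/d(x,y)$ is the local Lipschitz constant. $W_p(\mu,\nu)=\inf\{\|d\|_{L^p(\pi)}:\pi\text{ a coupling of }\mu,\nu\}\in[0,\infty]$. Exponents: $p,p_*,\beta,\beta_*\in(1,\infty)$ with $1/p+1/p_*=1$, $1/\beta+1/\beta_*=1$, $\beta\le p$. The functions $a:[0,\infty)\to(0,\infty)$ and $b:(0,\infty)\to(0,\infty)$ are continuous, $J$ is the measure on $[0,\infty)$ given by $J(dr)=b(r)^{-1}dr$, and $J([0,\delta))<\infty$ for every $\delta>0$ is assumed. When $t-s=0$ the term $(t-s)/b(\xi(r))$ is read as $0$ (also at $s=t=0$). Hopf–Lax semigroup: for $\delta>0$ and $f:M\to\mathbb{R}$, $Q_\delta f(x)=\inf_{y\in M}\left[f(y)+\frac{\delta}{p}\left(\frac{d(x,y)}{\delta}\right)^p\right]$;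 it maps $C_b^{\mathrm{Lip}}(M)$ to itself.
   Formalization: The semigroup is also assumed continuous at time 0: P_0 is the identity and P_t f(x) → f(x) as t ↓ 0 for bounded Lipschitz f. Without this the claim fails, e.g. P_0 = id and P_t(x,·) = π for all t > 0 satisfies (2)* but not (1). *)

theory Defs
  imports "HOL-Probability.Probability"
begin

section \<open>Metric notions\<close>

text \<open>The metric space \<open>M\<close> is a type of class \<open>polish_space\<close> (complete, second countable).\<close>

definition minimal_geodesic :: "(real \<Rightarrow> 'a::metric_space) \<Rightarrow> bool" where
  "minimal_geodesic \<gamma> \<longleftrightarrow>
     (\<forall>s\<in>{0..1}. \<forall>t\<in>{0..1}. dist (\<gamma> s) (\<gamma> t) = \<bar>s - t\<bar> * dist (\<gamma> 0) (\<gamma> 1))"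

definition bounded_lipschitz :: "('a::metric_space \<Rightarrow> real) set" where
  "bounded_lipschitz = {f. bounded (range f) \<and> (\<exists>C. C-lipschitz_on UNIV f)}"

text \<open>
  Local Lipschitz constant. Since it is valued in \<open>ennreal\<close>, it is \<open>0\<close> at an isolated point
  (where \<open>at x\<close> is the trivial filter); in a geodesic space this only concerns the
  one-point space.
\<close>

definition local_lip :: "('a::metric_space \<Rightarrow> real) \<Rightarrow> 'a \<Rightarrow> ennreal" where
  "local_lip f x = Limsup (at x) (\<lambda>y. ennreal (\<bar>f y - f x\<bar> / dist x y))"

definition hopf_lax :: "real \<Rightarrow> real \<Rightarrow> ('a::metric_space \<Rightarrow> real) \<Rightarrow> 'a \<Rightarrow> real" where
  "hopf_lax p \<delta> f x = (INF y. f y + \<delta> / p * (dist x y / \<delta>) powr p)"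

section \<open>Wasserstein distances\<close>

text \<open>Power on \<open>[0,\<infinity>]\<close>; only used for exponents \<open>r > 0\<close>.\<close>

definition epowr :: "ennreal \<Rightarrow> real \<Rightarrow> ennreal" where
  "epowr x r = (if x = \<top> then \<top> else ennreal (enn2real x powr r))"

abbreviation borel_probs :: "'a::topological_space measure set" where
  "borel_probs \<equiv> space (prob_algebra borel)"

definition couplings ::
    "'a::topological_space measure \<Rightarrow> 'a measure \<Rightarrow> ('a \<times> 'a) measure set" where
  "couplings \<mu> \<nu> = {\<pi> \<in> borel_probs. distr \<pi> borel fst = \<mu> \<and> distr \<pi> borel snd = \<nu>}"

definition wasserstein :: "real \<Rightarrow> 'a::metric_space measure \<Rightarrow> 'a measure \<Rightarrow> ennreal" where
  "wasserstein p \<mu> \<nu> =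
     (INF \<pi> \<in> couplings \<mu> \<nu>. epowr (\<integral>\<^sup>+ z. ennreal (dist (fst z) (snd z) powr p) \<partial>\<pi>) (1 / p))"

section \<open>Markov semigroups\<close>

definition kernel_op :: "(real \<Rightarrow> 'a \<Rightarrow> 'a measure) \<Rightarrow> real \<Rightarrow> ('a \<Rightarrow> real) \<Rightarrow> 'a \<Rightarrow> real" where
  "kernel_op P t f x = (\<integral>y. f y \<partial>P t x)"

text \<open>
  Only the kernels \<open>P t\<close> with \<open>t \<ge> 0\<close> matter. The last condition is the
  continuity at time \<open>0\<close> that is part of having an infinitesimal generator: for a Borel
  probability measure, testing against bounded Lipschitz functions amounts to weak convergence
  of \<open>P t x\<close> to the Dirac measure at \<open>x\<close>. It is not implied by the other conditions:
  \<open>P 0 x = return borel x\<close>, \<open>P t x = \<pi>\<close> for \<open>t > 0\<close> satisfies them.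
\<close>

definition markov_semigroup :: "(real \<Rightarrow> 'a::metric_space \<Rightarrow> 'a measure) \<Rightarrow> bool" where
  "markov_semigroup P \<longleftrightarrow>
     (\<forall>t\<ge>0. P t \<in> borel \<rightarrow>\<^sub>M prob_algebra borel) \<and>
     (\<forall>x. P 0 x = return borel x) \<and>
     (\<forall>s\<ge>0. \<forall>t\<ge>0. \<forall>x. P (s + t) x = P s x \<bind> P t) \<and>
     (\<forall>f\<in>bounded_lipschitz. \<forall>x. ((\<lambda>t. kernel_op P t f x) \<longlongrightarrow> f x) (at_right 0))"

text \<open>
  \<open>gen_quotient P f t x s\<close> is the quotient whose limit for \<open>s \<rightarrow> 0\<close> (two-sided, at times
  \<open>t > 0\<close>) is \<open>\<L> P\<^sub>t f (x)\<close>.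
\<close>

definition gen_quotient ::
    "(real \<Rightarrow> 'a \<Rightarrow> 'a measure) \<Rightarrow> ('a \<Rightarrow> real) \<Rightarrow> real \<Rightarrow> 'a \<Rightarrow> real \<Rightarrow> real" where
  "gen_quotient P f t x s = (kernel_op P (t + s) f x - kernel_op P t f x) / s"

definition gen_semigroup ::
    "(real \<Rightarrow> 'a \<Rightarrow> 'a measure) \<Rightarrow> ('a \<Rightarrow> real) \<Rightarrow> real \<Rightarrow> 'a \<Rightarrow> real" where
  "gen_semigroup P f t x = Lim (at 0) (gen_quotient P f t x)"

section \<open>The three conditions\<close>

text \<open>
  The function \<open>b\<close> is only meaningful on \<open>(0,\<infinity>)\<close>; its value at \<open>0\<close> enters below on
  Lebesgue null sets only, or multiplied by \<open>0\<close>.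
\<close>

definition time_measure :: "(real \<Rightarrow> real) \<Rightarrow> real measure" where
  "time_measure b = density lborel (\<lambda>r. indicator {0..} r * ennreal (1 / b r))"

definition wasserstein_control ::
    "(real \<Rightarrow> 'a::metric_space \<Rightarrow> 'a measure) \<Rightarrow> (real \<Rightarrow> real) \<Rightarrow> (real \<Rightarrow> real) \<Rightarrow>
      real \<Rightarrow> real \<Rightarrow> bool" where
  "wasserstein_control P a b p \<beta> \<longleftrightarrow>
     (\<forall>\<mu>\<^sub>0\<in>borel_probs. \<forall>\<mu>\<^sub>1\<in>borel_probs. \<forall>s t. 0 \<le> s \<and> s < t \<longrightarrow>
        epowr (wasserstein p (\<mu>\<^sub>0 \<bind> P s) (\<mu>\<^sub>1 \<bind> P t)) \<beta>
        \<le> ennreal ((1 / measure (time_measure b) {s..t} *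
                      (LINT r:{s..t}|time_measure b. 1 / a r)) powr (- \<beta>)) *
            epowr (wasserstein p \<mu>\<^sub>0 \<mu>\<^sub>1) \<beta> +
          ennreal (measure (time_measure b) {s..t} powr \<beta>))"

text \<open>
  The right-hand side of the gradient estimate may a priori be negative, so the inequality is
  stated in \<open>ereal\<close> rather than with the truncated subtraction of \<open>ennreal\<close>.
\<close>

definition hopf_lax_gradient_estimate ::
    "(real \<Rightarrow> 'a::metric_space \<Rightarrow> 'a measure) \<Rightarrow> (real \<Rightarrow> real) \<Rightarrow> (real \<Rightarrow> real) \<Rightarrow>
      real \<Rightarrow> real \<Rightarrow> real \<Rightarrow> bool" where
  "hopf_lax_gradient_estimate P a b p p' \<beta>' \<longleftrightarrow>
     (\<forall>t>0. \<forall>x. \<forall>\<delta>>0. \<forall>g\<in>bounded_lipschitz. \<forall>f. f = hopf_lax p \<delta> g \<longrightarrow>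
        enn2ereal (epowr (local_lip (kernel_op P t f) x) \<beta>')
        \<le> ereal (a t powr \<beta>') *
            (enn2ereal (epowr (\<integral>\<^sup>+ y. epowr (local_lip f y) p' \<partial>P t x) (\<beta>' / p'))
             - ereal (b t powr \<beta>' * \<bar>gen_semigroup P f t x\<bar> powr \<beta>')))"

definition geodesic_space_time_estimate ::
    "(real \<Rightarrow> 'a::metric_space \<Rightarrow> 'a measure) \<Rightarrow> (real \<Rightarrow> real) \<Rightarrow> (real \<Rightarrow> real) \<Rightarrow>
      real \<Rightarrow> real \<Rightarrow> bool" where
  "geodesic_space_time_estimate P a b p' \<beta> \<longleftrightarrow>
     (\<forall>\<gamma> s t. \<forall>f\<in>bounded_lipschitz. minimal_geodesic \<gamma> \<and> 0 \<le> s \<and> s \<le> t \<longrightarrow>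
        (let \<xi> = (\<lambda>r. r * t + (1 - r) * s) in
          ennreal \<bar>kernel_op P t f (\<gamma> 1) - kernel_op P s f (\<gamma> 0)\<bar>
          \<le> (\<integral>\<^sup>+ r\<in>{0..1}.
                ennreal ((a (\<xi> r) powr \<beta> * dist (\<gamma> 0) (\<gamma> 1) powr \<beta>
                          + ((t - s) / b (\<xi> r)) powr \<beta>) powr (1 / \<beta>)) *
                epowr (\<integral>\<^sup>+ y. epowr (local_lip f y) p' \<partial>P (\<xi> r) (\<gamma> r)) (1 / p') \<partial>lborel)))"

end

theory Submission
  imports Defs "HOL-Real_Asymp.Real_Asymp"
begin

text \<open>
  Conditions (2) and (3) each bound the increment of \<open>P\<^sub>t f\<close> along a geodesic traversed in time
  \<open>[s, t]\<close>, for \<open>f = Q\<^sub>\<delta> g\<close> and \<open>0 < s < t\<close>, by the suprema of \<open>a\<close>, \<open>1/b\<close> and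
  \<open>P(|\<nabla>f|\<^sup>p\<^sup>*)\<close> along it. Conversely this local bound suffices. It implies (1) by Kantorovich duality:
  move in space along \<open>\<gamma>(\<rho>(T))\<close> with speed proportional to \<open>1/(a b)\<close> while the Hopf--Lax parameter grows
  with speed proportional to \<open>1/b\<close>; by Young's inequality the loss in \<open>Q\<close> pays for the motion,
  so that \<open>P\<^sub>t Q\<^sub>1 f(y) - P\<^sub>s f(x)\<close> is bounded by the transport cost. It implies (2) by comparing
  \<open>P\<^sub>t f(y)\<close> with \<open>P\<^sub>t\<^sub>\<plusminus>\<^sub>\<lambda>\<^sub>d f(x)\<close>, \<open>d = d(x, y)\<close>, and optimising in \<open>\<lambda>\<close>. Passing to limits is possible because
  the slope of a Hopf--Lax function is upper semicontinuous. Finally (1) implies (3)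
  by Hoelder's inequality for optimal couplings of nearby points of a geodesic.
\<close>

section \<open>Inequalities for real powers\<close>

text \<open>The slope of a general \<open>f\<close> has no semicontinuity, so the local bound
  concerns Hopf--Lax functions only, and (3) for all bounded Lipschitz \<open>f\<close> is recovered
  through (1). For \<open>f = Q\<^sub>\<delta> g\<close> the slope moment is, by
  \<open>lip_hopf_lax\<close>, a constant times the integral of the left derivative of an infimal
  convolution, a decreasing limit of integrals of bounded Lipschitz difference quotients. One
  quotient close to the limit can be moved by the semigroup, whose known regularity concerns bounded
  Lipschitz functions. The speeds \<open>1 / (a * b)\<close> and \<open>1 / b\<close> make both
  summands of the increment bound proportional to the density of \<open>J\<close>. A constant
  \<open>w\<close> factors out, and Young's inequality
  \<open>w * N \<le> w powr p / p + N powr p' / p'\<close> matches the second summand with the loss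
  of the Hopf--Lax flow, leaving the cost \<open>w powr p / p\<close>. Up to the factor
  \<open>1 / p\<close> this is \<open>(A * d) powr \<beta> + J powr \<beta>\<close> to the power
  \<open>p / \<beta>\<close>, a concave function of \<open>d powr p\<close> since
  \<open>\<beta> \<le> p\<close>, so a tangent bound integrates it against a coupling without
  loss.\<close>

lemma powr_superadditive:
  fixes x y \<beta> :: real
  assumes "0 \<le> x" "0 \<le> y" "1 \<le> \<beta>"
  shows "x powr \<beta> + y powr \<beta> \<le> (x + y) powr \<beta>"
proof (cases "x + y = 0")
  case True
  then have "x = 0" "y = 0" using assms by auto
  then show ?thesis using assms by simp
next
  case False
  then have pos: "0 < x + y" using assms by simp
  have le: "u powr \<beta> \<le> u" if "0 \<le> u" "u \<le> 1" for u :: real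
    using powr_mono'[of 1 \<beta> u] that assms by simp
  have "(x / (x + y)) powr \<beta> + (y / (x + y)) powr \<beta> \<le> x / (x + y) + y / (x + y)"
    using assms pos by (intro add_mono le) (auto simp: divide_simps)
  also have "\<dots> = 1" using pos by (simp add: add_divide_distrib[symmetric])
  finally have "x powr \<beta> / (x + y) powr \<beta> + y powr \<beta> / (x + y) powr \<beta> \<le> 1"
    using assms pos by (simp add: powr_divide)
  then show ?thesis using pos by (simp add: add_divide_distrib[symmetric] divide_le_eq)
qed

text \<open>Comparison of the norms with exponents \<open>\<beta>\<close> and \<open>1\<close>; it
  turns space-time bounds into Lipschitz bounds in which the contributions of space and time simply
  add.\<close>

lemma powr_root_sum_le:
  fixes x y \<beta> :: real
  assumes "0 \<le> x" "0 \<le> y" "1 \<le> \<beta>"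
  shows "(x powr \<beta> + y powr \<beta>) powr (1 / \<beta>) \<le> x + y"
proof -
  have "(x powr \<beta> + y powr \<beta>) powr (1 / \<beta>) \<le> ((x + y) powr \<beta>) powr (1 / \<beta>)"
    using assms by (intro powr_mono2 powr_superadditive) auto
  also have "\<dots> = x + y" using assms by (simp add: powr_powr)
  finally show ?thesis .
qed

text \<open>Convexity of \<open>x powr q\<close> at the points \<open>u / l\<close> and
  \<open>v / (1 - l)\<close>. For fixed \<open>l\<close> the right-hand side is linear in
  \<open>u powr q\<close>, with equality when \<open>l = u / (u + v)\<close>. The weight stays free
  because it is used both close to \<open>1\<close>, with a small error \<open>v\<close>, and at the
  optimal value.\<close>

lemma powr_add_le_weighted:
  fixes u v q l :: real
  assumes "0 \<le> u" "0 \<le> v" "1 \<le> q" "0 < l" "l < 1"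
  shows "(u + v) powr q \<le> l powr (1 - q) * u powr q + (1 - l) powr (1 - q) * v powr q"
proof -
  have scale: "l powr (1 - q) * u powr q = l * (u / l) powr q" if "0 < l" "0 \<le> u" for l u :: real
    using that by (simp add: powr_divide powr_diff)
  have half: "(l * x) powr q \<le> l * x powr q" if "0 < l" "l < 1" "0 \<le> x" for l x :: real
  proof -
    have "(l * x) powr q = l powr q * x powr q" using that by (simp add: powr_mult)
    also have "\<dots> \<le> l * x powr q"
      using powr_mono'[of 1 q l] that assms by (intro mult_right_mono) auto
    finally show ?thesis .
  qed
  consider "u = 0" | "v = 0" | "0 < u" "0 < v" using assms by linarith
  then have "(u + v) powr q \<le> l * (u / l) powr q + (1 - l) * (v / (1 - l)) powr q"
  proof cases
    case 1
    then show ?thesis using half[of "1 - l" "v / (1 - l)"] assms by simp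
  next
    case 2
    then show ?thesis using half[of l "u / l"] assms by simp
  next
    case 3
    have "(l *\<^sub>R (u / l) + (1 - l) *\<^sub>R (v / (1 - l))) powr q
        \<le> l * (u / l) powr q + (1 - l) * (v / (1 - l)) powr q"
      using powr_convex[of q] assms 3 unfolding convex_on_def
      by (auto simp del: real_scaleR_def)
    then show ?thesis using assms by simp
  qed
  then show ?thesis using scale[of l u] scale[of "1 - l" v] assms by simp
qed

text \<open>Mean value theorem, with the derivative bounded by its value at \<open>u + d\<close>;
  \<open>u = 0\<close> is treated separately because \<open>powr\<close> is differentiated at
  positive points.\<close>

lemma powr_increment_le:
  fixes u d p :: real
  assumes "0 \<le> u" "0 \<le> d" "1 \<le> p"
  shows "(u + d) powr p - u powr p \<le> p * d * (u + d) powr (p - 1)"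
proof -
  consider "d = 0" | "u = 0" "0 < d" | "0 < u" "0 < d" using assms by linarith
  then show ?thesis
  proof cases
    case 2
    then have "d powr p = d * d powr (p - 1)" by (simp add: powr_diff)
    moreover have "1 * (d * d powr (p - 1)) \<le> p * (d * d powr (p - 1))"
      using 2 assms by (intro mult_right_mono) auto
    ultimately show ?thesis using 2 by (simp add: mult.assoc)
  next
    case 3
    have "\<exists>z>u. z < u + d \<and> (u + d) powr p - u powr p = (u + d - u) * (p * z powr (p - 1))"
      using 3 by (intro MVT2) (auto intro!: derivative_eq_intros)
    then obtain z where z: "u < z" "z < u + d"
      "(u + d) powr p - u powr p = d * (p * z powr (p - 1))" by auto
    have "z powr (p - 1) \<le> (u + d) powr (p - 1)"
      using z assms by (intro powr_mono2) auto
    then have "d * (p * z powr (p - 1)) \<le> d * (p * (u + d) powr (p - 1))"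
      using assms by (intro mult_left_mono) auto
    then show ?thesis unfolding z(3) by (simp add: algebra_simps)
  qed auto
qed

lemma conjugate_exponent:
  fixes p p' :: real
  assumes "1 < p" "1 / p + 1 / p' = 1"
  shows "1 < p'" "(p - 1) * p' = p" "p - 1 = p / p'" "p' - 1 = p' / p" "(1 - p) * p' = - p"
    "p' = p / (p - 1)"
proof -
  have e: "1 / p' = (p - 1) / p" using assms by (simp add: field_simps)
  then have "p' = inverse ((p - 1) / p)" by (metis inverse_eq_divide inverse_inverse_eq)
  then show e: "p' = p / (p - 1)" by simp
  show "1 < p'" unfolding e using assms by (simp add: field_simps)
  show "(p - 1) * p' = p" "p - 1 = p / p'" "p' - 1 = p' / p" "(1 - p) * p' = - p"
    unfolding e using assms by (auto simp: field_simps)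
qed

text \<open>Young's inequality in each coordinate after division by the norms \<open>X\<close> and
  \<open>Y\<close>; the right-hand sides then add up to
  \<open>1 / \<beta> + 1 / \<beta>' = 1\<close>.\<close>

lemma Holder_two_terms:
  fixes x1 x2 y1 y2 \<beta> \<beta>' :: real
  assumes "0 \<le> x1" "0 \<le> x2" "0 \<le> y1" "0 \<le> y2" "1 < \<beta>" "1 < \<beta>'" "1 / \<beta> + 1 / \<beta>' = 1"
  shows "x1 * y1 + x2 * y2
    \<le> (x1 powr \<beta> + x2 powr \<beta>) powr (1 / \<beta>) * (y1 powr \<beta>' + y2 powr \<beta>') powr (1 / \<beta>')"
proof -
  define X where "X = (x1 powr \<beta> + x2 powr \<beta>) powr (1 / \<beta>)"
  define Y where "Y = (y1 powr \<beta>' + y2 powr \<beta>') powr (1 / \<beta>')"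
  have X: "X powr \<beta> = x1 powr \<beta> + x2 powr \<beta>" and Y: "Y powr \<beta>' = y1 powr \<beta>' + y2 powr \<beta>'"
    using assms unfolding X_def Y_def by (simp_all add: powr_powr)
  have "0 \<le> X" "0 \<le> Y" unfolding X_def Y_def by simp_all
  then consider "X = 0" | "Y = 0" | "0 < X" "0 < Y" by linarith
  then show ?thesis unfolding X_def[symmetric] Y_def[symmetric]
  proof cases
    case 1
    then have "x1 powr \<beta> + x2 powr \<beta> = 0" using X assms by simp
    then have "x1 = 0" "x2 = 0" using assms by (auto simp: add_nonneg_eq_0_iff)
    then show "x1 * y1 + x2 * y2 \<le> X * Y" using 1 by simp
  next
    case 2
    then have "y1 powr \<beta>' + y2 powr \<beta>' = 0" using Y assms by simp
    then have "y1 = 0" "y2 = 0" using assms by (auto simp: add_nonneg_eq_0_iff)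
    then show "x1 * y1 + x2 * y2 \<le> X * Y" using 2 by simp
  next
    case 3
    have yo: "x / X * (y / Y) \<le> (x / X) powr \<beta> / \<beta> + (y / Y) powr \<beta>' / \<beta>'"
      if "0 \<le> x" "0 \<le> y" for x y
      using assms 3 that by (intro Youngs_inequality) auto
    have "(x1 * y1 + x2 * y2) / (X * Y) = x1 / X * (y1 / Y) + x2 / X * (y2 / Y)"
      by (simp add: add_divide_distrib)
    also have "\<dots> \<le> ((x1 / X) powr \<beta> / \<beta> + (y1 / Y) powr \<beta>' / \<beta>') + ((x2 / X) powr \<beta> / \<beta> + (y2 / Y) powr \<beta>' / \<beta>')"
      using assms by (intro add_mono yo) auto
    also have "\<dots> = (x1 powr \<beta> + x2 powr \<beta>) / X powr \<beta> / \<beta> + (y1 powr \<beta>' + y2 powr \<beta>') / Y powr \<beta>' / \<beta>'"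
      using assms 3 by (simp add: powr_divide add_divide_distrib)
    also have "\<dots> = 1" unfolding X[symmetric] Y[symmetric] using 3 assms by simp
    finally show "x1 * y1 + x2 * y2 \<le> X * Y" using 3 by (simp add: divide_le_eq)
  qed
qed

text \<open>The choice \<open>u = A\<^sup>\<beta>\<^sup>'\<^sup>-\<^sup>1\<close>, \<open>v = B\<^sup>\<beta>\<^sup>'\<^sup>-\<^sup>1\<close> turns the hypothesis into the dual inequality;
  it is only allowed for \<open>A > 0\<close>, and otherwise \<open>u \<rightarrow> 0\<close>.\<close>

lemma dual_norm_two_terms:
  fixes A B N \<beta> \<beta>' :: real
  assumes ex: "1 < \<beta>" "1 < \<beta>'" "1 / \<beta> + 1 / \<beta>' = 1"
    and nn: "0 \<le> A" "0 \<le> B" "0 \<le> N"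
    and le: "\<And>u v. 0 < u \<Longrightarrow> 0 < v \<Longrightarrow> u * A + v * B \<le> (u powr \<beta> + v powr \<beta>) powr (1 / \<beta>) * N"
  shows "A powr \<beta>' + B powr \<beta>' \<le> N powr \<beta>'"
proof -
  have lim: "((\<lambda>u. (u powr \<beta> + 1 powr \<beta>) powr (1 / \<beta>) * N) \<longlongrightarrow> (0 powr \<beta> + 1 powr \<beta>) powr (1 / \<beta>) * N)
      (at_right 0)"
  proof -
    have "((\<lambda>u::real. u powr \<beta>) \<longlongrightarrow> 0 powr \<beta>) (at_right 0)"
      using ex by (intro tendsto_powr2 tendsto_const tendsto_ident_at)
        (auto simp: eventually_at_filter intro!: always_eventually)
    then have "((\<lambda>u. u powr \<beta> + 1 powr \<beta>) \<longlongrightarrow> 0 powr \<beta> + 1 powr \<beta>) (at_right 0)"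
      by (intro tendsto_add tendsto_const)
    then show ?thesis
      by (rule tendsto_mult_right[OF tendsto_powr[OF _ tendsto_const]]) simp
  qed
  have small: "B \<le> N" if "\<And>u. 0 < u \<Longrightarrow> B \<le> (u powr \<beta> + 1 powr \<beta>) powr (1 / \<beta>) * N" for B
  proof -
    have "B \<le> (0 powr \<beta> + 1 powr \<beta>) powr (1 / \<beta>) * N"
      using that by (intro tendsto_lowerbound[OF lim])
        (auto simp: eventually_at_filter intro!: always_eventually)
    then show ?thesis using ex by simp
  qed
  consider "A = 0" | "B = 0" | "0 < A" "0 < B" using nn by linarith
  then show ?thesis
  proof cases
    case 1
    have "B \<le> N" using le[of _ 1] 1 by (intro small) auto
    then show ?thesis using 1 nn ex by (auto intro: powr_mono2)
  next
    case 2
    have "A \<le> N" using le[of 1] 2 by (intro small) (auto simp: add.commute)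
    then show ?thesis using 2 nn ex by (auto intro: powr_mono2)
  next
    case 3
    define S where "S = A powr \<beta>' + B powr \<beta>'"
    have S: "0 < S" unfolding S_def using 3 by (simp add: add_pos_pos)
    have e: "(\<beta>' - 1) * \<beta> = \<beta>'"
      using conjugate_exponent(2)[of \<beta>' \<beta>] ex by (simp add: add.commute)
    have "A powr (\<beta>' - 1) * A + B powr (\<beta>' - 1) * B
        \<le> ((A powr (\<beta>' - 1)) powr \<beta> + (B powr (\<beta>' - 1)) powr \<beta>) powr (1 / \<beta>) * N"
      using 3 by (intro le) auto
    also have "A powr (\<beta>' - 1) * A + B powr (\<beta>' - 1) * B = S"
      using 3 unfolding S_def by (simp add: powr_diff)
    also have "((A powr (\<beta>' - 1)) powr \<beta> + (B powr (\<beta>' - 1)) powr \<beta>) = S"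
      unfolding S_def by (simp add: powr_powr e)
    finally have "S \<le> S powr (1 / \<beta>) * N" .
    moreover have "S = S powr (1 / \<beta>) * S powr (1 / \<beta>')"
      using S ex by (simp flip: powr_add)
    ultimately have "S powr (1 / \<beta>) * S powr (1 / \<beta>') \<le> S powr (1 / \<beta>) * N" by simp
    then have "S powr (1 / \<beta>') \<le> N" using S by simp
    then have "(S powr (1 / \<beta>')) powr \<beta>' \<le> N powr \<beta>'" using ex by (intro powr_mono2) auto
    then show ?thesis using S ex unfolding S_def by (simp add: powr_powr)
  qed
qed

text \<open>Positive bounds \<open>A\<close>, \<open>B\<close> replace the norms, so that division
  by them is always possible. Young's inequality supplies the integrable majorant \<open>h\<close>,
  which gives integrability of the product together with the estimate.\<close>

lemma Holder_integral_bound: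
  fixes f g :: "'a \<Rightarrow> real"
  assumes ex: "1 < p" "1 < p'" "1 / p + 1 / p' = 1"
    and nn: "\<And>x. 0 \<le> f x" "\<And>x. 0 \<le> g x"
    and meas [measurable]: "f \<in> borel_measurable M" "g \<in> borel_measurable M"
    and int: "integrable M (\<lambda>x. f x powr p')" "integrable M (\<lambda>x. g x powr p)"
    and AB: "0 < A" "0 < B" "(\<integral>x. f x powr p' \<partial>M) \<le> A powr p'" "(\<integral>x. g x powr p \<partial>M) \<le> B powr p"
  shows "integrable M (\<lambda>x. f x * g x)" "(\<integral>x. f x * g x \<partial>M) \<le> A * B"
proof -
  define h where "h x = A * B * (f x powr p' / A powr p' / p' + g x powr p / B powr p / p)" for x
  have le: "f x * g x \<le> h x" for x
  proof -
    have "f x / A * (g x / B) \<le> (f x / A) powr p' / p' + (g x / B) powr p / p"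
      using ex AB nn by (intro Youngs_inequality) (auto simp: add.commute)
    then have "A * B * (f x / A * (g x / B)) \<le> h x"
      unfolding h_def using AB nn by (intro mult_left_mono) (simp_all add: powr_divide)
    then show ?thesis using AB by simp
  qed
  have hi: "integrable M h" unfolding h_def using int by auto
  show i: "integrable M (\<lambda>x. f x * g x)"
    by (rule Bochner_Integration.integrable_bound[OF hi]) (auto intro!: AE_I2 order_trans[OF _ le[THEN order_trans[OF _ abs_ge_self]]] simp: nn abs_mult)
  have "(\<integral>x. f x * g x \<partial>M) \<le> (\<integral>x. h x \<partial>M)" by (intro integral_mono i hi le)
  also have "\<dots> = A * B * ((\<integral>x. f x powr p' \<partial>M) / A powr p' / p' + (\<integral>x. g x powr p \<partial>M) / B powr p / p)"
    unfolding h_def using int by simp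
  also have "\<dots> \<le> A * B * (1 / p' + 1 / p)"
    using AB ex by (intro mult_left_mono add_mono divide_right_mono) (auto simp: divide_le_eq)
  finally show "(\<integral>x. f x * g x \<partial>M) \<le> A * B" using ex by (simp add: add.commute)
qed

section \<open>Powers of extended nonnegative reals\<close>

lemma epowr_ennreal [simp]: "0 \<le> x \<Longrightarrow> epowr (ennreal x) r = ennreal (x powr r)"
  by (simp add: epowr_def)

lemma epowr_top [simp]: "epowr \<top> r = \<top>"
  by (simp add: epowr_def)

lemma epowr_mono: "x \<le> y \<Longrightarrow> 0 \<le> r \<Longrightarrow> epowr x r \<le> epowr y r"
  by (cases x; cases y) (auto simp: top_unique intro!: ennreal_leI powr_mono2)

lemma epowr_epowr: "epowr (epowr x r) s = epowr x (r * s)"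
  by (cases x) (auto simp: powr_powr)

lemma epowr_one [simp]: "epowr x 1 = x"
  by (cases x) auto

lemma epowr_le_ennreal_iff:
  assumes "0 < r" "0 \<le> c"
  shows "epowr x r \<le> ennreal c \<longleftrightarrow> x \<le> ennreal (c powr (1 / r))"
proof
  assume "epowr x r \<le> ennreal c"
  from epowr_mono[OF this, of "1 / r"] show "x \<le> ennreal (c powr (1 / r))"
    using assms by (simp add: epowr_epowr)
next
  assume "x \<le> ennreal (c powr (1 / r))"
  from epowr_mono[OF this, of r] show "epowr x r \<le> ennreal c"
    using assms by (simp add: powr_powr)
qed

lemma measurable_epowr [measurable (raw)]:
  assumes [measurable]: "f \<in> borel_measurable M"
  shows "(\<lambda>x. epowr (f x) r) \<in> borel_measurable M"
  unfolding epowr_def by measurable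

section \<open>Dini derivatives\<close>

text \<open>The set \<open>S\<close> is closed by continuity, so it has a last time
  \<open>m\<close>, and the hypothesis at \<open>m\<close> produces a later element unless
  \<open>m = b\<close>. The comparison starts at an interior \<open>c\<close> because increments are
  controlled at interior times only; at the end \<open>e\<close> tends to \<open>0\<close> and
  \<open>c\<close> to \<open>a\<close>.\<close>

lemma Dini_nonincreasing:
  fixes v :: "real \<Rightarrow> real"
  assumes ab: "a < b" and cont: "continuous_on {a..b} v"
    and dini: "\<And>t e. a < t \<Longrightarrow> t < b \<Longrightarrow> 0 < e \<Longrightarrow>
      \<exists>\<eta>>0. \<forall>h. 0 < h \<and> h < \<eta> \<longrightarrow> v (t + h) - v t \<le> e * h"
  shows "v b \<le> v a"
proof -
  have main: "v b - v c \<le> e * (b - c)" if c: "a < c" "c < b" and e: "0 < e" for c e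
  proof -
    define S where "S = {t \<in> {c..b}. v t - e * t \<le> v c - e * c}"
    have co: "continuous_on {c..b} (\<lambda>t. v t - e * t)"
      using c by (intro continuous_intros continuous_on_subset[OF cont]) auto
    have "closed S" unfolding S_def
      by (intro continuous_on_closed_Collect_le[OF co] continuous_on_const closed_atLeastAtMost)
    moreover have "bounded S" unfolding S_def by (rule bounded_subset[of "{c..b}"]) auto
    ultimately have cS: "compact S" by (simp add: compact_eq_bounded_closed)
    have "c \<in> S" unfolding S_def using c by simp
    then have "S \<noteq> {}" by blast
    from compact_attains_sup[OF cS this] obtain m where m: "m \<in> S" "\<And>t. t \<in> S \<Longrightarrow> t \<le> m"
      by blast
    have "m = b"
    proof (rule ccontr)
      assume "m \<noteq> b"
      then have mb: "a < m" "m < b" using m(1) c unfolding S_def by auto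
      then obtain \<eta> where \<eta>: "0 < \<eta>" "\<And>h. 0 < h \<Longrightarrow> h < \<eta> \<Longrightarrow> v (m + h) - v m \<le> e * h"
        using dini[OF mb e] by blast
      define h where "h = min (\<eta> / 2) (b - m)"
      have h: "0 < h" "h < \<eta>" "m + h \<le> b" unfolding h_def using \<eta> mb by auto
      have "m + h \<in> S" using \<eta>(2)[OF h(1,2)] m(1) h unfolding S_def by (auto simp: algebra_simps)
      then show False using m(2)[of "m + h"] h by simp
    qed
    then show ?thesis using m(1) unfolding S_def by (simp add: algebra_simps)
  qed
  have le: "v b \<le> v c" if c: "a < c" "c < b" for c
  proof (rule field_le_epsilon)
    fix e :: real assume "0 < e"
    then show "v b \<le> v c + e" using main[OF c, of "e / (b - c)"] c by auto
  qed
  have "(v \<longlongrightarrow> v a) (at_right a)"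
    using cont ab by (simp add: continuous_on_Icc_at_rightD)
  moreover have "eventually (\<lambda>c. v b \<le> v c) (at_right a)"
    unfolding eventually_at_right[OF ab] using le ab by (intro exI[of _ b]) auto
  ultimately show ?thesis by (intro tendsto_lowerbound) auto
qed

text \<open>Local bounds with every constant above \<open>C\<close> make \<open>v\<close>
  continuous, and \<open>Dini_nonincreasing\<close> applies to \<open>v r - C * r\<close> and to
  \<open>- v r - C * r\<close>.\<close>

lemma Dini_lipschitz_bound:
  fixes v :: "real \<Rightarrow> real"
  assumes C: "0 \<le> C"
    and loc: "\<And>r K. 0 \<le> r \<Longrightarrow> r \<le> 1 \<Longrightarrow> C < K \<Longrightarrow>
      \<exists>\<eta>>0. \<forall>r'\<in>{0..1}. \<bar>r' - r\<bar> < \<eta> \<longrightarrow> \<bar>v r' - v r\<bar> \<le> K * \<bar>r' - r\<bar>"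
  shows "\<bar>v 1 - v 0\<bar> \<le> C"
proof -
  have cont: "continuous_on {0..1} v"
  proof (rule continuous_onI)
    fix r e :: real assume r: "r \<in> {0..1}" and e: "0 < e"
    obtain \<eta> where \<eta>: "0 < \<eta>" "\<And>r'. r' \<in> {0..1} \<Longrightarrow> \<bar>r' - r\<bar> < \<eta> \<Longrightarrow> \<bar>v r' - v r\<bar> \<le> (C + 1) * \<bar>r' - r\<bar>"
      using loc[of r "C + 1"] r by force
    define d where "d = min \<eta> (e / (C + 1))"
    have "0 < d" unfolding d_def using \<eta> e C by auto
    moreover have "dist (v r') (v r) \<le> e" if "r' \<in> {0..1}" "dist r' r < d" for r'
    proof -
      have "\<bar>v r' - v r\<bar> \<le> (C + 1) * \<bar>r' - r\<bar>"
        using \<eta>(2)[of r'] that unfolding d_def dist_real_def by auto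
      also have "\<dots> \<le> (C + 1) * (e / (C + 1))"
        using that C unfolding d_def dist_real_def by (intro mult_left_mono) auto
      finally show ?thesis using C by (simp add: dist_real_def)
    qed
    ultimately show "\<exists>d>0. \<forall>r'\<in>{0..1}. dist r' r < d \<longrightarrow> dist (v r') (v r) \<le> e" by blast
  qed
  have one: "s * v 1 - C \<le> s * v 0" if s: "\<bar>s\<bar> = 1" for s :: real
  proof -
    have "s * v 1 - C * 1 \<le> s * v 0 - C * 0"
    proof (rule Dini_nonincreasing[of 0 1 "\<lambda>r. s * v r - C * r"])
      show "continuous_on {0..1} (\<lambda>r. s * v r - C * r)" by (intro continuous_intros cont)
      fix t e :: real assume t: "0 < t" "t < 1" and e: "0 < e"
      then obtain \<eta> where \<eta>: "0 < \<eta>"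
        "\<And>r'. r' \<in> {0..1} \<Longrightarrow> \<bar>r' - t\<bar> < \<eta> \<Longrightarrow> \<bar>v r' - v t\<bar> \<le> (C + e) * \<bar>r' - t\<bar>"
        using loc[of t "C + e"] by force
      show "\<exists>\<eta>>0. \<forall>h. 0 < h \<and> h < \<eta> \<longrightarrow> s * v (t + h) - C * (t + h) - (s * v t - C * t) \<le> e * h"
      proof (intro exI[of _ "min \<eta> (1 - t)"] conjI allI impI)
        fix h assume h: "0 < h \<and> h < min \<eta> (1 - t)"
        have "s * (v (t + h) - v t) \<le> \<bar>s * (v (t + h) - v t)\<bar>" by simp
        also have "\<dots> \<le> (C + e) * h"
          using \<eta>(2)[of "t + h"] h t s by (simp add: abs_mult)
        finally show "s * v (t + h) - C * (t + h) - (s * v t - C * t) \<le> e * h"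
          by (simp add: algebra_simps)
      qed (use \<eta> t in auto)
    qed simp
    then show ?thesis by simp
  qed
  show ?thesis using one[of 1] one[of "-1"] by auto
qed

section \<open>The local Lipschitz constant\<close>

lemma local_lip_lessD:
  assumes "local_lip f x < ennreal K" "0 \<le> K"
  obtains r where "0 < r" "\<And>y. dist x y < r \<Longrightarrow> \<bar>f y - f x\<bar> \<le> K * dist x y"
proof -
  have "eventually (\<lambda>y. ennreal (\<bar>f y - f x\<bar> / dist x y) < ennreal K) (at x)"
    using assms(1) unfolding local_lip_def by (rule Limsup_lessD)
  then obtain r where r: "0 < r"
    "\<And>y. y \<noteq> x \<Longrightarrow> dist y x < r \<Longrightarrow> ennreal (\<bar>f y - f x\<bar> / dist x y) < ennreal K"
    unfolding eventually_at by blast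
  have "\<bar>f y - f x\<bar> \<le> K * dist x y" if "dist x y < r" for y
  proof (cases "y = x")
    case False
    then have "\<bar>f y - f x\<bar> / dist x y < K"
      using r(2)[of y] that assms(2) by (simp add: dist_commute ennreal_less_iff)
    then show ?thesis using False by (simp add: divide_less_eq)
  qed simp
  with r(1) show ?thesis by (rule that)
qed

lemma local_lip_leI:
  assumes "\<And>K. c < K \<Longrightarrow> \<exists>r>0. \<forall>y. dist x y < r \<longrightarrow> \<bar>f y - f x\<bar> \<le> K * dist x y"
  shows "local_lip f x \<le> ennreal c"
proof (cases "0 \<le> c")
  case True
  have "local_lip f x \<le> ennreal c + ennreal e" if e: "0 < e" for e
  proof -
    obtain r where r: "0 < r" "\<And>y. dist x y < r \<Longrightarrow> \<bar>f y - f x\<bar> \<le> (c + e) * dist x y"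
      using assms[of "c + e"] e by (meson less_add_same_cancel1)
    have "\<bar>f y - f x\<bar> / dist x y \<le> c + e" if "y \<noteq> x" "dist y x < r" for y
      using r(2)[of y] that by (simp add: dist_commute divide_le_eq)
    then have "eventually (\<lambda>y. ennreal (\<bar>f y - f x\<bar> / dist x y) \<le> ennreal (c + e)) (at x)"
      unfolding eventually_at using r(1) ennreal_leI by blast
    then have "local_lip f x \<le> ennreal (c + e)" unfolding local_lip_def by (rule Limsup_bounded)
    then show ?thesis using True e by simp
  qed
  then show ?thesis by (rule ennreal_le_epsilon) simp
next
  case False
  \<comment> \<open>For \<open>c < 0\<close> the hypothesis with \<open>K = c / 2\<close> leaves no
    point other than \<open>x\<close> in a ball, so \<open>x\<close> is isolated and both sides are
    \<open>0\<close>.\<close>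
  obtain r where r: "0 < r" "\<And>y. dist x y < r \<Longrightarrow> \<bar>f y - f x\<bar> \<le> c / 2 * dist x y"
  proof -
    have "c < c / 2" using False by simp
    then show ?thesis using assms that by blast
  qed
  have "eventually (\<lambda>y. ennreal (\<bar>f y - f x\<bar> / dist x y) \<le> ennreal c) (at x)"
    unfolding eventually_at
  proof (intro exI[of _ r] conjI ballI impI)
    fix y assume y: "y \<noteq> x \<and> dist y x < r"
    then have "\<bar>f y - f x\<bar> \<le> c / 2 * dist x y" using r(2)[of y] by (simp add: dist_commute)
    also have "\<dots> < 0" using False y by (intro mult_neg_pos) auto
    finally show "ennreal (\<bar>f y - f x\<bar> / dist x y) \<le> ennreal c" by simp
  qed (rule r(1))
  then show ?thesis unfolding local_lip_def by (rule Limsup_bounded)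
qed

text \<open>The local Lipschitz constant at a fixed scale. It is lower semicontinuous for continuous
  \<open>f\<close>, hence measurable, and decreases to \<open>local_lip\<close> as \<open>r\<close>
  tends to \<open>0\<close>. At a positive scale it bounds genuine increments, which
  \<open>local_lip\<close> does only in the limit.\<close>

definition steepness :: "real \<Rightarrow> ('a::metric_space \<Rightarrow> real) \<Rightarrow> 'a \<Rightarrow> ennreal" where
  "steepness r f x = (SUP y\<in>{y. 0 < dist x y \<and> dist x y < r}. ennreal (\<bar>f y - f x\<bar> / dist x y))"

lemma steepness_le:
  assumes "C-lipschitz_on UNIV f"
  shows "steepness r f x \<le> ennreal C"
proof -
  have "\<bar>f y - f x\<bar> / dist x y \<le> C" if "0 < dist x y" for y
    using lipschitz_onD[OF assms, of y x] that by (simp add: dist_commute dist_real_def divide_le_eq)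
  then show ?thesis unfolding steepness_def by (intro SUP_least ennreal_leI) auto
qed

lemma steepness_increment:
  assumes "C-lipschitz_on UNIV f" "dist x y < r"
  shows "\<bar>f x - f y\<bar> \<le> enn2real (steepness r f x) * dist x y"
proof (cases "x = y")
  case False
  have "ennreal (\<bar>f y - f x\<bar> / dist x y) \<le> steepness r f x"
    unfolding steepness_def using False assms by (intro SUP_upper) auto
  moreover have "steepness r f x < \<top>"
    using steepness_le[OF assms(1)] by (rule le_less_trans) simp
  ultimately have "enn2real (ennreal (\<bar>f y - f x\<bar> / dist x y)) \<le> enn2real (steepness r f x)"
    by (rule enn2real_mono)
  then have "\<bar>f y - f x\<bar> / dist x y \<le> enn2real (steepness r f x)" by simp
  then show ?thesis using False by (simp add: divide_le_eq abs_minus_commute)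
qed simp

text \<open>A point \<open>y\<close> that witnesses \<open>c < steepness r f x\<close> also works
  for every \<open>z\<close> near \<open>x\<close>, so the superlevel sets are open.\<close>

lemma measurable_steepness [measurable]:
  assumes "continuous_on UNIV f"
  shows "steepness r f \<in> borel_measurable borel"
proof (rule borel_measurableI_greater)
  fix c
  have "open {x. c < steepness r f x}"
    unfolding open_contains_ball
  proof (intro ballI)
    fix x assume "x \<in> {x. c < steepness r f x}"
    then obtain y where y: "0 < dist x y" "dist x y < r" "c < ennreal (\<bar>f y - f x\<bar> / dist x y)"
      unfolding steepness_def less_SUP_iff by auto
    have fx: "(f \<longlongrightarrow> f x) (at x)" using assms by (simp add: continuous_on_def)
    have dx: "((\<lambda>z. dist z y) \<longlongrightarrow> dist x y) (at x)" by (intro tendsto_intros)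
    have "((\<lambda>z. ennreal (\<bar>f y - f z\<bar> / dist z y)) \<longlongrightarrow> ennreal (\<bar>f y - f x\<bar> / dist x y)) (at x)"
      using y by (intro tendsto_intros fx dx) auto
    then have "eventually (\<lambda>z. c < ennreal (\<bar>f y - f z\<bar> / dist z y)) (at x)"
      using y(3) by (rule order_tendstoD)
    moreover have "eventually (\<lambda>z. 0 < dist z y) (at x)" "eventually (\<lambda>z. dist z y < r) (at x)"
      using order_tendstoD(1)[OF dx y(1)] order_tendstoD(2)[OF dx y(2)] by blast+
    ultimately have "eventually (\<lambda>z. c < steepness r f z) (at x)"
      by eventually_elim (auto simp: steepness_def less_SUP_iff)
    then obtain e where e: "0 < e" "\<And>z. z \<noteq> x \<Longrightarrow> dist z x < e \<Longrightarrow> c < steepness r f z"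
      unfolding eventually_at by blast
    have "c < steepness r f x" using y unfolding steepness_def less_SUP_iff by auto
    then have "c < steepness r f z" if "dist x z < e" for z
      using e(2)[of z] that by (cases "z = x") (auto simp: dist_commute)
    then have "ball x e \<subseteq> {x. c < steepness r f x}" by auto
    then show "\<exists>e>0. ball x e \<subseteq> {x. c < steepness r f x}" using e(1) by blast
  qed
  then show "{x \<in> space borel. c < steepness r f x} \<in> sets borel" by simp
qed

lemma steepness_mono: "r \<le> r' \<Longrightarrow> steepness r f x \<le> steepness r' f x"
  unfolding steepness_def by (intro SUP_subset_mono) auto

lemma steepness_tendsto: "(\<lambda>n. steepness (inverse (real (Suc n))) f x) \<longlonglongrightarrow> local_lip f x"
proof -
  have "local_lip f x = (INF n. steepness (inverse (real (Suc n))) f x)"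
  proof (rule antisym)
    show "local_lip f x \<le> (INF n. steepness (inverse (real (Suc n))) f x)"
    proof (rule INF_greatest)
      fix n
      have "eventually (\<lambda>y. ennreal (\<bar>f y - f x\<bar> / dist x y) \<le> steepness (inverse (real (Suc n))) f x) (at x)"
        unfolding eventually_at steepness_def
        by (intro exI[of _ "inverse (real (Suc n))"]) (auto simp: dist_commute intro!: SUP_upper)
      then show "local_lip f x \<le> steepness (inverse (real (Suc n))) f x"
        unfolding local_lip_def by (rule Limsup_bounded)
    qed
    show "(INF n. steepness (inverse (real (Suc n))) f x) \<le> local_lip f x"
      unfolding local_lip_def
    proof (rule Limsup_greatest)
      fix Q assume "eventually Q (at x)"
      then obtain e where e: "0 < e" "\<And>y. y \<noteq> x \<Longrightarrow> dist y x < e \<Longrightarrow> Q y"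
        unfolding eventually_at by blast
      obtain n where "inverse (real (Suc n)) < e" using reals_Archimedean[OF e(1)] by auto
      then have "steepness (inverse (real (Suc n))) f x \<le> (SUP y\<in>Collect Q. ennreal (\<bar>f y - f x\<bar> / dist x y))"
        unfolding steepness_def using e(2) by (intro SUP_subset_mono) (auto simp: dist_commute)
      then show "(INF n. steepness (inverse (real (Suc n))) f x) \<le> (SUP y\<in>Collect Q. ennreal (\<bar>f y - f x\<bar> / dist x y))"
        by (rule INF_lower2[OF UNIV_I])
    qed
  qed
  moreover have "decseq (\<lambda>n. steepness (inverse (real (Suc n))) f x)"
    by (intro antimonoI steepness_mono) (auto simp: field_simps)
  ultimately show ?thesis using LIMSEQ_INF[of "\<lambda>n. steepness (inverse (real (Suc n))) f x"] by simp
qed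

lemma measurable_local_lip:
  assumes "continuous_on UNIV f"
  shows "local_lip f \<in> borel_measurable borel"
  by (rule borel_measurable_LIMSEQ_order[OF steepness_tendsto])
    (intro measurable_steepness assms)

text \<open>Real-valued form for Bochner integrals. As \<open>enn2real\<close> sends \<top> to
  \<open>0\<close>, it represents \<open>local_lip\<close> faithfully where that is finite, in
  particular for Lipschitz \<open>f\<close>.\<close>

definition lip :: "('a::metric_space \<Rightarrow> real) \<Rightarrow> 'a \<Rightarrow> real" where
  "lip f x = enn2real (local_lip f x)"

lemma lip_nonneg [simp]: "0 \<le> lip f x"
  by (simp add: lip_def)

lemma local_lip_le:
  assumes "C-lipschitz_on UNIV f"
  shows "local_lip f x \<le> ennreal C"
proof (rule local_lip_leI)
  fix K assume "C < K"
  have "\<bar>f y - f x\<bar> \<le> K * dist x y" for y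
    using lipschitz_onD[OF assms, of y x] mult_right_mono[of C K "dist x y"] \<open>C < K\<close>
    by (simp add: dist_commute dist_real_def)
  then show "\<exists>r>0. \<forall>y. dist x y < r \<longrightarrow> \<bar>f y - f x\<bar> \<le> K * dist x y"
    by (intro exI[of _ 1]) auto
qed

lemma local_lip_eq_lip:
  assumes "C-lipschitz_on UNIV f"
  shows "local_lip f x = ennreal (lip f x)"
  using local_lip_le[OF assms, of x] unfolding lip_def
  by (metis ennreal_enn2real ennreal_less_top le_less_trans)

lemma lip_le:
  assumes "C-lipschitz_on UNIV f"
  shows "lip f x \<le> C"
  using local_lip_le[OF assms, of x] local_lip_eq_lip[OF assms, of x] lipschitz_on_nonneg[OF assms]
  by simp

lemma measurable_lip:
  assumes "continuous_on UNIV f"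
  shows "lip f \<in> borel_measurable borel"
  unfolding lip_def[abs_def] using measurable_local_lip[OF assms] by measurable

lemma lip_lessD:
  assumes "C-lipschitz_on UNIV f" "lip f x < K"
  obtains r where "0 < r" "\<And>y. dist x y < r \<Longrightarrow> \<bar>f y - f x\<bar> \<le> K * dist x y"
proof -
  have "0 \<le> K" using assms(2) lip_nonneg[of f x] by linarith
  moreover have "local_lip f x < ennreal K"
    using assms(2) unfolding local_lip_eq_lip[OF assms(1), of x] by (simp add: ennreal_less_iff)
  ultimately show ?thesis using local_lip_lessD that by blast
qed

lemma integrable_powr_lip:
  assumes "\<mu> \<in> borel_probs" "C-lipschitz_on UNIV f" "0 \<le> q"
  shows "integrable \<mu> (\<lambda>x. lip f x powr q)"
proof -
  interpret prob_space \<mu> using assms by (simp add: space_prob_algebra)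
  have [measurable_cong]: "sets \<mu> = sets borel" using assms by (simp add: space_prob_algebra)
  note [measurable] = measurable_lip[OF lipschitz_on_continuous_on[OF assms(2)]]
  show ?thesis
    using lip_le[OF assms(2)] assms(3)
    by (intro integrable_const_bound[of _ "C powr q"]) (auto intro!: powr_mono2)
qed

lemma epowr_nn_integral_local_lip:
  assumes \<mu>: "\<mu> \<in> borel_probs" and f: "C-lipschitz_on UNIV f" and q: "0 < q"
  shows "(\<integral>\<^sup>+ y. epowr (local_lip f y) q \<partial>\<mu>) = ennreal (\<integral>y. lip f y powr q \<partial>\<mu>)"
  using q by (subst nn_integral_eq_integral[symmetric])
    (auto simp: local_lip_eq_lip[OF f] intro!: integrable_powr_lip[OF \<mu> f])

section \<open>Geodesics\<close>

lemma minimal_geodesicD: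
  assumes "minimal_geodesic \<gamma>" "r \<in> {0..1}" "r' \<in> {0..1}"
  shows "dist (\<gamma> r) (\<gamma> r') = \<bar>r - r'\<bar> * dist (\<gamma> 0) (\<gamma> 1)"
  using assms unfolding minimal_geodesic_def by blast

lemma minimal_geodesic_affine:
  assumes "minimal_geodesic \<gamma>" "r0 \<in> {0..1}" "r1 \<in> {0..1}"
  shows "minimal_geodesic (\<lambda>r. \<gamma> (r0 + r * (r1 - r0)))"
proof -
  have in01: "r0 + r * (r1 - r0) \<in> {0..1}" if "r \<in> {0..1}" for r
  proof -
    have "r0 + r * (r1 - r0) = (1 - r) * r0 + r * r1" by (simp add: algebra_simps)
    moreover have "0 \<le> (1 - r) * r0 + r * r1" using that assms by simp
    moreover have "(1 - r) * r0 + r * r1 \<le> (1 - r) * 1 + r * 1"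
      using that assms by (intro add_mono mult_left_mono) auto
    ultimately show ?thesis by simp
  qed
  show ?thesis unfolding minimal_geodesic_def
  proof (intro ballI)
    fix s t :: real assume st: "s \<in> {0..1}" "t \<in> {0..1}"
    have "dist (\<gamma> (r0 + s * (r1 - r0))) (\<gamma> (r0 + t * (r1 - r0)))
        = \<bar>(s - t) * (r1 - r0)\<bar> * dist (\<gamma> 0) (\<gamma> 1)"
      using minimal_geodesicD[OF assms(1) in01[OF st(1)] in01[OF st(2)]] by (simp add: algebra_simps)
    also have "\<dots> = \<bar>s - t\<bar> * (\<bar>r0 - r1\<bar> * dist (\<gamma> 0) (\<gamma> 1))" by (simp add: abs_mult abs_minus_commute)
    also have "\<bar>r0 - r1\<bar> * dist (\<gamma> 0) (\<gamma> 1) = dist (\<gamma> r0) (\<gamma> r1)"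
      using minimal_geodesicD[OF assms] by simp
    finally show "dist (\<gamma> (r0 + s * (r1 - r0))) (\<gamma> (r0 + t * (r1 - r0)))
        = \<bar>s - t\<bar> * dist (\<gamma> (r0 + 0 * (r1 - r0))) (\<gamma> (r0 + 1 * (r1 - r0)))" by simp
  qed
qed

text \<open>Along a minimal geodesic of length \<open>D\<close> the function has local slope at most
  \<open>C * D\<close> in the parameter, and \<open>Dini_lipschitz_bound\<close> integrates this
  over the unit interval.\<close>

lemma lipschitz_if_local_lip_le:
  fixes f :: "'a::metric_space \<Rightarrow> real"
  assumes geodesic: "\<forall>x y :: 'a. \<exists>\<gamma>. minimal_geodesic \<gamma> \<and> \<gamma> 0 = x \<and> \<gamma> 1 = y"
    and le: "\<And>x. local_lip f x \<le> ennreal C" and C: "0 \<le> C"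
  shows "C-lipschitz_on UNIV f"
proof (rule lipschitz_onI[OF _ C])
  fix x y :: 'a
  show "dist (f x) (f y) \<le> C * dist x y"
  proof (cases "x = y")
    case False
    obtain \<gamma> where \<gamma>: "minimal_geodesic \<gamma>" "\<gamma> 0 = x" "\<gamma> 1 = y" using geodesic by blast
    define D where "D = dist x y"
    have D: "0 < D" unfolding D_def using False by simp
    have "\<bar>f (\<gamma> 1) - f (\<gamma> 0)\<bar> \<le> C * D"
    proof (rule Dini_lipschitz_bound)
      fix r K :: real assume r: "0 \<le> r" "r \<le> 1" and K: "C * D < K"
      have "C < K / D" using K D by (simp add: less_divide_eq)
      then have "local_lip f (\<gamma> r) < ennreal (K / D)" "0 \<le> K / D"
        using le[of "\<gamma> r"] C by (auto simp: ennreal_less_iff intro: le_less_trans)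
      then obtain e where e: "0 < e"
        "\<And>y. dist (\<gamma> r) y < e \<Longrightarrow> \<bar>f y - f (\<gamma> r)\<bar> \<le> K / D * dist (\<gamma> r) y"
        by (rule local_lip_lessD) blast
      show "\<exists>\<eta>>0. \<forall>r'\<in>{0..1}. \<bar>r' - r\<bar> < \<eta> \<longrightarrow> \<bar>f (\<gamma> r') - f (\<gamma> r)\<bar> \<le> K * \<bar>r' - r\<bar>"
      proof (intro exI[of _ "e / D"] conjI ballI impI)
        fix r' :: real assume r': "r' \<in> {0..1}" "\<bar>r' - r\<bar> < e / D"
        have d: "dist (\<gamma> r) (\<gamma> r') = \<bar>r' - r\<bar> * D"
          using minimal_geodesicD[OF \<gamma>(1), of r r'] r r' \<gamma> by (simp add: D_def abs_minus_commute)
        then have "dist (\<gamma> r) (\<gamma> r') < e" using r' D by (simp add: less_divide_eq)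
        then show "\<bar>f (\<gamma> r') - f (\<gamma> r)\<bar> \<le> K * \<bar>r' - r\<bar>" using e(2)[of "\<gamma> r'"] d D by simp
      qed (use e D in auto)
    qed (use C D in auto)
    then show ?thesis using \<gamma> by (simp add: dist_real_def D_def abs_minus_commute)
  qed simp
qed

section \<open>The Hopf--Lax semigroup\<close>

text \<open>In the variable \<open>T = \<delta>\<^sup>1\<^sup>-\<^sup>p\<close> the Hopf--Lax function is an infimum of affine functions,
  hence concave. Its left derivative in \<open>T\<close> is an infimum of difference quotients, which are
  continuous in \<open>x\<close>; this is why the slope of a Hopf--Lax function is upper semicontinuous.\<close>

definition infconv :: "real \<Rightarrow> ('a::metric_space \<Rightarrow> real) \<Rightarrow> real \<Rightarrow> 'a \<Rightarrow> real" where
  "infconv p f T x = (INF y. f y + T * (dist x y powr p / p))"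

definition infconv_quot :: "real \<Rightarrow> ('a::metric_space \<Rightarrow> real) \<Rightarrow> real \<Rightarrow> real \<Rightarrow> 'a \<Rightarrow> real" where
  "infconv_quot p f k T x = (infconv p f T x - infconv p f (T - k) x) / k"

text \<open>The left derivative in \<open>T\<close>. The steps \<open>T / (n + 2)\<close> start at
  \<open>T / 2\<close>, so \<open>T - k\<close> stays positive and each quotient is bounded and
  Lipschitz in \<open>x\<close>.\<close>

definition infconv_slope :: "real \<Rightarrow> ('a::metric_space \<Rightarrow> real) \<Rightarrow> real \<Rightarrow> 'a \<Rightarrow> real" where
  "infconv_slope p f T x = (INF n. infconv_quot p f (T / (real n + 2)) T x)"

lemma hopf_lax_eq_infconv:
  fixes f :: "'a::metric_space \<Rightarrow> real"
  assumes "0 < \<delta>" "1 < p"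
  shows "hopf_lax p \<delta> f = infconv p f (\<delta> powr (1 - p))"
proof
  fix x :: 'a
  have e: "\<delta> / p * (dist x y / \<delta>) powr p = \<delta> powr (1 - p) * (dist x y powr p / p)" for y
    using assms by (simp add: powr_divide powr_diff)
  show "hopf_lax p \<delta> f x = infconv p f (\<delta> powr (1 - p)) x"
    unfolding hopf_lax_def infconv_def e ..
qed

context
  fixes p B :: real and f :: "'a::metric_space \<Rightarrow> real"
  assumes p: "1 < p" and bound: "\<forall>y. \<bar>f y\<bar> \<le> B"
begin

lemma infconv_bdd_below: "0 \<le> T \<Longrightarrow> bdd_below (range (\<lambda>y. f y + T * (dist x y powr p / p)))"
proof (rule bdd_belowI2)
  fix y assume "0 \<le> T"
  then have "0 \<le> T * (dist x y powr p / p)" using p by simp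
  then show "- B \<le> f y + T * (dist x y powr p / p)" using bound[rule_format, of y] by simp
qed

lemma infconv_le: "0 \<le> T \<Longrightarrow> infconv p f T x \<le> f y + T * (dist x y powr p / p)"
  unfolding infconv_def by (intro cINF_lower infconv_bdd_below) auto

lemma infconv_le_self: "0 \<le> T \<Longrightarrow> infconv p f T x \<le> f x"
  using infconv_le[of T x x] p by simp

lemma infconv_ge: "(\<And>y. c \<le> f y + T * (dist x y powr p / p)) \<Longrightarrow> c \<le> infconv p f T x"
  unfolding infconv_def by (intro cINF_greatest) auto

lemma infconv_bound: "0 \<le> T \<Longrightarrow> \<bar>infconv p f T x\<bar> \<le> B"
proof -
  assume T: "0 \<le> T"
  have "- B \<le> infconv p f T x"
  proof (rule infconv_ge)
    fix y
    have "0 \<le> T * (dist x y powr p / p)" using T p by simp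
    then show "- B \<le> f y + T * (dist x y powr p / p)" using bound[rule_format, of y] by simp
  qed
  then show ?thesis using infconv_le_self[OF T, of x] bound[rule_format, of x] by auto
qed

lemma infconv_near_minimizer:
  assumes "0 < e"
  obtains z where "f z + T * (dist x z powr p / p) < infconv p f T x + e"
proof -
  have "\<exists>z. f z + T * (dist x z powr p / p) < infconv p f T x + e"
  proof (rule ccontr)
    assume "\<nexists>z. f z + T * (dist x z powr p / p) < infconv p f T x + e"
    then have "infconv p f T x + e \<le> infconv p f T x" by (intro infconv_ge) (simp add: not_less)
    then show False using assms by simp
  qed
  then show ?thesis using that by blast
qed

lemma infconv_mono: "0 \<le> T' \<Longrightarrow> T' \<le> T \<Longrightarrow> infconv p f T' x \<le> infconv p f T x"
proof (rule infconv_ge)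
  fix y assume "0 \<le> T'" "T' \<le> T"
  then have "T' * (dist x y powr p / p) \<le> T * (dist x y powr p / p)"
    using p by (intro mult_right_mono) auto
  then show "infconv p f T' x \<le> f y + T * (dist x y powr p / p)"
    using infconv_le[OF \<open>0 \<le> T'\<close>, of x y] by simp
qed

text \<open>For each \<open>y\<close> the competitor is affine in \<open>T\<close>, and an infimum
  of affine functions is concave. Denominators are cleared, so the three parameters may
  coincide.\<close>

lemma infconv_concave:
  assumes "0 \<le> T1" "T1 \<le> T2" "T2 \<le> T3"
  shows "(T3 - T2) * infconv p f T1 x + (T2 - T1) * infconv p f T3 x \<le> (T3 - T1) * infconv p f T2 x"
proof (cases "T1 = T3")
  case False
  then have pos: "0 < T3 - T1" using assms by simp
  have "((T3 - T2) * infconv p f T1 x + (T2 - T1) * infconv p f T3 x) / (T3 - T1) \<le> infconv p f T2 x"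
  proof (rule infconv_ge)
    fix y
    have "(T3 - T2) * infconv p f T1 x + (T2 - T1) * infconv p f T3 x
      \<le> (T3 - T2) * (f y + T1 * (dist x y powr p / p)) + (T2 - T1) * (f y + T3 * (dist x y powr p / p))"
      using assms by (intro add_mono mult_left_mono infconv_le) auto
    also have "\<dots> = (f y + T2 * (dist x y powr p / p)) * (T3 - T1)" by algebra
    finally show "((T3 - T2) * infconv p f T1 x + (T2 - T1) * infconv p f T3 x) / (T3 - T1)
      \<le> f y + T2 * (dist x y powr p / p)" using pos by (simp add: divide_le_eq)
  qed
  then show ?thesis using pos by (simp add: divide_le_eq mult.commute)
qed (use assms in auto)

text \<open>For a concave function, the slopes of chords ending at \<open>T\<close> decrease as the
  left endpoint approaches \<open>T\<close>.\<close>

lemma infconv_quot_mono: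
  assumes "0 < k'" "k' \<le> k" "k \<le> T"
  shows "infconv_quot p f k' T x \<le> infconv_quot p f k T x"
proof -
  have "k' * infconv p f (T - k) x + (k - k') * infconv p f T x \<le> k * infconv p f (T - k') x"
    using infconv_concave[of "T - k" "T - k'" T x] assms by simp
  then have "(infconv p f T x - infconv p f (T - k') x) * k \<le> (infconv p f T x - infconv p f (T - k) x) * k'"
    by (simp add: algebra_simps)
  then show ?thesis unfolding infconv_quot_def using assms by (simp add: divide_simps mult.commute)
qed

lemma infconv_quot_nonneg: "0 < k \<Longrightarrow> k \<le> T \<Longrightarrow> 0 \<le> infconv_quot p f k T x"
  unfolding infconv_quot_def using infconv_mono[of "T - k" T x] by simp

lemma infconv_quot_le: "0 < k \<Longrightarrow> k \<le> T \<Longrightarrow> infconv_quot p f k T x \<le> 2 * B / k"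
  unfolding infconv_quot_def using infconv_bound[of T x] infconv_bound[of "T - k" x]
  by (intro divide_right_mono) auto

text \<open>A near-minimiser \<open>z\<close> at \<open>x\<close> is also a competitor for the
  parameter \<open>T - k\<close>; comparing the two values bounds \<open>dist x z powr p / p\<close>
  by the difference quotient, up to \<open>e / k\<close>. The same \<open>z\<close> is then a
  competitor at \<open>y\<close>. The infimum need not be attained, hence the error \<open>e\<close>
  and the final limit.\<close>

lemma infconv_increment:
  assumes k: "0 < k" "k \<le> T"
  shows "infconv p f T y - infconv p f T x
    \<le> T * dist x y * ((p * infconv_quot p f k T x) powr (1 / p) + dist x y) powr (p - 1)"
proof -
  define S where "S = infconv_quot p f k T x"
  define d where "d = dist x y"
  have S: "0 \<le> S" unfolding S_def using k by (rule infconv_quot_nonneg)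
  have T: "0 < T" using k by simp
  have le: "infconv p f T y - infconv p f T x \<le> e + T * d * ((p * (S + e / k)) powr (1 / p) + d) powr (p - 1)"
    if e: "0 < e" for e
  proof -
    obtain z where z: "f z + T * (dist x z powr p / p) < infconv p f T x + e"
      using infconv_near_minimizer[OF e] by blast
    define u where "u = dist x z"
    have "infconv p f (T - k) x \<le> f z + (T - k) * (u powr p / p)"
      unfolding u_def using k by (intro infconv_le) auto
    then have "k * (u powr p / p) \<le> (infconv p f T x - infconv p f (T - k) x) + e"
      using z unfolding u_def by (simp add: algebra_simps diff_divide_distrib)
    then have "u powr p / p \<le> ((infconv p f T x - infconv p f (T - k) x) + e) / k"
      using k by (simp add: le_divide_eq mult.commute)
    then have "u powr p \<le> p * (S + e / k)"
      unfolding S_def infconv_quot_def using p by (simp add: divide_le_eq add_divide_distrib mult.commute)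
    then have "(u powr p) powr (1 / p) \<le> (p * (S + e / k)) powr (1 / p)"
      using p by (intro powr_mono2) auto
    then have u: "u \<le> (p * (S + e / k)) powr (1 / p)" using p by (simp add: powr_powr u_def)
    have "infconv p f T y \<le> f z + T * (dist y z powr p / p)" using T by (intro infconv_le) auto
    also have "\<dots> \<le> f z + T * ((u + d) powr p / p)"
      using T p dist_triangle[of y z x] unfolding u_def d_def
      by (intro add_left_mono mult_left_mono divide_right_mono powr_mono2) (auto simp: dist_commute)
    finally have "infconv p f T y - infconv p f T x \<le> e + T / p * ((u + d) powr p - u powr p)"
      using z unfolding u_def by (simp add: algebra_simps diff_divide_distrib)
    also have "\<dots> \<le> e + T / p * (p * d * (u + d) powr (p - 1))"
      using T p by (intro add_left_mono mult_left_mono powr_increment_le) (auto simp: u_def d_def)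
    also have "\<dots> = e + T * d * (u + d) powr (p - 1)" using p by simp
    also have "\<dots> \<le> e + T * d * ((p * (S + e / k)) powr (1 / p) + d) powr (p - 1)"
      using T p u by (intro add_left_mono mult_left_mono powr_mono2) (auto simp: u_def d_def)
    finally show ?thesis .
  qed
  have "((\<lambda>e. p * (S + e / k)) \<longlongrightarrow> p * (S + 0 / k)) (at_right 0)"
    using k by (intro tendsto_intros) auto
  then have "((\<lambda>e. (p * (S + e / k)) powr (1 / p)) \<longlongrightarrow> (p * (S + 0 / k)) powr (1 / p)) (at_right 0)"
    using p S k by (intro tendsto_powr'[OF _ tendsto_const])
      (auto simp: eventually_at_filter intro!: always_eventually)
  then have "((\<lambda>e. (p * (S + e / k)) powr (1 / p) + d) \<longlongrightarrow> (p * (S + 0 / k)) powr (1 / p) + d) (at_right 0)"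
    by (intro tendsto_add[OF _ tendsto_const])
  then have "((\<lambda>e. ((p * (S + e / k)) powr (1 / p) + d) powr (p - 1))
      \<longlongrightarrow> ((p * (S + 0 / k)) powr (1 / p) + d) powr (p - 1)) (at_right 0)"
    by (rule tendsto_powr'[OF _ tendsto_const]) (use p in \<open>auto simp: d_def\<close>)
  then have lim: "((\<lambda>e. e + T * d * ((p * (S + e / k)) powr (1 / p) + d) powr (p - 1))
      \<longlongrightarrow> 0 + T * d * ((p * (S + 0 / k)) powr (1 / p) + d) powr (p - 1)) (at_right 0)"
    by (intro tendsto_add tendsto_ident_at tendsto_mult_left)
  have "infconv p f T y - infconv p f T x
    \<le> 0 + T * d * ((p * (S + 0 / k)) powr (1 / p) + d) powr (p - 1)"
    using le by (intro tendsto_lowerbound[OF lim]) (auto simp: eventually_at_filter intro!: always_eventually)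
  then show ?thesis unfolding S_def d_def by simp
qed

lemma infconv_lipschitz:
  assumes T: "0 < T"
  shows "\<exists>C. C-lipschitz_on UNIV (infconv p f T)"
proof -
  \<comment> \<open>Beyond distance \<open>1\<close> the oscillation \<open>2 * B\<close> suffices;
    below it \<open>infconv_increment\<close> is used with \<open>k = T\<close>, where the quotient
    is at most \<open>2 * B / T\<close>.\<close>
  define C where "C = max (2 * B) (T * ((p * (2 * B / T)) powr (1 / p) + 1) powr (p - 1))"
  have B: "0 \<le> B" using bound[rule_format, of undefined] by auto
  have le: "infconv p f T y - infconv p f T x \<le> C * dist x y" for x y
  proof (cases "dist x y \<le> 1")
    case True
    have "infconv p f T y - infconv p f T x
      \<le> T * dist x y * ((p * infconv_quot p f T T x) powr (1 / p) + dist x y) powr (p - 1)"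
      using T by (intro infconv_increment) auto
    also have "\<dots> \<le> T * dist x y * ((p * (2 * B / T)) powr (1 / p) + 1) powr (p - 1)"
      using T p True infconv_quot_le[of T T x] infconv_quot_nonneg[of T T x]
      by (intro mult_left_mono powr_mono2 add_mono) auto
    also have "\<dots> = (T * ((p * (2 * B / T)) powr (1 / p) + 1) powr (p - 1)) * dist x y" by simp
    also have "\<dots> \<le> C * dist x y" unfolding C_def by (intro mult_right_mono) auto
    finally show ?thesis .
  next
    case False
    have "infconv p f T y - infconv p f T x \<le> 2 * B * 1"
      using infconv_bound[of T x] infconv_bound[of T y] T by auto
    also have "\<dots> \<le> C * dist x y" using False B unfolding C_def by (intro mult_mono) auto
    finally show ?thesis .
  qed
  have "C-lipschitz_on UNIV (infconv p f T)"
  proof (rule lipschitz_onI)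
    show "dist (infconv p f T x) (infconv p f T y) \<le> C * dist x y" for x y
      using le[of x y] le[of y x] by (auto simp: dist_real_def dist_commute)
    show "0 \<le> C" unfolding C_def using B by simp
  qed
  then show ?thesis by blast
qed

text \<open>By concavity the chord slope over \<open>[T', T]\<close> is at most the one over
  \<open>[0, T']\<close>, which is at most \<open>2 * B / T'\<close>.\<close>

lemma infconv_time_lipschitz:
  assumes "0 < T'" "T' \<le> T"
  shows "\<bar>infconv p f T x - infconv p f T' x\<bar> \<le> 2 * B / T' * (T - T')"
proof -
  have "(T - T') * infconv p f 0 x + T' * infconv p f T x \<le> T * infconv p f T' x"
    using infconv_concave[of 0 T' T x] assms by simp
  then have "T' * (infconv p f T x - infconv p f T' x) \<le> (T - T') * (infconv p f T' x - infconv p f 0 x)"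
    by (simp add: algebra_simps)
  also have "\<dots> \<le> (T - T') * (2 * B)"
    using infconv_bound[of T' x] infconv_bound[of 0 x] assms by (intro mult_left_mono) auto
  finally have "infconv p f T x - infconv p f T' x \<le> 2 * B / T' * (T - T')"
    using assms by (simp add: field_simps)
  then show ?thesis using infconv_mono[of T' T x] assms by simp
qed

lemma infconv_slope_le_quot:
  assumes "0 < k" "k \<le> T"
  shows "infconv_slope p f T x \<le> infconv_quot p f k T x"
proof -
  obtain n where n: "T / k < real n" using reals_Archimedean2 by blast
  have T: "0 < T" using assms by simp
  have "infconv_slope p f T x \<le> infconv_quot p f (T / (real n + 2)) T x"
    unfolding infconv_slope_def using T
    by (intro cINF_lower bdd_belowI2[of _ 0] infconv_quot_nonneg) (auto simp: divide_le_eq)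
  also have "\<dots> \<le> infconv_quot p f k T x"
    using n assms T by (intro infconv_quot_mono) (auto simp: field_simps)
  finally show ?thesis .
qed

lemma infconv_slope_nonneg:
  assumes "0 < T"
  shows "0 \<le> infconv_slope p f T x"
  unfolding infconv_slope_def using assms
  by (intro cINF_greatest infconv_quot_nonneg) (auto simp: divide_le_eq)

lemma infconv_quot_tendsto_slope:
  assumes T: "0 < T"
  shows "(\<lambda>n. infconv_quot p f (T / (real n + 2)) T x) \<longlonglongrightarrow> infconv_slope p f T x"
  unfolding infconv_slope_def
proof (rule LIMSEQ_decseq_INF)
  show "bdd_below (range (\<lambda>n. infconv_quot p f (T / (real n + 2)) T x))"
    using T by (intro bdd_belowI2[of _ 0] infconv_quot_nonneg) (auto simp: divide_le_eq)
  show "decseq (\<lambda>n. infconv_quot p f (T / (real n + 2)) T x)"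
    using T by (intro antimonoI infconv_quot_mono frac_le) (auto simp: divide_le_eq)
qed

lemma infconv_decrease:
  assumes "0 < T'" "T' < T"
  shows "(T - T') * infconv_slope p f T x \<le> infconv p f T x - infconv p f T' x"
  using infconv_slope_le_quot[of "T - T'" T x] assms
  by (simp add: infconv_quot_def le_divide_eq mult.commute)

lemma infconv_quot_bounded_lipschitz:
  assumes "0 < k" "k < T"
  shows "infconv_quot p f k T \<in> bounded_lipschitz"
proof -
  obtain C C' where C: "C-lipschitz_on UNIV (infconv p f T)" "C'-lipschitz_on UNIV (infconv p f (T - k))"
    using infconv_lipschitz assms by (meson diff_gt_0_iff_gt order_less_trans)
  have "(\<bar>1 / k\<bar> * (C + C'))-lipschitz_on UNIV (\<lambda>x. (1 / k) * (infconv p f T x - infconv p f (T - k) x))"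
    by (intro lipschitz_intros C)
  moreover have "\<bar>infconv_quot p f k T x\<bar> \<le> 2 * B / k" for x
    using infconv_quot_le[of k T x] infconv_quot_nonneg[of k T x] assms by auto
  ultimately show ?thesis
    unfolding bounded_lipschitz_def infconv_quot_def[abs_def] bounded_iff by auto
qed

lemma infconv_bounded_lipschitz:
  assumes "0 < T"
  shows "infconv p f T \<in> bounded_lipschitz"
  using infconv_lipschitz[OF assms] infconv_bound[of T] assms
  unfolding bounded_lipschitz_def bounded_iff by auto

end

section \<open>Bounded Lipschitz functions as test functions\<close>

lemma bounded_lipschitzE:
  assumes "f \<in> bounded_lipschitz"
  obtains B C where "\<forall>x. \<bar>f x\<bar> \<le> B" "C-lipschitz_on UNIV f"
  using assms unfolding bounded_lipschitz_def bounded_iff by auto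

lemma bounded_lipschitzI:
  assumes "\<forall>x. \<bar>f x\<bar> \<le> B" "C-lipschitz_on UNIV f"
  shows "f \<in> bounded_lipschitz"
  using assms unfolding bounded_lipschitz_def bounded_iff by auto

lemma bounded_lipschitz_measurable:
  assumes "f \<in> bounded_lipschitz"
  shows "f \<in> borel_measurable borel"
  using bounded_lipschitzE[OF assms] borel_measurable_continuous_onI lipschitz_on_continuous_on by metis

lemma bounded_lipschitz_affine:
  assumes "f \<in> bounded_lipschitz"
  shows "(\<lambda>x. c * f x + d) \<in> bounded_lipschitz"
proof -
  obtain B C where *: "\<forall>x. \<bar>f x\<bar> \<le> B" "C-lipschitz_on UNIV f" using bounded_lipschitzE[OF assms] .
  have "(\<bar>c\<bar> * C + 0)-lipschitz_on UNIV (\<lambda>x. c * f x + d)" by (intro lipschitz_intros *)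
  moreover have "\<bar>c * f x + d\<bar> \<le> \<bar>c\<bar> * B + \<bar>d\<bar>" for x
    using mult_left_mono[OF *(1)[rule_format, of x], of "\<bar>c\<bar>"] abs_triangle_ineq[of "c * f x" d]
    by (simp add: abs_mult)
  ultimately show ?thesis by (intro bounded_lipschitzI) auto
qed

lemma borel_probsD:
  assumes "\<mu> \<in> borel_probs"
  shows "prob_space \<mu>" "sets \<mu> = sets borel" "space \<mu> = UNIV"
  using assms sets_eq_imp_space_eq[of \<mu> borel] by (auto simp: space_prob_algebra)

lemma integrable_borel_prob:
  fixes f :: "'a::topological_space \<Rightarrow> real"
  assumes "\<mu> \<in> borel_probs" "f \<in> borel_measurable borel" "\<forall>x. \<bar>f x\<bar> \<le> B"
  shows "integrable \<mu> f"
proof -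
  interpret prob_space \<mu> using borel_probsD[OF assms(1)] by simp
  have "f \<in> borel_measurable \<mu>"
    using assms(2) measurable_cong_sets[OF borel_probsD(2)[OF assms(1)] refl] by blast
  then show ?thesis using assms(3) by (intro integrable_const_bound[of _ B]) auto
qed

lemma integrable_bounded_lipschitz:
  assumes "\<mu> \<in> borel_probs" "f \<in> bounded_lipschitz"
  shows "integrable \<mu> f"
  using bounded_lipschitzE[OF assms(2)] integrable_borel_prob[OF assms(1) bounded_lipschitz_measurable[OF assms(2)]]
  by blast

lemma abs_integral_diff_le:
  fixes f g :: "'a::topological_space \<Rightarrow> real"
  assumes "\<mu> \<in> borel_probs" "integrable \<mu> f" "integrable \<mu> g" "\<And>x. \<bar>f x - g x\<bar> \<le> e"
  shows "\<bar>(\<integral>x. f x \<partial>\<mu>) - (\<integral>x. g x \<partial>\<mu>)\<bar> \<le> e"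
proof -
  interpret prob_space \<mu> using borel_probsD[OF assms(1)] by simp
  have "\<bar>\<integral>x. (f x - g x) \<partial>\<mu>\<bar> \<le> (\<integral>x. \<bar>f x - g x\<bar> \<partial>\<mu>)" by simp
  also have "\<dots> \<le> (\<integral>x. e \<partial>\<mu>)" using assms by (intro integral_mono) auto
  finally show ?thesis using assms by (simp add: prob_space)
qed

lemma hopf_lax_le:
  assumes "\<forall>y. \<bar>f y\<bar> \<le> B" "0 < \<delta>" "0 < p"
  shows "hopf_lax p \<delta> f x \<le> f y + \<delta> / p * (dist x y / \<delta>) powr p"
  unfolding hopf_lax_def
proof (intro cINF_lower bdd_belowI2[of _ "- B"])
  fix y
  have "0 \<le> \<delta> / p * (dist x y / \<delta>) powr p" using assms by simp
  then show "- B \<le> f y + \<delta> / p * (dist x y / \<delta>) powr p" using assms(1)[rule_format, of y] by simp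
qed simp

section \<open>Slope and decrease of Hopf--Lax functions\<close>

context
  fixes p p' B :: real and f :: "'a::metric_space \<Rightarrow> real"
  assumes p: "1 < p" and p': "1 / p + 1 / p' = 1" and bound: "\<forall>y. \<bar>f y\<bar> \<le> B"
begin

lemmas conj_p = conjugate_exponent[OF p p']

lemma infconv_quot_measurable: "0 < T \<Longrightarrow> infconv_quot p f (T / (real n + 2)) T \<in> borel_measurable borel"
  by (intro bounded_lipschitz_measurable infconv_quot_bounded_lipschitz[OF p bound]) (auto simp: divide_less_eq)

lemma infconv_slope_measurable: "0 < T \<Longrightarrow> infconv_slope p f T \<in> borel_measurable borel"
  by (rule borel_measurable_LIMSEQ_real[OF infconv_quot_tendsto_slope[OF p bound]])
    (auto intro: infconv_quot_measurable)

lemma infconv_quot_bounds: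
  assumes "0 < T"
  shows "0 \<le> infconv_quot p f (T / (real n + 2)) T x" "infconv_quot p f (T / (real n + 2)) T x \<le> 2 * B / (T / 2)"
proof -
  show "0 \<le> infconv_quot p f (T / (real n + 2)) T x"
    using assms by (intro infconv_quot_nonneg[OF p bound]) (auto simp: divide_le_eq)
  have "infconv_quot p f (T / (real n + 2)) T x \<le> infconv_quot p f (T / 2) T x"
    using assms by (intro infconv_quot_mono[OF p bound] frac_le) auto
  also have "\<dots> \<le> 2 * B / (T / 2)" using assms by (intro infconv_quot_le[OF p bound]) auto
  finally show "infconv_quot p f (T / (real n + 2)) T x \<le> 2 * B / (T / 2)" .
qed

text \<open>The slope itself need not be continuous; this replaces its integral by the integral of a
  bounded Lipschitz function at arbitrarily small cost.\<close>

lemma integral_infconv_quot_tendsto: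
  assumes T: "0 < T" and \<mu>: "\<mu> \<in> borel_probs"
  shows "(\<lambda>n. \<integral>x. infconv_quot p f (T / (real n + 2)) T x \<partial>\<mu>) \<longlonglongrightarrow> (\<integral>x. infconv_slope p f T x \<partial>\<mu>)"
proof -
  interpret prob_space \<mu> using borel_probsD[OF \<mu>] by simp
  have [measurable_cong]: "sets \<mu> = sets borel" using borel_probsD[OF \<mu>] by simp
  show ?thesis
  proof (rule integral_dominated_convergence[where w="\<lambda>_. 2 * B / (T / 2)"])
    show "infconv_slope p f T \<in> borel_measurable \<mu>"
      using infconv_slope_measurable[OF T] by measurable
    show "infconv_quot p f (T / (real n + 2)) T \<in> borel_measurable \<mu>" for n
      using infconv_quot_measurable[OF T] by measurable
    show "AE x in \<mu>. norm (infconv_quot p f (T / (real n + 2)) T x) \<le> 2 * B / (T / 2)" for n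
      using infconv_quot_bounds[OF T] by (intro AE_I2) (simp only: real_norm_def abs_of_nonneg)
  qed (use infconv_quot_tendsto_slope[OF p bound T] in auto)
qed

text \<open>One difference quotient \<open>S\<close> already gives a value below \<open>K\<close>.
  It is Lipschitz in the base point, so \<open>infconv_increment\<close> holds at \<open>x\<close>
  and at nearby \<open>y\<close> with almost the same constant; using both base points makes the
  one-sided increments two-sided.\<close>

lemma local_lip_infconv_le:
  assumes T: "0 < T"
  shows "local_lip (infconv p f T) x \<le> ennreal (T * (p * infconv_slope p f T x) powr (1 / p') )"
proof (rule local_lip_leI)
  fix K assume K: "T * (p * infconv_slope p f T x) powr (1 / p') < K"
  have e: "((u::real) powr (1 / p)) powr (p - 1) = u powr (1 / p')" for u
  proof -
    have "1 / p * (p - 1) = 1 / p'" unfolding conj_p(3) using p by simp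
    then show ?thesis by (simp only: powr_powr)
  qed
  have "(\<lambda>n. T * (p * infconv_quot p f (T / (real n + 2)) T x) powr (1 / p'))
      \<longlonglongrightarrow> T * (p * infconv_slope p f T x) powr (1 / p')"
    using p conj_p(1) infconv_quot_bounds[OF T]
    by (intro tendsto_mult_left tendsto_powr'[OF _ tendsto_const] infconv_quot_tendsto_slope[OF p bound T]) auto
  from order_tendstoD(2)[OF this K] obtain n where
    n: "T * (p * infconv_quot p f (T / (real n + 2)) T x) powr (1 / p') < K"
    using eventually_happens'[OF sequentially_bot] by blast
  define k where "k = T / (real n + 2)"
  have k: "0 < k" "k \<le> T" "k < T" unfolding k_def using T by (auto simp: divide_le_eq divide_less_eq)
  define S where "S = infconv_quot p f k T"
  have S0: "0 \<le> S x" for x unfolding S_def using k by (intro infconv_quot_nonneg[OF p bound])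
  obtain C where C: "C-lipschitz_on UNIV S"
    using infconv_quot_bounded_lipschitz[OF p bound k(1,3)] unfolding S_def bounded_lipschitz_def by blast
  note C0 = lipschitz_on_nonneg[OF C]
  \<comment> \<open>A rate valid from every base point within distance \<open>d\<close> of
    \<open>x\<close>, where \<open>S\<close> is at most \<open>S x + C * d\<close>; at
    \<open>d = 0\<close> it is the value below \<open>K\<close>.\<close>
  define \<phi> where "\<phi> d = T * ((p * (S x + C * d)) powr (1 / p) + d) powr (p - 1)" for d
  have "((\<lambda>d. p * (S x + C * d)) \<longlongrightarrow> p * (S x + C * 0)) (at_right 0)" by (intro tendsto_intros)
  then have "((\<lambda>d. (p * (S x + C * d)) powr (1 / p)) \<longlongrightarrow> (p * (S x + C * 0)) powr (1 / p)) (at_right 0)"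
    using p S0[of x] C0 by (intro tendsto_powr'[OF _ tendsto_const])
      (auto simp: eventually_at_filter intro!: always_eventually)
  then have "((\<lambda>d. (p * (S x + C * d)) powr (1 / p) + d) \<longlongrightarrow> (p * (S x + C * 0)) powr (1 / p) + 0) (at_right 0)"
    by (intro tendsto_add[OF _ tendsto_ident_at])
  then have "((\<lambda>d. ((p * (S x + C * d)) powr (1 / p) + d) powr (p - 1))
     \<longlongrightarrow> ((p * (S x + C * 0)) powr (1 / p) + 0) powr (p - 1)) (at_right 0)"
    by (rule tendsto_powr'[OF _ tendsto_const])
      (use p in \<open>auto simp: eventually_at_filter intro!: always_eventually\<close>)
  then have "(\<phi> \<longlongrightarrow> T * ((p * (S x + C * 0)) powr (1 / p) + 0) powr (p - 1)) (at_right 0)"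
    unfolding \<phi>_def by (intro tendsto_mult_left)
  moreover have "T * ((p * (S x + C * 0)) powr (1 / p) + 0) powr (p - 1) < K"
    using n unfolding S_def k_def by (simp add: e)
  ultimately have "eventually (\<lambda>d. \<phi> d < K) (at_right 0)" by (rule order_tendstoD)
  then obtain r where r: "0 < r" "\<And>d. 0 < d \<Longrightarrow> d < r \<Longrightarrow> \<phi> d < K"
    unfolding eventually_at_right_field by blast
  have "\<bar>infconv p f T y - infconv p f T x\<bar> \<le> K * dist x y" if y: "dist x y < r" for y
  proof (cases "x = y")
    case False
    define d where "d = dist x y"
    have d: "0 < d" "d < r" unfolding d_def using False y by auto
    have le: "T * d * ((p * S z) powr (1 / p) + d) powr (p - 1) \<le> K * d" if "z = x \<or> z = y" for z
    proof -
      have "S z \<le> S x + C * d"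
        using that lipschitz_onD[OF C, of z x] C0 d(1) by (auto simp: d_def dist_real_def dist_commute)
      then have "T * d * ((p * S z) powr (1 / p) + d) powr (p - 1)
        \<le> T * d * ((p * (S x + C * d)) powr (1 / p) + d) powr (p - 1)"
        using T p d S0 by (intro mult_left_mono powr_mono2 add_mono) auto
      also have "\<dots> = \<phi> d * d" unfolding \<phi>_def by simp
      also have "\<dots> \<le> K * d" using r(2)[OF d] d by (intro mult_right_mono) auto
      finally show ?thesis .
    qed
    have "infconv p f T y - infconv p f T x \<le> K * d"
      using infconv_increment[OF p bound k(1,2), of y x] le[of x] unfolding S_def d_def by simp
    moreover have "infconv p f T x - infconv p f T y \<le> K * d"
      using infconv_increment[OF p bound k(1,2), of x y] le[of y] unfolding S_def d_def by (simp add: dist_commute)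
    ultimately show ?thesis unfolding d_def by auto
  qed simp
  then show "\<exists>r>0. \<forall>y. dist x y < r \<longrightarrow> \<bar>infconv p f T y - infconv p f T x\<bar> \<le> K * dist x y"
    using r(1) by blast
qed

lemma powr_conj_time:
  assumes "0 < \<delta>"
  shows "(\<delta> powr (1 - p)) powr p' = \<delta> powr (- p)"
  using assms by (simp add: powr_powr conj_p(5))

lemma hopf_lax_bounded_lipschitz: "0 < \<delta> \<Longrightarrow> hopf_lax p \<delta> f \<in> bounded_lipschitz"
  using infconv_bounded_lipschitz[OF p bound, of "\<delta> powr (1 - p)"] hopf_lax_eq_infconv[of \<delta> p f] p
  by simp

lemma hopf_lax_bound: "0 < \<delta> \<Longrightarrow> \<bar>hopf_lax p \<delta> f x\<bar> \<le> B"
  using infconv_bound[OF p bound, of "\<delta> powr (1 - p)"] hopf_lax_eq_infconv[of \<delta> p f] p by simp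

lemma hopf_lax_ge:
  "(\<And>y. c \<le> f y + \<delta> / p * (dist x y / \<delta>) powr p) \<Longrightarrow> c \<le> hopf_lax p \<delta> f x"
  unfolding hopf_lax_def by (intro cINF_greatest) auto

lemma lip_hopf_lax_le:
  assumes \<delta>: "0 < \<delta>"
  shows "lip (hopf_lax p \<delta> f) x powr p' \<le> p * \<delta> powr (- p) * infconv_slope p f (\<delta> powr (1 - p)) x"
proof -
  define T where "T = \<delta> powr (1 - p)"
  have T: "0 < T" unfolding T_def using \<delta> by simp
  have S: "0 \<le> infconv_slope p f T x" by (rule infconv_slope_nonneg[OF p bound T])
  obtain C where C: "C-lipschitz_on UNIV (hopf_lax p \<delta> f)"
    using hopf_lax_bounded_lipschitz[OF \<delta>] unfolding bounded_lipschitz_def by blast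
  have "lip (hopf_lax p \<delta> f) x \<le> T * (p * infconv_slope p f T x) powr (1 / p')"
    using local_lip_infconv_le[OF T, of x] local_lip_eq_lip[OF C, of x] hopf_lax_eq_infconv[OF \<delta> p, of f] T
    by (simp add: T_def)
  then have "lip (hopf_lax p \<delta> f) x powr p' \<le> (T * (p * infconv_slope p f T x) powr (1 / p')) powr p'"
    using conj_p(1) by (intro powr_mono2) auto
  also have "\<dots> = T powr p' * (p * infconv_slope p f T x)"
    using T S p conj_p(1) by (simp add: powr_mult powr_powr)
  finally show ?thesis using powr_conj_time[OF \<delta>] unfolding T_def by (simp add: mult_ac)
qed

text \<open>By convexity of \<open>\<delta> \<mapsto> \<delta>\<^sup>1\<^sup>-\<^sup>p\<close>, \<open>T\<close> decreases at least at the rate of its later derivative.\<close>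

lemma time_decrease:
  assumes "0 < \<delta>" "0 < h"
  shows "h * ((p - 1) * (\<delta> + h) powr (- p)) \<le> \<delta> powr (1 - p) - (\<delta> + h) powr (1 - p)"
proof -
  have "\<exists>z>\<delta>. z < \<delta> + h \<and> (\<delta> + h) powr (1 - p) - \<delta> powr (1 - p) = (\<delta> + h - \<delta>) * ((1 - p) * z powr (- p))"
    using assms by (intro MVT2 DERIV_cong[OF has_real_derivative_powr]) auto
  then obtain z where z: "\<delta> < z" "z < \<delta> + h"
    "(\<delta> + h) powr (1 - p) - \<delta> powr (1 - p) = h * ((1 - p) * z powr (- p))" by auto
  have "(\<delta> + h) powr (- p) \<le> z powr (- p)"
    using z assms p by (intro powr_mono2') auto
  then have "h * ((p - 1) * (\<delta> + h) powr (- p)) \<le> h * ((p - 1) * z powr (- p))"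
    using assms p by (intro mult_left_mono) auto
  then show ?thesis using z(3) by (simp add: algebra_simps)
qed

text \<open>One half of the Hamilton--Jacobi equation in integrated form: by concavity in
  \<open>T = \<delta> powr (1 - p)\<close> the loss is at least the change of \<open>T\<close> times
  the left derivative at the initial \<open>T\<close>.\<close>

lemma hopf_lax_decrease:
  assumes \<delta>: "0 < \<delta>" and h: "0 < h"
  shows "hopf_lax p (\<delta> + h) f x - hopf_lax p \<delta> f x
    \<le> - (h * ((p - 1) * (\<delta> + h) powr (- p))) * infconv_slope p f (\<delta> powr (1 - p)) x"
proof -
  have *: "h * ((p - 1) * (\<delta> + h) powr (- p)) \<le> \<delta> powr (1 - p) - (\<delta> + h) powr (1 - p)"
    using \<delta> h by (rule time_decrease)
  have pos: "0 < h * ((p - 1) * (\<delta> + h) powr (- p))" using \<delta> h p by simp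
  have "h * ((p - 1) * (\<delta> + h) powr (- p)) * infconv_slope p f (\<delta> powr (1 - p)) x
    \<le> (\<delta> powr (1 - p) - (\<delta> + h) powr (1 - p)) * infconv_slope p f (\<delta> powr (1 - p)) x"
    using * \<delta> by (intro mult_right_mono infconv_slope_nonneg[OF p bound]) auto
  also have "\<dots> \<le> infconv p f (\<delta> powr (1 - p)) x - infconv p f ((\<delta> + h) powr (1 - p)) x"
    using * pos \<delta> h by (intro infconv_decrease[OF p bound]) auto
  finally show ?thesis using hopf_lax_eq_infconv[of _ p f] \<delta> h p by simp
qed

text \<open>The point at fraction \<open>h / (\<delta> + h)\<close> of a geodesic from
  \<open>x\<close> to \<open>y\<close> is a competitor for the outer infimum. Both legs have the
  same speed \<open>u\<close>, so their costs add up exactly to the cost of going from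
  \<open>x\<close> to \<open>y\<close>. The opposite inequality would follow from the triangle
  inequality alone; this one uses geodesics.\<close>

lemma hopf_lax_semigroup_le:
  assumes geodesic: "\<forall>x y :: 'a. \<exists>\<gamma>. minimal_geodesic \<gamma> \<and> \<gamma> 0 = x \<and> \<gamma> 1 = y"
    and \<delta>: "0 < \<delta>" and h: "0 < h"
  shows "hopf_lax p h (hopf_lax p \<delta> f) x \<le> hopf_lax p (\<delta> + h) f x"
proof (rule hopf_lax_ge)
  fix y
  obtain \<gamma> where \<gamma>: "minimal_geodesic \<gamma>" "\<gamma> 0 = x" "\<gamma> 1 = y" using geodesic by blast
  define z where "z = \<gamma> (h / (\<delta> + h))"
  define u where "u = dist x y / (\<delta> + h)"
  have i: "h / (\<delta> + h) \<in> {0..1}" "1 - h / (\<delta> + h) = \<delta> / (\<delta> + h)" using \<delta> h by (auto simp: field_simps)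
  have xz: "dist x z / h = u" and zy: "dist z y / \<delta> = u"
    using minimal_geodesicD[OF \<gamma>(1), of 0 "h / (\<delta> + h)"] minimal_geodesicD[OF \<gamma>(1), of "h / (\<delta> + h)" 1] i \<gamma> \<delta> h
    by (auto simp: z_def u_def abs_minus_commute)
  have "hopf_lax p h (hopf_lax p \<delta> f) x \<le> hopf_lax p \<delta> f z + h / p * (dist x z / h) powr p"
    using hopf_lax_bound[OF \<delta>] h p by (intro hopf_lax_le) auto
  also have "\<dots> \<le> f y + \<delta> / p * u powr p + h / p * u powr p"
    using hopf_lax_le[OF bound \<delta>, of p z y] p by (simp add: xz zy)
  also have "\<dots> = f y + (\<delta> + h) / p * u powr p" by (simp add: algebra_simps add_divide_distrib)
  finally show "hopf_lax p h (hopf_lax p \<delta> f) x \<le> f y + (\<delta> + h) / p * (dist x y / (\<delta> + h)) powr p"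
    unfolding u_def .
qed

text \<open>Applying the flow for a further short time \<open>h\<close> loses at most
  \<open>h * (K powr p' / p')\<close> at \<open>x\<close>: near \<open>x\<close> by Young's
  inequality with the slope bound \<open>K\<close>, far from \<open>x\<close> because the cost
  exceeds the oscillation. By the semigroup inequality this loss is at least the one in
  \<open>hopf_lax_decrease\<close>; division by \<open>h\<close> and \<open>h\<close> tending to
  \<open>0\<close> compare the two rates.\<close>

lemma lip_hopf_lax_ge:
  assumes geodesic: "\<forall>x y :: 'a. \<exists>\<gamma>. minimal_geodesic \<gamma> \<and> \<gamma> 0 = x \<and> \<gamma> 1 = y"
    and \<delta>: "0 < \<delta>"
  shows "p * \<delta> powr (- p) * infconv_slope p f (\<delta> powr (1 - p)) x \<le> lip (hopf_lax p \<delta> f) x powr p'"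
proof -
  define g where "g = hopf_lax p \<delta> f"
  define S where "S = infconv_slope p f (\<delta> powr (1 - p)) x"
  obtain C where C: "C-lipschitz_on UNIV g"
    using hopf_lax_bounded_lipschitz[OF \<delta>] unfolding g_def bounded_lipschitz_def by blast
  have gB: "\<bar>g y\<bar> \<le> B" for y unfolding g_def by (rule hopf_lax_bound[OF \<delta>])
  have pp: "0 < p'" using conj_p(1) by simp
  have main: "p * \<delta> powr (- p) * S \<le> K powr p'" if K: "lip g x < K" for K
  proof -
    have K0: "0 < K" using K lip_nonneg[of g x] by linarith
    obtain r where r: "0 < r" "\<And>y. dist x y < r \<Longrightarrow> \<bar>g y - g x\<bar> \<le> K * dist x y"
      using lip_lessD[OF C K] by blast
    \<comment> \<open>At distance \<open>r\<close> or more the cost is at least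
      \<open>h powr (1 - p) * (r powr p / p)\<close>, which blows up as \<open>h\<close> tends to
      \<open>0\<close>; thus distant competitors cannot lower the infimum.\<close>
    have small: "eventually (\<lambda>h. 2 * B \<le> h powr (1 - p) * (r powr p / p)) (at_right 0)"
    proof -
      have "filterlim (\<lambda>h::real. h powr (1 - p)) at_top (at_right 0)"
        using p by real_asymp
      then have "eventually (\<lambda>h. 2 * B / (r powr p / p) \<le> h powr (1 - p)) (at_right 0)"
        by (simp add: filterlim_at_top)
      then show ?thesis by eventually_elim (use r p in \<open>simp add: field_simps\<close>)
    qed
    have ev: "eventually (\<lambda>h. (p - 1) * (\<delta> + h) powr (- p) * S \<le> K powr p' / p') (at_right 0)"
      using small eventually_at_right_less[of 0]
    proof eventually_elim
      case (elim h)
      have "g x - h * (K powr p' / p') \<le> hopf_lax p h g x"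
        unfolding hopf_lax_def
      proof (rule cINF_greatest)
        fix y
        show "g x - h * (K powr p' / p') \<le> g y + h / p * (dist x y / h) powr p"
        proof (cases "dist x y < r")
          case True
          have "dist x y / h * K \<le> (dist x y / h) powr p / p + K powr p' / p'"
            using p conj_p(1) p' K0 elim by (intro Youngs_inequality) auto
          then have "h * (dist x y / h * K) \<le> h * ((dist x y / h) powr p / p + K powr p' / p')"
            using elim by (intro mult_left_mono) auto
          moreover have "h * (dist x y / h * K) = K * dist x y" using elim by simp
          ultimately have "K * dist x y \<le> h / p * (dist x y / h) powr p + h * (K powr p' / p')"
            by (simp add: algebra_simps)
          then show ?thesis using r(2)[OF True] by (auto simp: abs_le_iff)
        next
          case False
          have "2 * B \<le> h powr (1 - p) * (r powr p / p)" using elim by simp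
          also have "\<dots> \<le> h powr (1 - p) * (dist x y powr p / p)"
            using False r p by (intro mult_left_mono divide_right_mono powr_mono2) auto
          also have "\<dots> = h / p * (dist x y / h) powr p"
            using elim by (simp add: powr_divide powr_diff)
          finally have "2 * B \<le> h / p * (dist x y / h) powr p" .
          moreover have "0 \<le> h * (K powr p' / p')" using elim pp by simp
          ultimately show ?thesis using gB[of x] gB[of y] by (auto simp: abs_le_iff)
        qed
      qed simp
      also have "\<dots> \<le> hopf_lax p (\<delta> + h) f x"
        unfolding g_def using elim by (intro hopf_lax_semigroup_le geodesic \<delta>)
      also have "\<dots> \<le> g x - (h * ((p - 1) * (\<delta> + h) powr (- p))) * S"
        using hopf_lax_decrease[OF \<delta>, of h x] elim unfolding g_def S_def by simp
      finally have "h * ((p - 1) * (\<delta> + h) powr (- p) * S) \<le> h * (K powr p' / p')" by (simp add: mult_ac)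
      then show ?case using elim mult_le_cancel_left_pos by blast
    qed
    have "((\<lambda>h. (p - 1) * (\<delta> + h) powr (- p) * S) \<longlongrightarrow> (p - 1) * (\<delta> + 0) powr (- p) * S) (at_right 0)"
      using \<delta> by (intro tendsto_intros) auto
    then have "(p - 1) * (\<delta> + 0) powr (- p) * S \<le> K powr p' / p'"
      using ev by (rule tendsto_upperbound) simp
    then have "p' * ((p - 1) * \<delta> powr (- p) * S) \<le> K powr p'"
      using pp by (simp add: le_divide_eq mult.commute)
    then show ?thesis using conj_p(2) by (simp add: mult.assoc[symmetric] mult.commute[of p'])
  qed
  have lim: "((\<lambda>K. K powr p') \<longlongrightarrow> lip g x powr p') (at_right (lip g x))"
    using conj_p(1) by (intro tendsto_powr'[OF _ tendsto_const] tendsto_ident_at)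
      (auto simp: eventually_at_filter intro!: always_eventually order_trans[OF lip_nonneg less_imp_le])
  show ?thesis
    using main tendsto_lowerbound[OF lim] unfolding g_def S_def
    by (auto simp: eventually_at_filter intro!: always_eventually)
qed

text \<open>Both directions matter later: the upper bound for the slope turns the decrease of the
  flow into a gain, and the lower bound lets a bound on the slope moment pass to difference
  quotients.\<close>

lemma lip_hopf_lax:
  assumes geodesic: "\<forall>x y :: 'a. \<exists>\<gamma>. minimal_geodesic \<gamma> \<and> \<gamma> 0 = x \<and> \<gamma> 1 = y"
    and \<delta>: "0 < \<delta>"
  shows "lip (hopf_lax p \<delta> f) x powr p' = p * \<delta> powr (- p) * infconv_slope p f (\<delta> powr (1 - p)) x"
  using lip_hopf_lax_le[OF \<delta>] lip_hopf_lax_ge[OF geodesic \<delta>] by (rule antisym)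

end

text \<open>\<open>h\<close> is the power of the steepness at a small scale \<open>r\<close>; by
  dominated convergence its integral is still below \<open>K\<close>. Within distance
  \<open>r\<close> it controls increments to first order, and larger distances are absorbed into the
  term of order \<open>p\<close>.\<close>

lemma lipschitz_slope_approx:
  fixes f :: "'a::metric_space \<Rightarrow> real"
  assumes p: "1 < p" "1 / p + 1 / p' = 1" and f: "C-lipschitz_on UNIV f" and \<mu>: "\<mu> \<in> borel_probs"
    and K: "(\<integral>y. lip f y powr p' \<partial>\<mu>) < K"
  obtains h c where "h \<in> borel_measurable borel" "\<And>z. 0 \<le> h z" "\<And>z. h z \<le> C powr p'"
    "(\<integral>y. h y \<partial>\<mu>) < K" "0 \<le> c"
    "\<And>z w. \<bar>f z - f w\<bar> \<le> h z powr (1 / p') * dist z w + c * dist z w powr p"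
proof -
  interpret prob_space \<mu> using borel_probsD[OF \<mu>] by simp
  have [measurable_cong]: "sets \<mu> = sets borel" using borel_probsD[OF \<mu>] by simp
  have cont: "continuous_on UNIV f" by (rule lipschitz_on_continuous_on[OF f])
  note p'1 = conjugate_exponent(1)[OF p]
  note C0 = lipschitz_on_nonneg[OF f]
  define s where "s n z = enn2real (steepness (inverse (real (Suc n))) f z)" for n z
  have s0: "0 \<le> s n z" for n z unfolding s_def by simp
  have sC: "s n z \<le> C" for n z
    unfolding s_def using steepness_le[OF f] C0 by (intro enn2real_leI)
  have [measurable]: "s n \<in> borel_measurable borel" for n
    unfolding s_def[abs_def] using measurable_steepness[OF cont] by measurable
  note [measurable] = measurable_lip[OF cont]
  have slim: "(\<lambda>n. s n z) \<longlonglongrightarrow> lip f z" for z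
    unfolding s_def using steepness_tendsto[of f z] unfolding local_lip_eq_lip[OF f]
    by (rule tendsto_enn2real) simp
  have "(\<lambda>n. \<integral>z. s n z powr p' \<partial>\<mu>) \<longlonglongrightarrow> (\<integral>z. lip f z powr p' \<partial>\<mu>)"
  proof (rule integral_dominated_convergence[where w="\<lambda>_. C powr p'"])
    show "AE z in \<mu>. (\<lambda>n. s n z powr p') \<longlonglongrightarrow> lip f z powr p'"
      using p'1 s0 by (intro AE_I2 tendsto_powr'[OF slim tendsto_const]) auto
    show "AE z in \<mu>. norm (s n z powr p') \<le> C powr p'" for n
      using s0 sC p'1 by (intro AE_I2) (auto intro!: powr_mono2)
  qed auto
  from order_tendstoD(2)[OF this K] obtain n where n: "(\<integral>z. s n z powr p' \<partial>\<mu>) < K"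
    using eventually_happens'[OF sequentially_bot] by blast
  define r where "r = inverse (real (Suc n))"
  have r: "0 < r" unfolding r_def by simp
  have root: "(s n z powr p') powr (1 / p') = s n z" for z using p'1 s0 by (simp add: powr_powr)
  show ?thesis
  \<comment> \<open>For \<open>dist z w \<ge> r\<close> one has
    \<open>C * dist z w \<le> C * r powr (1 - p) * dist z w powr p\<close>; this is the origin of
    the second constant.\<close>
  proof (rule that[of "\<lambda>z. s n z powr p'" "C * r powr (1 - p)"])
    fix z w
    show "\<bar>f z - f w\<bar> \<le> (s n z powr p') powr (1 / p') * dist z w + C * r powr (1 - p) * dist z w powr p"
    proof (cases "dist z w < r")
      case True
      have "\<bar>f z - f w\<bar> \<le> s n z * dist z w"
        using steepness_increment[OF f, of z w r] True unfolding s_def r_def by simp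
      moreover have "0 \<le> C * r powr (1 - p) * dist z w powr p" using C0 by simp
      ultimately show ?thesis unfolding root by linarith
    next
      case False
      have "\<bar>f z - f w\<bar> \<le> C * dist z w * 1" using lipschitz_onD[OF f, of z w] by (simp add: dist_real_def)
      also have "\<dots> = C * dist z w * (r powr (1 - p) * r powr (p - 1))" using r by (simp flip: powr_add)
      also have "\<dots> \<le> C * dist z w * (r powr (1 - p) * dist z w powr (p - 1))"
        using False r p C0 by (intro mult_left_mono powr_mono2) auto
      also have "\<dots> = C * r powr (1 - p) * dist z w powr p"
        using False r by (simp add: powr_diff)
      finally show ?thesis using s0[of n z] unfolding root
        by (simp add: add_increasing)
    qed
  qed (use n C0 s0 sC p'1 in \<open>auto intro!: powr_mono2\<close>)
qed

lemma hopf_lax_uniform_approx: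
  assumes p: "1 < p" "1 / p + 1 / p' = 1" and B: "\<forall>x. \<bar>f x\<bar> \<le> B"
    and L: "L-lipschitz_on UNIV f" and \<delta>: "0 < \<delta>"
  shows "\<bar>hopf_lax p \<delta> f x - f x\<bar> \<le> \<delta> * (L powr p' / p')"
proof -
  note L0 = lipschitz_on_nonneg[OF L] and p' = conjugate_exponent(1)[OF p]
  have "f x - \<delta> * (L powr p' / p') \<le> hopf_lax p \<delta> f x"
  proof (rule hopf_lax_ge[OF p B])
    fix y
    have "f x - f y \<le> L * dist x y" using lipschitz_onD[OF L, of x y] by (simp add: dist_real_def)
    also have "\<dots> = \<delta> * (L * (dist x y / \<delta>))" using \<delta> by simp
    also have "\<dots> \<le> \<delta> * (L powr p' / p' + (dist x y / \<delta>) powr p / p)"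
      using \<delta> L0 p p' by (intro mult_left_mono Youngs_inequality) (auto simp: add.commute)
    finally show "f x - \<delta> * (L powr p' / p') \<le> f y + \<delta> / p * (dist x y / \<delta>) powr p"
      by (simp add: algebra_simps)
  qed
  moreover have "hopf_lax p \<delta> f x \<le> f x" using hopf_lax_le[OF B \<delta>, of p x x] p by simp
  ultimately show ?thesis by linarith
qed

text \<open>At \<open>\<delta> = 0\<close> the formula for \<open>hopf_lax\<close> degenerates to \<open>inf f\<close>; its limit is \<open>f\<close>.\<close>

definition hopf_lax0 :: "real \<Rightarrow> real \<Rightarrow> ('a::metric_space \<Rightarrow> real) \<Rightarrow> 'a \<Rightarrow> real" where
  "hopf_lax0 p \<delta> f = (if \<delta> = 0 then f else hopf_lax p \<delta> f)"

text \<open>At \<open>\<delta> = 0\<close> this is the uniform approximation by Young's inequality,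
  elsewhere Lipschitz continuity in the variable \<open>T\<close>. Uniformity in \<open>x\<close>
  lets the estimate survive integration against the kernels.\<close>

lemma hopf_lax0_continuous:
  assumes p: "1 < p" "1 / p + 1 / p' = 1" and f: "f \<in> bounded_lipschitz" and \<delta>: "0 \<le> \<delta>" and e: "0 < e"
  obtains \<eta> where "0 < \<eta>" "\<And>\<delta>' x. 0 \<le> \<delta>' \<Longrightarrow> \<bar>\<delta>' - \<delta>\<bar> < \<eta> \<Longrightarrow> \<bar>hopf_lax0 p \<delta>' f x - hopf_lax0 p \<delta> f x\<bar> \<le> e"
proof -
  obtain B L where B: "\<forall>x. \<bar>f x\<bar> \<le> B" and L: "L-lipschitz_on UNIV f" using f by (rule bounded_lipschitzE)
  show ?thesis
  proof (cases "\<delta> = 0")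
    case True
    define c where "c = L powr p' / p' + 1"
    have c: "1 \<le> c" unfolding c_def using conjugate_exponent(1)[OF p] by simp
    show ?thesis
    proof (rule that)
      show "0 < e / c" using e c by simp
      fix \<delta>' x assume *: "0 \<le> \<delta>'" "\<bar>\<delta>' - \<delta>\<bar> < e / c"
      show "\<bar>hopf_lax0 p \<delta>' f x - hopf_lax0 p \<delta> f x\<bar> \<le> e"
      proof (cases "\<delta>' = 0")
        case False
        then have "\<bar>hopf_lax p \<delta>' f x - f x\<bar> \<le> \<delta>' * (L powr p' / p')"
          using * by (intro hopf_lax_uniform_approx[OF p B L]) auto
        also have "\<dots> \<le> \<delta>' * c" unfolding c_def using * by (intro mult_left_mono) auto
        also have "\<dots> \<le> e" using * c True by (simp add: field_simps)
        finally show ?thesis using False True by (simp add: hopf_lax0_def)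
      qed (use True e in \<open>simp add: hopf_lax0_def\<close>)
    qed
  next
    case False
    then have \<delta>p: "0 < \<delta>" using \<delta> by simp
    define T where "T \<delta> = \<delta> powr (1 - p)" for \<delta> :: real
    have T: "0 < T \<delta>" unfolding T_def using \<delta>p by simp
    have B0: "0 \<le> B" using B[rule_format, of undefined] by linarith
    \<comment> \<open>The first entry keeps the smaller parameter above
      \<open>T \<delta> / 2\<close>, so the Lipschitz constant in \<open>T\<close> is at most
      \<open>4 * B / T \<delta>\<close>; the second makes the product at most
      \<open>e\<close>.\<close>
    define e' where "e' = min (T \<delta> / 2) (e * T \<delta> / (4 * (B + 1)))"
    have e': "0 < e'" unfolding e'_def using T e B0 by simp
    have "(T \<longlongrightarrow> T \<delta>) (at \<delta>)" unfolding T_def using \<delta>p by (intro tendsto_intros) auto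
    then obtain \<eta> where \<eta>: "0 < \<eta>" "\<And>\<delta>'. \<delta>' \<noteq> \<delta> \<Longrightarrow> \<bar>\<delta>' - \<delta>\<bar> < \<eta> \<Longrightarrow> \<bar>T \<delta>' - T \<delta>\<bar> < e'"
      using e' unfolding tendsto_iff eventually_at by (auto simp: dist_real_def)
    have *: "\<bar>infconv p f T1 x - infconv p f T2 x\<bar> \<le> e"
      if "T2 \<le> T1" "\<bar>T1 - T2\<bar> < e'" "T \<delta> / 2 < T2" for T1 T2 x
    proof -
      have T2: "0 < T2" using T that by linarith
      have "\<bar>infconv p f T1 x - infconv p f T2 x\<bar> \<le> 2 * B / T2 * (T1 - T2)"
        using that T2 by (intro infconv_time_lipschitz[OF p(1) B])
      also have "\<dots> \<le> 2 * B / (T \<delta> / 2) * (e * T \<delta> / (4 * (B + 1)))"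
        using that T T2 B0 unfolding e'_def by (intro mult_mono divide_left_mono) auto
      also have "\<dots> = B / (B + 1) * e" using T B0 by (simp add: field_simps)
      also have "\<dots> \<le> 1 * e" using B0 e by (intro mult_right_mono) auto
      finally show ?thesis by simp
    qed
    show ?thesis
    proof (rule that[of "min \<eta> \<delta>"])
      show "0 < min \<eta> \<delta>" using \<eta> \<delta>p by simp
      fix \<delta>' x assume d: "0 \<le> \<delta>'" "\<bar>\<delta>' - \<delta>\<bar> < min \<eta> \<delta>"
      then have \<delta>': "0 < \<delta>'" by linarith
      have Td: "\<bar>T \<delta>' - T \<delta>\<bar> < e'" using \<eta>(2)[of \<delta>'] d e' by (cases "\<delta>' = \<delta>") auto
      have "\<bar>infconv p f (T \<delta>') x - infconv p f (T \<delta>) x\<bar> \<le> e"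
        using *[of "T \<delta>'" "T \<delta>" x] *[of "T \<delta>" "T \<delta>'" x] Td T e'_def
        by (cases "T \<delta>' \<le> T \<delta>") (auto simp: abs_minus_commute)
      then show "\<bar>hopf_lax0 p \<delta>' f x - hopf_lax0 p \<delta> f x\<bar> \<le> e"
        using \<delta>' \<delta>p hopf_lax_eq_infconv[OF \<delta>' p(1), of f] hopf_lax_eq_infconv[OF \<delta>p p(1), of f]
        unfolding hopf_lax0_def T_def by simp
    qed
  qed
qed

text \<open>The lower endpoint \<open>T - k\<close> of the quotient is kept while the upper one
  moves down to \<open>T'\<close>. The numerator only shrinks, and the shorter step costs a factor
  tending to \<open>1\<close> as \<open>\<delta>'\<close> tends to \<open>\<delta>\<close>. One
  quotient at \<open>\<delta>\<close> thus bounds the slopes at all slightly later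
  parameters.\<close>

lemma lip_hopf_lax_later_le:
  fixes f :: "'a::metric_space \<Rightarrow> real"
  assumes p: "1 < p" "1 / p + 1 / p' = 1" and B: "\<forall>x. \<bar>f x\<bar> \<le> B"
    and \<delta>: "0 < \<delta>" "\<delta> \<le> \<delta>'" and k: "0 < k" "k \<le> \<delta> powr (1 - p)" "\<delta> powr (1 - p) < \<delta>' powr (1 - p) + k"
  shows "lip (hopf_lax p \<delta>' f) x powr p'
    \<le> p * \<delta> powr (- p) * (k / (\<delta>' powr (1 - p) - \<delta> powr (1 - p) + k)) * infconv_quot p f k (\<delta> powr (1 - p)) x"
proof -
  define T where "T = \<delta> powr (1 - p)"
  define T' where "T' = \<delta>' powr (1 - p)"
  have T': "0 < T'" "T' \<le> T" unfolding T_def T'_def using \<delta> p by (auto intro: powr_mono2')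
  define k' where "k' = T' - T + k"
  have k': "0 < k'" "k' \<le> T'" using k unfolding k'_def T_def T'_def by auto
  have "lip (hopf_lax p \<delta>' f) x powr p' \<le> p * \<delta>' powr (- p) * infconv_slope p f T' x"
    unfolding T'_def using \<delta> by (intro lip_hopf_lax_le[OF p B]) auto
  also have "\<dots> \<le> p * \<delta> powr (- p) * infconv_slope p f T' x"
    using p \<delta> infconv_slope_nonneg[OF p(1) B T'(1)] by (intro mult_right_mono mult_left_mono powr_mono2') auto
  also have "\<dots> \<le> p * \<delta> powr (- p) * infconv_quot p f k' T' x"
    using p k' by (intro mult_left_mono infconv_slope_le_quot[OF p(1) B]) auto
  also have "\<dots> \<le> p * \<delta> powr (- p) * (k / k' * infconv_quot p f k T x)"
  proof (intro mult_left_mono)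
    have "infconv_quot p f k' T' x = (infconv p f T' x - infconv p f (T - k) x) / k'"
      unfolding infconv_quot_def k'_def by simp
    also have "\<dots> \<le> (infconv p f T x - infconv p f (T - k) x) / k'"
      using k' T' infconv_mono[OF p(1) B, of T' T x] by (intro divide_right_mono) auto
    also have "\<dots> = k / k' * infconv_quot p f k T x" unfolding infconv_quot_def using k by simp
    finally show "infconv_quot p f k' T' x \<le> k / k' * infconv_quot p f k T x" .
  qed (use p in simp)
  finally show ?thesis unfolding k'_def T_def T'_def by (simp add: mult.assoc)
qed

lemma hopf_lax0_bounded_lipschitz:
  assumes "1 < p" "1 / p + 1 / p' = 1" "f \<in> bounded_lipschitz" "0 \<le> \<delta>"
  shows "hopf_lax0 p \<delta> f \<in> bounded_lipschitz"
proof (cases "\<delta> = 0")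
  case False
  obtain B where B: "\<forall>x. \<bar>f x\<bar> \<le> B" using assms(3) by (rule bounded_lipschitzE)
  show ?thesis using hopf_lax_bounded_lipschitz[OF assms(1,2) B, of \<delta>] assms False by (simp add: hopf_lax0_def)
qed (use assms in \<open>simp add: hopf_lax0_def\<close>)

text \<open>The decrease rewritten through \<open>lip_hopf_lax\<close> and
  \<open>p - 1 = p / p'\<close>; the factor \<open>(\<delta> / (\<delta> + k)) powr p\<close>
  compares the two powers of the parameter and tends to \<open>1\<close> with
  \<open>k\<close>.\<close>

lemma hopf_lax_decrease_lip:
  fixes f :: "'a::metric_space \<Rightarrow> real"
  assumes p: "1 < p" "1 / p + 1 / p' = 1" and B: "\<forall>x. \<bar>f x\<bar> \<le> B"
    and geodesic: "\<forall>x y :: 'a. \<exists>\<gamma>. minimal_geodesic \<gamma> \<and> \<gamma> 0 = x \<and> \<gamma> 1 = y"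
    and \<delta>: "0 < \<delta>" and k: "0 < k"
  shows "hopf_lax p (\<delta> + k) f x - hopf_lax p \<delta> f x
    \<le> - (k / p' * (\<delta> / (\<delta> + k)) powr p * lip (hopf_lax p \<delta> f) x powr p')"
proof -
  define S where "S = infconv_slope p f (\<delta> powr (1 - p)) x"
  have "k / p' * (\<delta> / (\<delta> + k)) powr p * lip (hopf_lax p \<delta> f) x powr p'
      = k * (p / p') * (\<delta> powr p * \<delta> powr (- p)) * (\<delta> + k) powr (- p) * S"
    unfolding lip_hopf_lax[OF p B geodesic \<delta>] S_def using \<delta> k by (simp add: powr_divide powr_minus divide_simps)
  also have "\<dots> = k * ((p - 1) * (\<delta> + k) powr (- p)) * S"
    using \<delta> conjugate_exponent(3)[OF p] by (simp add: powr_add[symmetric] mult.assoc)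
  finally show ?thesis using hopf_lax_decrease[OF p B \<delta> k, of x] unfolding S_def by simp
qed

section \<open>Couplings\<close>

lemma wasserstein_lessD:
  assumes "wasserstein p \<mu> \<nu> < ennreal w" "0 < p" "0 \<le> w"
  obtains \<pi> where "\<pi> \<in> couplings \<mu> \<nu>" "(\<integral>\<^sup>+ z. ennreal (dist (fst z) (snd z) powr p) \<partial>\<pi>) \<le> ennreal (w powr p)"
proof -
  obtain \<pi> where \<pi>: "\<pi> \<in> couplings \<mu> \<nu>"
    "epowr (\<integral>\<^sup>+ z. ennreal (dist (fst z) (snd z) powr p) \<partial>\<pi>) (1 / p) < ennreal w"
    using assms(1) unfolding wasserstein_def INF_less_iff by blast
  then have "epowr (\<integral>\<^sup>+ z. ennreal (dist (fst z) (snd z) powr p) \<partial>\<pi>) (1 / p) \<le> ennreal w"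
    by (intro less_imp_le)
  then have "(\<integral>\<^sup>+ z. ennreal (dist (fst z) (snd z) powr p) \<partial>\<pi>) \<le> ennreal (w powr p)"
    using assms by (subst (asm) epowr_le_ennreal_iff) auto
  with \<pi>(1) show ?thesis by (rule that)
qed

lemma wasserstein_leI:
  assumes "\<pi> \<in> couplings \<mu> \<nu>" "(\<integral>\<^sup>+ z. ennreal (dist (fst z) (snd z) powr p) \<partial>\<pi>) \<le> ennreal (w powr p)"
    "0 < p" "0 \<le> w"
  shows "wasserstein p \<mu> \<nu> \<le> ennreal w"
proof -
  have "epowr (\<integral>\<^sup>+ z. ennreal (dist (fst z) (snd z) powr p) \<partial>\<pi>) (1 / p) \<le> ennreal w"
    using epowr_le_ennreal_iff[of "1 / p" w] assms by simp
  then show ?thesis unfolding wasserstein_def by (rule INF_lower2[OF assms(1)])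
qed

lemma measurable_borel_fst [measurable]: "fst \<in> borel_measurable (borel :: ('a::topological_space \<times> 'b::topological_space) measure)"
  and measurable_borel_snd [measurable]: "snd \<in> borel_measurable (borel :: ('a \<times> 'b) measure)"
  and measurable_borel_dist [measurable]:
    "(\<lambda>z. dist (fst z) (snd z)) \<in> borel_measurable (borel :: ('c::metric_space \<times> 'c) measure)"
  by (intro borel_measurable_continuous_onI continuous_intros)+

lemma couplingD:
  fixes f :: "'a::topological_space \<Rightarrow> real"
  assumes "\<pi> \<in> couplings \<mu> \<nu>" and [measurable]: "f \<in> borel_measurable borel"
  shows "(\<integral>z. f (fst z) \<partial>\<pi>) = (\<integral>x. f x \<partial>\<mu>)" "(\<integral>z. f (snd z) \<partial>\<pi>) = (\<integral>x. f x \<partial>\<nu>)"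
proof -
  have [measurable_cong]: "sets \<pi> = sets borel" using assms borel_probsD by (auto simp: couplings_def)
  have \<pi>: "distr \<pi> borel fst = \<mu>" "distr \<pi> borel snd = \<nu>" using assms by (auto simp: couplings_def)
  show "(\<integral>z. f (fst z) \<partial>\<pi>) = (\<integral>x. f x \<partial>\<mu>)"
    unfolding \<pi>(1)[symmetric] by (rule integral_distr[symmetric]) measurable
  show "(\<integral>z. f (snd z) \<partial>\<pi>) = (\<integral>x. f x \<partial>\<nu>)"
    unfolding \<pi>(2)[symmetric] by (rule integral_distr[symmetric]) measurable
qed

text \<open>Hoelder's inequality for a nearly optimal coupling: the first-order term costs the
  \<open>p'\<close>-norm of the slope times the transport cost. The remainder is of order
  \<open>W powr p\<close>, negligible for small \<open>W\<close> because \<open>1 < p\<close>. The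
  margin \<open>e\<close> both provides a coupling and makes the two bounds positive.\<close>

lemma integral_diff_le_wasserstein:
  fixes f :: "'a::metric_space \<Rightarrow> real"
  assumes ex: "1 < p" "1 / p + 1 / p' = 1"
    and f [measurable]: "f \<in> borel_measurable borel" and fB: "\<forall>x. \<bar>f x\<bar> \<le> B"
    and h [measurable]: "h \<in> borel_measurable borel" and h0: "\<And>z. 0 \<le> h z" and hB: "\<And>z. h z \<le> B'"
    and c: "0 \<le> c"
    and le: "\<And>z w. \<bar>f z - f w\<bar> \<le> h z powr (1 / p') * dist z w + c * dist z w powr p"
    and W: "wasserstein p \<mu> \<nu> \<le> ennreal W" and W0: "0 \<le> W"
  shows "\<bar>(\<integral>x. f x \<partial>\<mu>) - (\<integral>x. f x \<partial>\<nu>)\<bar> \<le> (\<integral>x. h x \<partial>\<mu>) powr (1 / p') * W + c * W powr p"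
proof -
  note p'1 = conjugate_exponent(1)[OF ex]
  have h0': "0 \<le> (\<integral>x. h x \<partial>\<mu>)" using h0 by simp
  have main: "\<bar>(\<integral>x. f x \<partial>\<mu>) - (\<integral>x. f x \<partial>\<nu>)\<bar> \<le> ((\<integral>x. h x \<partial>\<mu>) + e) powr (1 / p') * (W + e) + c * (W + e) powr p"
    if e: "0 < e" for e
  proof -
    have "wasserstein p \<mu> \<nu> < ennreal (W + e)"
      using W W0 e by (auto simp: ennreal_less_iff intro: le_less_trans)
    then obtain \<pi> where \<pi>: "\<pi> \<in> couplings \<mu> \<nu>"
      "(\<integral>\<^sup>+ z. ennreal (dist (fst z) (snd z) powr p) \<partial>\<pi>) \<le> ennreal ((W + e) powr p)"
      using wasserstein_lessD[of p \<mu> \<nu> "W + e"] W0 e ex by auto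
    have \<pi>P: "\<pi> \<in> borel_probs" using \<pi>(1) by (simp add: couplings_def)
    interpret prob_space \<pi> using borel_probsD[OF \<pi>P] by simp
    have [measurable_cong]: "sets \<pi> = sets borel" using borel_probsD[OF \<pi>P] by simp
    have di: "integrable \<pi> (\<lambda>z. dist (fst z) (snd z) powr p)"
      using \<pi>(2) by (intro integrableI_bounded) (auto intro: le_less_trans)
    have dle: "(\<integral>z. dist (fst z) (snd z) powr p \<partial>\<pi>) \<le> (W + e) powr p"
      using \<pi>(2) nn_integral_eq_integral[OF di] W0 e by simp
    have fi: "integrable \<pi> (\<lambda>z. f (fst z))" "integrable \<pi> (\<lambda>z. f (snd z))"
      using fB by (auto intro!: integrable_const_bound[of _ B])
    have hi: "integrable \<pi> (\<lambda>z. h (fst z))"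
      using h0 hB by (auto intro!: integrable_const_bound[of _ B'])
    have root: "(h z powr (1 / p')) powr p' = h z" for z using h0[of z] p'1 by (simp add: powr_powr)
    have hd: "integrable \<pi> (\<lambda>z. h (fst z) powr (1 / p') * dist (fst z) (snd z))"
      "(\<integral>z. h (fst z) powr (1 / p') * dist (fst z) (snd z) \<partial>\<pi>) \<le> ((\<integral>x. h x \<partial>\<mu>) + e) powr (1 / p') * (W + e)"
    proof -
      have Api: "(((\<integral>x. h x \<partial>\<mu>) + e) powr (1 / p')) powr p' = (\<integral>x. h x \<partial>\<mu>) + e"
        using p'1 h0' e by (simp add: powr_powr)
      have pos: "0 < ((\<integral>x. h x \<partial>\<mu>) + e) powr (1 / p')" "0 < W + e" using h0' W0 e by auto
      have le: "(\<integral>z. (h (fst z) powr (1 / p')) powr p' \<partial>\<pi>) \<le> (((\<integral>x. h x \<partial>\<mu>) + e) powr (1 / p')) powr p'"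
        unfolding Api root couplingD(1)[OF \<pi>(1) h] using e by simp
      have ih: "integrable \<pi> (\<lambda>z. (h (fst z) powr (1 / p')) powr p')" unfolding root by (rule hi)
      have "(\<lambda>z. h (fst z) powr (1 / p')) \<in> borel_measurable \<pi>"
        "(\<lambda>z. dist (fst z) (snd z)) \<in> borel_measurable \<pi>" by measurable
      note Ho = Holder_integral_bound[OF ex(1) p'1 ex(2) _ _ this ih di pos le dle]
      show "integrable \<pi> (\<lambda>z. h (fst z) powr (1 / p') * dist (fst z) (snd z))"
        "(\<integral>z. h (fst z) powr (1 / p') * dist (fst z) (snd z) \<partial>\<pi>) \<le> ((\<integral>x. h x \<partial>\<mu>) + e) powr (1 / p') * (W + e)"
        by (rule Ho; simp)+
    qed
    have "\<bar>(\<integral>x. f x \<partial>\<mu>) - (\<integral>x. f x \<partial>\<nu>)\<bar> = \<bar>\<integral>z. (f (fst z) - f (snd z)) \<partial>\<pi>\<bar>"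
      using fi by (simp add: couplingD[OF \<pi>(1) f])
    also have "\<dots> \<le> (\<integral>z. \<bar>f (fst z) - f (snd z)\<bar> \<partial>\<pi>)" by simp
    also have "\<dots> \<le> (\<integral>z. h (fst z) powr (1 / p') * dist (fst z) (snd z) + c * dist (fst z) (snd z) powr p \<partial>\<pi>)"
      using fi hd di le by (intro integral_mono) auto
    also have "\<dots> = (\<integral>z. h (fst z) powr (1 / p') * dist (fst z) (snd z) \<partial>\<pi>) + c * (\<integral>z. dist (fst z) (snd z) powr p \<partial>\<pi>)"
      using hd di by simp
    also have "\<dots> \<le> ((\<integral>x. h x \<partial>\<mu>) + e) powr (1 / p') * (W + e) + c * (W + e) powr p"
      using hd dle c by (intro add_mono mult_left_mono) auto
    finally show ?thesis .
  qed
  have powr_lim: "((\<lambda>e. (a + e) powr q) \<longlongrightarrow> (a + 0) powr q) (at_right 0)" if "0 \<le> a" "0 < q" for a q :: real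
    using that by (intro tendsto_powr'[OF tendsto_add[OF tendsto_const tendsto_ident_at] tendsto_const])
      (auto simp: eventually_at_filter intro!: always_eventually)
  have lim: "((\<lambda>e. ((\<integral>x. h x \<partial>\<mu>) + e) powr (1 / p') * (W + e) + c * (W + e) powr p)
     \<longlongrightarrow> ((\<integral>x. h x \<partial>\<mu>) + 0) powr (1 / p') * (W + 0) + c * (W + 0) powr p) (at_right 0)"
    using ex p'1 h0' W0
    by (intro tendsto_add[OF tendsto_mult[OF powr_lim tendsto_add[OF tendsto_const tendsto_ident_at]] tendsto_mult_left[OF powr_lim]]) auto
  show ?thesis
    using main tendsto_lowerbound[OF lim] by (auto simp: eventually_at_filter intro!: always_eventually)
qed

lemma return_borel_prob: "return borel x \<in> borel_probs"
  by (simp add: space_prob_algebra prob_space_return)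

lemma wasserstein_return_le:
  fixes x y :: "'a::metric_space"
  assumes "0 < p"
  shows "wasserstein p (return borel x) (return borel y) \<le> ennreal (dist x y)"
proof (rule wasserstein_leI)
  show "return borel (x, y) \<in> couplings (return borel x) (return borel y)"
    unfolding couplings_def by (simp add: return_borel_prob distr_return)
  show "(\<integral>\<^sup>+ z. ennreal (dist (fst z) (snd z) powr p) \<partial>return borel (x, y)) \<le> ennreal (dist x y powr p)"
    by (subst nn_integral_return) auto
qed (use assms in auto)

section \<open>Kantorovich duality\<close>

text \<open>The Hahn--Banach theorem, for sublinear functionals on a space of functions: a minimal
  sublinear functional is linear.\<close>

locale function_space =
  fixes V :: "('i \<Rightarrow> real) set"
  assumes add_closed: "f \<in> V \<Longrightarrow> g \<in> V \<Longrightarrow> (\<lambda>x. f x + g x) \<in> V"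
    and scale_closed: "f \<in> V \<Longrightarrow> (\<lambda>x. c * f x) \<in> V"
begin

definition sublinear :: "(('i \<Rightarrow> real) \<Rightarrow> real) \<Rightarrow> bool" where
  "sublinear q \<longleftrightarrow> (\<forall>f\<in>V. \<forall>g\<in>V. q (\<lambda>x. f x + g x) \<le> q f + q g) \<and>
     (\<forall>f\<in>V. \<forall>c\<ge>0. q (\<lambda>x. c * f x) = c * q f)"

lemma sublinear_add: "sublinear q \<Longrightarrow> f \<in> V \<Longrightarrow> g \<in> V \<Longrightarrow> q (\<lambda>x. f x + g x) \<le> q f + q g"
  and sublinear_scale: "sublinear q \<Longrightarrow> f \<in> V \<Longrightarrow> 0 \<le> c \<Longrightarrow> q (\<lambda>x. c * f x) = c * q f"
  unfolding sublinear_def by auto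

lemma neg_closed: "f \<in> V \<Longrightarrow> (\<lambda>x. - f x) \<in> V"
  using scale_closed[of f "-1"] by simp

lemma sublinear_zero: "sublinear q \<Longrightarrow> f \<in> V \<Longrightarrow> q (\<lambda>x. 0) = 0"
  using sublinear_scale[of q f 0] by simp

lemma sublinear_neg_le: "sublinear q \<Longrightarrow> f \<in> V \<Longrightarrow> - q (\<lambda>x. - f x) \<le> q f"
  using sublinear_add[of q f "\<lambda>x. - f x"] sublinear_zero[of q f] neg_closed[of f] by simp

text \<open>The value \<open>0\<close> outside \<open>V\<close> turns equality on \<open>V\<close>
  into equality of functions, so that minimality can be stated in the pointwise order.\<close>

definition minorants :: "(('i \<Rightarrow> real) \<Rightarrow> real) \<Rightarrow> (('i \<Rightarrow> real) \<Rightarrow> real) set" where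
  "minorants q = {r. sublinear r \<and> (\<forall>f\<in>V. r f \<le> q f) \<and> (\<forall>f. f \<notin> V \<longrightarrow> r f = 0)}"

lemma minorants_bdd_below:
  assumes "f \<in> V" "C \<subseteq> minorants q"
  shows "bdd_below ((\<lambda>r. r f) ` C)"
proof (rule bdd_belowI2)
  fix r assume "r \<in> C"
  then have r: "sublinear r" "r (\<lambda>x. - f x) \<le> q (\<lambda>x. - f x)"
    using assms neg_closed unfolding minorants_def by blast+
  then show "- q (\<lambda>x. - f x) \<le> r f" using sublinear_neg_le[OF r(1) assms(1)] by linarith
qed

text \<open>Subadditivity of the infimum uses the chain: two members can be replaced by the smaller
  one. Finiteness comes from \<open>minorants_bdd_below\<close>.\<close>

lemma chain_Inf_minorant:
  assumes C: "C \<subseteq> minorants q" "C \<noteq> {}"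
    and chain: "\<And>r r'. r \<in> C \<Longrightarrow> r' \<in> C \<Longrightarrow> r \<le> r' \<or> r' \<le> r"
  shows "(\<lambda>f. if f \<in> V then INF r\<in>C. r f else 0) \<in> minorants q"
proof -
  define u where "u f = (if f \<in> V then INF r\<in>C. r f else 0)" for f
  have u_le: "u f \<le> r f" if "r \<in> C" "f \<in> V" for r f
    unfolding u_def using that minorants_bdd_below[OF that(2) C(1)] by (auto intro: cINF_lower)
  have u_ge: "c \<le> u f" if "\<And>r. r \<in> C \<Longrightarrow> c \<le> r f" "f \<in> V" for c f
    unfolding u_def using that C(2) by (auto intro: cINF_greatest)
  have sub: "sublinear r" if "r \<in> C" for r using that C(1) unfolding minorants_def by auto
  have "sublinear u" unfolding sublinear_def
  proof (intro conjI ballI allI impI)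
    fix f g assume fg: "f \<in> V" "g \<in> V"
    have le: "u (\<lambda>x. f x + g x) \<le> r f + r' g" if r: "r \<in> C" "r' \<in> C" for r r'
    proof -
      have "\<exists>s\<in>C. s f \<le> r f \<and> s g \<le> r' g"
        using chain[OF r] r by (auto simp: le_fun_def)
      then obtain s where s: "s \<in> C" "s f \<le> r f" "s g \<le> r' g" by blast
      have "u (\<lambda>x. f x + g x) \<le> s (\<lambda>x. f x + g x)" using s(1) fg by (intro u_le add_closed)
      also have "\<dots> \<le> s f + s g" using sub[OF s(1)] fg by (rule sublinear_add)
      finally show ?thesis using s by linarith
    qed
    have "u (\<lambda>x. f x + g x) - r' g \<le> u f" if "r' \<in> C" for r'
      using le[OF _ that] fg by (intro u_ge) (auto simp: algebra_simps)
    then have "u (\<lambda>x. f x + g x) - u f \<le> u g"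
      using fg by (intro u_ge) (auto simp: algebra_simps)
    then show "u (\<lambda>x. f x + g x) \<le> u f + u g" by simp
  next
    fix f and c :: real assume f: "f \<in> V" and c: "0 \<le> c"
    show "u (\<lambda>x. c * f x) = c * u f"
    proof (cases "c = 0")
      case True
      obtain r where "r \<in> C" using C(2) by blast
      have "(INF r\<in>C. r (\<lambda>x. 0)) = (INF r\<in>C. 0)"
        using sublinear_zero[OF sub f] by (intro INF_cong) auto
      then show ?thesis using True scale_closed[OF f, of 0] C(2) unfolding u_def by simp
    next
      case False
      then have c: "0 < c" using c by simp
      have cf: "(\<lambda>x. c * f x) \<in> V" using f by (rule scale_closed)
      have "u (\<lambda>x. c * f x) / c \<le> u f"
      proof (rule u_ge[OF _ f])
        fix r assume r: "r \<in> C"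
        have "u (\<lambda>x. c * f x) \<le> c * r f"
          using u_le[OF r cf] sublinear_scale[OF sub[OF r] f, of c] c by simp
        then show "u (\<lambda>x. c * f x) / c \<le> r f" using c by (simp add: divide_le_eq mult.commute)
      qed
      moreover have "c * u f \<le> u (\<lambda>x. c * f x)"
      proof (rule u_ge[OF _ cf])
        fix r assume r: "r \<in> C"
        show "c * u f \<le> r (\<lambda>x. c * f x)"
          using u_le[OF r f] sublinear_scale[OF sub[OF r] f, of c] c by simp
      qed
      ultimately show ?thesis using c by (simp add: divide_le_eq mult.commute)
    qed
  qed
  moreover have "u f \<le> q f" if "f \<in> V" for f
  proof -
    obtain r where r: "r \<in> C" using C(2) by blast
    then have "r f \<le> q f" using that C(1) unfolding minorants_def by auto
    then show ?thesis using u_le[OF r that] by simp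
  qed
  ultimately have "u \<in> minorants q" unfolding minorants_def by (auto simp: u_def)
  then show ?thesis unfolding u_def .
qed

text \<open>The infimum over \<open>t \<ge> 0\<close> of
  \<open>r (\<lambda>x. f x + t * g x) - t * r g\<close> is again a sublinear minorant and lies
  below \<open>r\<close>, hence equals \<open>r\<close> by minimality. Its competitor
  \<open>t = 1\<close> gives the superadditive half.\<close>

lemma minimal_minorant_additive:
  assumes r: "r \<in> minorants q" and min: "\<And>r'. r' \<in> minorants q \<Longrightarrow> r' \<le> r \<Longrightarrow> r' = r"
    and fg: "f \<in> V" "g \<in> V"
  shows "r (\<lambda>x. f x + g x) = r f + r g"
proof -
  have sub: "sublinear r" and rq: "\<And>f. f \<in> V \<Longrightarrow> r f \<le> q f" and out: "\<And>f. f \<notin> V \<Longrightarrow> r f = 0"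
    using r unfolding minorants_def by auto
  define F where "F f t = r (\<lambda>x. f x + t * g x) - t * r g" for f and t :: real
  define u where "u f = (if f \<in> V then INF t\<in>{0..}. F f t else 0)" for f
  have cl: "(\<lambda>x. f x + t * g x) \<in> V" if "f \<in> V" for f t
    using that fg(2) add_closed scale_closed by blast
  have bdd: "- r (\<lambda>x. - f x) \<le> F f t" if "f \<in> V" "0 \<le> t" for f t
  proof -
    have "r (\<lambda>x. (f x + t * g x) + - f x) \<le> r (\<lambda>x. f x + t * g x) + r (\<lambda>x. - f x)"
      using that by (intro sublinear_add[OF sub] cl neg_closed)
    then show ?thesis unfolding F_def using sublinear_scale[OF sub fg(2) that(2)] by simp
  qed
  have u_le: "u f \<le> F f t" if "f \<in> V" "0 \<le> t" for f t
    unfolding u_def using that bdd by (auto intro!: cINF_lower bdd_belowI2)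
  have u_ge: "c \<le> u f" if "\<And>t. 0 \<le> t \<Longrightarrow> c \<le> F f t" "f \<in> V" for c f
    unfolding u_def using that by (auto intro!: cINF_greatest)
  have ur: "u f \<le> r f" if "f \<in> V" for f using u_le[OF that, of 0] by (simp add: F_def)
  have "sublinear u" unfolding sublinear_def
  proof (intro conjI ballI allI impI)
    fix f1 f2 assume f: "f1 \<in> V" "f2 \<in> V"
    have le: "u (\<lambda>x. f1 x + f2 x) \<le> F f1 t1 + F f2 t2" if "0 \<le> t1" "0 \<le> t2" for t1 t2
    proof -
      have "u (\<lambda>x. f1 x + f2 x) \<le> F (\<lambda>x. f1 x + f2 x) (t1 + t2)"
        using f that by (intro u_le add_closed) auto
      also have "(\<lambda>x. f1 x + f2 x + (t1 + t2) * g x) = (\<lambda>x. (f1 x + t1 * g x) + (f2 x + t2 * g x))"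
        by (simp add: algebra_simps)
      then have "F (\<lambda>x. f1 x + f2 x) (t1 + t2) \<le> F f1 t1 + F f2 t2"
        unfolding F_def using sublinear_add[OF sub cl[OF f(1)] cl[OF f(2)], of t1 t2]
        by (simp add: algebra_simps)
      finally show ?thesis .
    qed
    have "u (\<lambda>x. f1 x + f2 x) - F f2 t2 \<le> u f1" if "0 \<le> t2" for t2
      using le[OF _ that] f by (intro u_ge) (auto simp: algebra_simps)
    then have "u (\<lambda>x. f1 x + f2 x) - u f1 \<le> u f2"
      using f by (intro u_ge) (auto simp: algebra_simps)
    then show "u (\<lambda>x. f1 x + f2 x) \<le> u f1 + u f2" by simp
  next
    fix f and c :: real assume f: "f \<in> V" and c: "0 \<le> c"
    show "u (\<lambda>x. c * f x) = c * u f"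
    proof (cases "c = 0")
      case True
      have z: "(\<lambda>x. 0) \<in> V" using scale_closed[OF f, of 0] by simp
      have "F (\<lambda>x. 0) t = 0" if "0 \<le> t" for t
        unfolding F_def using sublinear_scale[OF sub fg(2) that] by simp
      then have "u (\<lambda>x. 0) = 0" using u_le[OF z, of 0] u_ge[OF _ z, of 0] by fastforce
      then show ?thesis using True by simp
    next
      case False
      then have c: "0 < c" using c by simp
      have cf: "(\<lambda>x. c * f x) \<in> V" using f by (rule scale_closed)
      have Fc: "F (\<lambda>x. c * f x) (c * t) = c * F f t" for t
        using sublinear_scale[OF sub cl[OF f], of c t] c unfolding F_def by (simp add: algebra_simps)
      have "u (\<lambda>x. c * f x) / c \<le> u f"
      proof (rule u_ge[OF _ f])
        fix t :: real assume t: "0 \<le> t"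
        have "u (\<lambda>x. c * f x) \<le> c * F f t" using u_le[OF cf, of "c * t"] t c by (simp add: Fc)
        then show "u (\<lambda>x. c * f x) / c \<le> F f t" using c by (simp add: divide_le_eq mult.commute)
      qed
      moreover have "c * u f \<le> u (\<lambda>x. c * f x)"
      proof (rule u_ge[OF _ cf])
        fix t :: real assume t: "0 \<le> t"
        show "c * u f \<le> F (\<lambda>x. c * f x) t"
          using u_le[OF f, of "t / c"] t c Fc[of "t / c"] by simp
      qed
      ultimately show ?thesis using c by (simp add: divide_le_eq mult.commute)
    qed
  qed
  then have "u \<in> minorants q"
    unfolding minorants_def using ur rq by (auto simp: u_def intro: order_trans)
  moreover have "u \<le> r" using ur out by (auto simp: le_fun_def u_def)
  ultimately have "u = r" by (rule min)
  then have "r f \<le> F f 1" using u_le[OF fg(1), of 1] by simp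
  then show ?thesis using sublinear_add[OF sub fg] unfolding F_def by simp
qed

theorem Hahn_Banach_sublinear:
  assumes q: "sublinear q"
  obtains L where "\<And>f. f \<in> V \<Longrightarrow> L f \<le> q f"
    "\<And>f g. f \<in> V \<Longrightarrow> g \<in> V \<Longrightarrow> L (\<lambda>x. f x + g x) = L f + L g"
    "\<And>f c. f \<in> V \<Longrightarrow> L (\<lambda>x. c * f x) = c * L f"
proof -
  \<comment> \<open>The order is reversed, so that the maximal element given by Zorn's lemma is a
    minimal sublinear functional.\<close>
  let ?R = "relation_of (\<ge>) (minorants q)"
  have po: "partial_order_on (minorants q) ?R"
    unfolding partial_order_on_def preorder_on_def refl_on_def trans_def antisym_def relation_of_def
    by (auto intro: order_trans antisym)
  define q0 where "q0 f = (if f \<in> V then q f else 0)" for f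
  have "q0 \<in> minorants q"
    using q add_closed scale_closed unfolding minorants_def sublinear_def q0_def by auto
  have "\<exists>m\<in>minorants q. \<forall>a\<in>minorants q. m \<ge> a \<longrightarrow> a = m"
  proof (rule predicate_Zorn[OF po])
    fix C assume C: "C \<in> Chains ?R"
    have CM: "C \<subseteq> minorants q" using C unfolding Chains_def relation_of_def by auto
    show "\<exists>u\<in>minorants q. \<forall>a\<in>C. a \<ge> u"
    proof (cases "C = {}")
      case True
      then show ?thesis using \<open>q0 \<in> minorants q\<close> by blast
    next
      case False
      define u where "u f = (if f \<in> V then INF r\<in>C. r f else 0)" for f
      have "u \<in> minorants q" unfolding u_def
        using C by (intro chain_Inf_minorant CM False) (auto simp: Chains_def relation_of_def)
      moreover have "u \<le> a" if "a \<in> C" for a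
      proof (rule le_funI)
        fix f
        show "u f \<le> a f"
          using that CM minorants_bdd_below[OF _ CM, of f] unfolding u_def minorants_def
          by (auto intro: cINF_lower)
      qed
      ultimately show ?thesis by blast
    qed
  qed
  then obtain L where L: "L \<in> minorants q" "\<And>a. a \<in> minorants q \<Longrightarrow> a \<le> L \<Longrightarrow> a = L" by blast
  then have sub: "sublinear L" and Lq: "\<And>f. f \<in> V \<Longrightarrow> L f \<le> q f" unfolding minorants_def by auto
  have add: "L (\<lambda>x. f x + g x) = L f + L g" if "f \<in> V" "g \<in> V" for f g
    using minimal_minorant_additive[OF L that] .
  have "L (\<lambda>x. c * f x) = c * L f" if f: "f \<in> V" for f c
  proof (cases "0 \<le> c")
    case True
    then show ?thesis using sublinear_scale[OF sub f] by simp
  next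
    case False
    have "L (\<lambda>x. c * f x + - c * f x) = L (\<lambda>x. c * f x) + L (\<lambda>x. - c * f x)"
      using f by (intro add scale_closed)
    then show ?thesis
      using sublinear_scale[OF sub f, of "- c"] False sublinear_zero[OF sub f] by simp
  qed
  with Lq add show ?thesis by (rule that)
qed

end

section \<open>Couplings with prescribed weights on a countable partition\<close>

lemma nn_integral_index:
  fixes G :: "nat \<Rightarrow> ennreal"
  assumes I: "I \<in> M \<rightarrow>\<^sub>M count_space UNIV"
  shows "(\<integral>\<^sup>+ x. G (I x) \<partial>M) = (\<Sum>j. G j * emeasure M (I -` {j} \<inter> space M))"
proof -
  have [measurable]: "I -` {j} \<inter> space M \<in> sets M" for j by (rule measurable_sets[OF I]) simp
  have "(\<integral>\<^sup>+ x. G (I x) \<partial>M) = (\<integral>\<^sup>+ x. (\<Sum>j. G j * indicator (I -` {j} \<inter> space M) x) \<partial>M)"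
  proof (rule nn_integral_cong)
    fix x assume "x \<in> space M"
    then have "(\<lambda>j. G j * indicator (I -` {j} \<inter> space M) x) sums (\<Sum>j\<in>{I x}. G j * indicator (I -` {j} \<inter> space M) x)"
      by (intro sums_finite) auto
    with \<open>x \<in> space M\<close> show "G (I x) = (\<Sum>j. G j * indicator (I -` {j} \<inter> space M) x)"
      by (simp add: sums_iff)
  qed
  also have "\<dots> = (\<Sum>j. \<integral>\<^sup>+ x. G j * indicator (I -` {j} \<inter> space M) x \<partial>M)"
    by (intro nn_integral_suminf) measurable
  also have "\<dots> = (\<Sum>j. G j * emeasure M (I -` {j} \<inter> space M))"
    by (intro suminf_cong nn_integral_cmult_indicator) measurable
  finally show ?thesis .
qed

text \<open>A coupling of the images of \<open>\<mu>\<close> and \<open>\<nu>\<close> on a countable partition lifts to a coupling of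
  \<open>\<mu>\<close> and \<open>\<nu>\<close>: spread the mass of each pair of cells as a product measure.\<close>

lemma coupling_from_discrete:
  fixes \<mu> \<nu> :: "'a::second_countable_topology measure"
  assumes \<mu>: "\<mu> \<in> borel_probs" and \<nu>: "\<nu> \<in> borel_probs"
    and I: "I \<in> borel \<rightarrow>\<^sub>M (count_space UNIV :: nat measure)"
    and w0: "\<And>i j. 0 \<le> w i j"
    and row: "\<And>i. (\<lambda>j. w i j) sums measure \<mu> (I -` {i})"
    and col: "\<And>j. (\<lambda>i. w i j) sums measure \<nu> (I -` {j})"
  obtains \<pi> where "\<pi> \<in> couplings \<mu> \<nu>"
    "\<And>g G. (\<And>x y. g (x, y) \<le> G (I x) (I y)) \<Longrightarrow>
      (\<integral>\<^sup>+ z. g z \<partial>\<pi>) \<le> (\<Sum>i. \<Sum>j. ennreal (w i j) * G i j)"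
proof -
  interpret M: prob_space \<mu> using borel_probsD[OF \<mu>] by simp
  interpret N: prob_space \<nu> using borel_probsD[OF \<nu>] by simp
  interpret MN: pair_sigma_finite \<mu> \<nu> ..
  note sM [measurable_cong] = borel_probsD(2)[OF \<mu>] and sN [measurable_cong] = borel_probsD(2)[OF \<nu>]
  note spM [simp] = borel_probsD(3)[OF \<mu>] and spN [simp] = borel_probsD(3)[OF \<nu>]
  note [measurable] = I
  have cell [measurable]: "I -` {i} \<in> sets borel" for i using measurable_sets[OF I, of "{i}"] by simp
  define m where "m i = measure \<mu> (I -` {i})" for i
  define n where "n j = measure \<nu> (I -` {j})" for j
  have m0: "0 \<le> m i" and n0: "0 \<le> n i" for i unfolding m_def n_def by auto
  have w_m: "w i j \<le> m i" for i j
    using sum_le_suminf[of "\<lambda>j. w i j" "{j}"] row[of i] w0 unfolding m_def by (auto simp: sums_iff)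
  have w_n: "w i j \<le> n j" for i j
    using sum_le_suminf[of "\<lambda>i. w i j" "{i}"] col[of j] w0 unfolding n_def by (auto simp: sums_iff)
  \<comment> \<open>Density with respect to the product measure. On cells of mass zero division
    gives \<open>0\<close>, in agreement with \<open>w\<close>, which vanishes there by
    \<open>w_m\<close> and \<open>w_n\<close>.\<close>
  define W where "W z = ennreal (w (I (fst z)) (I (snd z)) / (m (I (fst z)) * n (I (snd z))))" for z :: "'a \<times> 'a"
  have Wm: "(\<lambda>x. ennreal (w (I (fst x)) (I (snd x)) / (m (I (fst x)) * n (I (snd x))))) \<in> borel_measurable (\<mu> \<Otimes>\<^sub>M \<nu>)"
    by measurable
  have W_meas [measurable]: "W \<in> borel_measurable (\<mu> \<Otimes>\<^sub>M \<nu>)" unfolding W_def[abs_def] by (rule Wm)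
  define \<pi> where "\<pi> = density (\<mu> \<Otimes>\<^sub>M \<nu>) W"
  have s\<pi>: "sets \<pi> = sets borel"
    unfolding \<pi>_def sets_density sets_pair_measure_cong[OF sM sN] borel_prod ..
  note [measurable_cong] = s\<pi>
  have sp\<pi>: "space \<pi> = UNIV" using sets_eq_imp_space_eq[OF s\<pi>] by simp
  have emM: "emeasure \<mu> (I -` {i}) = ennreal (m i)" and emN: "emeasure \<nu> (I -` {i}) = ennreal (n i)" for i
    unfolding m_def n_def by (simp_all add: M.emeasure_eq_measure N.emeasure_eq_measure)
  have q: "ennreal (w i j / (m i * n j)) * ennreal (m i) * ennreal (n j) = ennreal (w i j)" for i j
    using w_m[of i j] w_n[of i j] w0[of i j] m0[of i] n0[of j]
    by (cases "m i = 0 \<or> n j = 0") (auto simp flip: ennreal_mult' simp: field_simps)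
  have q1: "ennreal (w i j / (m i * n j)) * ennreal (n j) = ennreal (w i j / m i)" for i j
    using w_n[of i j] w0[of i j] m0[of i] n0[of j]
    by (cases "n j = 0") (auto simp flip: ennreal_mult')
  have q2: "ennreal (w i j / (m i * n j)) * ennreal (m i) = ennreal (w i j / n j)" for i j
    using w_m[of i j] w0[of i j] m0[of i] n0[of j]
    by (cases "m i = 0") (auto simp flip: ennreal_mult')
  have AEM: "AE x in \<mu>. m (I x) \<noteq> 0"
  proof -
    have "AE x in \<mu>. I x = i \<longrightarrow> m i \<noteq> 0" for i
    proof (cases "m i = 0")
      case True
      then have "I -` {i} \<inter> space \<mu> \<in> null_sets \<mu>" using emM[of i] cell sM by (auto simp: null_sets_def)
      then show ?thesis by (rule AE_I') (auto simp: True)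
    qed simp
    then have "AE x in \<mu>. \<forall>i. I x = i \<longrightarrow> m i \<noteq> 0" unfolding AE_all_countable by blast
    then show ?thesis by eventually_elim auto
  qed
  have AEN: "AE x in \<nu>. n (I x) \<noteq> 0"
  proof -
    have "AE x in \<nu>. I x = i \<longrightarrow> n i \<noteq> 0" for i
    proof (cases "n i = 0")
      case True
      then have "I -` {i} \<inter> space \<nu> \<in> null_sets \<nu>" using emN[of i] cell sN by (auto simp: null_sets_def)
      then show ?thesis by (rule AE_I') (auto simp: True)
    qed simp
    then have "AE x in \<nu>. \<forall>i. I x = i \<longrightarrow> n i \<noteq> 0" unfolding AE_all_countable by blast
    then show ?thesis by eventually_elim auto
  qed
  have sum1: "(\<Sum>j. ennreal (w i j / (m i * n j)) * ennreal (n j)) = 1" if "m i \<noteq> 0" for i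
  proof -
    have "(\<Sum>j. ennreal (w i j / (m i * n j)) * ennreal (n j)) = (\<Sum>j. ennreal (w i j / m i))"
      unfolding q1 ..
    also have "\<dots> = ennreal (m i / m i)"
      using sums_divide[OF row[of i], of "m i"] w0 m0[of i] unfolding m_def
      by (intro suminf_ennreal_eq) auto
    finally show ?thesis using that by simp
  qed
  have sum2: "(\<Sum>i. ennreal (w i j / (m i * n j)) * ennreal (m i)) = 1" if "n j \<noteq> 0" for j
  proof -
    have "(\<Sum>i. ennreal (w i j / (m i * n j)) * ennreal (m i)) = (\<Sum>i. ennreal (w i j / n j))"
      unfolding q2 ..
    also have "\<dots> = ennreal (n j / n j)"
      using sums_divide[OF col[of j], of "n j"] w0 n0[of j] unfolding n_def
      by (intro suminf_ennreal_eq) auto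
    finally show ?thesis using that by simp
  qed
  have dM: "distr \<pi> borel fst = \<mu>"
  proof (rule measure_eqI)
    fix A assume "A \<in> sets (distr \<pi> borel fst)"
    then have A [measurable]: "A \<in> sets borel" by simp
    have sA: "fst -` A \<in> sets (\<mu> \<Otimes>\<^sub>M \<nu>)"
      unfolding sets_pair_measure_cong[OF sM sN] borel_prod by (rule measurable_sets_borel[OF measurable_borel_fst A])
    have "emeasure (distr \<pi> borel fst) A = emeasure \<pi> (fst -` A)"
      by (subst emeasure_distr) (auto simp: sp\<pi>)
    also have "\<dots> = (\<integral>\<^sup>+ z. W z * indicator (fst -` A) z \<partial>(\<mu> \<Otimes>\<^sub>M \<nu>))"
      unfolding \<pi>_def by (rule emeasure_density[OF W_meas sA])
    also have "\<dots> = (\<integral>\<^sup>+ z. W z * indicator A (fst z) \<partial>(\<mu> \<Otimes>\<^sub>M \<nu>))"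
      by (intro nn_integral_cong) (auto simp: indicator_def)
    also have "\<dots> = (\<integral>\<^sup>+ x. \<integral>\<^sup>+ y. W (x, y) * indicator A x \<partial>\<nu> \<partial>\<mu>)"
      by (subst N.nn_integral_fst[symmetric]) auto
    also have "\<dots> = (\<integral>\<^sup>+ x. indicator A x * (\<Sum>j. ennreal (w (I x) j / (m (I x) * n j)) * ennreal (n j)) \<partial>\<mu>)"
    proof (rule nn_integral_cong)
      fix x
      have "(\<integral>\<^sup>+ y. W (x, y) * indicator A x \<partial>\<nu>) = indicator A x * (\<integral>\<^sup>+ y. ennreal (w (I x) (I y) / (m (I x) * n (I y))) \<partial>\<nu>)"
        unfolding W_def by (subst nn_integral_cmult[symmetric]) (auto simp: mult.commute)
      then show "(\<integral>\<^sup>+ y. W (x, y) * indicator A x \<partial>\<nu>) = indicator A x * (\<Sum>j. ennreal (w (I x) j / (m (I x) * n j)) * ennreal (n j))"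
        by (subst (asm) nn_integral_index[where G="\<lambda>j. ennreal (w (I x) j / (m (I x) * n j))"]) (auto simp: emN)
    qed
    also have "\<dots> = (\<integral>\<^sup>+ x. indicator A x \<partial>\<mu>)"
      using AEM by (intro nn_integral_cong_AE) (auto simp: sum1)
    finally show "emeasure (distr \<pi> borel fst) A = emeasure \<mu> A" by simp
  qed (simp add: sM)
  have dN: "distr \<pi> borel snd = \<nu>"
  proof (rule measure_eqI)
    fix A assume "A \<in> sets (distr \<pi> borel snd)"
    then have A [measurable]: "A \<in> sets borel" by simp
    have sA: "snd -` A \<in> sets (\<mu> \<Otimes>\<^sub>M \<nu>)"
      unfolding sets_pair_measure_cong[OF sM sN] borel_prod by (rule measurable_sets_borel[OF measurable_borel_snd A])
    have "emeasure (distr \<pi> borel snd) A = emeasure \<pi> (snd -` A)"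
      by (subst emeasure_distr) (auto simp: sp\<pi>)
    also have "\<dots> = (\<integral>\<^sup>+ z. W z * indicator (snd -` A) z \<partial>(\<mu> \<Otimes>\<^sub>M \<nu>))"
      unfolding \<pi>_def by (rule emeasure_density[OF W_meas sA])
    also have "\<dots> = (\<integral>\<^sup>+ z. W z * indicator A (snd z) \<partial>(\<mu> \<Otimes>\<^sub>M \<nu>))"
      by (intro nn_integral_cong) (auto simp: indicator_def)
    also have "\<dots> = (\<integral>\<^sup>+ y. \<integral>\<^sup>+ x. W (x, y) * indicator A y \<partial>\<mu> \<partial>\<nu>)"
      by (subst MN.nn_integral_snd[symmetric]) auto
    also have "\<dots> = (\<integral>\<^sup>+ y. indicator A y * (\<Sum>i. ennreal (w i (I y) / (m i * n (I y))) * ennreal (m i)) \<partial>\<nu>)"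
    proof (rule nn_integral_cong)
      fix y
      have "(\<integral>\<^sup>+ x. W (x, y) * indicator A y \<partial>\<mu>) = indicator A y * (\<integral>\<^sup>+ x. ennreal (w (I x) (I y) / (m (I x) * n (I y))) \<partial>\<mu>)"
        unfolding W_def by (subst nn_integral_cmult[symmetric]) (auto simp: mult.commute)
      then show "(\<integral>\<^sup>+ x. W (x, y) * indicator A y \<partial>\<mu>) = indicator A y * (\<Sum>i. ennreal (w i (I y) / (m i * n (I y))) * ennreal (m i))"
        by (subst (asm) nn_integral_index[where G="\<lambda>i. ennreal (w i (I y) / (m i * n (I y)))"]) (auto simp: emM)
    qed
    also have "\<dots> = (\<integral>\<^sup>+ y. indicator A y \<partial>\<nu>)"
      using AEN by (intro nn_integral_cong_AE) (auto simp: sum2)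
    finally show "emeasure (distr \<pi> borel snd) A = emeasure \<nu> A" by simp
  qed (simp add: sN)
  have "prob_space \<pi>"
  proof
    have "emeasure \<pi> (space \<pi>) = emeasure (distr \<pi> borel fst) UNIV"
      by (subst emeasure_distr) (auto simp: sp\<pi>)
    then show "emeasure \<pi> (space \<pi>) = 1" unfolding dM using M.emeasure_space_1 by simp
  qed
  then have coup: "\<pi> \<in> couplings \<mu> \<nu>"
    unfolding couplings_def using dM dN s\<pi> by (simp add: space_prob_algebra)
  have cost: "(\<integral>\<^sup>+ z. g z \<partial>\<pi>) \<le> (\<Sum>i. \<Sum>j. ennreal (w i j) * G i j)"
    if g: "\<And>x y. g (x, y) \<le> G (I x) (I y)" for g G
  proof -
    have [measurable]: "(\<lambda>z. G (I (fst z)) (I (snd z))) \<in> borel_measurable (\<mu> \<Otimes>\<^sub>M \<nu>)" by measurable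
    have "(\<integral>\<^sup>+ z. g z \<partial>\<pi>) \<le> (\<integral>\<^sup>+ z. G (I (fst z)) (I (snd z)) \<partial>\<pi>)"
    proof (rule nn_integral_mono)
      show "g z \<le> G (I (fst z)) (I (snd z))" for z using g[of "fst z" "snd z"] by simp
    qed
    also have "\<dots> = (\<integral>\<^sup>+ z. W z * G (I (fst z)) (I (snd z)) \<partial>(\<mu> \<Otimes>\<^sub>M \<nu>))"
      unfolding \<pi>_def by (intro nn_integral_density) measurable
    also have "\<dots> = (\<integral>\<^sup>+ x. \<integral>\<^sup>+ y. W (x, y) * G (I x) (I y) \<partial>\<nu> \<partial>\<mu>)"
      by (subst N.nn_integral_fst[symmetric]) auto
    also have "\<dots> = (\<integral>\<^sup>+ x. (\<Sum>j. ennreal (w (I x) j / (m (I x) * n j)) * G (I x) j * ennreal (n j)) \<partial>\<mu>)"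
      unfolding W_def fst_conv snd_conv
      by (subst nn_integral_index[where G="\<lambda>j. ennreal (w (I x) j / (m (I x) * n j)) * G (I x) j" for x]) (auto simp: emN)
    also have "\<dots> = (\<Sum>i. (\<Sum>j. ennreal (w i j / (m i * n j)) * G i j * ennreal (n j)) * ennreal (m i))"
      by (subst nn_integral_index[where G="\<lambda>i. \<Sum>j. ennreal (w i j / (m i * n j)) * G i j * ennreal (n j)"]) (auto simp: emM)
    also have "\<dots> = (\<Sum>i. \<Sum>j. ennreal (w i j) * G i j)"
    proof (rule suminf_cong)
      fix i
      have "(\<Sum>j. ennreal (w i j / (m i * n j)) * G i j * ennreal (n j)) * ennreal (m i)
        = (\<Sum>j. (ennreal (w i j / (m i * n j)) * ennreal (m i) * ennreal (n j)) * G i j)"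
        by (subst ennreal_suminf_multc[symmetric]) (simp add: mult_ac)
      then show "(\<Sum>j. ennreal (w i j / (m i * n j)) * G i j * ennreal (n j)) * ennreal (m i) = (\<Sum>j. ennreal (w i j) * G i j)"
        unfolding q .
    qed
    finally show ?thesis .
  qed
  from coup cost show ?thesis by (rule that)
qed

text \<open>A point gets the least index of a dense sequence within distance
  \<open>\<epsilon> / 2\<close>; points with equal index share that neighbour.\<close>

lemma ex_small_partition:
  fixes \<epsilon> :: real
  assumes "0 < \<epsilon>"
  obtains I :: "'a::{metric_space, second_countable_topology} \<Rightarrow> nat"
    where "I \<in> borel \<rightarrow>\<^sub>M count_space UNIV" "\<And>x y. I x = I y \<Longrightarrow> dist x y < \<epsilon>"
proof -
  obtain D :: "'a set" where D: "countable D" "\<And>X. open X \<Longrightarrow> X \<noteq> {} \<Longrightarrow> \<exists>d\<in>D. d \<in> X"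
    using countable_dense_setE by blast
  have "D \<noteq> {}" using D(2)[of UNIV] by auto
  define d where "d = from_nat_into D"
  have dD: "range d = D" unfolding d_def using \<open>D \<noteq> {}\<close> D(1) by (rule range_from_nat_into)
  have ex: "\<exists>n. dist x (d n) < \<epsilon> / 2" for x
  proof -
    obtain z where "z \<in> D" "z \<in> ball x (\<epsilon> / 2)" using D(2)[of "ball x (\<epsilon> / 2)"] assms by auto
    then show ?thesis using dD by auto
  qed
  define I where "I x = (LEAST n. dist x (d n) < \<epsilon> / 2)" for x
  have [measurable]: "(\<lambda>x. dist x (d n)) \<in> borel_measurable borel" for n
    by (intro borel_measurable_continuous_onI continuous_intros)
  have "I \<in> borel \<rightarrow>\<^sub>M count_space UNIV" unfolding I_def[abs_def] by measurable
  moreover have "dist x y < \<epsilon>" if "I x = I y" for x y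
  proof -
    have "dist x (d (I x)) < \<epsilon> / 2" "dist y (d (I y)) < \<epsilon> / 2"
      unfolding I_def using ex by (auto intro: LeastI_ex)
    then show ?thesis using that dist_triangle_half_l[of x "d (I x)" \<epsilon> y] by (simp add: dist_commute)
  qed
  ultimately show ?thesis by (rule that)
qed

lemma integrable_bounded_range:
  fixes f :: "'a::topological_space \<Rightarrow> real"
  assumes "\<mu> \<in> borel_probs" "f \<in> borel_measurable borel" "bounded (range f)"
  shows "integrable \<mu> f"
proof -
  obtain B where "\<forall>x. \<bar>f x\<bar> \<le> B" using assms(3) unfolding bounded_iff by auto
  then show ?thesis by (rule integrable_borel_prob[OF assms(1,2)])
qed

text \<open>Applying Hahn--Banach to the optimal value of the dual problem yields a finitely additive
  optimal coupling \<open>L\<close>; the discretisation in the next lemmas makes it countably additive.\<close>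

lemma dual_functional:
  fixes \<mu> \<nu> :: "'a::topological_space measure" and c :: "'a \<times> 'a \<Rightarrow> real"
  assumes \<mu>: "\<mu> \<in> borel_probs" and \<nu>: "\<nu> \<in> borel_probs" and c0: "\<And>z. 0 \<le> c z"
    and dual: "\<And>\<phi> \<psi>. \<phi> \<in> borel_measurable borel \<Longrightarrow> \<psi> \<in> borel_measurable borel \<Longrightarrow>
      bounded (range \<phi>) \<Longrightarrow> bounded (range \<psi>) \<Longrightarrow> (\<And>x y. \<phi> x + \<psi> y \<le> c (x, y)) \<Longrightarrow>
      (\<integral>x. \<phi> x \<partial>\<mu>) + (\<integral>y. \<psi> y \<partial>\<nu>) \<le> K"
    and V: "V = {h. \<exists>B s. 0 \<le> s \<and> (\<forall>z. \<bar>h z\<bar> \<le> B + s * c z)}"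
  obtains L where
    "\<And>f g. f \<in> V \<Longrightarrow> g \<in> V \<Longrightarrow> L (\<lambda>x. f x + g x) = L f + L g"
    "\<And>f c. f \<in> V \<Longrightarrow> L (\<lambda>x. c * f x) = c * L f"
    "\<And>h \<phi> \<psi> s. h \<in> V \<Longrightarrow> \<phi> \<in> borel_measurable borel \<Longrightarrow> \<psi> \<in> borel_measurable borel \<Longrightarrow>
      bounded (range \<phi>) \<Longrightarrow> bounded (range \<psi>) \<Longrightarrow> 0 \<le> s \<Longrightarrow>
      (\<And>x y. h (x, y) \<le> \<phi> x + \<psi> y + s * c (x, y)) \<Longrightarrow>
      L h \<le> (\<integral>x. \<phi> x \<partial>\<mu>) + (\<integral>y. \<psi> y \<partial>\<nu>) + s * K"
proof -
  interpret M: prob_space \<mu> using borel_probsD[OF \<mu>] by simp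
  \<comment> \<open>Prices of majorants of \<open>h\<close>: functions of one variable are priced by
    their integrals and the cost by \<open>K\<close>. The infimum of the prices is the sublinear
    functional, so a dominated linear functional has the right marginals and value at most
    \<open>K\<close> on \<open>c\<close>.\<close>
  define D where "D h = {(\<integral>x. \<phi> x \<partial>\<mu>) + (\<integral>y. \<psi> y \<partial>\<nu>) + s * K | \<phi> \<psi> s.
    \<phi> \<in> borel_measurable borel \<and> \<psi> \<in> borel_measurable borel \<and> bounded (range \<phi>) \<and> bounded (range \<psi>) \<and>
    0 \<le> s \<and> (\<forall>x y. h (x, y) \<le> \<phi> x + \<psi> y + s * c (x, y))}" for h
  have DI: "(\<integral>x. \<phi> x \<partial>\<mu>) + (\<integral>y. \<psi> y \<partial>\<nu>) + s * K \<in> D h"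
    if "\<phi> \<in> borel_measurable borel" "\<psi> \<in> borel_measurable borel" "bounded (range \<phi>)" "bounded (range \<psi>)"
      "0 \<le> s" "\<And>x y. h (x, y) \<le> \<phi> x + \<psi> y + s * c (x, y)" for \<phi> \<psi> s h
    unfolding D_def using that by blast
  have sc: "bounded (range (\<lambda>x. k * f x))" if "bounded (range f)" for k :: real and f :: "'a \<Rightarrow> real"
    using bounded_scaling[OF that, of k] by (simp add: image_image)
  \<comment> \<open>The bound \<open>dual\<close> enters here, for the pair scaled by
    \<open>- 1 / t\<close>. As \<open>s\<close> may be \<open>0\<close>, some \<open>t > s\<close>
    is used and then sent to \<open>s\<close>.\<close>
  have nonneg: "0 \<le> (\<integral>x. \<phi> x \<partial>\<mu>) + (\<integral>y. \<psi> y \<partial>\<nu>) + s * K"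
    if m: "\<phi> \<in> borel_measurable borel" "\<psi> \<in> borel_measurable borel" and b: "bounded (range \<phi>)" "bounded (range \<psi>)"
      and s: "0 \<le> s" and le: "\<And>x y. 0 \<le> \<phi> x + \<psi> y + s * c (x, y)" for \<phi> \<psi> s
  proof -
    have pos: "0 \<le> (\<integral>x. \<phi> x \<partial>\<mu>) + (\<integral>y. \<psi> y \<partial>\<nu>) + t * K" if t: "s < t" for t
    proof -
      have t0: "0 < t" using s t by simp
      have "(\<integral>x. (- 1 / t) * \<phi> x \<partial>\<mu>) + (\<integral>y. (- 1 / t) * \<psi> y \<partial>\<nu>) \<le> K"
      proof (rule dual)
        fix x y
        have "0 \<le> \<phi> x + \<psi> y + t * c (x, y)"
          using le[of x y] mult_right_mono[of s t "c (x, y)"] t c0[of "(x, y)"] by simp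
        then show "(- 1 / t) * \<phi> x + (- 1 / t) * \<psi> y \<le> c (x, y)" using t0 by (simp add: field_simps)
      qed (use m b in \<open>auto intro!: sc simp del: times_divide_eq_left mult_minus_left\<close>)
      then show ?thesis using t0 by (simp add: field_simps)
    qed
    have "((\<lambda>t. (\<integral>x. \<phi> x \<partial>\<mu>) + (\<integral>y. \<psi> y \<partial>\<nu>) + t * K) \<longlongrightarrow> (\<integral>x. \<phi> x \<partial>\<mu>) + (\<integral>y. \<psi> y \<partial>\<nu>) + s * K) (at_right s)"
      by (intro tendsto_intros)
    then show ?thesis
      using pos by (rule tendsto_lowerbound[OF _ eventually_at_rightI[of s "s + 1"]]) auto
  qed
  interpret function_space V
  proof
    fix f g assume "f \<in> V" "g \<in> V"
    then obtain B s B' s' where *: "0 \<le> s" "0 \<le> s'" "\<And>z. \<bar>f z\<bar> \<le> B + s * c z" "\<And>z. \<bar>g z\<bar> \<le> B' + s' * c z"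
      unfolding V by blast
    have "\<bar>f z + g z\<bar> \<le> (B + B') + (s + s') * c z" for z
      using *(3)[of z] *(4)[of z] by (simp add: algebra_simps)
    then show "(\<lambda>x. f x + g x) \<in> V" unfolding V using *(1,2) by (intro CollectI exI[of _ "B + B'"] exI[of _ "s + s'"]) simp
  next
    fix f and k :: real assume "f \<in> V"
    then obtain B s where *: "0 \<le> s" "\<And>z. \<bar>f z\<bar> \<le> B + s * c z" unfolding V by blast
    have "\<bar>k * f z\<bar> \<le> \<bar>k\<bar> * B + (\<bar>k\<bar> * s) * c z" for z
      using mult_left_mono[OF *(2)[of z], of "\<bar>k\<bar>"] by (simp add: abs_mult algebra_simps)
    then show "(\<lambda>x. k * f x) \<in> V" unfolding V using *(1) by (intro CollectI exI[of _ "\<bar>k\<bar> * B"] exI[of _ "\<bar>k\<bar> * s"]) simp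
  qed
  have Dne: "D h \<noteq> {}" if "h \<in> V" for h
  proof -
    obtain B s where *: "0 \<le> s" "\<And>z. \<bar>h z\<bar> \<le> B + s * c z" using \<open>h \<in> V\<close> unfolding V by blast
    have "(\<integral>x. B \<partial>\<mu>) + (\<integral>y. 0 \<partial>\<nu>) + s * K \<in> D h"
    proof (rule DI)
      show "h (x, y) \<le> B + 0 + s * c (x, y)" for x y using *(2)[of "(x, y)"] by simp
    qed (use * in \<open>auto simp: bounded_iff\<close>)
    then show ?thesis by blast
  qed
  have Dbdd: "bdd_below (D h)" if h: "h \<in> V" for h
  proof -
    obtain B s where *: "0 \<le> s" "\<And>z. \<bar>h z\<bar> \<le> B + s * c z" using \<open>h \<in> V\<close> unfolding V by blast
    show ?thesis
    proof (rule bdd_belowI)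
      fix v assume "v \<in> D h"
      then obtain \<phi> \<psi> s' where v: "v = (\<integral>x. \<phi> x \<partial>\<mu>) + (\<integral>y. \<psi> y \<partial>\<nu>) + s' * K"
        "\<phi> \<in> borel_measurable borel" "\<psi> \<in> borel_measurable borel" "bounded (range \<phi>)" "bounded (range \<psi>)"
        "0 \<le> s'" "\<And>x y. h (x, y) \<le> \<phi> x + \<psi> y + s' * c (x, y)"
        unfolding D_def by blast
      have "0 \<le> (\<integral>x. (\<phi> x + B) \<partial>\<mu>) + (\<integral>y. \<psi> y \<partial>\<nu>) + (s' + s) * K"
      proof (rule nonneg)
        show "bounded (range (\<lambda>x. \<phi> x + B))"
          using bounded_translation[OF v(4), of B] by (simp add: image_image add.commute)
        show "0 \<le> \<phi> x + B + \<psi> y + (s' + s) * c (x, y)" for x y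
          using v(7)[of x y] *(2)[of "(x, y)"] by (simp add: algebra_simps)
      qed (use v * in auto)
      then show "- B - s * K \<le> v"
        using v(1) integrable_bounded_range[OF \<mu> v(2,4)] by (simp add: algebra_simps M.prob_space)
    qed
  qed
  define q where "q h = Inf (D h)" for h
  have q_le: "q h \<le> v" if "h \<in> V" "v \<in> D h" for h v
    unfolding q_def using that Dbdd by (auto intro: cInf_lower)
  have q_ge: "b \<le> q h" if "h \<in> V" "\<And>v. v \<in> D h \<Longrightarrow> b \<le> v" for h b
    unfolding q_def using that Dne by (auto intro: cInf_greatest)
  have "sublinear q" unfolding sublinear_def
  proof (intro conjI ballI allI impI)
    fix f g assume fg: "f \<in> V" "g \<in> V"
    have le: "q (\<lambda>x. f x + g x) \<le> v + v'" if vD: "v \<in> D f" "v' \<in> D g" for v v'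
    proof -
      obtain \<phi> \<psi> s where v: "v = (\<integral>x. \<phi> x \<partial>\<mu>) + (\<integral>y. \<psi> y \<partial>\<nu>) + s * K"
        "\<phi> \<in> borel_measurable borel" "\<psi> \<in> borel_measurable borel" "bounded (range \<phi>)" "bounded (range \<psi>)"
        "0 \<le> s" "\<And>x y. f (x, y) \<le> \<phi> x + \<psi> y + s * c (x, y)"
        using vD(1) unfolding D_def by blast
      obtain \<phi>' \<psi>' s' where v': "v' = (\<integral>x. \<phi>' x \<partial>\<mu>) + (\<integral>y. \<psi>' y \<partial>\<nu>) + s' * K"
        "\<phi>' \<in> borel_measurable borel" "\<psi>' \<in> borel_measurable borel" "bounded (range \<phi>')" "bounded (range \<psi>')"
        "0 \<le> s'" "\<And>x y. g (x, y) \<le> \<phi>' x + \<psi>' y + s' * c (x, y)"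
        using vD(2) unfolding D_def by blast
      have "(\<integral>x. \<phi> x + \<phi>' x \<partial>\<mu>) + (\<integral>y. \<psi> y + \<psi>' y \<partial>\<nu>) + (s + s') * K \<in> D (\<lambda>x. f x + g x)"
      proof (rule DI)
        show "f (x, y) + g (x, y) \<le> \<phi> x + \<phi>' x + (\<psi> y + \<psi>' y) + (s + s') * c (x, y)" for x y
          using v(7)[of x y] v'(7)[of x y] by (simp add: algebra_simps)
      qed (use v v' in \<open>auto intro: bounded_plus_comp\<close>)
      then have "q (\<lambda>x. f x + g x) \<le> (\<integral>x. \<phi> x + \<phi>' x \<partial>\<mu>) + (\<integral>y. \<psi> y + \<psi>' y \<partial>\<nu>) + (s + s') * K"
        using fg by (intro q_le add_closed)
      also have "\<dots> = v + v'"
        unfolding v(1) v'(1)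
        using integrable_bounded_range[OF \<mu> v(2,4)] integrable_bounded_range[OF \<nu> v(3,5)]
          integrable_bounded_range[OF \<mu> v'(2,4)] integrable_bounded_range[OF \<nu> v'(3,5)]
        by (simp add: algebra_simps)
      finally show ?thesis .
    qed
    have "q (\<lambda>x. f x + g x) - v' \<le> q f" if "v' \<in> D g" for v'
      using le[OF _ that] fg by (intro q_ge) (auto simp: algebra_simps)
    then have "q (\<lambda>x. f x + g x) - q f \<le> q g"
      using fg by (intro q_ge) (auto simp: algebra_simps)
    then show "q (\<lambda>x. f x + g x) \<le> q f + q g" by simp
  next
    fix f and k :: real assume f: "f \<in> V" and k: "0 \<le> k"
    have le: "q (\<lambda>x. k * f x) \<le> k * q f" if f: "f \<in> V" and k: "0 < k" for f k
    proof -
      have "q (\<lambda>x. k * f x) / k \<le> q f"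
      proof (rule q_ge[OF f])
        fix v assume "v \<in> D f"
        then obtain \<phi> \<psi> s where v: "v = (\<integral>x. \<phi> x \<partial>\<mu>) + (\<integral>y. \<psi> y \<partial>\<nu>) + s * K"
          "\<phi> \<in> borel_measurable borel" "\<psi> \<in> borel_measurable borel" "bounded (range \<phi>)" "bounded (range \<psi>)"
          "0 \<le> s" "\<And>x y. f (x, y) \<le> \<phi> x + \<psi> y + s * c (x, y)"
          unfolding D_def by blast
        have "(\<integral>x. k * \<phi> x \<partial>\<mu>) + (\<integral>y. k * \<psi> y \<partial>\<nu>) + (k * s) * K \<in> D (\<lambda>x. k * f x)"
        proof (rule DI)
          show "k * f (x, y) \<le> k * \<phi> x + k * \<psi> y + k * s * c (x, y)" for x y
            using mult_left_mono[OF v(7)[of x y], of k] k by (simp add: algebra_simps)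
        qed (use v k in \<open>auto intro: sc\<close>)
        then have "q (\<lambda>x. k * f x) \<le> (\<integral>x. k * \<phi> x \<partial>\<mu>) + (\<integral>y. k * \<psi> y \<partial>\<nu>) + (k * s) * K"
          using f by (intro q_le scale_closed)
        also have "\<dots> = k * v" unfolding v(1) by (simp add: algebra_simps)
        finally show "q (\<lambda>x. k * f x) / k \<le> v" using k by (simp add: divide_le_eq mult.commute)
      qed
      then show ?thesis using k by (simp add: divide_le_eq mult.commute)
    qed
    show "q (\<lambda>x. k * f x) = k * q f"
    proof (cases "k = 0")
      case True
      have z: "(\<lambda>x. 0) \<in> V" using scale_closed[OF f, of 0] by simp
      have "(\<integral>x. 0 \<partial>\<mu>) + (\<integral>y. 0 \<partial>\<nu>) + 0 * K \<in> D (\<lambda>x. 0)" by (rule DI) auto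
      then have "q (\<lambda>x. 0) \<le> 0" using q_le[OF z] by fastforce
      moreover have "0 \<le> q (\<lambda>x. 0)"
      proof (rule q_ge[OF z])
        fix v assume "v \<in> D (\<lambda>x. 0)"
        then show "0 \<le> v" unfolding D_def using nonneg by blast
      qed
      ultimately show ?thesis using True by simp
    next
      case False
      then have k: "0 < k" using k by simp
      have "q (\<lambda>x. (1 / k) * (k * f x)) \<le> 1 / k * q (\<lambda>x. k * f x)"
        using k f by (intro le scale_closed) auto
      then have "k * q f \<le> q (\<lambda>x. k * f x)" using k by (simp add: field_simps)
      then show ?thesis using le[OF f k] by simp
    qed
  qed
  then obtain L where L: "\<And>f. f \<in> V \<Longrightarrow> L f \<le> q f"
    "\<And>f g. f \<in> V \<Longrightarrow> g \<in> V \<Longrightarrow> L (\<lambda>x. f x + g x) = L f + L g"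
    "\<And>f c. f \<in> V \<Longrightarrow> L (\<lambda>x. c * f x) = c * L f"
    using Hahn_Banach_sublinear by blast
  show ?thesis
  proof (rule that[OF L(2,3)])
    fix h \<phi> \<psi> s
    assume *: "h \<in> V" "\<phi> \<in> borel_measurable borel" "\<psi> \<in> borel_measurable borel"
      "bounded (range \<phi>)" "bounded (range \<psi>)" "0 \<le> s"
      "\<And>x y. h (x, y) \<le> \<phi> x + \<psi> y + s * c (x, y)"
    show "L h \<le> (\<integral>x. \<phi> x \<partial>\<mu>) + (\<integral>y. \<psi> y \<partial>\<nu>) + s * K"
      using L(1)[OF *(1)] q_le[OF *(1) DI[OF *(2-7)]] by linarith
  qed
qed

lemma suminf_suminf_ennreal_le:
  fixes f :: "nat \<Rightarrow> nat \<Rightarrow> ennreal"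
  assumes "\<And>m n. (\<Sum>i<m. \<Sum>j<n. f i j) \<le> K"
  shows "(\<Sum>i. \<Sum>j. f i j) \<le> K"
proof (rule suminf_le_const)
  fix m
  have "(\<Sum>i<m. \<Sum>j. f i j) = (\<Sum>j. \<Sum>i<m. f i j)" by (intro suminf_sum[symmetric] summableI)
  also have "\<dots> \<le> K"
  proof (rule suminf_le_const[OF summableI])
    show "(\<Sum>j<n. \<Sum>i<m. f i j) \<le> K" for n
      using assms[of n m] sum.swap[where g=f and A="{..<m}" and B="{..<n}"] by simp
  qed
  finally show "(\<Sum>i<m. \<Sum>j. f i j) \<le> K" .
qed (rule summableI)

text \<open>\<open>L\<close> may fail to be countably additive, but its values on products of cells
  form a matrix whose row and column sums are the masses of the cells, since its marginals are
  genuine measures. \<open>coupling_from_discrete\<close> turns the matrix into a coupling, and the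
  gap between \<open>K\<close> and \<open>K'\<close> pays for the mesh of the partition.\<close>

theorem Kantorovich_duality:
  fixes \<mu> \<nu> :: "'a::{metric_space, second_countable_topology} measure"
  assumes \<mu>: "\<mu> \<in> borel_probs" and \<nu>: "\<nu> \<in> borel_probs" and p: "1 \<le> p"
    and dual: "\<And>\<phi> \<psi>. \<phi> \<in> borel_measurable borel \<Longrightarrow> \<psi> \<in> borel_measurable borel \<Longrightarrow>
      bounded (range \<phi>) \<Longrightarrow> bounded (range \<psi>) \<Longrightarrow> (\<And>x y. \<phi> x + \<psi> y \<le> dist x y powr p) \<Longrightarrow>
      (\<integral>x. \<phi> x \<partial>\<mu>) + (\<integral>y. \<psi> y \<partial>\<nu>) \<le> K"
    and K': "K < K'"
  obtains \<pi> where "\<pi> \<in> couplings \<mu> \<nu>" "(\<integral>\<^sup>+ z. ennreal (dist (fst z) (snd z) powr p) \<partial>\<pi>) \<le> ennreal K'"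
proof -
  interpret M: prob_space \<mu> using borel_probsD[OF \<mu>] by simp
  interpret N: prob_space \<nu> using borel_probsD[OF \<nu>] by simp
  note sM [measurable_cong] = borel_probsD(2)[OF \<mu>] and sN [measurable_cong] = borel_probsD(2)[OF \<nu>]
  define c where "c z = dist (fst z) (snd z) powr p" for z :: "'a \<times> 'a"
  have c0: "0 \<le> c z" for z unfolding c_def by simp
  \<comment> \<open>Growth up to a multiple of \<open>c\<close> is allowed because \<open>L\<close>
    has to be evaluated at the possibly unbounded cost.\<close>
  define V where "V = {h. \<exists>B s. 0 \<le> s \<and> (\<forall>z. \<bar>h z\<bar> \<le> B + s * c z)}"
  obtain L where Ladd: "\<And>f g. f \<in> V \<Longrightarrow> g \<in> V \<Longrightarrow> L (\<lambda>x. f x + g x) = L f + L g"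
    and Lscale: "\<And>f c. f \<in> V \<Longrightarrow> L (\<lambda>x. c * f x) = c * L f"
    and Lle: "\<And>h \<phi> \<psi> s. h \<in> V \<Longrightarrow> \<phi> \<in> borel_measurable borel \<Longrightarrow> \<psi> \<in> borel_measurable borel \<Longrightarrow>
      bounded (range \<phi>) \<Longrightarrow> bounded (range \<psi>) \<Longrightarrow> 0 \<le> s \<Longrightarrow>
      (\<And>x y. h (x, y) \<le> \<phi> x + \<psi> y + s * c (x, y)) \<Longrightarrow>
      L h \<le> (\<integral>x. \<phi> x \<partial>\<mu>) + (\<integral>y. \<psi> y \<partial>\<nu>) + s * K"
    by (rule dual_functional[OF \<mu> \<nu> c0 _ V_def, of K]) (use dual in \<open>auto simp: c_def\<close>)
  have VI: "h \<in> V" if "\<And>z. \<bar>h z\<bar> \<le> B + s * c z" "0 \<le> s" for h B s unfolding V_def using that by blast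
  have Vbounded: "h \<in> V" if "\<And>z. \<bar>h z\<bar> \<le> B" for h B using VI[of h B 0] that by simp
  have Vsum: "(\<lambda>z. \<Sum>a\<in>A. f a z) \<in> V" if "finite A" "\<And>a. a \<in> A \<Longrightarrow> f a \<in> V" for A and f :: "'b \<Rightarrow> 'a \<times> 'a \<Rightarrow> real"
    using that
  proof (induction A rule: finite_induct)
    case empty
    then show ?case by (intro Vbounded[of _ 0]) simp
  next
    case (insert a A)
    then obtain B s B' s' where *: "0 \<le> s" "0 \<le> s'" "\<And>z. \<bar>f a z\<bar> \<le> B + s * c z" "\<And>z. \<bar>\<Sum>a\<in>A. f a z\<bar> \<le> B' + s' * c z"
      unfolding V_def by blast
    have "\<bar>f a z + (\<Sum>a\<in>A. f a z)\<bar> \<le> (B + B') + (s + s') * c z" for z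
      using *(3)[of z] *(4)[of z] by (simp add: algebra_simps)
    then show ?case using *(1,2) insert.hyps by (intro VI[of _ "B + B'" "s + s'"]) auto
  qed
  have Lsum: "L (\<lambda>z. \<Sum>a\<in>A. f a z) = (\<Sum>a\<in>A. L (f a))" if "finite A" "\<And>a. a \<in> A \<Longrightarrow> f a \<in> V" for A and f :: "'b \<Rightarrow> 'a \<times> 'a \<Rightarrow> real"
    using that
  proof (induction A rule: finite_induct)
    case empty
    show ?case using Lscale[OF Vbounded[of "\<lambda>_. 0" 0], of 0] by simp
  next
    case (insert a A)
    then show ?case by (simp add: Ladd Vsum)
  qed
  have Lneg: "L h \<le> 0" if "h \<in> V" "\<And>z. h z \<le> 0" for h
    using Lle[OF that(1), of "\<lambda>_. 0" "\<lambda>_. 0" 0] that(2) by simp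
  have Lmono: "L h \<le> L h'" if "h \<in> V" "h' \<in> V" "\<And>z. h z \<le> h' z" for h h'
  proof -
    have n: "(\<lambda>z. - 1 * h' z) \<in> V" using that(2) unfolding V_def by simp
    have "(\<lambda>z. h z + - 1 * h' z) \<in> V"
      using Vsum[of "{True, False}" "\<lambda>b. if b then h else (\<lambda>z. - 1 * h' z)"] that(1) n by simp
    then have "L (\<lambda>z. h z + - 1 * h' z) \<le> 0" using that(3) by (intro Lneg) auto
    then show ?thesis using Ladd[OF that(1) n] Lscale[OF that(2), of "- 1"] by simp
  qed
  have Lc: "L c \<le> K"
    using Lle[OF VI[of c 0 1], of "\<lambda>_. 0" "\<lambda>_. 0" 1] c0 by simp
  have Lfst: "L (\<lambda>z. \<phi> (fst z)) = (\<integral>x. \<phi> x \<partial>\<mu>)" if \<phi>: "\<phi> \<in> borel_measurable borel" "bounded (range \<phi>)" for \<phi>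
  proof -
    obtain B where B: "\<And>x. \<bar>\<phi> x\<bar> \<le> B" using \<phi>(2) unfolding bounded_iff by auto
    have v: "(\<lambda>z. \<phi> (fst z)) \<in> V" "(\<lambda>z. - 1 * \<phi> (fst z)) \<in> V" using B by (auto intro!: Vbounded[of _ B])
    have "bounded (range (\<lambda>x. - 1 * \<phi> x))" using B unfolding bounded_iff by auto
    then have "L (\<lambda>z. - 1 * \<phi> (fst z)) \<le> - (\<integral>x. \<phi> x \<partial>\<mu>)"
      using Lle[OF v(2), of "\<lambda>x. - 1 * \<phi> x" "\<lambda>_. 0" 0] \<phi> by simp
    moreover have "L (\<lambda>z. \<phi> (fst z)) \<le> (\<integral>x. \<phi> x \<partial>\<mu>)"
      using Lle[OF v(1), of \<phi> "\<lambda>_. 0" 0] \<phi> by simp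
    ultimately show ?thesis using Lscale[OF v(1), of "- 1"] by simp
  qed
  have Lsnd: "L (\<lambda>z. \<psi> (snd z)) = (\<integral>x. \<psi> x \<partial>\<nu>)" if \<psi>: "\<psi> \<in> borel_measurable borel" "bounded (range \<psi>)" for \<psi>
  proof -
    obtain B where B: "\<And>x. \<bar>\<psi> x\<bar> \<le> B" using \<psi>(2) unfolding bounded_iff by auto
    have v: "(\<lambda>z. \<psi> (snd z)) \<in> V" "(\<lambda>z. - 1 * \<psi> (snd z)) \<in> V" using B by (auto intro!: Vbounded[of _ B])
    have "bounded (range (\<lambda>x. - 1 * \<psi> x))" using B unfolding bounded_iff by auto
    then have "L (\<lambda>z. - 1 * \<psi> (snd z)) \<le> - (\<integral>x. \<psi> x \<partial>\<nu>)"
      using Lle[OF v(2), of "\<lambda>_. 0" "\<lambda>x. - 1 * \<psi> x" 0] \<psi> by simp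
    moreover have "L (\<lambda>z. \<psi> (snd z)) \<le> (\<integral>x. \<psi> x \<partial>\<nu>)"
      using Lle[OF v(1), of "\<lambda>_. 0" \<psi> 0] \<psi> by simp
    ultimately show ?thesis using Lscale[OF v(1), of "- 1"] by simp
  qed
  \<comment> \<open>Constants for \<open>powr_add_le_weighted\<close>: the weight
    \<open>l < 1\<close> is fixed so close to \<open>1\<close> that
    \<open>l powr (1 - p) * K < K'\<close>; the mesh \<open>r\<close> is then chosen so small that
    \<open>b * r powr p\<close> fits into the remaining gap.\<close>
  have "((\<lambda>l. l powr (1 - p) * K) \<longlongrightarrow> 1 powr (1 - p) * K) (at_left 1)"
    by (intro tendsto_intros) auto
  then have "eventually (\<lambda>l. l powr (1 - p) * K < K') (at_left 1)"
    using K' by (intro order_tendstoD(2)) auto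
  moreover have "eventually (\<lambda>l. l \<in> {0<..<1::real}) (at_left 1)"
    by (rule eventually_at_left_real) simp
  ultimately have "eventually (\<lambda>l. l powr (1 - p) * K < K' \<and> l \<in> {0<..<1}) (at_left 1)"
    by (rule eventually_conj)
  then obtain l where l: "l powr (1 - p) * K < K'" "0 < l" "l < 1"
    using eventually_happens'[OF trivial_limit_at_left_real] by fastforce
  define b where "b = (1 - l) powr (1 - p)"
  have b: "0 \<le> b" unfolding b_def by simp
  have "((\<lambda>r::real. r powr p) \<longlongrightarrow> 0 powr p) (at_right 0)"
    using p by (intro tendsto_powr'[OF _ tendsto_const] tendsto_ident_at)
      (auto simp: eventually_at_filter intro!: always_eventually)
  then have "((\<lambda>r. l powr (1 - p) * K + b * r powr p) \<longlongrightarrow> l powr (1 - p) * K + b * 0 powr p) (at_right 0)"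
    by (intro tendsto_add[OF tendsto_const] tendsto_mult_left)
  then have "eventually (\<lambda>r. l powr (1 - p) * K + b * r powr p < K') (at_right 0)"
    by (rule order_tendstoD) (use l p in simp)
  then obtain r where r: "0 < r" "l powr (1 - p) * K + b * r powr p < K'"
    unfolding eventually_at_right_field using dense by blast
  obtain I :: "'a \<Rightarrow> nat" where I: "I \<in> borel \<rightarrow>\<^sub>M count_space UNIV" "\<And>x y. I x = I y \<Longrightarrow> dist x y < r / 2"
    using ex_small_partition[of "r / 2"] r by auto
  note [measurable] = I(1)
  have cell [measurable]: "I -` J \<in> sets borel" for J using measurable_sets[OF I(1), of J] by simp
  define e where "e i j = (\<lambda>z. indicator {z. I (fst z) = i \<and> I (snd z) = j} z :: real)" for i j
  have eV: "e i j \<in> V" for i j by (intro Vbounded[of _ 1]) (auto simp: e_def indicator_def)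
  define w where "w i j = L (e i j)" for i j
  have w0: "0 \<le> w i j" for i j
    using Lmono[of "\<lambda>_. 0" "e i j"] Lscale[OF eV[of i j], of 0] Vbounded[of "\<lambda>_. 0" 0] eV
    unfolding w_def by (simp add: e_def)
  have row: "(\<lambda>j. w i j) sums measure \<mu> (I -` {i})" for i
  proof -
    define R where "R m z = (indicator {z. I (fst z) = i \<and> m \<le> I (snd z)} z :: real)" for m z
    have RV: "R m \<in> V" for m by (intro Vbounded[of _ 1]) (auto simp: R_def indicator_def)
    have split: "(\<Sum>j<m. w i j) = measure \<mu> (I -` {i}) - L (R m)" for m
    proof -
      have "(\<lambda>z. (\<Sum>j<m. e i j z) + R m z) = (\<lambda>z. indicator (I -` {i}) (fst z))"
      proof
        fix z
        have "(\<Sum>j<m. e i j z) = (\<Sum>j<m. if j = I (snd z) then indicator {i} (I (fst z)) else 0)"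
          by (intro sum.cong) (auto simp: e_def indicator_def)
        also have "\<dots> = (if I (snd z) < m then indicator {i} (I (fst z)) else 0)" by (simp add: sum.delta)
        finally show "(\<Sum>j<m. e i j z) + R m z = indicator (I -` {i}) (fst z)"
          by (auto simp: R_def indicator_def)
      qed
      then have "L (\<lambda>z. (\<Sum>j<m. e i j z) + R m z) = L (\<lambda>z. indicator (I -` {i}) (fst z))" by simp
      also have "\<dots> = measure \<mu> (I -` {i})"
        by (subst Lfst) (auto simp: bounded_iff indicator_def sM intro!: exI[of _ 1])
      also have "L (\<lambda>z. (\<Sum>j<m. e i j z) + R m z) = (\<Sum>j<m. w i j) + L (R m)"
        by (simp add: Ladd Vsum eV RV Lsum w_def)
      finally show ?thesis by simp
    qed
    \<comment> \<open>Mass escaping along the row is bounded by the tail of the other marginal,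
      which is countably additive.\<close>
    have Rlim: "(\<lambda>m. L (R m)) \<longlonglongrightarrow> 0"
    proof (rule tendsto_sandwich[of "\<lambda>_. 0"])
      show "eventually (\<lambda>m. 0 \<le> L (R m)) sequentially"
        using Lmono[of "\<lambda>_. 0" "R m" for m] Lscale[OF RV, of 0] Vbounded[of "\<lambda>_. 0" 0] RV
        by (simp add: R_def)
      have "L (R m) \<le> measure \<nu> (I -` {m..})" for m
      proof -
        have "L (R m) \<le> L (\<lambda>z. indicator (I -` {m..}) (snd z))"
          by (intro Lmono RV Vbounded[of _ 1]) (auto simp: R_def indicator_def)
        also have "\<dots> = measure \<nu> (I -` {m..})"
          by (subst Lsnd) (auto simp: bounded_iff indicator_def sN intro!: exI[of _ 1])
        finally show ?thesis .
      qed
      then show "eventually (\<lambda>m. L (R m) \<le> measure \<nu> (I -` {m..})) sequentially" by simp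
      have "(\<lambda>m. measure \<nu> (I -` {m..})) \<longlonglongrightarrow> measure \<nu> (\<Inter>m. I -` {m..})"
        by (intro N.finite_Lim_measure_decseq) (auto simp: decseq_def sN)
      moreover have "x \<notin> I -` {Suc (I x)..}" for x by simp
      then have "(\<Inter>m. I -` {m..}) = {}" by blast
      ultimately show "(\<lambda>m. measure \<nu> (I -` {m..})) \<longlonglongrightarrow> 0" by simp
    qed simp
    have "(\<lambda>m. measure \<mu> (I -` {i}) - L (R m)) \<longlonglongrightarrow> measure \<mu> (I -` {i}) - 0"
      by (intro tendsto_diff tendsto_const Rlim)
    then show ?thesis unfolding sums_def split by simp
  qed
  have col: "(\<lambda>i. w i j) sums measure \<nu> (I -` {j})" for j
  proof -
    define R where "R m z = (indicator {z. m \<le> I (fst z) \<and> I (snd z) = j} z :: real)" for m z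
    have RV: "R m \<in> V" for m by (intro Vbounded[of _ 1]) (auto simp: R_def indicator_def)
    have split: "(\<Sum>i<m. w i j) = measure \<nu> (I -` {j}) - L (R m)" for m
    proof -
      have "(\<lambda>z. (\<Sum>i<m. e i j z) + R m z) = (\<lambda>z. indicator (I -` {j}) (snd z))"
      proof
        fix z
        have "(\<Sum>i<m. e i j z) = (\<Sum>i<m. if i = I (fst z) then indicator {j} (I (snd z)) else 0)"
          by (intro sum.cong) (auto simp: e_def indicator_def)
        also have "\<dots> = (if I (fst z) < m then indicator {j} (I (snd z)) else 0)" by (simp add: sum.delta)
        finally show "(\<Sum>i<m. e i j z) + R m z = indicator (I -` {j}) (snd z)"
          by (auto simp: R_def indicator_def)
      qed
      then have "L (\<lambda>z. (\<Sum>i<m. e i j z) + R m z) = L (\<lambda>z. indicator (I -` {j}) (snd z))" by simp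
      also have "\<dots> = measure \<nu> (I -` {j})"
        by (subst Lsnd) (auto simp: bounded_iff indicator_def sN intro!: exI[of _ 1])
      also have "L (\<lambda>z. (\<Sum>i<m. e i j z) + R m z) = (\<Sum>i<m. w i j) + L (R m)"
        by (simp add: Ladd Vsum eV RV Lsum w_def)
      finally show ?thesis by simp
    qed
    have Rlim: "(\<lambda>m. L (R m)) \<longlonglongrightarrow> 0"
    proof (rule tendsto_sandwich[of "\<lambda>_. 0"])
      show "eventually (\<lambda>m. 0 \<le> L (R m)) sequentially"
        using Lmono[of "\<lambda>_. 0" "R m" for m] Lscale[OF RV, of 0] Vbounded[of "\<lambda>_. 0" 0] RV
        by (simp add: R_def)
      have "L (R m) \<le> measure \<mu> (I -` {m..})" for m
      proof -
        have "L (R m) \<le> L (\<lambda>z. indicator (I -` {m..}) (fst z))"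
          by (intro Lmono RV Vbounded[of _ 1]) (auto simp: R_def indicator_def)
        also have "\<dots> = measure \<mu> (I -` {m..})"
          by (subst Lfst) (auto simp: bounded_iff indicator_def sM intro!: exI[of _ 1])
        finally show ?thesis .
      qed
      then show "eventually (\<lambda>m. L (R m) \<le> measure \<mu> (I -` {m..})) sequentially" by simp
      have "(\<lambda>m. measure \<mu> (I -` {m..})) \<longlonglongrightarrow> measure \<mu> (\<Inter>m. I -` {m..})"
        by (intro M.finite_Lim_measure_decseq) (auto simp: decseq_def sM)
      moreover have "x \<notin> I -` {Suc (I x)..}" for x by simp
      then have "(\<Inter>m. I -` {m..}) = {}" by blast
      ultimately show "(\<lambda>m. measure \<mu> (I -` {m..})) \<longlonglongrightarrow> 0" by simp
    qed simp
    have "(\<lambda>m. measure \<nu> (I -` {j}) - L (R m)) \<longlonglongrightarrow> measure \<nu> (I -` {j}) - 0"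
      by (intro tendsto_diff tendsto_const Rlim)
    then show ?thesis unfolding sums_def split by simp
  qed
  obtain \<pi> where \<pi>: "\<pi> \<in> couplings \<mu> \<nu>"
    "\<And>g G. (\<And>x y. g (x, y) \<le> G (I x) (I y)) \<Longrightarrow> (\<integral>\<^sup>+ z. g z \<partial>\<pi>) \<le> (\<Sum>i. \<Sum>j. ennreal (w i j) * G i j)"
    using coupling_from_discrete[OF \<mu> \<nu> I(1) w0 row col] by blast
  \<comment> \<open>Least distance between two cells: its power lies below the cost, so it can be
    tested with \<open>L\<close>, and it falls short of the distance by at most
    \<open>r\<close>.\<close>
  define E where "E i j = (INF z\<in>{z. I (fst z) = i \<and> I (snd z) = j}. dist (fst z) (snd z))" for i j
  have E_le: "E (I x) (I y) \<le> dist x y" for x y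
  proof -
    have "E (I x) (I y) \<le> dist (fst (x, y)) (snd (x, y))"
      unfolding E_def by (intro cINF_lower bdd_belowI2[of _ 0]) auto
    then show ?thesis by simp
  qed
  have E_ge: "dist x y - r \<le> E (I x) (I y)" for x y
    unfolding E_def
  proof (rule cINF_greatest)
    fix z assume "z \<in> {z. I (fst z) = I x \<and> I (snd z) = I y}"
    then have "dist x (fst z) < r / 2" "dist (snd z) y < r / 2" using I(2) by auto
    then show "dist x y - r \<le> dist (fst z) (snd z)"
      using dist_triangle[of x y "fst z"] dist_triangle[of "fst z" y "snd z"] by linarith
  qed (auto intro: exI[of _ "(x, y)"])
  have E0: "0 \<le> E (I x) (I y)" for x y
    unfolding E_def by (rule cINF_greatest) (auto intro: exI[of _ "(x, y)"])
  define G where "G i j = l powr (1 - p) * E i j powr p + b * r powr p" for i j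
  have G0: "0 \<le> G i j" for i j unfolding G_def using b by simp
  have GI: "ennreal (dist x y powr p) \<le> ennreal (G (I x) (I y))" for x y
  proof -
    have "dist x y powr p \<le> (E (I x) (I y) + r) powr p"
      using E_ge[of x y] p by (intro powr_mono2) auto
    also have "\<dots> \<le> G (I x) (I y)" unfolding G_def b_def
      using E0[of x y] r l p by (intro powr_add_le_weighted) auto
    finally show ?thesis by (rule ennreal_leI)
  qed
  \<comment> \<open>On finite rectangles finite additivity of \<open>L\<close> suffices; the full
    double series is the supremum over such rectangles.\<close>
  have rect: "(\<Sum>i<m. \<Sum>j<n. w i j * G i j) \<le> K'" for m n
  proof -
    have cells: "(\<Sum>a\<in>{..<m} \<times> {..<n}. f (fst a) (snd a) * e (fst a) (snd a) z)
      = (if I (fst z) < m \<and> I (snd z) < n then f (I (fst z)) (I (snd z)) else 0)" for f z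
    proof -
      have "(\<Sum>a\<in>{..<m} \<times> {..<n}. f (fst a) (snd a) * e (fst a) (snd a) z)
        = (\<Sum>a\<in>{..<m} \<times> {..<n}. if a = (I (fst z), I (snd z)) then f (I (fst z)) (I (snd z)) else 0)"
        by (intro sum.cong) (auto simp: e_def indicator_def)
      also have "\<dots> = (if (I (fst z), I (snd z)) \<in> {..<m} \<times> {..<n} then f (I (fst z)) (I (snd z)) else 0)"
        by (rule sum.delta) simp
      finally show ?thesis by simp
    qed
    have fV: "(\<lambda>z. f (fst a) (snd a) * e (fst a) (snd a) z) \<in> V" for f :: "nat \<Rightarrow> nat \<Rightarrow> real" and a
      by (rule Vbounded[of _ "\<bar>f (fst a) (snd a)\<bar>"]) (auto simp: e_def indicator_def)
    have fL: "L (\<lambda>z. \<Sum>a\<in>{..<m} \<times> {..<n}. f (fst a) (snd a) * e (fst a) (snd a) z) = (\<Sum>i<m. \<Sum>j<n. w i j * f i j)" for f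
      by (subst Lsum) (auto simp: fV Lscale[OF eV] w_def sum.cartesian_product' mult.commute)
    have "(\<Sum>i<m. \<Sum>j<n. w i j * E i j powr p) \<le> L c"
      unfolding fL[of "\<lambda>i j. E i j powr p", symmetric] cells[of "\<lambda>i j. E i j powr p"]
    proof (rule Lmono)
      have le: "(if I (fst z) < m \<and> I (snd z) < n then E (I (fst z)) (I (snd z)) powr p else 0) \<le> c z" for z
        using E0 E_le p unfolding c_def by (auto intro!: powr_mono2)
      then show "(if I (fst z) < m \<and> I (snd z) < n then E (I (fst z)) (I (snd z)) powr p else 0) \<le> c z" for z .
      show "(\<lambda>z. if I (fst z) < m \<and> I (snd z) < n then E (I (fst z)) (I (snd z)) powr p else 0) \<in> V"
        using le by (intro VI[of _ 0 1]) auto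
      show "c \<in> V" using c0 by (intro VI[of _ 0 1]) auto
    qed
    also note Lc
    finally have 1: "(\<Sum>i<m. \<Sum>j<n. w i j * E i j powr p) \<le> K" .
    have "(\<Sum>i<m. \<Sum>j<n. w i j * 1) \<le> L (\<lambda>z. indicator UNIV (fst z))"
      unfolding fL[of "\<lambda>i j. 1", symmetric] cells[of "\<lambda>i j. 1"]
      by (rule Lmono) (auto intro!: Vbounded[of _ 1])
    also have "\<dots> = 1" by (subst Lfst) (auto simp: bounded_iff M.prob_space)
    finally have 2: "(\<Sum>i<m. \<Sum>j<n. w i j) \<le> 1" by simp
    have "(\<Sum>i<m. \<Sum>j<n. w i j * G i j)
      = l powr (1 - p) * (\<Sum>i<m. \<Sum>j<n. w i j * E i j powr p) + b * r powr p * (\<Sum>i<m. \<Sum>j<n. w i j)"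
      unfolding G_def by (simp add: algebra_simps sum.distrib sum_distrib_left sum_distrib_right)
    also have "\<dots> \<le> l powr (1 - p) * K + b * r powr p * 1"
      using 1 2 b by (intro add_mono mult_left_mono) auto
    finally show ?thesis using r by simp
  qed
  have "(\<integral>\<^sup>+ z. ennreal (dist (fst z) (snd z) powr p) \<partial>\<pi>) \<le> (\<Sum>i. \<Sum>j. ennreal (w i j) * ennreal (G i j))"
    by (rule \<pi>(2)) (use GI in simp)
  also have "\<dots> \<le> ennreal K'"
  proof (rule suminf_suminf_ennreal_le)
    fix m n
    have "(\<Sum>i<m. \<Sum>j<n. ennreal (w i j) * ennreal (G i j)) = ennreal (\<Sum>i<m. \<Sum>j<n. w i j * G i j)"
      by (simp add: w0 G0 sum_ennreal sum_nonneg flip: ennreal_mult')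
    also have "\<dots> \<le> ennreal K'" using rect by (rule ennreal_leI)
    finally show "(\<Sum>i<m. \<Sum>j<n. ennreal (w i j) * ennreal (G i j)) \<le> ennreal K'" .
  qed
  finally show ?thesis using \<pi>(1) that by blast
qed

section \<open>Testing the Wasserstein distance with Hopf--Lax functions\<close>

lemma ennreal_le_of_forall_gt:
  assumes "\<And>v. w < v \<Longrightarrow> x \<le> ennreal v" "0 \<le> w"
  shows "x \<le> ennreal w"
proof (rule ennreal_le_epsilon)
  fix e :: real assume "0 < e"
  then show "x \<le> ennreal w + ennreal e" using assms(1)[of "w + e"] assms(2) by simp
qed

text \<open>A merely measurable admissible pair is replaced by a better regular one. With
  \<open>g = - \<psi> / p\<close>, the bounded Lipschitz function \<open>F = - Q\<^sub>1 g\<close>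
  lies below \<open>- \<phi> / p\<close>, and \<open>Q\<^sub>1 F\<close> lies above
  \<open>\<psi> / p\<close>. The factor \<open>1 / p\<close> matches the cost normalised as in
  \<open>hopf_lax\<close>.\<close>

lemma wasserstein_le_dual:
  fixes \<mu> \<nu> :: "'a::polish_space measure"
  assumes \<mu>: "\<mu> \<in> borel_probs" and \<nu>: "\<nu> \<in> borel_probs" and p: "1 < p" and w: "0 \<le> w"
    and dual: "\<And>f. f \<in> bounded_lipschitz \<Longrightarrow>
      (\<integral>y. hopf_lax p 1 f y \<partial>\<nu>) - (\<integral>x. f x \<partial>\<mu>) \<le> w powr p / p"
  shows "wasserstein p \<mu> \<nu> \<le> ennreal w"
proof (rule ennreal_le_of_forall_gt[OF _ w])
  fix v assume v: "w < v"
  have p': "1 / p + 1 / (p / (p - 1)) = 1" using p by (simp add: field_simps)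
  have lt: "w powr p < v powr p" using v w p by (intro powr_less_mono2) auto
  obtain \<pi> where "\<pi> \<in> couplings \<mu> \<nu>" "(\<integral>\<^sup>+ z. ennreal (dist (fst z) (snd z) powr p) \<partial>\<pi>) \<le> ennreal (v powr p)"
  proof (rule Kantorovich_duality[OF \<mu> \<nu> _ _ lt])
    fix \<phi> \<psi> :: "'a \<Rightarrow> real"
    assume m: "\<phi> \<in> borel_measurable borel" "\<psi> \<in> borel_measurable borel"
      and b: "bounded (range \<phi>)" "bounded (range \<psi>)" and le: "\<And>x y. \<phi> x + \<psi> y \<le> dist x y powr p"
    obtain B where B: "\<And>y. \<bar>\<psi> y\<bar> \<le> B" using b(2) unfolding bounded_iff by auto
    define g where "g y = - \<psi> y / p" for y
    have gB: "\<forall>y. \<bar>g y\<bar> \<le> B / p" using B p by (auto simp: g_def abs_mult intro!: divide_right_mono)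
    define F where "F x = (- 1) * hopf_lax p 1 g x + 0" for x
    have FBL: "F \<in> bounded_lipschitz" unfolding F_def[abs_def]
      using hopf_lax_bounded_lipschitz[OF p p' gB, of 1] by (intro bounded_lipschitz_affine) auto
    have F_le: "F x \<le> - (\<phi> x / p)" for x
    proof -
      have "\<phi> x / p \<le> hopf_lax p 1 g x" unfolding hopf_lax_def
      proof (rule cINF_greatest)
        fix y
        show "\<phi> x / p \<le> g y + 1 / p * (dist x y / 1) powr p"
          using divide_right_mono[OF le[of x y], of p] p by (simp add: g_def add_divide_distrib)
      qed simp
      then show ?thesis unfolding F_def by simp
    qed
    obtain B' where FB: "\<forall>x. \<bar>F x\<bar> \<le> B'" using FBL by (rule bounded_lipschitzE) blast
    have QF: "\<psi> y / p \<le> hopf_lax p 1 F y" for y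
      unfolding hopf_lax_def
    proof (rule cINF_greatest)
      fix x
      show "\<psi> y / p \<le> F x + 1 / p * (dist y x / 1) powr p"
        using hopf_lax_le[OF gB, of 1 p x y] p by (simp add: F_def g_def[of y] dist_commute)
    qed simp
    have QFBL: "hopf_lax p 1 F \<in> bounded_lipschitz"
      by (rule hopf_lax_bounded_lipschitz[OF p p' FB]) simp
    have "(\<integral>y. \<psi> y / p \<partial>\<nu>) \<le> (\<integral>y. hopf_lax p 1 F y \<partial>\<nu>)"
      using QF integrable_bounded_range[OF \<nu> m(2) b(2)] integrable_bounded_lipschitz[OF \<nu> QFBL]
      by (intro integral_mono) auto
    moreover have "(\<integral>x. F x \<partial>\<mu>) \<le> (\<integral>x. - (\<phi> x / p) \<partial>\<mu>)"
      using F_le integrable_bounded_range[OF \<mu> m(1) b(1)] integrable_bounded_lipschitz[OF \<mu> FBL]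
      by (intro integral_mono) auto
    ultimately have "(\<integral>y. \<psi> y \<partial>\<nu>) / p + (\<integral>x. \<phi> x \<partial>\<mu>) / p \<le> w powr p / p"
      using dual[OF FBL] by simp
    then show "(\<integral>x. \<phi> x \<partial>\<mu>) + (\<integral>y. \<psi> y \<partial>\<nu>) \<le> w powr p"
      using p by (simp add: add_divide_distrib[symmetric] divide_le_cancel add.commute)
  qed (use p in auto)
  then show "wasserstein p \<mu> \<nu> \<le> ennreal v"
    using p v w by (intro wasserstein_leI) auto
qed

section \<open>Integrals against composed kernels and auxiliary limits\<close>

lemma bind_borel_probs:
  assumes "\<mu> \<in> borel_probs" "\<kappa> \<in> borel \<rightarrow>\<^sub>M prob_algebra borel"
  shows "\<mu> \<bind> \<kappa> \<in> borel_probs"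
proof -
  have "(\<lambda>_. \<mu> \<bind> \<kappa>) \<in> \<mu> \<rightarrow>\<^sub>M prob_algebra borel"
    using assms by (intro measurable_bind_prob_space[of _ _ borel]) auto
  moreover have "space \<mu> \<noteq> {}" using borel_probsD[OF assms(1)] by simp
  ultimately show ?thesis by (auto dest: measurable_space)
qed

lemma integral_bind_bounded:
  fixes f :: "'a::topological_space \<Rightarrow> real"
  assumes \<mu>: "\<mu> \<in> borel_probs" and \<kappa>: "\<kappa> \<in> borel \<rightarrow>\<^sub>M prob_algebra borel"
    and f [measurable]: "f \<in> borel_measurable borel" and B: "\<forall>x. \<bar>f x\<bar> \<le> B"
  shows "(\<integral>x. f x \<partial>(\<mu> \<bind> \<kappa>)) = (\<integral>x. (\<integral>y. f y \<partial>\<kappa> x) \<partial>\<mu>)"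
    "(\<lambda>x. \<integral>y. f y \<partial>\<kappa> x) \<in> borel_measurable borel"
proof -
  interpret M: prob_space \<mu> using borel_probsD[OF \<mu>] by simp
  have sM [measurable_cong]: "sets \<mu> = sets borel" using borel_probsD[OF \<mu>] by simp
  have \<kappa>P: "\<kappa> x \<in> borel_probs" for x using measurable_space[OF \<kappa>, of x] by simp
  interpret K: prob_space "\<kappa> x" for x using borel_probsD[OF \<kappa>P] by simp
  have b: "\<mu> \<bind> \<kappa> \<in> borel_probs" by (rule bind_borel_probs[OF \<mu> \<kappa>])
  interpret MK: prob_space "\<mu> \<bind> \<kappa>" using borel_probsD[OF b] by simp
  have \<kappa>s [measurable]: "\<kappa> \<in> borel \<rightarrow>\<^sub>M subprob_algebra borel" using \<kappa> by (rule measurable_prob_algebraD)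
  have \<kappa>M: "\<kappa> \<in> \<mu> \<rightarrow>\<^sub>M subprob_algebra borel" by measurable
  show meas [measurable]: "(\<lambda>x. \<integral>y. f y \<partial>\<kappa> x) \<in> borel_measurable borel" by measurable
  have fi: "integrable \<nu> f" if "\<nu> \<in> borel_probs" for \<nu> using integrable_borel_prob[OF that f B] .
  \<comment> \<open>The shift by \<open>B\<close> makes the integrand nonnegative, so that
    \<open>nn_integral_bind\<close> applies.\<close>
  have f0: "0 \<le> f x + B" for x using B[rule_format, of x] by linarith
  have inner: "(\<integral>y. f y + B \<partial>\<kappa> x) = (\<integral>y. f y \<partial>\<kappa> x) + B" for x
    using fi[OF \<kappa>P] by (simp add: K.prob_space)
  have ib: "\<bar>\<integral>y. f y \<partial>\<kappa> x\<bar> \<le> B" for x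
    using abs_integral_diff_le[OF \<kappa>P fi[OF \<kappa>P], of x "\<lambda>_. 0" B] B by simp
  have ii: "integrable \<mu> (\<lambda>x. \<integral>y. f y \<partial>\<kappa> x)" by (rule integrable_borel_prob[OF \<mu> meas]) (use ib in blast)
  have ii2: "integrable \<mu> (\<lambda>x. \<integral>y. f y + B \<partial>\<kappa> x)" unfolding inner using ii by simp
  have in0: "0 \<le> (\<integral>y. f y + B \<partial>\<kappa> x)" for x using f0 by simp
  have "ennreal (\<integral>x. f x + B \<partial>(\<mu> \<bind> \<kappa>)) = (\<integral>\<^sup>+ x. ennreal (f x + B) \<partial>(\<mu> \<bind> \<kappa>))"
    using fi[OF b] f0 by (intro nn_integral_eq_integral[symmetric]) auto
  also have "\<dots> = (\<integral>\<^sup>+ x. \<integral>\<^sup>+ y. ennreal (f y + B) \<partial>\<kappa> x \<partial>\<mu>)"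
    by (rule nn_integral_bind[OF _ \<kappa>M]) measurable
  also have "\<dots> = (\<integral>\<^sup>+ x. ennreal (\<integral>y. f y + B \<partial>\<kappa> x) \<partial>\<mu>)"
    using fi[OF \<kappa>P] f0 by (intro nn_integral_cong nn_integral_eq_integral) auto
  also have "\<dots> = ennreal (\<integral>x. (\<integral>y. f y + B \<partial>\<kappa> x) \<partial>\<mu>)"
    by (intro nn_integral_eq_integral ii2 AE_I2 in0)
  finally have "(\<integral>x. f x + B \<partial>(\<mu> \<bind> \<kappa>)) = (\<integral>x. (\<integral>y. f y + B \<partial>\<kappa> x) \<partial>\<mu>)"
    using f0 by (subst (asm) ennreal_inj) auto
  then show "(\<integral>x. f x \<partial>(\<mu> \<bind> \<kappa>)) = (\<integral>x. (\<integral>y. f y \<partial>\<kappa> x) \<partial>\<mu>)"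
    using fi[OF b] ii by (simp add: inner MK.prob_space M.prob_space)
qed

text \<open>Used in two ways: as right derivative of the integrals of \<open>1 / b\<close> and
  \<open>1 / (a * b)\<close>, and to recover the value of a continuous function from its
  averages.\<close>

lemma right_average_tendsto:
  fixes g :: "real \<Rightarrow> real"
  assumes "continuous_on {t..u} g" "t < u"
  shows "((\<lambda>h. integral {t..t + h} g / h) \<longlongrightarrow> g t) (at_right 0)"
proof -
  have "((\<lambda>x. integral {t..x} g) has_real_derivative g t) (at t within {t..u})"
    using assms by (intro integral_has_real_derivative) auto
  then have "((\<lambda>x. (integral {t..x} g - integral {t..t} g) / (x - t)) \<longlongrightarrow> g t) (at t within {t..u})"
    by (simp add: has_field_derivative_iff)
  then have "((\<lambda>x. integral {t..x} g / (x - t)) \<longlongrightarrow> g t) (at_right t)"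
    using assms(2) by (simp add: at_within_Icc_at_right)
  then have "((\<lambda>h. integral {t..h + t} g / (h + t - t)) \<longlongrightarrow> g t) (at_right 0)"
    unfolding at_right_to_0[of t] filterlim_filtermap .
  then show ?thesis by (simp add: add.commute)
qed

lemma set_nn_integral_mono:
  fixes f g :: "'b \<Rightarrow> ennreal"
  assumes "\<And>x. x \<in> A \<Longrightarrow> f x \<le> g x"
  shows "(\<integral>\<^sup>+ x\<in>A. f x \<partial>M) \<le> (\<integral>\<^sup>+ x\<in>A. g x \<partial>M)"
  using assms by (intro nn_integral_mono) (auto split: split_indicator)

section \<open>The setting\<close>

text \<open>Density of \<open>J\<close>, set to \<open>0\<close> for \<open>r \<le> 0\<close>, where
  \<open>b\<close> is not controlled; it differs from the density in \<open>time_measure\<close> at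
  most at the point \<open>0\<close>.\<close>

definition density_on_pos :: "(real \<Rightarrow> real) \<Rightarrow> real \<Rightarrow> real" where
  "density_on_pos b r = (if 0 < r then 1 / b r else 0)"

locale space_time =
  fixes P :: "real \<Rightarrow> 'a::polish_space \<Rightarrow> 'a measure"
    and a b :: "real \<Rightarrow> real"
    and p p' \<beta> \<beta>' :: real
  assumes geodesic: "\<forall>x y :: 'a. \<exists>\<gamma>. minimal_geodesic \<gamma> \<and> \<gamma> 0 = x \<and> \<gamma> 1 = y"
    and semigroup: "markov_semigroup P"
    and exponents: "1 < p" "1 < p'" "1 < \<beta>" "1 < \<beta>'"
      "1 / p + 1 / p' = 1" "1 / \<beta> + 1 / \<beta>' = 1" "\<beta> \<le> p"
    and a: "continuous_on {0..} a" "\<forall>r\<ge>0. a r > 0"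
    and b: "continuous_on {0<..} b" "\<forall>r>0. b r > 0"
    and J_finite: "\<forall>\<delta>>0. emeasure (time_measure b) {0..<\<delta>} < \<infinity>"
    and generator: "\<forall>f\<in>bounded_lipschitz. \<forall>t>0. \<forall>x. \<exists>L. (gen_quotient P f t x \<longlongrightarrow> L) (at 0)"
begin

abbreviation d\<^sub>J :: "real \<Rightarrow> real" where "d\<^sub>J \<equiv> density_on_pos b"

definition J :: "real \<Rightarrow> real \<Rightarrow> real" where "J s t = integral {s..t} d\<^sub>J"

lemma dJ_nonneg: "0 \<le> d\<^sub>J r"
  using b(2) by (simp add: density_on_pos_def less_imp_le)

lemma dJ_pos: "0 < r \<Longrightarrow> 0 < d\<^sub>J r"
  using b(2) by (simp add: density_on_pos_def)

lemma dJ_continuous: "continuous_on {0<..} d\<^sub>J"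
proof -
  have "continuous_on {0<..} (\<lambda>r. 1 / b r)"
    using b by (intro continuous_intros) (auto simp: less_imp_neq[THEN not_sym])
  then show ?thesis by (rule continuous_on_eq) (auto simp: density_on_pos_def)
qed

lemma dJ_measurable [measurable]: "d\<^sub>J \<in> borel_measurable borel"
proof -
  have "(\<lambda>r. indicator {0<..} r *\<^sub>R d\<^sub>J r) \<in> borel_measurable borel"
    by (intro borel_measurable_continuous_on_indicator dJ_continuous) simp
  moreover have "(\<lambda>r. indicator {0<..} r *\<^sub>R d\<^sub>J r) = d\<^sub>J"
    by (auto simp: density_on_pos_def indicator_def)
  ultimately show ?thesis by simp
qed

lemma time_measure_eq: "time_measure b = density lborel (\<lambda>r. ennreal (d\<^sub>J r))"
  unfolding time_measure_def
proof (rule density_cong)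
  have eq: "(\<lambda>r. indicator {0..} r * ennreal (1 / b r)) = (\<lambda>r. if r = 0 then ennreal (1 / b 0) else ennreal (d\<^sub>J r))"
    by (auto simp: density_on_pos_def indicator_def)
  show "(\<lambda>r. indicator {0..} r * ennreal (1 / b r)) \<in> borel_measurable lborel"
    unfolding eq by measurable
  have "AE r in lborel. r \<noteq> (0::real)" by (rule AE_lborel_singleton)
  then show "AE r in lborel. indicator {0..} r * ennreal (1 / b r) = ennreal (d\<^sub>J r)"
    by eventually_elim (auto simp: density_on_pos_def indicator_def)
qed measurable

text \<open>\<open>1 / b\<close> may be unbounded near \<open>0\<close>, so integrability comes from
  finiteness of \<open>J\<close> and not from continuity.\<close>

lemma dJ_set_integrable: "set_integrable lborel {s..t} d\<^sub>J"
proof -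
  define \<delta> where "\<delta> = max t 0 + 1"
  have "(\<integral>\<^sup>+ r. ennreal (norm (indicator {s..t} r *\<^sub>R d\<^sub>J r)) \<partial>lborel) \<le> (\<integral>\<^sup>+ r. ennreal (d\<^sub>J r) * indicator {0..<\<delta>} r \<partial>lborel)"
  proof (rule nn_integral_mono)
    fix r
    have "r \<in> {0..<\<delta>}" if "r \<in> {s..t}" "d\<^sub>J r \<noteq> 0"
      using that by (auto simp: density_on_pos_def \<delta>_def split: if_splits)
    then show "ennreal (norm (indicator {s..t} r *\<^sub>R d\<^sub>J r)) \<le> ennreal (d\<^sub>J r) * indicator {0..<\<delta>} r"
      using dJ_nonneg[of r] by (cases "r \<in> {s..t}"; cases "d\<^sub>J r = 0") auto
  qed
  also have "\<dots> = emeasure (time_measure b) {0..<\<delta>}"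
    unfolding time_measure_eq by (subst emeasure_density) auto
  also have "\<dots> < \<infinity>" using J_finite by (auto simp: \<delta>_def)
  finally show ?thesis unfolding set_integrable_def by (intro integrableI_bounded) auto
qed

lemma dJ_integrable: "d\<^sub>J integrable_on {s..t}"
  using set_borel_integral_eq_integral(1)[OF dJ_set_integrable] .

lemma measure_time_measure: "measure (time_measure b) {s..t} = J s t"
proof -
  have "emeasure (time_measure b) {s..t} = (\<integral>\<^sup>+ r. ennreal (indicator {s..t} r *\<^sub>R d\<^sub>J r) \<partial>lborel)"
    unfolding time_measure_eq
    by (subst emeasure_density) (auto intro!: nn_integral_cong simp: indicator_def)
  also have "\<dots> = ennreal (LINT r:{s..t}|lborel. d\<^sub>J r)"
    using dJ_set_integrable[of s t] dJ_nonneg unfolding set_lebesgue_integral_def set_integrable_def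
    by (intro nn_integral_eq_integral) auto
  also have "(LINT r:{s..t}|lborel. d\<^sub>J r) = J s t"
    unfolding J_def by (rule set_borel_integral_eq_integral(2)[OF dJ_set_integrable])
  finally show ?thesis
    unfolding measure_def J_def using integral_nonneg[OF dJ_integrable] dJ_nonneg by simp
qed

lemma J_nonneg: "0 \<le> J s t"
  unfolding J_def using integral_nonneg[OF dJ_integrable] dJ_nonneg by simp

text \<open>Outside \<open>[0,\<infinity>)\<close> nothing is known about \<open>a\<close>, but there the density vanishes.\<close>

lemma dJa_integrable:
  assumes "0 \<le> s"
  shows "set_integrable lborel {s..t} (\<lambda>r. d\<^sub>J r / a r)"
    "(LINT r:{s..t}|time_measure b. 1 / a r) = integral {s..t} (\<lambda>r. d\<^sub>J r / a r)"
proof -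
  have ca: "continuous_on {s..t} (\<lambda>r. 1 / a r)"
    using a assms by (intro continuous_intros continuous_on_subset[OF a(1)]) (auto simp: less_imp_neq[THEN not_sym])
  have m: "(\<lambda>r. indicator {s..t} r *\<^sub>R (1 / a r)) \<in> borel_measurable borel"
    by (intro borel_measurable_continuous_on_indicator ca) simp
  have "bounded ((\<lambda>r. 1 / a r) ` {s..t})"
    by (intro compact_imp_bounded compact_continuous_image ca compact_Icc)
  then obtain B where "\<forall>x\<in>(\<lambda>r. 1 / a r) ` {s..t}. norm x \<le> B" unfolding bounded_iff by blast
  then have B: "\<bar>1 / a r\<bar> \<le> B" if "r \<in> {s..t}" for r using that by auto
  have eq: "(\<lambda>r. indicator {s..t} r *\<^sub>R (d\<^sub>J r / a r)) = (\<lambda>r. d\<^sub>J r *\<^sub>R (indicator {s..t} r *\<^sub>R (1 / a r)))"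
    by auto
  have int: "integrable lborel (\<lambda>r. B * (indicator {s..t} r *\<^sub>R d\<^sub>J r))"
    using dJ_set_integrable unfolding set_integrable_def by (intro integrable_mult_right)
  have meas: "(\<lambda>r. indicator {s..t} r *\<^sub>R (d\<^sub>J r / a r)) \<in> borel_measurable lborel"
    unfolding eq using m by measurable
  have bnd: "norm (indicator {s..t} r *\<^sub>R (d\<^sub>J r / a r)) \<le> norm (B * (indicator {s..t} r *\<^sub>R d\<^sub>J r))" for r
  proof (cases "r \<in> {s..t}")
    case True
    have "\<bar>d\<^sub>J r / a r\<bar> = \<bar>1 / a r\<bar> * d\<^sub>J r" using dJ_nonneg[of r] by (simp add: abs_mult)
    also have "\<dots> \<le> \<bar>B\<bar> * d\<^sub>J r" using B[OF True] dJ_nonneg[of r] by (intro mult_right_mono) auto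
    finally show ?thesis using True dJ_nonneg[of r] by (simp add: abs_mult)
  qed simp
  show i: "set_integrable lborel {s..t} (\<lambda>r. d\<^sub>J r / a r)"
    unfolding set_integrable_def by (rule Bochner_Integration.integrable_bound[OF int meas AE_I2[OF bnd]])
  have "(LINT r:{s..t}|time_measure b. 1 / a r) = (LINT r:{s..t}|lborel. d\<^sub>J r / a r)"
    unfolding set_lebesgue_integral_def time_measure_eq eq
    using m dJ_nonneg by (intro integral_density) auto
  also have "\<dots> = integral {s..t} (\<lambda>r. d\<^sub>J r / a r)"
    by (rule set_borel_integral_eq_integral(2)[OF i])
  finally show "(LINT r:{s..t}|time_measure b. 1 / a r) = integral {s..t} (\<lambda>r. d\<^sub>J r / a r)" .
qed

lemma J_le:
  assumes "0 \<le> s" "s \<le> t" "\<And>r. s \<le> r \<Longrightarrow> r \<le> t \<Longrightarrow> d\<^sub>J r \<le> m"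
  shows "J s t \<le> m * (t - s)"
proof -
  have "J s t \<le> integral {s..t} (\<lambda>_. m)"
    unfolding J_def using assms by (intro integral_le dJ_integrable) auto
  then show ?thesis using assms by (simp add: mult.commute)
qed

lemma J_pos:
  assumes "0 \<le> s" "s < t"
  shows "0 < J s t"
proof -
  \<comment> \<open>Starting at the midpoint keeps away from time \<open>0\<close>, where the
    density is set to \<open>0\<close>; on the remaining interval it has a positive minimum.\<close>
  have "continuous_on {(s + t) / 2..t} d\<^sub>J" using assms by (intro continuous_on_subset[OF dJ_continuous]) auto
  then obtain r where r: "r \<in> {(s + t) / 2..t}" "\<And>y. y \<in> {(s + t) / 2..t} \<Longrightarrow> d\<^sub>J r \<le> d\<^sub>J y"
    using continuous_attains_inf[of "{(s + t) / 2..t}" d\<^sub>J] assms by auto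
  have "0 < d\<^sub>J r * (t - (s + t) / 2)" using r(1) assms by (intro mult_pos_pos dJ_pos) auto
  also have "\<dots> = integral {(s + t) / 2..t} (\<lambda>_. d\<^sub>J r)" using assms by (simp add: mult.commute)
  also have "\<dots> \<le> integral {(s + t) / 2..t} d\<^sub>J"
    using r(2) by (intro integral_le dJ_integrable) auto
  also have "\<dots> \<le> J s t" unfolding J_def using assms dJ_nonneg
    by (intro integral_subset_le dJ_integrable) auto
  finally show ?thesis .
qed

lemma J_combine: "s \<le> r \<Longrightarrow> r \<le> t \<Longrightarrow> J s r + J r t = J s t"
  unfolding J_def by (intro Henstock_Kurzweil_Integration.integral_combine dJ_integrable)

lemma J_continuous: "continuous_on {s..t} (J s)"
  unfolding J_def[abs_def] by (intro indefinite_integral_continuous_1 dJ_integrable)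

lemma kernel_measurable: "0 \<le> t \<Longrightarrow> P t \<in> borel \<rightarrow>\<^sub>M prob_algebra borel"
  using semigroup unfolding markov_semigroup_def by blast

lemma kernel_prob: "0 \<le> t \<Longrightarrow> P t x \<in> borel_probs"
  using measurable_space[OF kernel_measurable, of t x] by simp

lemma kernel_zero: "P 0 x = return borel x"
  using semigroup unfolding markov_semigroup_def by blast

lemma kernel_op_zero: "f \<in> borel_measurable borel \<Longrightarrow> kernel_op P 0 f x = f x"
  unfolding kernel_op_def kernel_zero by (intro integral_return) auto

lemma bind_return_kernel: "0 \<le> t \<Longrightarrow> return borel x \<bind> P t = P t x"
  by (rule bind_return[OF measurable_prob_algebraD[OF kernel_measurable]]) auto

lemma kernel_op_tendsto_zero:
  "f \<in> bounded_lipschitz \<Longrightarrow> ((\<lambda>t. kernel_op P t f x) \<longlongrightarrow> f x) (at_right 0)"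
  using semigroup unfolding markov_semigroup_def by blast

lemma generator_tendsto:
  assumes "f \<in> bounded_lipschitz" "0 < t"
  shows "(gen_quotient P f t x \<longlongrightarrow> gen_semigroup P f t x) (at 0)"
proof -
  obtain L where L: "(gen_quotient P f t x \<longlongrightarrow> L) (at 0)" using generator assms by blast
  then show ?thesis unfolding gen_semigroup_def using tendsto_Lim[OF _ L] by simp
qed

lemma kernel_op_has_derivative:
  assumes "f \<in> bounded_lipschitz" "0 < t"
  shows "((\<lambda>s. kernel_op P s f x) has_real_derivative gen_semigroup P f t x) (at t)"
  using generator_tendsto[OF assms, of x] unfolding DERIV_def gen_quotient_def[abs_def] .

text \<open>At \<open>t = 0\<close> this is the continuity contained in
  \<open>markov_semigroup\<close>; at positive times it follows from the existence of the
  generator.\<close>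

lemma kernel_op_time_tendsto:
  assumes f: "f \<in> bounded_lipschitz" and t: "0 \<le> t"
  shows "((\<lambda>s. kernel_op P s f x) \<longlongrightarrow> kernel_op P t f x) (at t within {0..})"
proof (cases "t = 0")
  case True
  have "(at 0 within {0::real..}) = at_right 0" by (simp add: at_within_Ici_at_right)
  then show ?thesis
    using kernel_op_tendsto_zero[OF f] kernel_op_zero[OF bounded_lipschitz_measurable[OF f]] True by simp
next
  case False
  then have "isCont (\<lambda>s. kernel_op P s f x) t"
    using DERIV_isCont[OF kernel_op_has_derivative[OF f]] t by simp
  then show ?thesis unfolding isCont_def by (rule tendsto_within_subset) simp
qed

end

section \<open>Increments of a function of two variables along the diagonal\<close>

lemma limsup_ennreal_leI:
  assumes "\<And>K. c < K \<Longrightarrow> eventually (\<lambda>n. X n \<le> K) F" "0 \<le> c"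
  shows "Limsup F (\<lambda>n. ennreal (X n)) \<le> ennreal c"
proof (rule ennreal_le_of_forall_gt[OF _ assms(2)])
  fix v assume "c < v"
  then have "eventually (\<lambda>n. X n \<le> v) F" by (rule assms(1))
  then have "eventually (\<lambda>n. ennreal (X n) \<le> ennreal v) F"
    by eventually_elim (rule ennreal_leI)
  then show "Limsup F (\<lambda>n. ennreal (X n)) \<le> ennreal v" by (rule Limsup_bounded)
qed

lemma continuous_on_if_abs_le:
  fixes f :: "real \<Rightarrow> real"
  assumes "\<And>x y. x \<in> A \<Longrightarrow> y \<in> A \<Longrightarrow> \<bar>f x - f y\<bar> \<le> L * \<bar>x - y\<bar>" "0 \<le> L"
  shows "continuous_on A f"
proof -
  have "L-lipschitz_on A f" using assms by (intro lipschitz_onI) (auto simp: dist_real_def)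
  then show ?thesis by (rule lipschitz_on_continuous_on)
qed

text \<open>Only partial difference quotients at the diagonal are controlled. The increment of the
  second argument is taken at the later value of the first one; shifting the variable of
  integration moves it back to the diagonal, and the reverse Fatou lemma passes to the limit.\<close>

lemma diagonal_increment_inner:
  fixes F :: "real \<Rightarrow> real \<Rightarrow> real" and \<theta> :: "real \<Rightarrow> ennreal"
  assumes r: "0 < r0" "r0 < r1" "r1 < 1"
    and lip: "\<And>r r' s s'. r \<in> {r0 / 2..(1 + r1) / 2} \<Longrightarrow> r' \<in> {r0 / 2..(1 + r1) / 2} \<Longrightarrow>
      s \<in> {r0 / 2..(1 + r1) / 2} \<Longrightarrow> s' \<in> {r0 / 2..(1 + r1) / 2} \<Longrightarrow>
      \<bar>F r s - F r' s'\<bar> \<le> L * (\<bar>r - r'\<bar> + \<bar>s - s'\<bar>)" and L: "0 \<le> L"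
    and lim: "\<And>r. r \<in> {r0..r1} \<Longrightarrow>
      limsup (\<lambda>n. ennreal (real n * (\<bar>F r r - F r (r - 1 / real n)\<bar> + \<bar>F (r + 1 / real n) r - F r r\<bar>))) \<le> \<theta> r"
  shows "ennreal \<bar>F r1 r1 - F r0 r0\<bar> \<le> (\<integral>\<^sup>+ r\<in>{r0..r1}. \<theta> r \<partial>lborel)"
proof (cases "(\<integral>\<^sup>+ r\<in>{r0..r1}. \<theta> r \<partial>lborel) = \<top>")
  case False
  then obtain c where c: "(\<integral>\<^sup>+ r\<in>{r0..r1}. \<theta> r \<partial>lborel) = ennreal c" "0 \<le> c"
    by (cases "\<integral>\<^sup>+ r\<in>{r0..r1}. \<theta> r \<partial>lborel") auto
  define I where "I = {r0 / 2..(1 + r1) / 2}"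
  define u where "u r = F r r" for r
  define k where "k h r = \<bar>F r r - F r (r - h)\<bar>" for h r
  define k' where "k' h r = \<bar>F (r + h) r - F r r\<bar>" for h r
  define q where "q n r = real n * (k (1 / real n) r + k' (1 / real n) r)" for n r
  define \<delta> where "\<delta> = min (r0 / 2) ((1 - r1) / 2)"
  have \<delta>: "0 < \<delta>" "\<delta> \<le> r0 / 2" "\<delta> \<le> (1 - r1) / 2"
    using r min.cobounded1[of "r0 / 2" "(1 - r1) / 2"] min.cobounded2[of "r0 / 2" "(1 - r1) / 2"]
    unfolding \<delta>_def by auto
  have mem: "r \<in> I" "r - h \<in> I" "r + h \<in> I" if "r \<in> {r0..r1}" "0 \<le> h" "h < \<delta>" for r h
    using that \<delta> r unfolding I_def by (auto simp: field_simps)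
  note Flip = lip[folded I_def]
  have cu: "continuous_on I u" unfolding u_def
    by (rule continuous_on_if_abs_le[of _ _ "L * 2"]) (use Flip L in \<open>force simp: algebra_simps\<close>)+
  have cF: "continuous_on {r0..r1 + h} (\<lambda>r. F r (r - h))" if h: "0 \<le> h" "h < \<delta>" for h
  proof (rule continuous_on_if_abs_le[of _ _ "L * 2"])
    fix x y assume "x \<in> {r0..r1 + h}" "y \<in> {r0..r1 + h}"
    then have "x \<in> I" "y \<in> I" "x - h \<in> I" "y - h \<in> I" using h \<delta> r unfolding I_def by (auto simp: field_simps)
    then show "\<bar>F x (x - h) - F y (y - h)\<bar> \<le> L * 2 * \<bar>x - y\<bar>"
      using Flip[of x y "x - h" "y - h"] by simp
  qed (use L in simp)
  have cF': "continuous_on {r0..r1} (\<lambda>r. F (r + h) r)" if h: "0 \<le> h" "h < \<delta>" for h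
  proof (rule continuous_on_if_abs_le[of _ _ "L * 2"])
    fix x y assume xy: "x \<in> {r0..r1}" "y \<in> {r0..r1}"
    show "\<bar>F (x + h) x - F (y + h) y\<bar> \<le> L * 2 * \<bar>x - y\<bar>"
      using Flip[OF mem(3)[OF xy(1) h] mem(3)[OF xy(2) h] mem(1)[OF xy(1) h] mem(1)[OF xy(2) h]] by simp
  qed (use L in simp)
  have subI: "{r0..r1 + h} \<subseteq> I" "{r0..r1} \<subseteq> I" if "0 \<le> h" "h < \<delta>" for h
    using that \<delta> r unfolding I_def by (auto simp: field_simps)
  have ck: "continuous_on {r0..r1 + h} (k h)" if h: "0 \<le> h" "h < \<delta>" for h
    unfolding k_def using cF[OF h] continuous_on_subset[OF cu subI(1)[OF h]]
    by (intro continuous_intros) (auto simp: u_def)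
  have ck': "continuous_on {r0..r1} (k' h)" if h: "0 \<le> h" "h < \<delta>" for h
    unfolding k'_def using cF'[OF h] continuous_on_subset[OF cu subI(2)[OF h]]
    by (intro continuous_intros) (auto simp: u_def)
  have kle: "k h r \<le> L * h" if "r \<in> I" "r - h \<in> I" "0 \<le> h" for h r
    using Flip[of r r r "r - h"] that unfolding k_def by simp
  have k'le: "k' h r \<le> L * h" if "r \<in> I" "r + h \<in> I" "0 \<le> h" for h r
    using Flip[of "r + h" r r r] that unfolding k'_def by simp
  \<comment> \<open>Windows of length \<open>h\<close> turn the increment into the integral of
    \<open>u (r + h) - u r\<close>. The shifted integral of \<open>k h\<close> runs up to
    \<open>r1 + h\<close>; the overhang beyond \<open>r1\<close> costs \<open>L * h * h\<close>,
    negligible after division by \<open>h\<close>.\<close>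
  have step: "\<bar>integral {r1..r1 + h} u - integral {r0..r0 + h} u\<bar>
      \<le> integral {r0..r1} (\<lambda>r. k h r + k' h r) + L * h * h" if h: "0 < h" "h < \<delta>" for h
  proof -
    have h0: "0 \<le> h" using h by simp
    have uint: "u integrable_on {x..y}" if "{x..y} \<subseteq> I" for x y
      by (intro integrable_continuous_interval continuous_on_subset[OF cu that])
    have kint: "k h integrable_on {x..y}" if "{x..y} \<subseteq> {r0..r1 + h}" for x y
      by (intro integrable_continuous_interval continuous_on_subset[OF ck[OF h0 h(2)] that])
    have i1: "integral {r0..r0 + h} u + integral {r0 + h..r1 + h} u = integral {r0..r1 + h} u"
      "integral {r0..r1} u + integral {r1..r1 + h} u = integral {r0..r1 + h} u"
      using h r \<delta> subI(1)[OF h0 h(2)]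
      by (auto intro!: Henstock_Kurzweil_Integration.integral_combine uint)
    have i2: "integral {r0 + h..r1 + h} u = integral {r0..r1} (\<lambda>r. u (r + h))"
      using integral_shift_Icc_real[of r0 r1 u h] by (simp add: comp_def add.commute)
    have cuh: "continuous_on {r0..r1} (\<lambda>r. u (r + h))"
      by (rule continuous_on_compose2[OF cu]) (use subI(1)[OF h0 h(2)] h in \<open>auto intro!: continuous_intros subsetD[OF subI(1)[OF h0 h(2)]]\<close>)
    have ckh: "continuous_on {r0..r1} (\<lambda>r. k h (r + h))"
      by (rule continuous_on_compose2[OF ck[OF h0 h(2)]]) (use h in \<open>auto intro!: continuous_intros\<close>)
    have "integral {r1..r1 + h} u - integral {r0..r0 + h} u = integral {r0..r1} (\<lambda>r. u (r + h) - u r)"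
      using i1 i2 cuh uint[OF subI(2)[OF h0 h(2)]]
      by (subst Henstock_Kurzweil_Integration.integral_diff) (auto intro!: integrable_continuous_interval)
    also have "\<bar>\<dots>\<bar> \<le> integral {r0..r1} (\<lambda>r. k h (r + h) + k' h r)"
    proof -
      have pt: "norm (u (r + h) - u r) \<le> k h (r + h) + k' h r" for r
        by (simp add: u_def k_def k'_def)
      have "norm (integral {r0..r1} (\<lambda>r. u (r + h) - u r)) \<le> integral {r0..r1} (\<lambda>r. k h (r + h) + k' h r)"
        using cuh uint[OF subI(2)[OF h0 h(2)]] ckh ck'[OF h0 h(2)]
        by (intro integral_norm_bound_integral integrable_add integrable_diff)
          (auto intro!: integrable_continuous_interval pt simp del: real_norm_def)
      then show ?thesis by simp
    qed
    also have "\<dots> = integral {r0..r1} (\<lambda>r. k h (r + h)) + integral {r0..r1} (k' h)"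
      using ckh ck'[OF h0 h(2)]
      by (intro Henstock_Kurzweil_Integration.integral_add integrable_continuous_interval)
    also have "integral {r0..r1} (\<lambda>r. k h (r + h)) = integral {r0 + h..r1 + h} (k h)"
      using integral_shift_Icc_real[of r0 r1 "k h" h] by (simp add: comp_def add.commute)
    also have "\<dots> \<le> integral {r0..r1 + h} (k h)"
      using h by (intro integral_subset_le kint) (auto simp: k_def)
    also have "\<dots> = integral {r0..r1} (k h) + integral {r1..r1 + h} (k h)"
      using h r by (intro Henstock_Kurzweil_Integration.integral_combine[symmetric] kint) auto
    also have "integral {r1..r1 + h} (k h) \<le> integral {r1..r1 + h} (\<lambda>_. L * h)"
    proof (rule integral_le)
      show "k h integrable_on {r1..r1 + h}" using r h by (intro kint) auto
      fix x assume "x \<in> {r1..r1 + h}"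
      then have "x \<in> I" "x - h \<in> I" using h \<delta> r unfolding I_def by (auto simp: field_simps)
      then show "k h x \<le> L * h" using h0 by (rule kle)
    qed (rule integrable_const_ivl)
    also have "\<dots> = L * h * h" using h by simp
    also have "integral {r0..r1} (k h) + L * h * h + integral {r0..r1} (k' h)
        = integral {r0..r1} (\<lambda>r. k h r + k' h r) + L * h * h"
      using h ck'[OF h0 h(2)] continuous_on_subset[OF ck[OF h0 h(2)], of "{r0..r1}"]
      by (subst Henstock_Kurzweil_Integration.integral_add) (auto intro!: kint integrable_continuous_interval)
    finally show ?thesis by simp
  qed
  obtain N where N: "1 / \<delta> < real N" using reals_Archimedean2 by blast
  then have N0: "0 < N" using \<delta> by (cases "N = 0") auto
  have hn: "0 < 1 / real n" "1 / real n < \<delta>" if "N \<le> n" for n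
  proof -
    have "1 / \<delta> < real n" using N that by linarith
    then show "1 / real n < \<delta>" using \<delta> N0 that by (simp add: field_simps)
    show "0 < 1 / real n" using N0 that by simp
  qed
  \<comment> \<open>For \<open>n < N\<close> the step \<open>1 / n\<close> may leave the interval on
    which \<open>F\<close> is Lipschitz; the value \<open>0\<close> gives one dominating function
    for all \<open>n\<close>.\<close>
  define Q where "Q n r = (if N \<le> n then ennreal (q n r) * indicator {r0..r1} r else 0)" for n r
  have cq: "continuous_on {r0..r1} (q n)" if "N \<le> n" for n
    unfolding q_def using hn[OF that] continuous_on_subset[OF ck[of "1 / real n"], of "{r0..r1}"] ck'[of "1 / real n"]
    by (intro continuous_intros) auto
  have q0: "0 \<le> q n r" for n r unfolding q_def k_def k'_def by simp
  have QI: "(\<integral>\<^sup>+ r. Q n r \<partial>lborel) = ennreal (integral {r0..r1} (q n))" if "N \<le> n" for n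
    unfolding Q_def using that q0 integrable_continuous_interval[OF cq[OF that]]
    by (simp add: nn_integral_has_integral_lebesgue'[OF _ integrable_integral])
  have "limsup (\<lambda>n. \<integral>\<^sup>+ r. Q n r \<partial>lborel) \<le> (\<integral>\<^sup>+ r. limsup (\<lambda>n. Q n r) \<partial>lborel)"
  proof (rule nn_integral_limsup[where w="\<lambda>r. ennreal (2 * L) * indicator {r0..r1} r"])
    show "Q n \<in> borel_measurable lborel" for n
    proof (cases "N \<le> n")
      case True
      have "(\<lambda>r. indicator {r0..r1} r *\<^sub>R q n r) \<in> borel_measurable borel"
        by (intro borel_measurable_continuous_on_indicator cq True) simp
      then have "(\<lambda>r. ennreal (indicator {r0..r1} r *\<^sub>R q n r)) \<in> borel_measurable lborel" by measurable
      moreover have "(\<lambda>r. ennreal (indicator {r0..r1} r *\<^sub>R q n r)) = Q n"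
        unfolding Q_def using True by (auto simp: indicator_def)
      ultimately show ?thesis by simp
    qed (simp add: Q_def[abs_def])
    show "AE r in lborel. Q n r \<le> ennreal (2 * L) * indicator {r0..r1} r" for n
    proof (rule AE_I2)
      fix r
      show "Q n r \<le> ennreal (2 * L) * indicator {r0..r1} r"
      proof (cases "N \<le> n \<and> r \<in> {r0..r1}")
        case True
        then have "k (1 / real n) r \<le> L * (1 / real n)" "k' (1 / real n) r \<le> L * (1 / real n)"
          using hn[of n] mem[of r "1 / real n"] kle[of r "1 / real n"] k'le[of r "1 / real n"] by auto
        then have "q n r \<le> real n * (L * (1 / real n) + L * (1 / real n))"
          unfolding q_def by (intro mult_left_mono add_mono) auto
        also have "\<dots> = 2 * L" using hn(1)[of n] True by simp
        finally show ?thesis unfolding Q_def using True by (auto intro: ennreal_leI)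
      qed (auto simp: Q_def indicator_def)
    qed
    show "(\<integral>\<^sup>+ r. ennreal (2 * L) * indicator {r0..r1} r \<partial>lborel) < \<infinity>"
      by (subst nn_integral_cmult_indicator) (use r in \<open>auto simp: ennreal_mult_less_top\<close>)
  qed measurable
  also have "\<dots> \<le> (\<integral>\<^sup>+ r. \<theta> r * indicator {r0..r1} r \<partial>lborel)"
  proof (rule nn_integral_mono)
    fix r
    show "limsup (\<lambda>n. Q n r) \<le> \<theta> r * indicator {r0..r1} r"
    proof (cases "r \<in> {r0..r1}")
      case True
      have "limsup (\<lambda>n. Q n r) = limsup (\<lambda>n. ennreal (q n r))"
        by (rule Limsup_eq) (use True in \<open>auto simp: Q_def intro!: eventually_sequentiallyI[of N]\<close>)
      also have "\<dots> \<le> \<theta> r" using lim[OF True] unfolding q_def k_def k'_def .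
      finally show ?thesis using True by simp
    next
      case False
      then have "limsup (\<lambda>n. Q n r) \<le> 0" by (intro Limsup_bounded) (auto simp: Q_def)
      then show ?thesis using False by simp
    qed
  qed
  finally have ls: "limsup (\<lambda>n. \<integral>\<^sup>+ r. Q n r \<partial>lborel) \<le> ennreal c" using c by simp
  have le: "\<bar>u r1 - u r0\<bar> \<le> c + e" if e: "0 < e" for e
  proof -
    have inv0: "filterlim (\<lambda>n. 1 / real n) (at_right 0) sequentially"
      unfolding filterlim_at by (auto intro!: lim_1_over_n eventually_sequentiallyI[of 1] simp: greaterThan_def)
    have avg: "((\<lambda>n. integral {t..t + 1 / real n} u / (1 / real n)) \<longlonglongrightarrow> u t)" if "{t..t + \<delta>} \<subseteq> I" for t
      using right_average_tendsto[OF continuous_on_subset[OF cu that]] \<delta>(1)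
      by (intro filterlim_compose[OF _ inv0]) auto
    have "{r0..r0 + \<delta>} \<subseteq> I" "{r1..r1 + \<delta>} \<subseteq> I" using \<delta> r unfolding I_def by (auto simp: field_simps)
    then have "(\<lambda>n. \<bar>integral {r1..r1 + 1 / real n} u / (1 / real n) - integral {r0..r0 + 1 / real n} u / (1 / real n)\<bar>)
        \<longlonglongrightarrow> \<bar>u r1 - u r0\<bar>"
      by (intro tendsto_intros avg)
    then have 1: "(\<lambda>n. \<bar>integral {r1..r1 + 1 / real n} u / (1 / real n) - integral {r0..r0 + 1 / real n} u / (1 / real n)\<bar> - L * (1 / real n))
        \<longlonglongrightarrow> \<bar>u r1 - u r0\<bar> - L * 0"
      by (intro tendsto_diff tendsto_mult_left lim_1_over_n)
    have "ennreal c < ennreal (c + e)" using c e by (simp add: ennreal_less_iff)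
    then have "eventually (\<lambda>n. (\<integral>\<^sup>+ r. Q n r \<partial>lborel) < ennreal (c + e)) sequentially"
      using ls by (intro Limsup_lessD) auto
    then have "eventually (\<lambda>n. \<bar>integral {r1..r1 + 1 / real n} u / (1 / real n) - integral {r0..r0 + 1 / real n} u / (1 / real n)\<bar> - L * (1 / real n) \<le> c + e) sequentially"
      using eventually_ge_at_top[of N]
    proof eventually_elim
      case (elim n)
      define h where "h = 1 / real n"
      have h: "0 < h" "h < \<delta>" unfolding h_def using hn elim by auto
      have "ennreal (integral {r0..r1} (q n)) < ennreal (c + e)" using elim QI by simp
      then have qc: "integral {r0..r1} (q n) < c + e"
        using integral_nonneg[OF integrable_continuous_interval[OF cq]] q0 elim by (simp add: ennreal_less_iff)
      have qk: "integral {r0..r1} (q n) = integral {r0..r1} (\<lambda>r. k h r + k' h r) / h"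
        unfolding q_def h_def by simp
      have "\<bar>integral {r1..r1 + h} u / h - integral {r0..r0 + h} u / h\<bar> = \<bar>integral {r1..r1 + h} u - integral {r0..r0 + h} u\<bar> / h"
        using h by (simp add: diff_divide_distrib[symmetric])
      also have "\<dots> \<le> (integral {r0..r1} (\<lambda>r. k h r + k' h r) + L * h * h) / h"
        using step[OF h] h by (intro divide_right_mono) auto
      also have "\<dots> = integral {r0..r1} (q n) + L * h" unfolding qk using h by (simp add: add_divide_distrib)
      finally show ?case using qc unfolding h_def by simp
    qed
    then show ?thesis using tendsto_upperbound[OF 1] by simp
  qed
  have "\<bar>u r1 - u r0\<bar> \<le> c" by (rule field_le_epsilon) (rule le)
  then show ?thesis unfolding c(1) u_def by (rule ennreal_leI)
qed simp

text \<open>Lipschitz bounds are assumed on compact subintervals only, since \<open>1 / b\<close>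
  may blow up at the initial time. The inner estimate is exhausted up to the endpoints by continuity
  on the diagonal.\<close>

lemma diagonal_increment_le:
  fixes F :: "real \<Rightarrow> real \<Rightarrow> real" and \<theta> :: "real \<Rightarrow> ennreal"
  assumes cont: "continuous_on {0..1} (\<lambda>r. F r r)"
    and lip: "\<And>r0 r1. 0 < r0 \<Longrightarrow> r1 < 1 \<Longrightarrow> \<exists>L\<ge>0. \<forall>r\<in>{r0..r1}. \<forall>r'\<in>{r0..r1}. \<forall>s\<in>{r0..r1}. \<forall>s'\<in>{r0..r1}.
      \<bar>F r s - F r' s'\<bar> \<le> L * (\<bar>r - r'\<bar> + \<bar>s - s'\<bar>)"
    and lim: "\<And>r. 0 < r \<Longrightarrow> r < 1 \<Longrightarrow>
      limsup (\<lambda>n. ennreal (real n * (\<bar>F r r - F r (r - 1 / real n)\<bar> + \<bar>F (r + 1 / real n) r - F r r\<bar>))) \<le> \<theta> r"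
  shows "ennreal \<bar>F 1 1 - F 0 0\<bar> \<le> (\<integral>\<^sup>+ r\<in>{0..1}. \<theta> r \<partial>lborel)"
proof -
  have le: "ennreal \<bar>F r1 r1 - F r0 r0\<bar> \<le> (\<integral>\<^sup>+ r\<in>{0..1}. \<theta> r \<partial>lborel)" if r: "0 < r0" "r0 < r1" "r1 < 1" for r0 r1
  proof -
    obtain L where L: "0 \<le> L" "\<And>r r' s s'. r \<in> {r0 / 2..(1 + r1) / 2} \<Longrightarrow> r' \<in> {r0 / 2..(1 + r1) / 2} \<Longrightarrow>
      s \<in> {r0 / 2..(1 + r1) / 2} \<Longrightarrow> s' \<in> {r0 / 2..(1 + r1) / 2} \<Longrightarrow> \<bar>F r s - F r' s'\<bar> \<le> L * (\<bar>r - r'\<bar> + \<bar>s - s'\<bar>)"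
      using lip[of "r0 / 2" "(1 + r1) / 2"] r by auto
    have "ennreal \<bar>F r1 r1 - F r0 r0\<bar> \<le> (\<integral>\<^sup>+ r\<in>{r0..r1}. \<theta> r \<partial>lborel)"
      by (rule diagonal_increment_inner[OF r L(2) L(1)]) (use lim r in auto)
    also have "\<dots> \<le> (\<integral>\<^sup>+ r\<in>{0..1}. \<theta> r \<partial>lborel)"
      using r by (intro nn_integral_mono) (auto simp: indicator_def)
    finally show ?thesis .
  qed
  \<comment> \<open>The offset \<open>3\<close> ensures \<open>1 / (n + 3) < 1 - 1 / (n + 3)\<close>
    already at \<open>n = 0\<close>.\<close>
  have z: "(\<lambda>n. 1 / real (n + 3)) \<longlonglongrightarrow> 0"
    using LIMSEQ_ignore_initial_segment[OF lim_1_over_n, of 3] by simp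
  have "(\<lambda>n. F (1 - 1 / real (n + 3)) (1 - 1 / real (n + 3))) \<longlonglongrightarrow> F (1 - 0) (1 - 0)"
    by (rule continuous_on_tendsto_compose[OF cont tendsto_diff[OF tendsto_const z]])
      (auto intro!: always_eventually)
  moreover have "(\<lambda>n. F (1 / real (n + 3)) (1 / real (n + 3))) \<longlonglongrightarrow> F 0 0"
    by (rule continuous_on_tendsto_compose[OF cont z]) (auto intro!: always_eventually)
  ultimately have "(\<lambda>n. ennreal \<bar>F (1 - 1 / real (n + 3)) (1 - 1 / real (n + 3)) - F (1 / real (n + 3)) (1 / real (n + 3))\<bar>)
      \<longlonglongrightarrow> ennreal \<bar>F (1 - 0) (1 - 0) - F 0 0\<bar>"
    by (intro tendsto_ennrealI tendsto_rabs tendsto_diff)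
  then have "ennreal \<bar>F (1 - 0) (1 - 0) - F 0 0\<bar> \<le> (\<integral>\<^sup>+ r\<in>{0..1}. \<theta> r \<partial>lborel)"
    by (rule tendsto_upperbound) (auto intro!: always_eventually le simp: field_simps)
  then show ?thesis by simp
qed

section \<open>From transport control to the estimate along geodesics\<close>

context space_time
begin

lemma p'_pos: "0 < p'" and \<beta>_pos: "0 < \<beta>" and \<beta>'_pos: "0 < \<beta>'" and p_pos: "0 < p"
  using exponents(1-4) by auto

lemma kernel_integrable:
  "0 \<le> t \<Longrightarrow> f \<in> bounded_lipschitz \<Longrightarrow> integrable (P t x) f"
  by (rule integrable_bounded_lipschitz[OF kernel_prob])

lemma a_bounded:
  assumes "0 \<le> s"
  obtains \<alpha> where "0 < \<alpha>" "\<And>r. s \<le> r \<Longrightarrow> r \<le> t \<Longrightarrow> a r < \<alpha>"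
proof -
  have "bounded (a ` {s..t})"
    using assms by (intro compact_imp_bounded compact_continuous_image continuous_on_subset[OF a(1)] compact_Icc) auto
  then obtain B where "\<forall>x\<in>a ` {s..t}. norm x \<le> B"
    unfolding bounded_iff by blast
  then have B: "\<bar>a r\<bar> \<le> B" if "r \<in> {s..t}" for r using that by auto
  show ?thesis
  proof (rule that[of "\<bar>B\<bar> + 1"])
    fix r assume "s \<le> r" "r \<le> t"
    then have "\<bar>a r\<bar> \<le> B" by (intro B) simp
    then show "a r < \<bar>B\<bar> + 1" by linarith
  qed simp
qed

lemma dJ_bounded:
  assumes "0 < s"
  obtains m where "0 < m" "\<And>r. s \<le> r \<Longrightarrow> r \<le> t \<Longrightarrow> d\<^sub>J r \<le> m"
proof -
  have "bounded (d\<^sub>J ` {s..t})"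
    using assms by (intro compact_imp_bounded compact_continuous_image continuous_on_subset[OF dJ_continuous] compact_Icc) auto
  then obtain B where "\<forall>x\<in>d\<^sub>J ` {s..t}. norm x \<le> B"
    unfolding bounded_iff by blast
  then have B: "\<bar>d\<^sub>J r\<bar> \<le> B" if "r \<in> {s..t}" for r using that by auto
  show ?thesis
  proof (rule that[of "\<bar>B\<bar> + 1"])
    fix r assume "s \<le> r" "r \<le> t"
    then have "\<bar>d\<^sub>J r\<bar> \<le> B" by (intro B) simp
    then show "d\<^sub>J r \<le> \<bar>B\<bar> + 1" by linarith
  qed simp
qed

lemma a_near:
  assumes "0 \<le> t" "a t < \<alpha>"
  obtains \<eta> where "0 < \<eta>" "\<And>r. 0 \<le> r \<Longrightarrow> \<bar>r - t\<bar> < \<eta> \<Longrightarrow> a r < \<alpha>"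
proof -
  have "(a \<longlongrightarrow> a t) (at t within {0..})" using a(1) assms(1) by (simp add: continuous_on_def)
  from order_tendstoD(2)[OF this assms(2)] obtain \<eta> where
    \<eta>: "0 < \<eta>" "\<And>r. 0 \<le> r \<Longrightarrow> r \<noteq> t \<Longrightarrow> \<bar>r - t\<bar> < \<eta> \<Longrightarrow> a r < \<alpha>"
    unfolding eventually_at by (auto simp: dist_real_def)
  have "a r < \<alpha>" if "0 \<le> r" "\<bar>r - t\<bar> < \<eta>" for r
    using \<eta>(2)[of r] that assms(2) by (cases "r = t") auto
  with \<eta>(1) show ?thesis by (rule that)
qed

lemma dJ_near:
  assumes "0 < t" "d\<^sub>J t < m"
  obtains \<eta> where "0 < \<eta>" "\<And>r. \<bar>r - t\<bar> < \<eta> \<Longrightarrow> d\<^sub>J r < m"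
proof -
  have "(d\<^sub>J \<longlongrightarrow> d\<^sub>J t) (at t)"
    using dJ_continuous assms(1) continuous_on_eq_continuous_at[of "{0<..}" d\<^sub>J] by (simp add: isCont_def)
  from order_tendstoD(2)[OF this assms(2)] obtain \<eta> where
    \<eta>: "0 < \<eta>" "\<And>r. r \<noteq> t \<Longrightarrow> \<bar>r - t\<bar> < \<eta> \<Longrightarrow> d\<^sub>J r < m"
    unfolding eventually_at by (auto simp: dist_real_def)
  have "d\<^sub>J r < m" if "\<bar>r - t\<bar> < \<eta>" for r
    using \<eta>(2)[of r] that assms(2) by (cases "r = t") auto
  with \<eta>(1) show ?thesis by (rule that)
qed

text \<open>The integral of \<open>1 / a\<close> against \<open>J\<close>; the factor in
  \<open>wasserstein_control\<close> is \<open>(Ja s t / J s t) powr (- \<beta>)\<close>.\<close>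

definition Ja :: "real \<Rightarrow> real \<Rightarrow> real" where "Ja s t = integral {s..t} (\<lambda>r. d\<^sub>J r / a r)"

lemma dJa_integrable_on: "0 \<le> s \<Longrightarrow> (\<lambda>r. d\<^sub>J r / a r) integrable_on {s..t}"
  by (rule set_borel_integral_eq_integral(1)[OF dJa_integrable(1)])

lemma dJa_nonneg: "0 \<le> r \<Longrightarrow> 0 \<le> d\<^sub>J r / a r"
  using a(2) dJ_nonneg by (simp add: less_imp_le)

lemma Ja_nonneg: "0 \<le> s \<Longrightarrow> 0 \<le> Ja s t"
  unfolding Ja_def by (intro integral_nonneg dJa_integrable_on) (auto intro: dJa_nonneg)

lemma Ja_combine: "0 \<le> s \<Longrightarrow> s \<le> r \<Longrightarrow> r \<le> t \<Longrightarrow> Ja s r + Ja r t = Ja s t"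
  unfolding Ja_def by (intro Henstock_Kurzweil_Integration.integral_combine dJa_integrable_on)

lemma Ja_continuous: "0 \<le> s \<Longrightarrow> continuous_on {s..t} (Ja s)"
  unfolding Ja_def[abs_def] by (intro indefinite_integral_continuous_1 dJa_integrable_on)

lemma Ja_ge:
  assumes "0 \<le> s" "s < t" and \<alpha>: "\<And>r. s \<le> r \<Longrightarrow> r \<le> t \<Longrightarrow> a r \<le> \<alpha>"
  shows "1 / \<alpha> * J s t \<le> Ja s t"
proof -
  have \<alpha>0: "0 < \<alpha>" using \<alpha>[of s] a(2) assms(1,2) by (auto intro: less_le_trans)
  have "1 / \<alpha> * J s t = integral {s..t} (\<lambda>r. 1 / \<alpha> * d\<^sub>J r)" unfolding J_def by simp
  also have "\<dots> \<le> Ja s t" unfolding Ja_def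
  proof (rule integral_le)
    show "(\<lambda>r. 1 / \<alpha> * d\<^sub>J r) integrable_on {s..t}" by (intro integrable_on_mult_right dJ_integrable)
    show "(\<lambda>r. d\<^sub>J r / a r) integrable_on {s..t}" by (rule dJa_integrable_on[OF assms(1)])
    fix r assume r: "r \<in> {s..t}"
    then have "1 / \<alpha> \<le> 1 / a r" using \<alpha>[of r] a(2) assms(1) \<alpha>0 by (intro divide_left_mono) auto
    then have "1 / \<alpha> * d\<^sub>J r \<le> 1 / a r * d\<^sub>J r" using dJ_nonneg by (rule mult_right_mono)
    then show "1 / \<alpha> * d\<^sub>J r \<le> d\<^sub>J r / a r" by simp
  qed
  finally show ?thesis .
qed

lemma Ja_pos:
  assumes "0 \<le> s" "s < t"
  shows "0 < Ja s t"
proof -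
  obtain \<alpha> where \<alpha>: "0 < \<alpha>" "\<And>r. s \<le> r \<Longrightarrow> r \<le> t \<Longrightarrow> a r < \<alpha>" using a_bounded[OF assms(1)] by blast
  have "0 < 1 / \<alpha> * J s t" using J_pos[OF assms] \<alpha> by simp
  also have "\<dots> \<le> Ja s t" using \<alpha>(2) by (intro Ja_ge[OF assms] less_imp_le)
  finally show ?thesis .
qed

text \<open>The transport control is applied to two Dirac masses. The mean of \<open>1 / a\<close>
  with respect to \<open>J\<close> is at least \<open>1 / \<alpha>\<close>, which replaces the
  averaged constant by a pointwise bound.\<close>

lemma control_dirac:
  assumes C: "wasserstein_control P a b p \<beta>" and st: "0 \<le> s" "s < t"
    and \<alpha>: "\<And>r. s \<le> r \<Longrightarrow> r \<le> t \<Longrightarrow> a r \<le> \<alpha>" and j: "J s t \<le> j"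
  shows "wasserstein p (P s x) (P t y) \<le> ennreal (((\<alpha> * dist x y) powr \<beta> + j powr \<beta>) powr (1 / \<beta>))"
proof -
  have "0 < a s" using a(2) st by simp
  then have \<alpha>0: "0 < \<alpha>" using \<alpha>[of s] st by simp
  define A where "A = 1 / J s t * integral {s..t} (\<lambda>r. d\<^sub>J r / a r)"
  have Jp: "0 < J s t" using st by (rule J_pos)
  have "1 / \<alpha> * J s t \<le> J s t * A" unfolding A_def using Ja_ge[OF st \<alpha>] Jp by (simp add: Ja_def)
  then have "1 / \<alpha> \<le> A" using Jp by (simp only: mult.commute[of "1 / \<alpha>"] mult_le_cancel_left_pos)
  then have "A powr (- \<beta>) \<le> (1 / \<alpha>) powr (- \<beta>)" using \<alpha>0 \<beta>_pos by (intro powr_mono2') auto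
  also have "\<dots> = \<alpha> powr \<beta>" using \<alpha>0 by (simp add: powr_divide powr_minus)
  finally have A: "A powr (- \<beta>) \<le> \<alpha> powr \<beta>" .
  have "epowr (wasserstein p (P s x) (P t y)) \<beta>
    \<le> ennreal (A powr (- \<beta>)) * epowr (wasserstein p (return borel x) (return borel y)) \<beta> + ennreal (J s t powr \<beta>)"
  proof -
    have t0: "0 \<le> t" using st by simp
    have "epowr (wasserstein p (return borel x \<bind> P s) (return borel y \<bind> P t)) \<beta>
        \<le> ennreal ((1 / measure (time_measure b) {s..t} * (LINT r:{s..t}|time_measure b. 1 / a r)) powr (- \<beta>)) *
            epowr (wasserstein p (return borel x) (return borel y)) \<beta> +
          ennreal (measure (time_measure b) {s..t} powr \<beta>)"
      using C[unfolded wasserstein_control_def, rule_format, OF return_borel_prob return_borel_prob, of s t x y] st by simp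
    then show ?thesis
      unfolding bind_return_kernel[OF st(1)] bind_return_kernel[OF t0] measure_time_measure
        dJa_integrable(2)[OF st(1)] A_def .
  qed
  also have "\<dots> \<le> ennreal (\<alpha> powr \<beta>) * epowr (ennreal (dist x y)) \<beta> + ennreal (j powr \<beta>)"
    using A j \<beta>_pos wasserstein_return_le[OF p_pos, of x y] J_nonneg[of s t]
    by (intro add_mono mult_mono ennreal_leI epowr_mono powr_mono2) auto
  also have "\<dots> = ennreal ((\<alpha> * dist x y) powr \<beta> + j powr \<beta>)"
    using \<alpha>0 by (simp add: powr_mult ennreal_mult)
  finally show ?thesis
    using \<beta>_pos by (subst (asm) epowr_le_ennreal_iff) auto
qed

text \<open>Strict bounds leave room for the limit \<open>t \<down> s\<close>, which covers \<open>s = t\<close>.\<close>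

lemma control_increment:
  assumes C: "wasserstein_control P a b p \<beta>" and st: "0 \<le> s" "s \<le> t"
    and \<alpha>: "\<And>r. s \<le> r \<Longrightarrow> r \<le> t \<Longrightarrow> a r < \<alpha>" and j: "J s t < j"
    and f: "f \<in> bounded_lipschitz"
    and h: "h \<in> borel_measurable borel" "\<And>z. 0 \<le> h z" "\<And>z. h z \<le> B'" and c: "0 \<le> c"
    and le: "\<And>z w. \<bar>f z - f w\<bar> \<le> h z powr (1 / p') * dist z w + c * dist z w powr p"
    and W: "W = ((\<alpha> * dist x y) powr \<beta> + j powr \<beta>) powr (1 / \<beta>)"
  shows "\<bar>kernel_op P t f y - kernel_op P s f x\<bar> \<le> (\<integral>z. h z \<partial>P s x) powr (1 / p') * W + c * W powr p"
proof -
  obtain B where B: "\<forall>x. \<bar>f x\<bar> \<le> B" using f by (rule bounded_lipschitzE) blast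
  have strict: "\<bar>kernel_op P t f y - kernel_op P s f x\<bar> \<le> (\<integral>z. h z \<partial>P s x) powr (1 / p') * W + c * W powr p"
    if "s < t" "\<And>r. s \<le> r \<Longrightarrow> r \<le> t \<Longrightarrow> a r < \<alpha>" "J s t < j" for t
  proof -
    have "wasserstein p (P s x) (P t y) \<le> ennreal W"
      unfolding W using control_dirac[OF C st(1) that(1), of \<alpha> j x y] that by (auto intro: less_imp_le)
    then have "\<bar>(\<integral>x. f x \<partial>P s x) - (\<integral>x. f x \<partial>P t y)\<bar> \<le> (\<integral>z. h z \<partial>P s x) powr (1 / p') * W + c * W powr p"
      by (rule integral_diff_le_wasserstein[OF exponents(1,5) bounded_lipschitz_measurable[OF f] B h c le]) (simp add: W)
    then show ?thesis unfolding kernel_op_def by (simp add: abs_minus_commute)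
  qed
  show ?thesis
  proof (cases "s < t")
    case True
    then show ?thesis using \<alpha> j by (rule strict)
  next
    case False
    then have eq: "t = s" using st by simp
    have "J s s = 0" unfolding J_def by simp
    then have j0: "0 < j" using j eq by simp
    obtain \<eta> where \<eta>: "0 < \<eta>" "\<And>r. 0 \<le> r \<Longrightarrow> \<bar>r - s\<bar> < \<eta> \<Longrightarrow> a r < \<alpha>"
      using a_near[of s \<alpha>] \<alpha>[of s] st eq by auto
    have "(J s \<longlongrightarrow> J s s) (at_right s)"
      using J_continuous[of s "s + 1"] by (simp add: continuous_on_Icc_at_rightD)
    then have "eventually (\<lambda>u. J s u < j) (at_right s)"
      using j0 \<open>J s s = 0\<close> by (intro order_tendstoD(2)) auto
    moreover have "eventually (\<lambda>u. u < s + \<eta>) (at_right s)"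
      unfolding eventually_at_right_field using \<eta>(1) by (intro exI[of _ "s + \<eta>"]) auto
    moreover have "eventually (\<lambda>u. s < u) (at_right s)" by (rule eventually_at_right_less)
    ultimately have ev: "eventually (\<lambda>u. \<bar>kernel_op P u f y - kernel_op P s f x\<bar> \<le> (\<integral>z. h z \<partial>P s x) powr (1 / p') * W + c * W powr p) (at_right s)"
    proof eventually_elim
      case (elim u)
      show ?case using elim \<eta>(2) st by (intro strict) auto
    qed
    have "((\<lambda>u. kernel_op P u f y) \<longlongrightarrow> kernel_op P s f y) (at_right s)"
      by (rule tendsto_within_subset[OF kernel_op_time_tendsto[OF f st(1)]]) (use st in auto)
    then have "((\<lambda>u. \<bar>kernel_op P u f y - kernel_op P s f x\<bar>) \<longlongrightarrow> \<bar>kernel_op P s f y - kernel_op P s f x\<bar>) (at_right s)"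
      by (intro tendsto_intros)
    then show ?thesis unfolding eq using ev by (rule tendsto_upperbound) simp
  qed
qed

lemma control_lipschitz:
  assumes C: "wasserstein_control P a b p \<beta>" and st: "0 \<le> s" "s \<le> t"
    and \<alpha>: "\<And>r. s \<le> r \<Longrightarrow> r \<le> t \<Longrightarrow> a r < \<alpha>"
    and f: "f \<in> bounded_lipschitz" "L-lipschitz_on UNIV f"
  shows "\<bar>kernel_op P t f y - kernel_op P s f x\<bar> \<le> L * (\<alpha> * dist x y + J s t)"
proof (rule field_le_epsilon)
  fix e :: real assume e: "0 < e"
  note L0 = lipschitz_on_nonneg[OF f(2)]
  interpret prob_space "P s x" using borel_probsD[OF kernel_prob[OF st(1)]] by simp
  \<comment> \<open>Strictly above \<open>J s t\<close>, as \<open>control_increment\<close>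
    requires; \<open>L + 1\<close> keeps the excess, multiplied by \<open>L\<close>, below
    \<open>e\<close>.\<close>
  define j where "j = J s t + e / (L + 1)"
  have j: "J s t < j" unfolding j_def using e L0 by simp
  have "0 < a s" using a(2) st by simp
  then have \<alpha>0: "0 \<le> \<alpha>" using \<alpha>[of s] st by simp
  define W where "W = ((\<alpha> * dist x y) powr \<beta> + j powr \<beta>) powr (1 / \<beta>)"
  have root: "(L powr p') powr (1 / p') = L" using L0 p'_pos by (simp add: powr_powr)
  have "\<bar>f z - f w\<bar> \<le> (L powr p') powr (1 / p') * dist z w + 0 * dist z w powr p" for z w
    unfolding root using lipschitz_onD[OF f(2), of z w] by (simp add: dist_real_def)
  then have "\<bar>kernel_op P t f y - kernel_op P s f x\<bar> \<le> (\<integral>z. L powr p' \<partial>P s x) powr (1 / p') * W + 0 * W powr p"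
    by (intro control_increment[OF C st \<alpha> j f(1) _ _ _ _ _ W_def, of "\<lambda>_. L powr p'" "L powr p'"]) auto
  also have "\<dots> = L * W" using root by (simp add: prob_space)
  also have "W \<le> \<alpha> * dist x y + j"
    unfolding W_def using \<alpha>0 exponents(3) j J_nonneg[of s t] by (intro powr_root_sum_le) auto
  then have "L * W \<le> L * (\<alpha> * dist x y + j)" using L0 by (intro mult_left_mono)
  also have "\<dots> = L * (\<alpha> * dist x y + J s t) + L / (L + 1) * e" unfolding j_def by (simp add: algebra_simps)
  also have "L / (L + 1) * e \<le> 1 * e" using L0 e by (intro mult_right_mono) auto
  finally show "\<bar>kernel_op P t f y - kernel_op P s f x\<bar> \<le> L * (\<alpha> * dist x y + J s t) + e" by simp
qed

lemma root_tendsto: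
  assumes "(U \<longlongrightarrow> u) F" "(V \<longlongrightarrow> v) F" "(N \<longlongrightarrow> n) F"
    and "eventually (\<lambda>x. 0 \<le> U x) F" "eventually (\<lambda>x. 0 \<le> V x) F" "eventually (\<lambda>x. 0 \<le> N x) F"
  shows "((\<lambda>x. (U x powr \<beta> + V x powr \<beta>) powr (1 / \<beta>) * N x powr (1 / p'))
    \<longlongrightarrow> (u powr \<beta> + v powr \<beta>) powr (1 / \<beta>) * n powr (1 / p')) F"
proof (intro tendsto_mult tendsto_powr' tendsto_add tendsto_const assms)
qed (use assms p'_pos \<beta>_pos in auto)

lemma root_perturbed_tendsto:
  assumes "0 \<le> u" "0 \<le> v" "0 \<le> n" "0 \<le> k"
  shows "((\<lambda>e. ((u + e * k) powr \<beta> + (v + e) powr \<beta>) powr (1 / \<beta>) * (n + e) powr (1 / p'))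
    \<longlongrightarrow> (u powr \<beta> + v powr \<beta>) powr (1 / \<beta>) * n powr (1 / p')) (at_right 0)"
proof (rule root_tendsto)
  have "eventually (\<lambda>e::real. 0 < e) (at_right 0)" by (rule eventually_at_right_less)
  then show "eventually (\<lambda>e. 0 \<le> u + e * k) (at_right 0)" "eventually (\<lambda>e. 0 \<le> v + e) (at_right 0)"
    "eventually (\<lambda>e. 0 \<le> n + e) (at_right 0)"
    by (eventually_elim; use assms in simp)+
  show "((\<lambda>e. u + e * k) \<longlongrightarrow> u) (at_right 0)" "((\<lambda>e. v + e) \<longlongrightarrow> v) (at_right 0)"
    "((\<lambda>e. n + e) \<longlongrightarrow> n) (at_right 0)"
    by (auto intro!: tendsto_eq_intros)
qed

text \<open>The coupling estimate bounds a forward space-time increment by the slope moment at its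
  starting point alone, so general Lipschitz \<open>f\<close> are admissible without any
  semicontinuity of their slopes. Since space and time are moved together, the diagonal lemma is
  used with \<open>F\<close> independent of its second argument.\<close>

lemma control_imp_geodesic:
  assumes C: "wasserstein_control P a b p \<beta>"
  shows "geodesic_space_time_estimate P a b p' \<beta>"
  unfolding geodesic_space_time_estimate_def Let_def
proof (intro allI ballI impI)
  fix \<gamma> :: "real \<Rightarrow> 'a" and s t :: real and f :: "'a \<Rightarrow> real"
  assume f: "f \<in> bounded_lipschitz" and "minimal_geodesic \<gamma> \<and> 0 \<le> s \<and> s \<le> t"
  then have \<gamma>: "minimal_geodesic \<gamma>" and st: "0 \<le> s" "s \<le> t" by auto
  obtain L where L: "L-lipschitz_on UNIV f" using f by (rule bounded_lipschitzE)
  note L0 = lipschitz_on_nonneg[OF L]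
  define D where "D = dist (\<gamma> 0) (\<gamma> 1)"
  define \<xi> where "\<xi> r = r * t + (1 - r) * s" for r
  have \<xi>: "\<xi> r' - \<xi> r = (r' - r) * (t - s)" for r r' unfolding \<xi>_def by (simp add: algebra_simps)
  have \<xi>m: "\<xi> r \<le> \<xi> r'" if "r \<le> r'" for r r'
  proof -
    have "0 \<le> (r' - r) * (t - s)" using that st by simp
    then show ?thesis using \<xi>[of r' r] by simp
  qed
  have \<xi>01: "\<xi> 0 = s" "\<xi> 1 = t" unfolding \<xi>_def by auto
  have \<xi>s: "s \<le> \<xi> r" "\<xi> r \<le> t" if "0 \<le> r" "r \<le> 1" for r using \<xi>m[of 0 r] \<xi>m[of r 1] that \<xi>01 by auto
  define u where "u r = kernel_op P (\<xi> r) f (\<gamma> r)" for r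
  obtain \<alpha> where \<alpha>: "0 < \<alpha>" "\<And>r. s \<le> r \<Longrightarrow> r \<le> t \<Longrightarrow> a r < \<alpha>" using a_bounded[OF st(1)] by blast
  have dg: "dist (\<gamma> r) (\<gamma> r') = \<bar>r - r'\<bar> * D" if "0 \<le> r" "r \<le> 1" "0 \<le> r'" "r' \<le> 1" for r r'
    using minimal_geodesicD[OF \<gamma>, of r r'] that unfolding D_def by simp
  have D0: "0 \<le> D" unfolding D_def by simp
  have incr: "\<bar>u r' - u r\<bar> \<le> L * (\<alpha> * (\<bar>r' - r\<bar> * D) + J (\<xi> r) (\<xi> r'))" if "0 \<le> r" "r \<le> r'" "r' \<le> 1" for r r'
  proof -
    have x: "s \<le> \<xi> r" "\<xi> r \<le> \<xi> r'" "\<xi> r' \<le> t" using \<xi>s(1)[of r] \<xi>s(2)[of r'] \<xi>m[of r r'] that by linarith+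
    have "\<bar>kernel_op P (\<xi> r') f (\<gamma> r') - kernel_op P (\<xi> r) f (\<gamma> r)\<bar> \<le> L * (\<alpha> * dist (\<gamma> r) (\<gamma> r') + J (\<xi> r) (\<xi> r'))"
    proof (rule control_lipschitz[OF C _ x(2) _ f L])
      show "0 \<le> \<xi> r" using x st by linarith
      show "a y < \<alpha>" if "\<xi> r \<le> y" "y \<le> \<xi> r'" for y using \<alpha>(2)[of y] x that by linarith
    qed
    moreover have "dist (\<gamma> r) (\<gamma> r') = \<bar>r' - r\<bar> * D" using dg[of r r'] that by (simp add: abs_minus_commute)
    ultimately show ?thesis unfolding u_def by simp
  qed
  have Jx: "J (\<xi> r) (\<xi> r') = J s (\<xi> r') - J s (\<xi> r)" if "0 \<le> r" "r \<le> r'" "r' \<le> 1" for r r'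
    using J_combine[of s "\<xi> r" "\<xi> r'"] \<xi>s[of r] \<xi>m[of r r'] that by simp
  have u_cont: "continuous_on {0..1} u"
  proof -
    have "continuous_on {0..1} \<xi>" unfolding \<xi>_def by (intro continuous_intros)
    then have cG: "continuous_on {0..1} (\<lambda>r. L * (\<alpha> * (r * D) + J s (\<xi> r)))"
      using \<xi>s by (intro continuous_intros continuous_on_compose2[OF J_continuous[of s t]]) auto
    define G where "G r = L * (\<alpha> * (r * D) + J s (\<xi> r))" for r
    have le1: "\<bar>u r' - u r\<bar> \<le> \<bar>G r' - G r\<bar>" if "0 \<le> r" "r \<le> r'" "r' \<le> 1" for r r'
      using incr[OF that] that unfolding Jx[OF that] G_def by (simp add: algebra_simps)
    have le: "\<bar>u r' - u r\<bar> \<le> \<bar>G r' - G r\<bar>" if "r \<in> {0..1}" "r' \<in> {0..1}" for r r'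
      using le1[of r r'] le1[of r' r] that by (cases "r \<le> r'") (auto simp: abs_minus_commute)
    show ?thesis unfolding continuous_on_def
    proof
      fix r :: real assume r: "r \<in> {0..1}"
      have "(G \<longlongrightarrow> G r) (at r within {0..1})"
        using cG r unfolding continuous_on_def G_def[abs_def] by blast
      then have "((\<lambda>r'. \<bar>G r' - G r\<bar>) \<longlongrightarrow> 0) (at r within {0..1})"
        by (intro tendsto_rabs_zero) (simp add: LIM_zero)
      then have "((\<lambda>r'. u r' - u r) \<longlongrightarrow> 0) (at r within {0..1})"
        by (rule Lim_null_comparison[rotated]) (use le r in \<open>auto simp: eventually_at_filter intro!: always_eventually\<close>)
      then show "(u \<longlongrightarrow> u r) (at r within {0..1})" by (simp add: LIM_zero_iff)
    qed
  qed
  have pos: "0 < \<xi> r" if "0 < r" "s \<noteq> t" "r < 1" for r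
  proof -
    have "0 < r * (t - s)" using that st by simp
    then show ?thesis using \<xi>[of r 0] \<xi>01 st by simp
  qed
  \<comment> \<open>\<open>0 < r0\<close> matters when \<open>s = 0 < t\<close>: the density of
    \<open>J\<close> is bounded only away from time \<open>0\<close>.\<close>
  have Jbound: "\<exists>m\<ge>0. \<forall>r\<in>{r0..r1}. \<forall>r'\<in>{r0..r1}. r \<le> r' \<longrightarrow> J (\<xi> r) (\<xi> r') \<le> m * (r' - r)"
    if r01: "0 < r0" "r1 < 1" for r0 r1
  proof (cases "s = t")
    case True
    then have "\<xi> r = s" for r unfolding \<xi>_def by (simp add: algebra_simps)
    then show ?thesis unfolding J_def by (intro exI[of _ 0]) simp
  next
    case False
    show ?thesis
    proof (cases "r0 \<le> r1")
      case True
      obtain m where m: "0 < m" "\<And>r. \<xi> r0 \<le> r \<Longrightarrow> r \<le> t \<Longrightarrow> d\<^sub>J r \<le> m"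
        using dJ_bounded[OF pos[of r0]] r01 True False by auto
      have "J (\<xi> r) (\<xi> r') \<le> m * (t - s) * (r' - r)" if "r \<in> {r0..r1}" "r' \<in> {r0..r1}" "r \<le> r'" for r r'
      proof -
        have "J (\<xi> r) (\<xi> r') \<le> m * (\<xi> r' - \<xi> r)"
          using that \<xi>m[of r r'] \<xi>m[of r0 r] \<xi>s[of r'] \<xi>s[of r] r01 st by (intro J_le m(2)) auto
        then show ?thesis by (simp add: \<xi> mult_ac)
      qed
      then show ?thesis using m st by (intro exI[of _ "m * (t - s)"]) auto
    qed (auto intro: exI[of _ 0])
  qed
  define \<theta> where "\<theta> r = ennreal ((a (\<xi> r) powr \<beta> * dist (\<gamma> 0) (\<gamma> 1) powr \<beta> + ((t - s) / b (\<xi> r)) powr \<beta>) powr (1 / \<beta>)) *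
      epowr (\<integral>\<^sup>+ y. epowr (local_lip f y) p' \<partial>P (\<xi> r) (\<gamma> r)) (1 / p')" for r
  have "ennreal \<bar>u 1 - u 0\<bar> \<le> (\<integral>\<^sup>+ r\<in>{0..1}. \<theta> r \<partial>lborel)"
  proof (rule diagonal_increment_le[where F="\<lambda>r _. u r"])
    show "continuous_on {0..1} u" by (rule u_cont)
    fix r0 r1 :: real assume r01: "0 < r0" "r1 < 1"
    obtain m where m: "0 \<le> m" "\<And>r r'. r \<in> {r0..r1} \<Longrightarrow> r' \<in> {r0..r1} \<Longrightarrow> r \<le> r' \<Longrightarrow> J (\<xi> r) (\<xi> r') \<le> m * (r' - r)"
      using Jbound[OF r01] by blast
    define K where "K = L * (\<alpha> * D + m)"
    have K0: "0 \<le> K" unfolding K_def using L0 \<alpha> D0 m by simp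
    have le1: "\<bar>u r' - u r\<bar> \<le> K * \<bar>r' - r\<bar>" if "r \<in> {r0..r1}" "r' \<in> {r0..r1}" "r \<le> r'" for r r'
    proof -
      have "\<bar>u r' - u r\<bar> \<le> L * (\<alpha> * (\<bar>r' - r\<bar> * D) + J (\<xi> r) (\<xi> r'))" using that r01 by (intro incr) auto
      also have "\<dots> \<le> L * (\<alpha> * (\<bar>r' - r\<bar> * D) + m * (r' - r))"
        using m(2)[OF that] L0 by (intro mult_left_mono add_left_mono)
      also have "\<dots> = K * \<bar>r' - r\<bar>" unfolding K_def using that by (simp add: algebra_simps)
      finally show ?thesis .
    qed
    have "\<bar>u r - u r'\<bar> \<le> K * (\<bar>r - r'\<bar> + \<bar>x - x'\<bar>)" if "r \<in> {r0..r1}" "r' \<in> {r0..r1}" for r r' x x'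
    proof -
      have "\<bar>u r - u r'\<bar> \<le> K * \<bar>r - r'\<bar>"
        using le1[of r r'] le1[of r' r] that by (cases "r \<le> r'") (auto simp: abs_minus_commute)
      also have "\<dots> \<le> K * (\<bar>r - r'\<bar> + \<bar>x - x'\<bar>)" using K0 by (intro mult_left_mono) auto
      finally show ?thesis .
    qed
    then show "\<exists>L\<ge>0. \<forall>r\<in>{r0..r1}. \<forall>r'\<in>{r0..r1}. \<forall>s\<in>{r0..r1}. \<forall>s'\<in>{r0..r1}. \<bar>u r - u r'\<bar> \<le> L * (\<bar>r - r'\<bar> + \<bar>s - s'\<bar>)"
      using K0 by blast
  next
    fix r :: real assume r: "0 < r" "r < 1"
    have \<xi>r: "0 \<le> \<xi> r" using \<xi>s[of r] r st by simp
    define v where "v = (t - s) * d\<^sub>J (\<xi> r)"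
    have v0: "0 \<le> v" unfolding v_def using st dJ_nonneg by simp
    \<comment> \<open>For \<open>s = t\<close> both sides vanish whatever the value of
      \<open>b\<close> is, including at time \<open>0\<close>; for \<open>s < t\<close> the time
      \<open>\<xi> r\<close> is positive.\<close>
    have vb: "((t - s) / b (\<xi> r)) powr \<beta> = v powr \<beta>"
    proof (cases "s = t")
      case False
      then show ?thesis using pos[OF r(1) False r(2)] unfolding v_def density_on_pos_def by simp
    qed (simp add: v_def)
    define n where "n = (\<integral>y. lip f y powr p' \<partial>P (\<xi> r) (\<gamma> r))"
    have n0: "0 \<le> n" unfolding n_def by simp
    define A0 where "A0 = ((a (\<xi> r) * D) powr \<beta> + v powr \<beta>) powr (1 / \<beta>) * n powr (1 / p')"
    have a0: "0 < a (\<xi> r)" using a(2) \<xi>r by simp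
    have \<theta>: "\<theta> r = ennreal A0"
      unfolding \<theta>_def A0_def epowr_nn_integral_local_lip[OF kernel_prob[OF \<xi>r] L p'_pos] vb n_def[symmetric] D_def[symmetric]
      using n0 a0 D0 by (simp add: powr_mult ennreal_mult)
    have "limsup (\<lambda>k. ennreal (real k * (\<bar>u r - u r\<bar> + \<bar>u (r + 1 / real k) - u r\<bar>))) \<le> ennreal A0"
    proof (rule limsup_ennreal_leI)
      fix K assume K: "A0 < K"
      have "eventually (\<lambda>e. ((a (\<xi> r) * D + e * D) powr \<beta> + (v + e) powr \<beta>) powr (1 / \<beta>) * (n + e) powr (1 / p') < K) (at_right 0)"
        using a0 D0 v0 n0 K unfolding A0_def by (intro order_tendstoD(2)[OF root_perturbed_tendsto]) auto
      then obtain e where e: "0 < e" "((a (\<xi> r) * D + e * D) powr \<beta> + (v + e) powr \<beta>) powr (1 / \<beta>) * (n + e) powr (1 / p') < K"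
        unfolding eventually_at_right_field using dense by blast
      obtain h c where h: "h \<in> borel_measurable borel" "\<And>z. 0 \<le> h z" "\<And>z. h z \<le> L powr p'"
          "(\<integral>y. h y \<partial>P (\<xi> r) (\<gamma> r)) < n + e" "0 \<le> c"
          "\<And>z w. \<bar>f z - f w\<bar> \<le> h z powr (1 / p') * dist z w + c * dist z w powr p"
        using lipschitz_slope_approx[OF exponents(1,5) L kernel_prob[OF \<xi>r], of "\<gamma> r" "n + e"] e n_def by auto
      define w where "w = ((a (\<xi> r) * D + e * D) powr \<beta> + (v + e) powr \<beta>) powr (1 / \<beta>)"
      have w0: "0 \<le> w" unfolding w_def by simp
      have ev1: "eventually (\<lambda>k. (\<forall>x. \<xi> r \<le> x \<and> x \<le> \<xi> (r + 1 / real k) \<longrightarrow> a x < a (\<xi> r) + e)) sequentially"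
        and ev2: "eventually (\<lambda>k. J (\<xi> r) (\<xi> (r + 1 / real k)) < (v + e) / real k) sequentially"
      proof -
        have xilim: "(\<lambda>k. \<xi> (r + 1 / real k)) \<longlonglongrightarrow> \<xi> r"
        proof -
          have "(\<lambda>k. \<xi> r + 1 / real k * (t - s)) \<longlonglongrightarrow> \<xi> r + 0 * (t - s)" by (intro tendsto_intros lim_1_over_n)
          moreover have "\<xi> (r + 1 / real k) = \<xi> r + 1 / real k * (t - s)" for k
            using \<xi>[of "r + 1 / real k" r] by simp
          ultimately show ?thesis by simp
        qed
        obtain \<eta> where \<eta>: "0 < \<eta>" "\<And>x. 0 \<le> x \<Longrightarrow> \<bar>x - \<xi> r\<bar> < \<eta> \<Longrightarrow> a x < a (\<xi> r) + e"
          using a_near[OF \<xi>r, of "a (\<xi> r) + e"] e by auto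
        have "eventually (\<lambda>k. \<xi> (r + 1 / real k) < \<xi> r + \<eta>) sequentially"
          using order_tendstoD(2)[OF xilim] \<eta>(1) by simp
        then show "eventually (\<lambda>k. (\<forall>x. \<xi> r \<le> x \<and> x \<le> \<xi> (r + 1 / real k) \<longrightarrow> a x < a (\<xi> r) + e)) sequentially"
          by eventually_elim (use \<eta>(2) \<xi>r in auto)
        show "eventually (\<lambda>k. J (\<xi> r) (\<xi> (r + 1 / real k)) < (v + e) / real k) sequentially"
        proof (cases "s = t")
          case True
          then have "\<xi> r = s" for r unfolding \<xi>_def by (simp add: algebra_simps)
          then show ?thesis using v0 e unfolding J_def by (intro eventually_sequentiallyI[of 1]) auto
        next
          case False
          then have ts: "0 < t - s" using st by simp
          obtain \<eta>' where \<eta>': "0 < \<eta>'" "\<And>x. \<bar>x - \<xi> r\<bar> < \<eta>' \<Longrightarrow> d\<^sub>J x < d\<^sub>J (\<xi> r) + e / 2 / (t - s)"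
            using dJ_near[OF pos[OF r(1) False r(2)], of "d\<^sub>J (\<xi> r) + e / 2 / (t - s)"] e ts by auto
          have "eventually (\<lambda>k. \<xi> (r + 1 / real k) < \<xi> r + \<eta>') sequentially"
            using order_tendstoD(2)[OF xilim] \<eta>'(1) by simp
          then show ?thesis using eventually_gt_at_top[of 0]
          proof eventually_elim
            case (elim k)
            have "J (\<xi> r) (\<xi> (r + 1 / real k)) \<le> (d\<^sub>J (\<xi> r) + e / 2 / (t - s)) * (\<xi> (r + 1 / real k) - \<xi> r)"
              using elim \<xi>m[of r "r + 1 / real k"] \<xi>r by (intro J_le less_imp_le[OF \<eta>'(2)]) auto
            also have "\<dots> = (v + e / 2) / real k" unfolding \<xi> v_def using ts elim by (simp add: field_simps)
            also have "\<dots> < (v + e) / real k" using e elim by (intro divide_strict_right_mono) auto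
            finally show ?case .
          qed
        qed
      qed
      have "eventually (\<lambda>k. 1 / real k < 1 - r) sequentially"
        using r by (intro order_tendstoD(2)[OF lim_1_over_n]) auto
      \<comment> \<open>The remainder is of order \<open>k powr (- p)\<close> per step, hence
        negligible after multiplication by \<open>k\<close>, because \<open>1 < p\<close>.\<close>
      moreover have "eventually (\<lambda>k. (n + e) powr (1 / p') * w + c * w powr p * real k powr (1 - p) < K) sequentially"
      proof (rule order_tendstoD(2))
        have "((\<lambda>k. real k powr (1 - p)) \<longlonglongrightarrow> 0)"
          using exponents(1) filterlim_real_sequentially by (intro tendsto_neg_powr) auto
        then show "(\<lambda>k. (n + e) powr (1 / p') * w + c * w powr p * real k powr (1 - p)) \<longlonglongrightarrow> (n + e) powr (1 / p') * w + c * w powr p * 0"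
          by (intro tendsto_add tendsto_const tendsto_mult_left)
        show "(n + e) powr (1 / p') * w + c * w powr p * 0 < K" using e(2) unfolding w_def by (simp add: mult.commute)
      qed
      ultimately show "eventually (\<lambda>k. real k * (\<bar>u r - u r\<bar> + \<bar>u (r + 1 / real k) - u r\<bar>) \<le> K) sequentially"
        using ev1 ev2 eventually_gt_at_top[of 0]
      proof eventually_elim
        case (elim k)
        define W where "W = (((a (\<xi> r) + e) * dist (\<gamma> r) (\<gamma> (r + 1 / real k))) powr \<beta> + ((v + e) / real k) powr \<beta>) powr (1 / \<beta>)"
        have k: "0 < real k" using elim by simp
        have "(a (\<xi> r) + e) * dist (\<gamma> r) (\<gamma> (r + 1 / real k)) = (a (\<xi> r) * D + e * D) / real k"
          using dg[of r "r + 1 / real k"] r elim by (simp add: algebra_simps add_divide_distrib)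
        moreover have "((a (\<xi> r) * D + e * D) / real k) powr \<beta> = (a (\<xi> r) * D + e * D) powr \<beta> / real k powr \<beta>"
          "((v + e) / real k) powr \<beta> = (v + e) powr \<beta> / real k powr \<beta>"
          using a0 e D0 v0 k by (intro powr_divide; simp)+
        ultimately have "W = (((a (\<xi> r) * D + e * D) powr \<beta> + (v + e) powr \<beta>) / real k powr \<beta>) powr (1 / \<beta>)"
          unfolding W_def by (simp only: add_divide_distrib)
        also have "\<dots> = w / real k"
          unfolding w_def using k \<beta>_pos by (simp add: powr_divide powr_powr)
        finally have Ww: "W = w / real k" .
        have "\<bar>u (r + 1 / real k) - u r\<bar> \<le> (\<integral>z. h z \<partial>P (\<xi> r) (\<gamma> r)) powr (1 / p') * W + c * W powr p"
          unfolding u_def using elim \<xi>m[of r "r + 1 / real k"] \<xi>r h W_def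
          by (intro control_increment[OF C \<xi>r _ _ _ f, where \<alpha>="a (\<xi> r) + e" and j="(v + e) / real k" and B'="L powr p'"]) auto
        also have "\<dots> \<le> (n + e) powr (1 / p') * W + c * W powr p"
          using h n0 e w0 k p'_pos by (intro add_right_mono mult_right_mono powr_mono2) (auto simp: Ww)
        finally have "real k * \<bar>u (r + 1 / real k) - u r\<bar> \<le> real k * ((n + e) powr (1 / p') * W + c * W powr p)"
          using k by (intro mult_left_mono) auto
        also have "\<dots> = (n + e) powr (1 / p') * w + c * w powr p * real k powr (1 - p)"
          unfolding Ww using k w0 by (simp add: powr_divide powr_diff algebra_simps)
        finally show ?case using elim by simp
      qed
    qed (simp add: A0_def)
    then show "limsup (\<lambda>n. ennreal (real n * (\<bar>u r - u r\<bar> + \<bar>u (r + 1 / real n) - u r\<bar>))) \<le> \<theta> r"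
      unfolding \<theta> .
  qed
  then show "ennreal \<bar>kernel_op P t f (\<gamma> 1) - kernel_op P s f (\<gamma> 0)\<bar> \<le> (\<integral>\<^sup>+ r\<in>{0..1}.
     ennreal ((a (r * t + (1 - r) * s) powr \<beta> * dist (\<gamma> 0) (\<gamma> 1) powr \<beta> + ((t - s) / b (r * t + (1 - r) * s)) powr \<beta>) powr (1 / \<beta>)) *
     epowr (\<integral>\<^sup>+ y. epowr (local_lip f y) p' \<partial>P (r * t + (1 - r) * s) (\<gamma> r)) (1 / p') \<partial>lborel)"
    unfolding u_def \<theta>_def \<xi>01 unfolding \<xi>_def .
qed

text \<open>A geodesic to a second point passes arbitrarily close to \<open>x\<close>, so isolated
  points occur only in a one-point space. There \<open>local_lip\<close> carries no information and
  the generator is treated separately.\<close>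

lemma singleton_or_near:
  fixes x :: 'a
  obtains "\<And>y. y = x" | "\<And>r. 0 < r \<Longrightarrow> \<exists>y. 0 < dist x y \<and> dist x y < r"
proof (cases "\<forall>y. y = x")
  case False
  then obtain z where z: "z \<noteq> x" by blast
  obtain \<gamma> where \<gamma>: "minimal_geodesic \<gamma>" "\<gamma> 0 = x" "\<gamma> 1 = z" using geodesic by blast
  have d: "0 < dist x z" using z by simp
  have "\<exists>y. 0 < dist x y \<and> dist x y < r" if r: "0 < r" for r
  proof -
    define l where "l = min 1 (r / 2 / dist x z)"
    have l: "0 < l" "l \<le> 1" "l * dist x z < r"
      unfolding l_def using r d by (auto simp: min_def field_simps)
    have "dist x (\<gamma> l) = l * dist x z"
      using minimal_geodesicD[OF \<gamma>(1), of 0 l] l \<gamma> by simp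
    then show ?thesis using l d by (intro exI[of _ "\<gamma> l"]) simp
  qed
  then show ?thesis by (rule that(2))
qed (use that(1) in blast)

lemma generator_singleton:
  assumes "\<And>y. y = x" "f \<in> bounded_lipschitz" "0 < t"
  shows "gen_semigroup P f t x = 0"
proof -
  have const: "kernel_op P s f x = f x" if "0 \<le> s" for s
  proof -
    interpret prob_space "P s x" using borel_probsD[OF kernel_prob[OF that]] by simp
    have "(\<integral>y. f y \<partial>P s x) = (\<integral>y. f x \<partial>P s x)"
      by (rule Bochner_Integration.integral_cong) (auto intro!: arg_cong[of _ _ f] assms(1))
    then show ?thesis unfolding kernel_op_def by (simp add: prob_space)
  qed
  have "((\<lambda>s. kernel_op P s f x) has_real_derivative 0) (at t)"
  proof (rule has_field_derivative_transform_within_open[where S="{0<..}"])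
    show "((\<lambda>s. f x) has_real_derivative 0) (at t)" by simp
    show "f x = kernel_op P s f x" if "s \<in> {0<..}" for s using const[of s] that by simp
  qed (use assms in auto)
  then show ?thesis using kernel_op_has_derivative[OF assms(2,3)] DERIV_unique by blast
qed

lemma dJ_eq: "0 < t \<Longrightarrow> d\<^sub>J t = 1 / b t"
  by (simp add: density_on_pos_def)

section \<open>Increments along geodesics in space and time\<close>

lemma lip_moment_le:
  assumes "0 \<le> t" "L-lipschitz_on UNIV f"
  shows "(\<integral>y. lip f y powr p' \<partial>P t x) \<le> L powr p'"
proof -
  interpret prob_space "P t x" using borel_probsD(1)[OF kernel_prob[OF assms(1)]] .
  have "(\<integral>y. lip f y powr p' \<partial>P t x) \<le> (\<integral>y. L powr p' \<partial>P t x)"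
    using p'_pos lip_le[OF assms(2)]
    by (intro integral_mono integrable_powr_lip[OF kernel_prob[OF assms(1)] assms(2)] powr_mono2) auto
  then show ?thesis by (simp add: prob_space)
qed

text \<open>The left-hand side being nonnegative, so is the right-hand side \<open>Z\<close>, and
  the inequality descends from \<open>ereal\<close> to the reals. Without the generator term it
  bounds \<open>local_lip\<close>, whence \<open>kernel_op P t f\<close> is Lipschitz on a geodesic
  space; this finiteness is what allows the full inequality to be stated with
  \<open>lip\<close>.\<close>

lemma gradient_estimateD:
  assumes E: "hopf_lax_gradient_estimate P a b p p' \<beta>'" and t: "0 < t" and \<delta>: "0 < \<delta>"
    and g: "g \<in> bounded_lipschitz" and f: "f = hopf_lax p \<delta> g" and L: "L-lipschitz_on UNIV f"
  shows "(a t * L)-lipschitz_on UNIV (kernel_op P t f)"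
    and "(lip (kernel_op P t f) x / a t) powr \<beta>' + (b t * \<bar>gen_semigroup P f t x\<bar>) powr \<beta>'
      \<le> (\<integral>y. lip f y powr p' \<partial>P t x) powr (\<beta>' / p')"
proof -
  have t0: "0 \<le> t" using t by simp
  note L0 = lipschitz_on_nonneg[OF L]
  have at0: "0 < a t" and bt0: "0 < b t" using a(2) b(2) t by auto
  define n where "n x = (\<integral>y. lip f y powr p' \<partial>P t x)" for x
  have n0: "0 \<le> n x" for x unfolding n_def by simp
  define Z where "Z x = a t powr \<beta>' * (n x powr (\<beta>' / p') - b t powr \<beta>' * \<bar>gen_semigroup P f t x\<bar> powr \<beta>')" for x
  have "enn2ereal (epowr (local_lip (kernel_op P t f) x) \<beta>') \<le> ereal (Z x)" for x
  proof -
    have "enn2ereal (epowr (\<integral>\<^sup>+ y. epowr (local_lip f y) p' \<partial>P t x) (\<beta>' / p')) = ereal (n x powr (\<beta>' / p'))"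
      unfolding epowr_nn_integral_local_lip[OF kernel_prob[OF t0] L p'_pos] n_def[symmetric]
      using n0 by (simp add: enn2ereal_ennreal)
    then show ?thesis
      using E[unfolded hopf_lax_gradient_estimate_def, rule_format, OF t \<delta> g f, of x] unfolding Z_def by simp
  qed
  note le = this
  have Z0: "0 \<le> Z x" for x using order_trans[OF enn2ereal_nonneg le[of x]] by simp
  have "epowr (local_lip (kernel_op P t f) x) \<beta>' \<le> ennreal (Z x)" for x
    using le[of x] Z0[of x] by (simp add: less_eq_ennreal.rep_eq enn2ereal_ennreal)
  then have ll: "local_lip (kernel_op P t f) x \<le> ennreal (Z x powr (1 / \<beta>'))" for x
    using epowr_le_ennreal_iff[OF \<beta>'_pos Z0] by blast
  have nL: "n x \<le> L powr p'" for x
    unfolding n_def by (rule lip_moment_le[OF t0 L])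
  have "Z x powr (1 / \<beta>') \<le> a t * L" for x
  proof -
    have "n x powr (\<beta>' / p') \<le> (L powr p') powr (\<beta>' / p')"
      using nL n0 p'_pos \<beta>'_pos by (intro powr_mono2) auto
    also have "\<dots> = L powr \<beta>'" using p'_pos by (simp add: powr_powr)
    finally have "Z x \<le> a t powr \<beta>' * L powr \<beta>'" unfolding Z_def by (intro mult_left_mono) (auto intro: order_trans[rotated])
    then have "Z x \<le> (a t * L) powr \<beta>'" using at0 L0 by (simp add: powr_mult)
    then have "Z x powr (1 / \<beta>') \<le> ((a t * L) powr \<beta>') powr (1 / \<beta>')"
      using Z0 \<beta>'_pos by (intro powr_mono2) auto
    then show ?thesis using \<beta>'_pos at0 L0 by (simp add: powr_powr)
  qed
  then have "local_lip (kernel_op P t f) x \<le> ennreal (a t * L)" for x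
    using order_trans[OF ll ennreal_leI] by blast
  then show lipP: "(a t * L)-lipschitz_on UNIV (kernel_op P t f)"
    using at0 L0 by (intro lipschitz_if_local_lip_le[OF geodesic]) auto
  define X where "X = lip (kernel_op P t f) x"
  have X0: "0 \<le> X" unfolding X_def by simp
  have "X powr \<beta>' \<le> Z x"
    using le[of x] X0 unfolding local_lip_eq_lip[OF lipP] X_def[symmetric] by (simp add: enn2ereal_ennreal)
  then have "X powr \<beta>' / a t powr \<beta>' \<le> n x powr (\<beta>' / p') - b t powr \<beta>' * \<bar>gen_semigroup P f t x\<bar> powr \<beta>'"
    unfolding Z_def using at0 by (simp add: divide_le_eq mult.commute)
  then show "(lip (kernel_op P t f) x / a t) powr \<beta>' + (b t * \<bar>gen_semigroup P f t x\<bar>) powr \<beta>'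
      \<le> (\<integral>y. lip f y powr p' \<partial>P t x) powr (\<beta>' / p')"
    using X0 at0 bt0 unfolding X_def[symmetric] n_def by (simp add: powr_divide powr_mult)
qed

text \<open>The local form shared by conditions (2) and (3); \<open>s > 0\<close> keeps away from the value of \<open>b\<close> at \<open>0\<close>.\<close>

definition hopf_lax_increment_bound :: bool where
  "hopf_lax_increment_bound \<longleftrightarrow>
     (\<forall>g\<in>bounded_lipschitz. \<forall>\<delta>>0. \<forall>\<gamma> s t \<alpha> m K. minimal_geodesic \<gamma> \<longrightarrow> 0 < s \<longrightarrow> s < t \<longrightarrow>
        (\<forall>r\<in>{0..1}. let \<xi> = r * t + (1 - r) * s in
          a \<xi> \<le> \<alpha> \<and> d\<^sub>J \<xi> \<le> m \<and> (\<integral>y. lip (hopf_lax p \<delta> g) y powr p' \<partial>P \<xi> (\<gamma> r)) \<le> K) \<longrightarrow>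
        \<bar>kernel_op P t (hopf_lax p \<delta> g) (\<gamma> 1) - kernel_op P s (hopf_lax p \<delta> g) (\<gamma> 0)\<bar>
          \<le> ((\<alpha> * dist (\<gamma> 0) (\<gamma> 1)) powr \<beta> + ((t - s) * m) powr \<beta>) powr (1 / \<beta>) * K powr (1 / p'))"

text \<open>The space variable and the time variable of \<open>F\<close> are separated, because the
  gradient estimate controls the two partial rates at one point but no joint derivative. The rates
  \<open>D * X\<close> and \<open>h * Y\<close> are combined by the two-term Hoelder inequality and
  integrated by the diagonal lemma.\<close>

lemma gradient_imp_increment_bound:
  assumes E: "hopf_lax_gradient_estimate P a b p p' \<beta>'"
  shows hopf_lax_increment_bound
  unfolding hopf_lax_increment_bound_def Let_def
proof (intro ballI allI impI)
  fix g :: "'a \<Rightarrow> real" and \<delta> s t \<alpha> m K :: real and \<gamma> :: "real \<Rightarrow> 'a"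
  assume g: "g \<in> bounded_lipschitz" and \<delta>: "0 < \<delta>" and \<gamma>: "minimal_geodesic \<gamma>" and s: "0 < s" and st: "s < t"
  define f where "f = hopf_lax p \<delta> g"
  define \<xi> where "\<xi> r = r * t + (1 - r) * s" for r
  assume "\<forall>r\<in>{0..1}. a (r * t + (1 - r) * s) \<le> \<alpha> \<and> d\<^sub>J (r * t + (1 - r) * s) \<le> m \<and>
      (\<integral>y. lip (hopf_lax p \<delta> g) y powr p' \<partial>P (r * t + (1 - r) * s) (\<gamma> r)) \<le> K"
  then have bd: "a (\<xi> r) \<le> \<alpha>" "d\<^sub>J (\<xi> r) \<le> m" "(\<integral>y. lip f y powr p' \<partial>P (\<xi> r) (\<gamma> r)) \<le> K" if "0 \<le> r" "r \<le> 1" for r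
    using that unfolding \<xi>_def f_def by auto
  obtain B where B: "\<forall>x. \<bar>g x\<bar> \<le> B" using g by (rule bounded_lipschitzE) blast
  have fBL: "f \<in> bounded_lipschitz"
    unfolding f_def by (rule hopf_lax_bounded_lipschitz[OF exponents(1,5) B \<delta>])
  obtain L where L: "L-lipschitz_on UNIV f" using fBL by (rule bounded_lipschitzE)
  note L0 = lipschitz_on_nonneg[OF L]
  have gr1: "(a \<tau> * L)-lipschitz_on UNIV (kernel_op P \<tau> f)" if "0 < \<tau>" for \<tau>
    by (rule gradient_estimateD(1)[OF E that \<delta> g f_def L])
  have gr2: "(lip (kernel_op P \<tau> f) x / a \<tau>) powr \<beta>' + (b \<tau> * \<bar>gen_semigroup P f \<tau> x\<bar>) powr \<beta>'
      \<le> (\<integral>y. lip f y powr p' \<partial>P \<tau> x) powr (\<beta>' / p')" if "0 < \<tau>" for \<tau> x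
    by (rule gradient_estimateD(2)[OF E that \<delta> g f_def L])
  define D where "D = dist (\<gamma> 0) (\<gamma> 1)"
  have D0: "0 \<le> D" unfolding D_def by simp
  define h where "h = t - s"
  have h: "0 < h" unfolding h_def using st by simp
  have \<xi>: "\<xi> r = s + r * h" for r unfolding \<xi>_def h_def by (simp add: algebra_simps)
  have \<xi>d: "\<xi> r' - \<xi> r = (r' - r) * h" for r r' unfolding \<xi> by (simp add: algebra_simps)
  have \<xi>s: "s \<le> \<xi> r" "\<xi> r \<le> t" if "0 \<le> r" "r \<le> 1" for r
  proof -
    have "0 \<le> r * h" "r * h \<le> h" using that h mult_left_le_one_le[of h r] by auto
    then show "s \<le> \<xi> r" "\<xi> r \<le> t" unfolding \<xi> h_def by linarith+
  qed
  obtain \<alpha>' where \<alpha>': "0 < \<alpha>'" "\<And>r. s \<le> r \<Longrightarrow> r \<le> t \<Longrightarrow> a r < \<alpha>'" using a_bounded[of s t] s by auto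
  obtain m' where m': "0 < m'" "\<And>r. s \<le> r \<Longrightarrow> r \<le> t \<Longrightarrow> d\<^sub>J r \<le> m'" using dJ_bounded[OF s, of t] by blast
  have dg: "dist (\<gamma> r) (\<gamma> r') = \<bar>r - r'\<bar> * D" if "0 \<le> r" "r \<le> 1" "0 \<le> r'" "r' \<le> 1" for r r'
    using minimal_geodesicD[OF \<gamma>, of r r'] that unfolding D_def by simp
  \<comment> \<open>Dropping the gradient term bounds the generator by \<open>L / b \<tau>\<close>,
    which the mean value inequality turns into Lipschitz continuity in time.\<close>
  have Yle: "\<bar>gen_semigroup P f \<tau> x\<bar> \<le> L * d\<^sub>J \<tau>" if "0 < \<tau>" for \<tau> x
  proof -
    have bt: "0 < b \<tau>" using b(2) that by auto
    have "(b \<tau> * \<bar>gen_semigroup P f \<tau> x\<bar>) powr \<beta>' \<le> (\<integral>y. lip f y powr p' \<partial>P \<tau> x) powr (\<beta>' / p')"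
      using gr2[OF that, of x] by (smt (verit) powr_ge_zero)
    also have "\<dots> \<le> (L powr p') powr (\<beta>' / p')"
      using lip_moment_le[OF less_imp_le[OF that] L] p'_pos \<beta>'_pos by (intro powr_mono2) auto
    also have "\<dots> = L powr \<beta>'" using p'_pos by (simp add: powr_powr)
    finally have le: "(b \<tau> * \<bar>gen_semigroup P f \<tau> x\<bar>) powr \<beta>' \<le> L powr \<beta>'" .
    have "((b \<tau> * \<bar>gen_semigroup P f \<tau> x\<bar>) powr \<beta>') powr (1 / \<beta>') \<le> (L powr \<beta>') powr (1 / \<beta>')"
      using powr_mono2[OF _ _ le, of "1 / \<beta>'"] \<beta>'_pos by simp
    then have "b \<tau> * \<bar>gen_semigroup P f \<tau> x\<bar> \<le> L"
      using \<beta>'_pos L0 bt by (simp add: powr_powr)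
    then show ?thesis using bt unfolding dJ_eq[OF that] by (simp add: field_simps)
  qed
  have time: "\<bar>kernel_op P \<tau>' f x - kernel_op P \<tau> f x\<bar> \<le> L * m' * \<bar>\<tau>' - \<tau>\<bar>"
    if "s \<le> \<tau>" "\<tau> \<le> t" "s \<le> \<tau>'" "\<tau>' \<le> t" for \<tau> \<tau>' x
  proof -
    have "norm (kernel_op P \<tau>' f x - kernel_op P \<tau> f x) \<le> L * m' * norm (\<tau>' - \<tau>)"
    proof (rule field_differentiable_bound[where S="{s..t}" and f'="\<lambda>\<tau>. gen_semigroup P f \<tau> x"])
      fix \<sigma> assume \<sigma>: "\<sigma> \<in> {s..t}"
      then have p: "0 < \<sigma>" using s by simp
      show "((\<lambda>\<tau>. kernel_op P \<tau> f x) has_field_derivative gen_semigroup P f \<sigma> x) (at \<sigma> within {s..t})"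
        using kernel_op_has_derivative[OF fBL p] by (rule has_field_derivative_at_within)
      have "L * d\<^sub>J \<sigma> \<le> L * m'" using m'(2)[of \<sigma>] \<sigma> L0 by (intro mult_left_mono) auto
      then show "norm (gen_semigroup P f \<sigma> x) \<le> L * m'" using Yle[OF p, of x] by simp
    qed (use that in auto)
    then show ?thesis by simp
  qed
  have space: "\<bar>kernel_op P \<tau> f y - kernel_op P \<tau> f x\<bar> \<le> \<alpha>' * L * dist y x" if "s \<le> \<tau>" "\<tau> \<le> t" for \<tau> x y
  proof -
    have "\<bar>kernel_op P \<tau> f y - kernel_op P \<tau> f x\<bar> \<le> a \<tau> * L * dist y x"
      using lipschitz_onD[OF gr1, of \<tau> y x] that s by (simp add: dist_real_def)
    also have "\<dots> \<le> \<alpha>' * L * dist y x" using \<alpha>'(2)[OF that] L0 by (intro mult_right_mono) auto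
    finally show ?thesis .
  qed
  define F where "F r x = kernel_op P (\<xi> x) f (\<gamma> r)" for r x
  define M where "M = \<alpha>' * L * D + L * m' * h"
  have M0: "0 \<le> M" unfolding M_def using \<alpha>'(1) m'(1) L0 D0 h by simp
  have Flip: "\<bar>F r x - F r' x'\<bar> \<le> M * (\<bar>r - r'\<bar> + \<bar>x - x'\<bar>)"
    if "r \<in> {0..1}" "r' \<in> {0..1}" "x \<in> {0..1}" "x' \<in> {0..1}" for r r' x x'
  proof -
    have "\<bar>F r x - F r' x\<bar> \<le> \<alpha>' * L * (\<bar>r - r'\<bar> * D)"
      unfolding F_def using space[of "\<xi> x" "\<gamma> r" "\<gamma> r'"] \<xi>s[of x] dg[of r r'] that by simp
    moreover have "\<bar>F r' x - F r' x'\<bar> \<le> L * m' * (\<bar>x - x'\<bar> * h)"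
      unfolding F_def using time[of "\<xi> x'" "\<xi> x" "\<gamma> r'"] \<xi>s[of x] \<xi>s[of x'] that h unfolding \<xi>d by (simp add: abs_mult)
    moreover have "\<alpha>' * L * (\<bar>r - r'\<bar> * D) + L * m' * (\<bar>x - x'\<bar> * h) \<le> M * (\<bar>r - r'\<bar> + \<bar>x - x'\<bar>)"
    proof -
      have "0 \<le> \<alpha>' * L * D * \<bar>x - x'\<bar> + L * m' * h * \<bar>r - r'\<bar>" using \<alpha>'(1) m'(1) L0 D0 h by simp
      then show ?thesis unfolding M_def by (simp add: algebra_simps)
    qed
    ultimately show ?thesis by linarith
  qed
  define C where "C = ((\<alpha> * D) powr \<beta> + (h * m) powr \<beta>) powr (1 / \<beta>) * K powr (1 / p')"
  have C0: "0 \<le> C" unfolding C_def by simp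
  have "ennreal \<bar>F 1 1 - F 0 0\<bar> \<le> (\<integral>\<^sup>+ r\<in>{0..1::real}. ennreal C \<partial>lborel)"
  proof (rule diagonal_increment_le[where F=F])
    have "\<bar>F r r - F r' r'\<bar> \<le> 2 * M * \<bar>r - r'\<bar>" if "r \<in> {0..1}" "r' \<in> {0..1}" for r r'
      using Flip[OF that that] by simp
    then show "continuous_on {0..1} (\<lambda>r. F r r)" by (rule continuous_on_if_abs_le) (use M0 in auto)
    fix r0 r1 :: real assume "0 < r0" "r1 < 1"
    then have "r \<in> {r0..r1} \<Longrightarrow> r \<in> {0..1}" for r by auto
    then show "\<exists>L\<ge>0. \<forall>r\<in>{r0..r1}. \<forall>r'\<in>{r0..r1}. \<forall>s\<in>{r0..r1}. \<forall>s'\<in>{r0..r1}. \<bar>F r s - F r' s'\<bar> \<le> L * (\<bar>r - r'\<bar> + \<bar>s - s'\<bar>)"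
      using M0 Flip by (intro exI[of _ M]) blast
  next
    fix r :: real assume r: "0 < r" "r < 1"
    define \<tau> where "\<tau> = \<xi> r"
    define x where "x = \<gamma> r"
    have \<tau>: "0 < \<tau>" unfolding \<tau>_def using \<xi>s[of r] r s by simp
    define X where "X = lip (kernel_op P \<tau> f) x"
    define Y where "Y = \<bar>gen_semigroup P f \<tau> x\<bar>"
    define n where "n = (\<integral>y. lip f y powr p' \<partial>P \<tau> x)"
    have at0: "0 < a \<tau>" and bt0: "0 < b \<tau>" using a(2) b(2) \<tau> by auto
    \<comment> \<open>The products are grouped so that one Hoelder factor is the space-time speed
      and the other is exactly what the gradient estimate bounds.\<close>
    have "D * X + h * Y = (a \<tau> * D) * (X / a \<tau>) + (h * d\<^sub>J \<tau>) * (b \<tau> * Y)"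
      using at0 bt0 unfolding dJ_eq[OF \<tau>] by simp
    also have "\<dots> \<le> ((a \<tau> * D) powr \<beta> + (h * d\<^sub>J \<tau>) powr \<beta>) powr (1 / \<beta>) * ((X / a \<tau>) powr \<beta>' + (b \<tau> * Y) powr \<beta>') powr (1 / \<beta>')"
      using at0 bt0 D0 h dJ_nonneg[of \<tau>] exponents by (intro Holder_two_terms) (auto simp: X_def Y_def)
    also have "\<dots> \<le> C" unfolding C_def
    proof (intro mult_mono)
      show "((a \<tau> * D) powr \<beta> + (h * d\<^sub>J \<tau>) powr \<beta>) powr (1 / \<beta>) \<le> ((\<alpha> * D) powr \<beta> + (h * m) powr \<beta>) powr (1 / \<beta>)"
        using at0 bt0 D0 h dJ_nonneg[of \<tau>] \<beta>_pos bd(1,2)[of r] r unfolding \<tau>_def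
        by (intro powr_mono2 add_mono mult_right_mono mult_left_mono) auto
      have "((X / a \<tau>) powr \<beta>' + (b \<tau> * Y) powr \<beta>') powr (1 / \<beta>') \<le> (n powr (\<beta>' / p')) powr (1 / \<beta>')"
        using gr2[OF \<tau>, of x] \<beta>'_pos unfolding X_def Y_def n_def by (intro powr_mono2) auto
      also have "\<dots> = n powr (1 / p')" using \<beta>'_pos by (simp add: powr_powr)
      also have "\<dots> \<le> K powr (1 / p')"
        using bd(3)[of r] r p'_pos unfolding n_def \<tau>_def x_def by (intro powr_mono2) auto
      finally show "((X / a \<tau>) powr \<beta>' + (b \<tau> * Y) powr \<beta>') powr (1 / \<beta>') \<le> K powr (1 / p')" .
    qed auto
    finally have XY: "D * X + h * Y \<le> C" .
    show "limsup (\<lambda>n. ennreal (real n * (\<bar>F r r - F r (r - 1 / real n)\<bar> + \<bar>F (r + 1 / real n) r - F r r\<bar>))) \<le> ennreal C"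
    proof (rule limsup_ennreal_leI[OF _ C0])
      fix K assume K: "C < K"
      define e where "e = (K - C) / (D + 1)"
      have e: "0 < e" "D * e < K - C" unfolding e_def using K D0 by (auto simp: divide_simps)
      \<comment> \<open>The diagonal lemma takes the second increment backwards, so the time
        quotient has negative steps; the limit defining the generator is two-sided.\<close>
      have "((\<lambda>n. - h / real n) \<longlongrightarrow> 0) sequentially" using tendsto_mult[OF tendsto_const[of "- h"] lim_1_over_n] by simp
      then have "filterlim (\<lambda>n. - h / real n) (at 0) sequentially"
        using h by (intro filterlim_atI) (auto intro!: eventually_sequentiallyI[of 1])
      then have "(\<lambda>n. gen_quotient P f \<tau> x (- h / real n)) \<longlonglongrightarrow> gen_semigroup P f \<tau> x"
        by (rule filterlim_compose[OF generator_tendsto[OF fBL \<tau>]])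
      then have "(\<lambda>n. h * \<bar>gen_quotient P f \<tau> x (- h / real n)\<bar>) \<longlonglongrightarrow> h * Y"
        unfolding Y_def by (intro tendsto_intros)
      then have ev1: "eventually (\<lambda>n. h * \<bar>gen_quotient P f \<tau> x (- h / real n)\<bar> < K - D * (X + e)) sequentially"
        using XY e by (intro order_tendstoD(2)) (auto simp: algebra_simps)
      obtain \<rho> where \<rho>: "0 < \<rho>" "\<And>y. dist x y < \<rho> \<Longrightarrow> \<bar>kernel_op P \<tau> f y - kernel_op P \<tau> f x\<bar> \<le> (X + e) * dist x y"
        using lip_lessD[OF gr1[OF \<tau>], of x "X + e"] e unfolding X_def by auto
      have "(\<lambda>n. 1 / real n * D) \<longlonglongrightarrow> 0 * D" by (intro tendsto_intros lim_1_over_n)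
      then have ev2: "eventually (\<lambda>n. 1 / real n * D < \<rho>) sequentially" using \<rho>(1) by (intro order_tendstoD(2)) auto
      have ev3: "eventually (\<lambda>n. 1 / real n < 1 - r) sequentially"
        using r by (intro order_tendstoD(2)[OF lim_1_over_n]) auto
      show "eventually (\<lambda>n. real n * (\<bar>F r r - F r (r - 1 / real n)\<bar> + \<bar>F (r + 1 / real n) r - F r r\<bar>) \<le> K) sequentially"
        using ev1 ev2 ev3 eventually_gt_at_top[of 0]
      proof eventually_elim
        case (elim n)
        have n: "0 < real n" using elim by simp
        have "\<xi> (r - 1 / real n) = \<tau> + - h / real n" unfolding \<tau>_def \<xi> by (simp add: algebra_simps)
        then have "\<bar>F r r - F r (r - 1 / real n)\<bar> = \<bar>(- h / real n) * gen_quotient P f \<tau> x (- h / real n)\<bar>"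
          unfolding F_def gen_quotient_def x_def[symmetric] \<tau>_def[symmetric] using h n by (simp add: abs_minus_commute)
        then have 1: "real n * \<bar>F r r - F r (r - 1 / real n)\<bar> = h * \<bar>gen_quotient P f \<tau> x (- h / real n)\<bar>"
          using h n by (simp add: abs_mult)
        have d: "dist x (\<gamma> (r + 1 / real n)) = 1 / real n * D"
          unfolding x_def using dg[of r "r + 1 / real n"] r elim by simp
        have "\<bar>F (r + 1 / real n) r - F r r\<bar> \<le> (X + e) * (1 / real n * D)"
          using \<rho>(2)[of "\<gamma> (r + 1 / real n)"] elim(2) unfolding d F_def x_def[symmetric] \<tau>_def[symmetric] by simp
        then have 2: "real n * \<bar>F (r + 1 / real n) r - F r r\<bar> \<le> D * (X + e)" using n by (simp add: field_simps)
        show ?case unfolding distrib_left 1 using 2 elim(1) by linarith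
      qed
    qed
  qed
  then have "\<bar>F 1 1 - F 0 0\<bar> \<le> C" using C0 by (simp add: nn_integral_cmult_indicator)
  then show "\<bar>kernel_op P t (hopf_lax p \<delta> g) (\<gamma> 1) - kernel_op P s (hopf_lax p \<delta> g) (\<gamma> 0)\<bar>
          \<le> ((\<alpha> * dist (\<gamma> 0) (\<gamma> 1)) powr \<beta> + ((t - s) * m) powr \<beta>) powr (1 / \<beta>) * K powr (1 / p')"
    unfolding F_def C_def D_def h_def f_def by (simp add: \<xi>_def)
qed

lemma geodesic_imp_increment_bound:
  assumes E: "geodesic_space_time_estimate P a b p' \<beta>"
  shows hopf_lax_increment_bound
  unfolding hopf_lax_increment_bound_def Let_def
proof (intro ballI allI impI)
  fix g :: "'a \<Rightarrow> real" and \<delta> s t \<alpha> m K :: real and \<gamma> :: "real \<Rightarrow> 'a"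
  assume g: "g \<in> bounded_lipschitz" and \<delta>: "0 < \<delta>" and \<gamma>: "minimal_geodesic \<gamma>" and s: "0 < s" and st: "s < t"
  define f where "f = hopf_lax p \<delta> g"
  define \<xi> where "\<xi> r = r * t + (1 - r) * s" for r
  assume "\<forall>r\<in>{0..1}. a (r * t + (1 - r) * s) \<le> \<alpha> \<and> d\<^sub>J (r * t + (1 - r) * s) \<le> m \<and>
      (\<integral>y. lip (hopf_lax p \<delta> g) y powr p' \<partial>P (r * t + (1 - r) * s) (\<gamma> r)) \<le> K"
  then have bd: "a (\<xi> r) \<le> \<alpha>" "d\<^sub>J (\<xi> r) \<le> m" "(\<integral>y. lip f y powr p' \<partial>P (\<xi> r) (\<gamma> r)) \<le> K" if "0 \<le> r" "r \<le> 1" for r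
    using that unfolding \<xi>_def f_def by auto
  obtain B where B: "\<forall>x. \<bar>g x\<bar> \<le> B" using g by (rule bounded_lipschitzE) blast
  have fBL: "f \<in> bounded_lipschitz"
    unfolding f_def by (rule hopf_lax_bounded_lipschitz[OF exponents(1,5) B \<delta>])
  obtain L where L: "L-lipschitz_on UNIV f" using fBL by (rule bounded_lipschitzE)
  define D where "D = dist (\<gamma> 0) (\<gamma> 1)"
  define C where "C = ((\<alpha> * D) powr \<beta> + ((t - s) * m) powr \<beta>) powr (1 / \<beta>) * K powr (1 / p')"
  have "ennreal \<bar>kernel_op P t f (\<gamma> 1) - kernel_op P s f (\<gamma> 0)\<bar>
      \<le> (\<integral>\<^sup>+ r\<in>{0..1}. ennreal ((a (\<xi> r) powr \<beta> * D powr \<beta> + ((t - s) / b (\<xi> r)) powr \<beta>) powr (1 / \<beta>)) *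
          epowr (\<integral>\<^sup>+ y. epowr (local_lip f y) p' \<partial>P (\<xi> r) (\<gamma> r)) (1 / p') \<partial>lborel)"
    using E fBL \<gamma> s st unfolding geodesic_space_time_estimate_def Let_def D_def \<xi>_def by simp
  also have "\<dots> \<le> (\<integral>\<^sup>+ r\<in>{0..1::real}. ennreal C \<partial>lborel)"
  proof (rule set_nn_integral_mono)
    fix r :: real assume "r \<in> {0..1}"
    then have r: "0 \<le> r" "r \<le> 1" by auto
    have "s = r * s + (1 - r) * s" by (simp add: algebra_simps)
    also have "\<dots> \<le> \<xi> r" unfolding \<xi>_def using r st by (intro add_right_mono mult_left_mono) auto
    finally have \<xi>0: "0 < \<xi> r" using s by simp
    then have \<xi>1: "0 \<le> \<xi> r" by simp
    have at0: "0 < a (\<xi> r)" using a(2) \<xi>0 by auto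
    define n where "n = (\<integral>y. lip f y powr p' \<partial>P (\<xi> r) (\<gamma> r))"
    have n0: "0 \<le> n" unfolding n_def by simp
    have "((a (\<xi> r) * D) powr \<beta> + ((t - s) * d\<^sub>J (\<xi> r)) powr \<beta>) powr (1 / \<beta>) * n powr (1 / p') \<le> C"
      unfolding C_def using at0 st dJ_nonneg[of "\<xi> r"] \<beta>_pos p'_pos bd[OF r] n0
      by (intro mult_mono powr_mono2 add_mono mult_left_mono mult_right_mono) (auto simp: D_def n_def)
    moreover have "(a (\<xi> r) * D) powr \<beta> = a (\<xi> r) powr \<beta> * D powr \<beta>" unfolding D_def using at0 by (simp add: powr_mult)
    ultimately show "ennreal ((a (\<xi> r) powr \<beta> * D powr \<beta> + ((t - s) / b (\<xi> r)) powr \<beta>) powr (1 / \<beta>)) *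
          epowr (\<integral>\<^sup>+ y. epowr (local_lip f y) p' \<partial>P (\<xi> r) (\<gamma> r)) (1 / p') \<le> ennreal C"
      unfolding epowr_nn_integral_local_lip[OF kernel_prob[OF \<xi>1] L p'_pos] n_def[symmetric] 
      using n0 by (simp add: dJ_eq[OF \<xi>0] ennreal_mult[symmetric] ennreal_leI)
  qed
  also have "\<dots> = ennreal C" by (simp add: nn_integral_cmult_indicator)
  finally have "\<bar>kernel_op P t f (\<gamma> 1) - kernel_op P s f (\<gamma> 0)\<bar> \<le> C" unfolding C_def by simp
  then show "\<bar>kernel_op P t (hopf_lax p \<delta> g) (\<gamma> 1) - kernel_op P s (hopf_lax p \<delta> g) (\<gamma> 0)\<bar>
          \<le> ((\<alpha> * dist (\<gamma> 0) (\<gamma> 1)) powr \<beta> + ((t - s) * m) powr \<beta>) powr (1 / \<beta>) * K powr (1 / p')"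
    unfolding C_def D_def f_def .
qed

section \<open>Regularity of the semigroup from the local increment bound\<close>

text \<open>The increment bound compares distinct times, so \<open>kernel_op P t f y\<close> is
  compared with time \<open>s < t\<close> at \<open>x\<close>. The contribution of time vanishes as
  \<open>s\<close> increases to \<open>t\<close>, and the slope moments are at most
  \<open>L powr p'\<close>.\<close>

lemma increment_bound_lipschitz:
  assumes H: hopf_lax_increment_bound and t: "0 < t" and \<delta>: "0 < \<delta>" and g: "g \<in> bounded_lipschitz"
    and L: "L-lipschitz_on UNIV (hopf_lax p \<delta> g)" and \<alpha>: "a t < \<alpha>"
  shows "(\<alpha> * L)-lipschitz_on UNIV (kernel_op P t (hopf_lax p \<delta> g))"
proof (rule lipschitz_onI)
  define f where "f = hopf_lax p \<delta> g"
  note L = L[folded f_def] and L0 = lipschitz_on_nonneg[OF L]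
  have \<alpha>0: "0 < \<alpha>" using a(2) t \<alpha> by (meson less_imp_le less_trans)
  then show "0 \<le> \<alpha> * L" using L0 by simp
  obtain B where B: "\<forall>x. \<bar>g x\<bar> \<le> B" using g by (rule bounded_lipschitzE) blast
  have fBL: "f \<in> bounded_lipschitz"
    unfolding f_def by (rule hopf_lax_bounded_lipschitz[OF exponents(1,5) B \<delta>])
  fix x y :: 'a
  obtain \<gamma> where \<gamma>: "minimal_geodesic \<gamma>" "\<gamma> 0 = x" "\<gamma> 1 = y" using geodesic by blast
  define D where "D = dist x y"
  have D0: "0 \<le> D" unfolding D_def by simp
  obtain \<eta> where \<eta>: "0 < \<eta>" "\<And>r. 0 \<le> r \<Longrightarrow> \<bar>r - t\<bar> < \<eta> \<Longrightarrow> a r < \<alpha>"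
    using a_near[of t \<alpha>] t \<alpha> by auto
  obtain m where m: "0 < m" "\<And>r. t / 2 \<le> r \<Longrightarrow> r \<le> t \<Longrightarrow> d\<^sub>J r \<le> m" using dJ_bounded[of "t / 2" t] t by auto
  have ev: "\<bar>kernel_op P t f y - kernel_op P s f x\<bar> \<le> (\<alpha> * D + (t - s) * m) * L"
    if s: "t / 2 < s" "t - \<eta> < s" "s < t" for s
  proof -
    have s0: "0 < s" using s t by linarith
    have "\<bar>kernel_op P t f (\<gamma> 1) - kernel_op P s f (\<gamma> 0)\<bar>
        \<le> ((\<alpha> * dist (\<gamma> 0) (\<gamma> 1)) powr \<beta> + ((t - s) * m) powr \<beta>) powr (1 / \<beta>) * (L powr p') powr (1 / p')"
      unfolding f_def
    proof (rule H[unfolded hopf_lax_increment_bound_def Let_def, rule_format, OF g \<delta> \<gamma>(1) s0 s(3)])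
      fix r :: real assume r: "r \<in> {0..1}"
      define \<xi> where "\<xi> = r * t + (1 - r) * s"
      have "\<xi> = s + r * (t - s)" unfolding \<xi>_def by (simp add: algebra_simps)
      moreover have "0 \<le> r * (t - s)" "r * (t - s) \<le> t - s" using r s mult_left_le_one_le[of "t - s" r] by auto
      ultimately have \<xi>: "s \<le> \<xi>" "\<xi> \<le> t" by linarith+
      have "a \<xi> < \<alpha>" using \<eta>(2)[of \<xi>] \<xi> s s0 by auto
      moreover have "d\<^sub>J \<xi> \<le> m" using m(2)[of \<xi>] \<xi> s by auto
      moreover have "(\<integral>y. lip f y powr p' \<partial>P \<xi> (\<gamma> r)) \<le> L powr p'"
        using \<xi> s0 by (intro lip_moment_le L) auto
      ultimately show "a (r * t + (1 - r) * s) \<le> \<alpha> \<and> d\<^sub>J (r * t + (1 - r) * s) \<le> m \<and>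
          (\<integral>y. lip (hopf_lax p \<delta> g) y powr p' \<partial>P (r * t + (1 - r) * s) (\<gamma> r)) \<le> L powr p'"
        unfolding \<xi>_def f_def by simp
    qed
    also have "\<dots> \<le> (\<alpha> * D + (t - s) * m) * L"
    proof -
      have "((\<alpha> * D) powr \<beta> + ((t - s) * m) powr \<beta>) powr (1 / \<beta>) \<le> \<alpha> * D + (t - s) * m"
        using \<alpha>0 D0 s m exponents by (intro powr_root_sum_le) auto
      then show ?thesis using L0 p'_pos \<gamma> unfolding D_def by (simp add: powr_powr mult_right_mono)
    qed
    finally show ?thesis using \<gamma> by simp
  qed
  have "((\<lambda>s. kernel_op P s f x) \<longlongrightarrow> kernel_op P t f x) (at_left t)"
    using DERIV_isCont[OF kernel_op_has_derivative[OF fBL t, of x]] unfolding isCont_def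
    by (rule tendsto_within_subset) simp
  then have lim1: "((\<lambda>s. \<bar>kernel_op P t f y - kernel_op P s f x\<bar>) \<longlongrightarrow> \<bar>kernel_op P t f y - kernel_op P t f x\<bar>) (at_left t)"
    by (intro tendsto_rabs tendsto_diff tendsto_const)
  have lim2: "((\<lambda>s. (\<alpha> * D + (t - s) * m) * L) \<longlongrightarrow> (\<alpha> * D + (t - t) * m) * L) (at_left t)"
    by (intro tendsto_intros)
  have "eventually (\<lambda>s. \<bar>kernel_op P t f y - kernel_op P s f x\<bar> \<le> (\<alpha> * D + (t - s) * m) * L) (at_left t)"
    unfolding eventually_at_left_field using ev t \<eta>(1) by (intro exI[of _ "max (t / 2) (t - \<eta>)"]) auto
  then have "\<bar>kernel_op P t f y - kernel_op P t f x\<bar> \<le> (\<alpha> * D + (t - t) * m) * L"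
    by (rule tendsto_le[OF trivial_limit_at_left_real lim2 lim1])
  then show "dist (kernel_op P t (hopf_lax p \<delta> g) x) (kernel_op P t (hopf_lax p \<delta> g) y) \<le> \<alpha> * L * dist x y"
    unfolding D_def f_def by (simp add: dist_real_def abs_minus_commute mult_ac)
qed

text \<open>A general bounded Lipschitz \<open>f\<close> is uniformly close to a Hopf--Lax function
  \<open>g\<close>, for which the Lipschitz bound in space is known; kernels preserve uniform
  closeness, and continuity in time at the fixed point \<open>x\<close> does the rest.\<close>

lemma kernel_op_jointly_continuous:
  assumes H: hopf_lax_increment_bound and f: "f \<in> bounded_lipschitz" and t: "0 \<le> t" and e: "0 < e"
  obtains \<eta> where "0 < \<eta>"
    "\<And>\<tau> z. 0 \<le> \<tau> \<Longrightarrow> \<bar>\<tau> - t\<bar> < \<eta> \<Longrightarrow> dist z x < \<eta> \<Longrightarrow> \<bar>kernel_op P \<tau> f z - kernel_op P t f x\<bar> < e"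
proof -
  obtain B L where B: "\<forall>x. \<bar>f x\<bar> \<le> B" and L: "L-lipschitz_on UNIV f" using f by (rule bounded_lipschitzE)
  define c where "c = L powr p' / p' + 1"
  have c: "1 \<le> c" unfolding c_def using p'_pos by simp
  define \<epsilon> where "\<epsilon> = e / 4 / c"
  have \<epsilon>: "0 < \<epsilon>" unfolding \<epsilon>_def using e c by simp
  define g where "g = hopf_lax p \<epsilon> f"
  have fg: "\<bar>g y - f y\<bar> \<le> e / 4" for y
  proof -
    have "\<bar>g y - f y\<bar> \<le> \<epsilon> * (L powr p' / p')"
      unfolding g_def by (rule hopf_lax_uniform_approx[OF exponents(1,5) B L \<epsilon>])
    also have "\<dots> \<le> \<epsilon> * c" unfolding c_def using \<epsilon> by (intro mult_left_mono) auto
    finally show ?thesis unfolding \<epsilon>_def using c by simp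
  qed
  have gBL: "g \<in> bounded_lipschitz"
    unfolding g_def by (rule hopf_lax_bounded_lipschitz[OF exponents(1,5) B \<epsilon>])
  obtain M where M: "M-lipschitz_on UNIV g" using gBL by (rule bounded_lipschitzE)
  note M0 = lipschitz_on_nonneg[OF M]
  have Pfg: "\<bar>kernel_op P \<tau> g y - kernel_op P \<tau> f y\<bar> \<le> e / 4" if "0 \<le> \<tau>" for \<tau> y
    unfolding kernel_op_def
    by (rule abs_integral_diff_le[OF kernel_prob[OF that] kernel_integrable[OF that gBL] kernel_integrable[OF that f] fg])
  obtain \<alpha> where \<alpha>: "0 < \<alpha>" "\<And>r. 0 \<le> r \<Longrightarrow> r \<le> t + 1 \<Longrightarrow> a r < \<alpha>" using a_bounded[of 0 "t + 1"] by auto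
  \<comment> \<open>The entry \<open>1\<close> covers \<open>\<tau> = 0\<close>, where the kernel is
    the identity; the final summand makes \<open>A\<close> positive for the division below.\<close>
  define A where "A = max 1 \<alpha> * M + 1"
  have A: "0 < A" unfolding A_def using M0 by (simp add: add_nonneg_pos)
  have space: "\<bar>kernel_op P \<tau> g z - kernel_op P \<tau> g x\<bar> \<le> A * dist z x" if "0 \<le> \<tau>" "\<tau> \<le> t + 1" for \<tau> z
  proof (cases "\<tau> = 0")
    case True
    have "\<bar>g z - g x\<bar> \<le> M * dist z x" using lipschitz_onD[OF M, of z x] by (simp add: dist_real_def)
    also have "\<dots> \<le> A * dist z x" unfolding A_def using M0 mult_right_mono[of 1 "max 1 \<alpha>" M]
      by (intro mult_right_mono) auto
    finally show ?thesis using True kernel_op_zero[OF bounded_lipschitz_measurable[OF gBL]] by simp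
  next
    case False
    then have "(\<alpha> * M)-lipschitz_on UNIV (kernel_op P \<tau> g)"
      unfolding g_def using that \<alpha> M by (intro increment_bound_lipschitz[OF H _ \<epsilon> f]) (auto simp: g_def)
    then have "\<bar>kernel_op P \<tau> g z - kernel_op P \<tau> g x\<bar> \<le> \<alpha> * M * dist z x"
      using lipschitz_onD[of "\<alpha> * M" UNIV "kernel_op P \<tau> g" z x] by (simp add: dist_real_def)
    also have "\<dots> \<le> A * dist z x" unfolding A_def using M0 mult_right_mono[of \<alpha> "max 1 \<alpha>" M]
      by (intro mult_right_mono) auto
    finally show ?thesis .
  qed
  obtain \<eta> where \<eta>: "0 < \<eta>" "\<And>\<tau>. 0 \<le> \<tau> \<Longrightarrow> \<tau> \<noteq> t \<Longrightarrow> \<bar>\<tau> - t\<bar> < \<eta> \<Longrightarrow> \<bar>kernel_op P \<tau> g x - kernel_op P t g x\<bar> < e / 4"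
    using kernel_op_time_tendsto[OF gBL t, of x, unfolded tendsto_iff eventually_at, rule_format, of "e / 4"] e
    by (auto simp: dist_real_def)
  show ?thesis
  proof (rule that[of "min (min 1 \<eta>) (e / 4 / A)"])
    show "0 < min (min 1 \<eta>) (e / 4 / A)" using \<eta> e A by simp
    fix \<tau> z assume *: "0 \<le> \<tau>" "\<bar>\<tau> - t\<bar> < min (min 1 \<eta>) (e / 4 / A)" "dist z x < min (min 1 \<eta>) (e / 4 / A)"
    have "\<bar>kernel_op P \<tau> g z - kernel_op P \<tau> g x\<bar> \<le> A * dist z x" using * by (intro space) auto
    moreover have "A * dist z x < e / 4" using * A by (simp add: field_simps)
    moreover have "\<bar>kernel_op P \<tau> g x - kernel_op P t g x\<bar> < e / 4" using \<eta>(2)[of \<tau>] * e by (cases "\<tau> = t") auto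
    ultimately show "\<bar>kernel_op P \<tau> f z - kernel_op P t f x\<bar> < e"
      using Pfg[OF *(1), of z] Pfg[OF t, of x] by linarith
  qed
qed

text \<open>One difference quotient \<open>S\<close> has integral so close to the limit that
  \<open>A * kernel_op P t S x < K\<close>. As \<open>S\<close> is bounded Lipschitz, joint
  continuity moves time and point, and \<open>lip_hopf_lax_later_le\<close> moves the parameter to
  later values at the price of a factor near \<open>1\<close>.\<close>

lemma slope_moment_upper_semicontinuous:
  assumes H: hopf_lax_increment_bound and f: "f \<in> bounded_lipschitz" and t: "0 \<le> t" and \<delta>: "0 < \<delta>"
    and K: "(\<integral>y. lip (hopf_lax p \<delta> f) y powr p' \<partial>P t x) < K"
  obtains \<eta> where "0 < \<eta>"
    "\<And>\<delta>' \<tau> z. \<delta> \<le> \<delta>' \<Longrightarrow> \<delta>' < \<delta> + \<eta> \<Longrightarrow> 0 \<le> \<tau> \<Longrightarrow> \<bar>\<tau> - t\<bar> < \<eta> \<Longrightarrow> dist z x < \<eta> \<Longrightarrow>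
      (\<integral>y. lip (hopf_lax p \<delta>' f) y powr p' \<partial>P \<tau> z) \<le> K"
proof -
  obtain B where B: "\<forall>x. \<bar>f x\<bar> \<le> B" using f by (rule bounded_lipschitzE)
  define T where "T = \<delta> powr (1 - p)"
  have T: "0 < T" unfolding T_def using \<delta> by simp
  define A where "A = p * \<delta> powr (- p)"
  have A: "0 < A" unfolding A_def using p_pos \<delta> by simp
  note \<mu> = kernel_prob[OF t, of x]
  have "(\<lambda>n. A * (\<integral>x. infconv_quot p f (T / (real n + 2)) T x \<partial>P t x)) \<longlonglongrightarrow> A * (\<integral>x. infconv_slope p f T x \<partial>P t x)"
    by (intro tendsto_mult_left integral_infconv_quot_tendsto[OF exponents(1,5) B T \<mu>])
  moreover have "A * (\<integral>x. infconv_slope p f T x \<partial>P t x) = (\<integral>y. lip (hopf_lax p \<delta> f) y powr p' \<partial>P t x)"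
    unfolding lip_hopf_lax[OF exponents(1,5) B geodesic \<delta>] A_def T_def by simp
  ultimately have "eventually (\<lambda>n. A * (\<integral>x. infconv_quot p f (T / (real n + 2)) T x \<partial>P t x) < K) sequentially"
    using K order_tendstoD(2) by metis
  then obtain n where n: "A * (\<integral>x. infconv_quot p f (T / (real n + 2)) T x \<partial>P t x) < K"
    using eventually_happens'[OF sequentially_bot] by blast
  define k where "k = T / (real n + 2)"
  have k: "0 < k" "k \<le> T" "k < T" unfolding k_def using T by (auto simp: divide_le_eq divide_less_eq)
  define S where "S = infconv_quot p f k T"
  have S0: "0 \<le> S x" for x unfolding S_def using k by (intro infconv_quot_nonneg[OF exponents(1) B])
  have SBL: "S \<in> bounded_lipschitz"
    unfolding S_def using k by (intro infconv_quot_bounded_lipschitz[OF exponents(1) B])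
  define c where "c \<delta>' = k / (\<delta>' powr (1 - p) - T + k)" for \<delta>'
  define Q where "Q = kernel_op P t S x"
  have Q: "A * Q < K" "0 \<le> Q" using n S0 unfolding Q_def kernel_op_def S_def k_def by (auto simp: S_def[symmetric])
  \<comment> \<open>The factor \<open>1 + e\<close> is the allowance for the later parameter,
    \<open>Q + e\<close> the one for the change of time and point.\<close>
  have "((\<lambda>e. A * ((1 + e) * (Q + e))) \<longlongrightarrow> A * ((1 + 0) * (Q + 0))) (at_right 0)" by (intro tendsto_intros)
  then have "eventually (\<lambda>e. A * ((1 + e) * (Q + e)) < K) (at_right 0)" using Q by (intro order_tendstoD(2)) auto
  then obtain e where e: "0 < e" "A * ((1 + e) * (Q + e)) < K" unfolding eventually_at_right_field using dense by blast
  have "((\<lambda>\<delta>'. \<delta>' powr (1 - p) - T + k) \<longlongrightarrow> \<delta> powr (1 - p) - T + k) (at_right \<delta>)"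
    using \<delta> by (intro tendsto_intros) auto
  then have lim1: "((\<lambda>\<delta>'. \<delta>' powr (1 - p) - T + k) \<longlongrightarrow> k) (at_right \<delta>)" unfolding T_def by simp
  then have "(c \<longlongrightarrow> k / k) (at_right \<delta>)" unfolding c_def using k by (intro tendsto_intros) auto
  then have "eventually (\<lambda>\<delta>'. c \<delta>' < 1 + e \<and> 0 < \<delta>' powr (1 - p) - T + k) (at_right \<delta>)"
    using k e lim1 by (intro eventually_conj order_tendstoD) auto
  then obtain \<eta>1 where \<eta>1: "\<delta> < \<eta>1" "\<And>\<delta>'. \<delta> < \<delta>' \<Longrightarrow> \<delta>' < \<eta>1 \<Longrightarrow> c \<delta>' < 1 + e \<and> 0 < \<delta>' powr (1 - p) - T + k"
    unfolding eventually_at_right_field by blast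
  obtain \<eta>2 where \<eta>2: "0 < \<eta>2"
    "\<And>\<tau> z. 0 \<le> \<tau> \<Longrightarrow> \<bar>\<tau> - t\<bar> < \<eta>2 \<Longrightarrow> dist z x < \<eta>2 \<Longrightarrow> \<bar>kernel_op P \<tau> S z - kernel_op P t S x\<bar> < e"
    using kernel_op_jointly_continuous[OF H SBL t e(1), of x] by blast
  show ?thesis
  proof (rule that[of "min (\<eta>1 - \<delta>) \<eta>2"])
    show "0 < min (\<eta>1 - \<delta>) \<eta>2" using \<eta>1 \<eta>2 by simp
    fix \<delta>' \<tau> z
    assume *: "\<delta> \<le> \<delta>'" "\<delta>' < \<delta> + min (\<eta>1 - \<delta>) \<eta>2" "0 \<le> \<tau>" "\<bar>\<tau> - t\<bar> < min (\<eta>1 - \<delta>) \<eta>2" "dist z x < min (\<eta>1 - \<delta>) \<eta>2"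
    have c: "c \<delta>' < 1 + e" "0 < \<delta>' powr (1 - p) - T + k"
    proof -
      have "c \<delta>' < 1 + e \<and> 0 < \<delta>' powr (1 - p) - T + k"
      proof (cases "\<delta>' = \<delta>")
        case True
        then show ?thesis using k e by (simp add: c_def T_def)
      next
        case False
        then show ?thesis using \<eta>1(2)[of \<delta>'] * by auto
      qed
      then show "c \<delta>' < 1 + e" "0 < \<delta>' powr (1 - p) - T + k" by auto
    qed
    have c0: "0 \<le> c \<delta>'" unfolding c_def using k c by simp
    have \<delta>': "0 < \<delta>'" using * \<delta> by linarith
    obtain L where L: "L-lipschitz_on UNIV (hopf_lax p \<delta>' f)"
      using hopf_lax_bounded_lipschitz[OF exponents(1,5) B \<delta>'] by (rule bounded_lipschitzE)
    have "(\<integral>y. lip (hopf_lax p \<delta>' f) y powr p' \<partial>P \<tau> z) \<le> (\<integral>y. A * c \<delta>' * S y \<partial>P \<tau> z)"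
    proof (rule integral_mono)
      show "integrable (P \<tau> z) (\<lambda>y. lip (hopf_lax p \<delta>' f) y powr p')"
        using p'_pos by (intro integrable_powr_lip[OF kernel_prob[OF *(3)] L]) auto
      show "integrable (P \<tau> z) (\<lambda>y. A * c \<delta>' * S y)" using kernel_integrable[OF *(3) SBL] by simp
      show "lip (hopf_lax p \<delta>' f) y powr p' \<le> A * c \<delta>' * S y" for y
        unfolding A_def c_def S_def T_def
        using c k unfolding T_def by (intro lip_hopf_lax_later_le[OF exponents(1,5) B \<delta> *(1)]) auto
    qed
    also have "\<dots> = A * (c \<delta>' * kernel_op P \<tau> S z)" unfolding kernel_op_def by simp
    also have "\<dots> \<le> A * ((1 + e) * (Q + e))"
    proof (intro mult_left_mono mult_mono)
      show "kernel_op P \<tau> S z \<le> Q + e" using \<eta>2(2)[of \<tau> z] * unfolding Q_def by auto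
      show "0 \<le> kernel_op P \<tau> S z" unfolding kernel_op_def using S0 by simp
    qed (use c c0 A e in auto)
    finally show "(\<integral>y. lip (hopf_lax p \<delta>' f) y powr p' \<partial>P \<tau> z) \<le> K" using e by simp
  qed
qed

section \<open>The Hopf--Lax flow along a geodesic\<close>

text \<open>Along the curve \<open>T \<mapsto> (T, Q\<^sub>q\<^sub>(\<^sub>T\<^sub>) f, \<gamma>(\<rho>(T)))\<close>, the increase due to the motion in space and
  time is compensated by the Hopf--Lax flow; \<open>q\<close> and \<open>\<rho>\<close> are chosen such that
  the resulting bound is a multiple of \<open>q'\<close>.\<close>

lemma hopf_lax_flow_Dini:
  assumes H: hopf_lax_increment_bound and f: "f \<in> bounded_lipschitz" and st: "0 \<le> s" "s < T" "T < t"
    and \<gamma>: "minimal_geodesic \<gamma>" and e: "0 < e"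
    and q: "q = (\<lambda>T. J s T / J s t)" and \<rho>: "\<rho> = (\<lambda>T. Ja s T / Ja s t)"
    and w: "w = ((dist (\<gamma> 0) (\<gamma> 1) * (J s t / Ja s t)) powr \<beta> + J s t powr \<beta>) powr (1 / \<beta>)"
    and u: "u = (\<lambda>T. kernel_op P T (hopf_lax0 p (q T) f) (\<gamma> (\<rho> T)))"
  shows "\<exists>\<eta>>0. \<forall>h. 0 < h \<and> h < \<eta> \<longrightarrow>
    (u (T + h) - w powr p / p * q (T + h)) - (u T - w powr p / p * q T) \<le> e * h"
proof -
  obtain B where B: "\<forall>x. \<bar>f x\<bar> \<le> B" using f by (rule bounded_lipschitzE)
  have T: "0 < T" "0 \<le> T" using st by auto
  define Jst where "Jst = J s t"
  define I where "I = Ja s t"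
  define D where "D = dist (\<gamma> 0) (\<gamma> 1)"
  define C where "C = w powr p / p"
  have Jst: "0 < Jst" and I: "0 < I" unfolding Jst_def I_def using st by (auto intro: J_pos Ja_pos)
  have D: "0 \<le> D" unfolding D_def by simp
  have w': "w = ((D * (Jst / I)) powr \<beta> + Jst powr \<beta>) powr (1 / \<beta>)" unfolding w D_def Jst_def I_def ..
  have w0: "0 \<le> w" unfolding w by simp
  have at0: "0 < a T" using a(2) T by simp
  have dJ0: "0 < d\<^sub>J T" by (rule dJ_pos[OF T(1)])
  define \<delta> where "\<delta> = q T"
  have \<delta>: "0 < \<delta>" unfolding \<delta>_def q using st J_pos[of s T] J_pos[of s t] by simp
  define x where "x = \<gamma> (\<rho> T)"
  define n where "n = (\<integral>y. lip (hopf_lax p \<delta> f) y powr p' \<partial>P T x)"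
  have n0: "0 \<le> n" unfolding n_def by simp
  \<comment> \<open>The derivatives of \<open>q\<close> and \<open>\<rho>\<close> at
    \<open>T\<close> are \<open>\<kappa>\<close> and \<open>\<sigma>\<close>.\<close>
  define \<kappa> where "\<kappa> = d\<^sub>J T / Jst"
  define \<sigma> where "\<sigma> = d\<^sub>J T / a T / I"
  have \<kappa>: "0 < \<kappa>" and \<sigma>: "0 < \<sigma>" unfolding \<kappa>_def \<sigma>_def using dJ0 Jst at0 I by auto
  define X where "X = ((a T * (\<sigma> * D)) powr \<beta> + d\<^sub>J T powr \<beta>) powr (1 / \<beta>) * n powr (1 / p')"
  \<comment> \<open>Both summands inside the root are \<open>\<kappa> powr \<beta>\<close> times a
    summand of \<open>w powr \<beta>\<close>, so
    \<open>X = \<kappa> * (w * n powr (1 / p'))\<close>. Young's inequality splits this into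
    \<open>\<kappa> * C\<close>, the growth of \<open>C * q\<close>, and
    \<open>\<kappa> * (n / p')\<close>, the rate of loss of the Hopf--Lax flow.\<close>
  have X: "X \<le> \<kappa> * (n / p' + C)"
  proof -
    have "a T * (\<sigma> * D) = \<kappa> * (D * (Jst / I))" "d\<^sub>J T = \<kappa> * Jst"
      unfolding \<sigma>_def \<kappa>_def using at0 Jst by simp_all
    then have "(a T * (\<sigma> * D)) powr \<beta> = \<kappa> powr \<beta> * (D * (Jst / I)) powr \<beta>" "d\<^sub>J T powr \<beta> = \<kappa> powr \<beta> * Jst powr \<beta>"
      by (simp_all only: powr_mult)
    then have "(a T * (\<sigma> * D)) powr \<beta> + d\<^sub>J T powr \<beta> = \<kappa> powr \<beta> * ((D * (Jst / I)) powr \<beta> + Jst powr \<beta>)"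
      by (simp only: distrib_left)
    then have "X = (\<kappa> powr \<beta>) powr (1 / \<beta>) * w * n powr (1 / p')"
      unfolding X_def w' by (simp only: powr_mult)
    also have "\<dots> = \<kappa> * (w * n powr (1 / p'))" using \<kappa> \<beta>_pos by (simp add: powr_powr)
    also have "\<dots> \<le> \<kappa> * (w powr p / p + (n powr (1 / p')) powr p' / p')"
      using \<kappa> w0 exponents by (intro mult_left_mono Youngs_inequality) auto
    also have "\<dots> = \<kappa> * (n / p' + C)" using p'_pos n0 unfolding C_def by (simp add: powr_powr add.commute)
    finally show ?thesis .
  qed
  define E where "E \<eta> = (((a T + \<eta>) * ((\<sigma> + \<eta>) * D)) powr \<beta> + (d\<^sub>J T + \<eta>) powr \<beta>) powr (1 / \<beta>) * (n + \<eta>) powr (1 / p')" for \<eta>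
  have "(E \<longlongrightarrow> (((a T + 0) * ((\<sigma> + 0) * D)) powr \<beta> + (d\<^sub>J T + 0) powr \<beta>) powr (1 / \<beta>) * (n + 0) powr (1 / p')) (at_right 0)"
    unfolding E_def
  proof (rule root_tendsto)
    have pos: "eventually (\<lambda>\<eta>::real. 0 < \<eta>) (at_right 0)" by (rule eventually_at_right_less)
    show "eventually (\<lambda>\<eta>. 0 \<le> (a T + \<eta>) * ((\<sigma> + \<eta>) * D)) (at_right 0)"
      "eventually (\<lambda>\<eta>. 0 \<le> d\<^sub>J T + \<eta>) (at_right 0)" "eventually (\<lambda>\<eta>. 0 \<le> n + \<eta>) (at_right 0)"
      using pos by (eventually_elim; use at0 \<sigma> D dJ0 n0 in simp)+
  qed (intro tendsto_intros)+
  then have "(E \<longlongrightarrow> X) (at_right 0)" unfolding X_def by simp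
  then have "eventually (\<lambda>\<eta>. E \<eta> < X + e / 2) (at_right 0)" using e by (intro order_tendstoD(2)) auto
  then obtain \<eta> where \<eta>: "0 < \<eta>" "E \<eta> < X + e / 2" unfolding eventually_at_right_field using dense by blast
  obtain \<eta>1 where \<eta>1: "0 < \<eta>1" "\<And>r. 0 \<le> r \<Longrightarrow> \<bar>r - T\<bar> < \<eta>1 \<Longrightarrow> a r < a T + \<eta>"
    using a_near[OF T(2), of "a T + \<eta>"] \<eta> by auto
  obtain \<eta>2 where \<eta>2: "0 < \<eta>2" "\<And>r. \<bar>r - T\<bar> < \<eta>2 \<Longrightarrow> d\<^sub>J r < d\<^sub>J T + \<eta>"
    using dJ_near[OF T(1), of "d\<^sub>J T + \<eta>"] \<eta> by auto
  obtain \<eta>3 where \<eta>3: "0 < \<eta>3"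
    "\<And>\<delta>' \<tau> z. \<delta> \<le> \<delta>' \<Longrightarrow> \<delta>' < \<delta> + \<eta>3 \<Longrightarrow> 0 \<le> \<tau> \<Longrightarrow> \<bar>\<tau> - T\<bar> < \<eta>3 \<Longrightarrow> dist z x < \<eta>3 \<Longrightarrow>
      (\<integral>y. lip (hopf_lax p \<delta>' f) y powr p' \<partial>P \<tau> z) \<le> n + \<eta>"
    using slope_moment_upper_semicontinuous[OF H f T(2) \<delta>, of x "n + \<eta>"] \<eta> unfolding n_def by auto
  define k where "k h = J T (T + h) / Jst" for h
  have Jlim: "((\<lambda>h. J T (T + h) / h) \<longlongrightarrow> d\<^sub>J T) (at_right 0)"
    unfolding J_def using T by (intro right_average_tendsto[of T "T + 1"] continuous_on_subset[OF dJ_continuous]) auto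
  have Jalim: "((\<lambda>h. Ja T (T + h) / h) \<longlongrightarrow> d\<^sub>J T / a T) (at_right 0)"
    unfolding Ja_def
  proof (rule right_average_tendsto[of T "T + 1"])
    show "continuous_on {T..T + 1} (\<lambda>r. d\<^sub>J r / a r)"
      using T a by (intro continuous_intros continuous_on_subset[OF dJ_continuous] continuous_on_subset[OF a(1)])
        (auto simp: less_imp_neq[THEN not_sym])
  qed simp
  have klim: "((\<lambda>h. k h / h) \<longlongrightarrow> \<kappa>) (at_right 0)"
    using tendsto_divide[OF Jlim tendsto_const[of Jst]] Jst unfolding k_def \<kappa>_def by (simp add: mult.commute)
  have "((\<lambda>h. k h / h * h) \<longlongrightarrow> \<kappa> * 0) (at_right 0)" by (intro tendsto_mult klim tendsto_ident_at)
  then have k0: "(k \<longlongrightarrow> 0) (at_right 0)"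
    unfolding mult_zero_right
    by (rule Lim_transform_eventually) (use eventually_at_right_less[of "0::real"] in \<open>eventually_elim, simp\<close>)
  \<comment> \<open>Compensation per unit time over a step of length \<open>h\<close>: half of
    \<open>e\<close> is reserved for its deviation from the limit, the other half for
    \<open>E \<eta>\<close>.\<close>
  have "((\<lambda>h. k h / h * ((\<delta> / (\<delta> + k h)) powr p * (n / p') + C)) \<longlongrightarrow> \<kappa> * ((\<delta> / (\<delta> + 0)) powr p * (n / p') + C)) (at_right 0)"
    using \<delta> by (intro tendsto_mult klim tendsto_add tendsto_const tendsto_powr tendsto_divide k0) auto
  then have evE: "eventually (\<lambda>h. \<kappa> * (n / p' + C) - e / 2 < k h / h * ((\<delta> / (\<delta> + k h)) powr p * (n / p') + C)) (at_right 0)"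
    using \<delta> e by (intro order_tendstoD(1)) auto
  have evC: "eventually (\<lambda>h. Ja T (T + h) / h < (\<sigma> + \<eta>) * I) (at_right 0)"
    using I \<eta> unfolding \<sigma>_def by (intro order_tendstoD(2)[OF Jalim]) (auto simp: distrib_right)
  have "((\<lambda>h. h * ((\<sigma> + \<eta>) * D)) \<longlongrightarrow> 0 * ((\<sigma> + \<eta>) * D)) (at_right 0)" by (intro tendsto_intros)
  then have evD: "eventually (\<lambda>h. h * ((\<sigma> + \<eta>) * D) < \<eta>3) (at_right 0)" using \<eta>3 by (intro order_tendstoD(2)) auto
  have evk: "eventually (\<lambda>h. k h < \<eta>3) (at_right 0)" using \<eta>3 by (intro order_tendstoD(2)[OF k0]) auto
  have evh: "eventually (\<lambda>h. h < min (min \<eta>1 \<eta>2) (min \<eta>3 (t - T))) (at_right 0)"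
    using \<eta>1 \<eta>2 \<eta>3 st by (intro order_tendstoD(2)[OF tendsto_ident_at]) auto
  have "eventually (\<lambda>h. (u (T + h) - C * q (T + h)) - (u T - C * q T) \<le> e * h) (at_right 0)"
    using evE evC evD evk evh eventually_at_right_less
  proof eventually_elim
    case (elim h)
    have h: "0 < h" using elim by simp
    have kp: "0 < k h" unfolding k_def using J_pos[of T "T + h"] T h Jst by simp
    have qh: "q (T + h) = \<delta> + k h"
      unfolding q \<delta>_def k_def Jst_def using J_combine[of s T "T + h"] st h by (simp add: add_divide_distrib[symmetric])
    \<comment> \<open>The step is split at the fixed space-time point \<open>(T, x)\<close>: the
      parameter changes there, and \<open>G\<close> is then carried along the geodesic. Slope
      moments are thus taken at a parameter not below \<open>\<delta>\<close>, where the
      semicontinuity lemma applies.\<close>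
    define G where "G = hopf_lax p (\<delta> + k h) f"
    have uT: "u T = kernel_op P T (hopf_lax p \<delta> f) x"
      unfolding u \<delta>_def[symmetric] x_def hopf_lax0_def using \<delta> by simp
    have uh: "u (T + h) = kernel_op P (T + h) G (\<gamma> (\<rho> (T + h)))"
      unfolding u qh hopf_lax0_def G_def using \<delta> kp by simp
    have GBL: "G \<in> bounded_lipschitz"
      unfolding G_def using \<delta> kp by (intro hopf_lax_bounded_lipschitz[OF exponents(1,5) B]) auto
    have QBL: "hopf_lax p \<delta> f \<in> bounded_lipschitz"
      by (rule hopf_lax_bounded_lipschitz[OF exponents(1,5) B \<delta>])
    obtain L where L: "L-lipschitz_on UNIV (hopf_lax p \<delta> f)" using QBL by (rule bounded_lipschitzE)
    have flow: "kernel_op P T G x - kernel_op P T (hopf_lax p \<delta> f) x \<le> - (k h * ((\<delta> / (\<delta> + k h)) powr p * (n / p')))"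
    proof -
      have "kernel_op P T G x - kernel_op P T (hopf_lax p \<delta> f) x = (\<integral>y. G y - hopf_lax p \<delta> f y \<partial>P T x)"
        unfolding kernel_op_def using kernel_integrable[OF T(2)] GBL QBL by simp
      also have "\<dots> \<le> (\<integral>y. - (k h / p' * (\<delta> / (\<delta> + k h)) powr p * lip (hopf_lax p \<delta> f) y powr p') \<partial>P T x)"
        unfolding G_def using kernel_integrable[OF T(2)] GBL[unfolded G_def] QBL p'_pos
          integrable_powr_lip[OF kernel_prob[OF T(2)] L, of p' x]
        by (intro integral_mono hopf_lax_decrease_lip[OF exponents(1,5) B geodesic \<delta> kp]) auto
      also have "\<dots> = - (k h / p' * (\<delta> / (\<delta> + k h)) powr p * n)" unfolding n_def by simp
      finally show ?thesis by (simp add: mult_ac)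
    qed
    define d where "d = \<rho> (T + h) - \<rho> T"
    have dJa: "d = Ja T (T + h) / I"
      unfolding d_def \<rho> I_def using Ja_combine[of s T "T + h"] st h by (simp add: diff_divide_distrib[symmetric])
    have d0: "0 \<le> d" unfolding dJa using Ja_nonneg[of T "T + h"] T I by simp
    have dle: "d \<le> h * (\<sigma> + \<eta>)" unfolding dJa using elim I h by (simp add: field_simps)
    have \<rho>01: "0 \<le> \<rho> T" "\<rho> (T + h) \<le> 1"
    proof -
      show "0 \<le> \<rho> T" unfolding \<rho> using Ja_nonneg[of s T] st I I_def by simp
      have "Ja s (T + h) + Ja (T + h) t = Ja s t" using st h elim by (intro Ja_combine) auto
      then show "\<rho> (T + h) \<le> 1" unfolding \<rho> using Ja_nonneg[of "T + h" t] T h I I_def by (simp add: field_simps)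
    qed
    define \<gamma>' where "\<gamma>' r = \<gamma> (\<rho> T + r * d)" for r
    have i: "\<rho> T \<in> {0..1}" "\<rho> (T + h) \<in> {0..1}" using \<rho>01 d0 unfolding d_def by auto
    have \<gamma>': "minimal_geodesic \<gamma>'" unfolding \<gamma>'_def d_def by (rule minimal_geodesic_affine[OF \<gamma> i])
    have \<gamma>'0: "\<gamma>' 0 = x" "\<gamma>' 1 = \<gamma> (\<rho> (T + h))" unfolding \<gamma>'_def x_def d_def by simp_all
    have \<gamma>'D: "dist (\<gamma>' 0) (\<gamma>' 1) = d * D"
      unfolding \<gamma>'0 x_def D_def minimal_geodesicD[OF \<gamma> i] using d0 unfolding d_def by simp
    have "\<bar>kernel_op P (T + h) G (\<gamma>' 1) - kernel_op P T G (\<gamma>' 0)\<bar>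
        \<le> (((a T + \<eta>) * dist (\<gamma>' 0) (\<gamma>' 1)) powr \<beta> + ((T + h - T) * (d\<^sub>J T + \<eta>)) powr \<beta>) powr (1 / \<beta>) * (n + \<eta>) powr (1 / p')"
      unfolding G_def
    proof (rule H[unfolded hopf_lax_increment_bound_def Let_def, rule_format, OF f _ \<gamma>' T(1)])
      show "0 < \<delta> + k h" "T < T + h" using \<delta> kp h by auto
      fix r :: real assume r: "r \<in> {0..1}"
      define \<xi> where "\<xi> = r * (T + h) + (1 - r) * T"
      have "\<xi> = T + r * h" unfolding \<xi>_def by (simp add: algebra_simps)
      moreover have "0 \<le> r * h" "r * h \<le> h" using r h mult_left_le_one_le[of h r] by auto
      ultimately have \<xi>: "\<bar>\<xi> - T\<bar> \<le> h" "0 \<le> \<xi>" using T by auto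
      have "dist (\<gamma>' r) x = r * (d * D)"
        using minimal_geodesicD[OF \<gamma>', of r 0] r unfolding \<gamma>'0(1)[symmetric] \<gamma>'D by simp
      also have "\<dots> \<le> d * D" using r d0 D mult_left_le_one_le[of "d * D" r] by auto
      also have "\<dots> \<le> h * (\<sigma> + \<eta>) * D" using dle D by (rule mult_right_mono)
      also have "\<dots> < \<eta>3" using elim by (simp add: mult.assoc)
      finally have dr: "dist (\<gamma>' r) x < \<eta>3" .
      have "(\<integral>y. lip (hopf_lax p (\<delta> + k h) f) y powr p' \<partial>P \<xi> (\<gamma>' r)) \<le> n + \<eta>"
        using kp elim \<xi> dr by (intro \<eta>3(2)) auto
      moreover have "a \<xi> \<le> a T + \<eta>" "d\<^sub>J \<xi> \<le> d\<^sub>J T + \<eta>"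
        using \<eta>1(2)[of \<xi>] \<eta>2(2)[of \<xi>] \<xi> elim by (auto intro: less_imp_le)
      ultimately show "a (r * (T + h) + (1 - r) * T) \<le> a T + \<eta> \<and> d\<^sub>J (r * (T + h) + (1 - r) * T) \<le> d\<^sub>J T + \<eta> \<and>
          (\<integral>y. lip (hopf_lax p (\<delta> + k h) f) y powr p' \<partial>P (r * (T + h) + (1 - r) * T) (\<gamma>' r)) \<le> n + \<eta>"
        unfolding \<xi>_def by simp
    qed
    also have "\<dots> \<le> h * E \<eta>"
    proof -
      define U where "U = (a T + \<eta>) * ((\<sigma> + \<eta>) * D)"
      define V where "V = d\<^sub>J T + \<eta>"
      have "(a T + \<eta>) * dist (\<gamma>' 0) (\<gamma>' 1) \<le> h * U"
        using mult_left_mono[OF mult_right_mono[OF dle D], of "a T + \<eta>"] at0 \<eta> unfolding \<gamma>'D U_def by (simp add: mult_ac)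
      then have "(((a T + \<eta>) * dist (\<gamma>' 0) (\<gamma>' 1)) powr \<beta> + ((T + h - T) * V) powr \<beta>) powr (1 / \<beta>)
        \<le> ((h * U) powr \<beta> + (h * V) powr \<beta>) powr (1 / \<beta>)"
        using at0 \<eta> h dJ0 \<beta>_pos unfolding V_def by (intro powr_mono2 add_mono) auto
      also have "\<dots> = (h powr \<beta> * (U powr \<beta> + V powr \<beta>)) powr (1 / \<beta>)"
        by (simp only: powr_mult distrib_left)
      also have "\<dots> = h * (U powr \<beta> + V powr \<beta>) powr (1 / \<beta>)"
        unfolding powr_mult[of "h powr \<beta>"] using h \<beta>_pos by (simp add: powr_powr)
      finally have "(((a T + \<eta>) * dist (\<gamma>' 0) (\<gamma>' 1)) powr \<beta> + ((T + h - T) * V) powr \<beta>) powr (1 / \<beta>) * (n + \<eta>) powr (1 / p')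
        \<le> h * (U powr \<beta> + V powr \<beta>) powr (1 / \<beta>) * (n + \<eta>) powr (1 / p')"
        by (rule mult_right_mono) simp
      then show ?thesis unfolding E_def U_def V_def by (simp only: mult.assoc)
    qed
    finally have move: "kernel_op P (T + h) G (\<gamma> (\<rho> (T + h))) - kernel_op P T G x \<le> h * E \<eta>"
      unfolding \<gamma>'0 by linarith
    have "h * (\<kappa> * (n / p' + C) - e / 2) \<le> h * (k h / h * ((\<delta> / (\<delta> + k h)) powr p * (n / p') + C))"
      using elim(1) h by (intro mult_left_mono) auto
    also have "\<dots> = k h * ((\<delta> / (\<delta> + k h)) powr p * (n / p')) + C * k h" using h by (simp add: algebra_simps)
    finally have gain: "h * (\<kappa> * (n / p' + C) - e / 2) \<le> k h * ((\<delta> / (\<delta> + k h)) powr p * (n / p')) + C * k h" .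
    have "(u (T + h) - C * q (T + h)) - (u T - C * q T) = u (T + h) - u T - C * k h"
      unfolding qh \<delta>_def[symmetric] by (simp add: algebra_simps)
    also have "\<dots> \<le> h * E \<eta> - h * (\<kappa> * (n / p' + C) - e / 2)"
      unfolding uT uh using move flow gain by linarith
    also have "\<dots> = h * (E \<eta> - \<kappa> * (n / p' + C) + e / 2)" by (simp add: algebra_simps)
    also have "\<dots> \<le> h * e" using \<eta>(2) X h by (intro mult_left_mono) auto
    finally show ?case by (simp add: mult.commute)
  qed
  then obtain h0 where "0 < h0" "\<And>h. 0 < h \<Longrightarrow> h < h0 \<Longrightarrow> (u (T + h) - C * q (T + h)) - (u T - C * q T) \<le> e * h"
    unfolding eventually_at_right_field by blast
  then show ?thesis unfolding C_def by blast
qed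

text \<open>Both \<open>q\<close> and \<open>\<rho>\<close> run from \<open>0\<close> to
  \<open>1\<close>, so the curve joins \<open>f\<close> at \<open>(s, x)\<close> to
  \<open>Q\<^sub>1 f\<close> at \<open>(t, y)\<close>. The Dini estimate holds at interior times; at
  \<open>T = s\<close>, where the parameter is \<open>0\<close>, continuity with
  \<open>hopf_lax0\<close> is enough.\<close>

lemma hopf_lax_flow_le:
  assumes H: hopf_lax_increment_bound and f: "f \<in> bounded_lipschitz" and st: "0 \<le> s" "s < t"
    and w: "w = ((dist x y * (J s t / Ja s t)) powr \<beta> + J s t powr \<beta>) powr (1 / \<beta>)"
  shows "kernel_op P t (hopf_lax p 1 f) y - kernel_op P s f x \<le> w powr p / p"
proof -
  obtain \<gamma> where \<gamma>: "minimal_geodesic \<gamma>" "\<gamma> 0 = x" "\<gamma> 1 = y" using geodesic by blast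
  define q where "q = (\<lambda>T. J s T / J s t)"
  define \<rho> where "\<rho> = (\<lambda>T. Ja s T / Ja s t)"
  define u where "u = (\<lambda>T. kernel_op P T (hopf_lax0 p (q T) f) (\<gamma> (\<rho> T)))"
  have Jst: "0 < J s t" and I: "0 < Ja s t" using st by (auto intro: J_pos Ja_pos)
  have q0: "0 \<le> q T" for T unfolding q_def using Jst J_nonneg by simp
  have q01: "q s = 0" "q t = 1" "\<rho> s = 0" "\<rho> t = 1"
    unfolding q_def \<rho>_def using Jst I by (auto simp: J_def Ja_def)
  have \<rho>01: "\<rho> T \<in> {0..1}" if "T \<in> {s..t}" for T
    using Ja_combine[of s T t] Ja_nonneg[of s T] Ja_nonneg[of T t] st that I unfolding \<rho>_def by (auto simp: divide_le_eq)
  have cq: "continuous_on {s..t} q"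
    unfolding q_def using Jst J_continuous by (intro continuous_intros) auto
  have c\<rho>: "continuous_on {s..t} \<rho>"
    unfolding \<rho>_def using I Ja_continuous[OF st(1)] by (intro continuous_intros) auto
  \<comment> \<open>The change of the parameter is uniform in space and survives the kernel; what
    remains is joint continuity for the fixed function \<open>F\<close>.\<close>
  have "continuous_on {s..t} u"
    unfolding continuous_on_iff
  proof (intro ballI allI impI)
    fix T e :: real assume T: "T \<in> {s..t}" and e: "0 < e"
    have T0: "0 \<le> T" using T st by simp
    define F where "F = hopf_lax0 p (q T) f"
    have FBL: "F \<in> bounded_lipschitz"
      unfolding F_def by (rule hopf_lax0_bounded_lipschitz[OF exponents(1,5) f q0])
    obtain \<eta>1 where \<eta>1: "0 < \<eta>1"
      "\<And>\<delta>' x. 0 \<le> \<delta>' \<Longrightarrow> \<bar>\<delta>' - q T\<bar> < \<eta>1 \<Longrightarrow> \<bar>hopf_lax0 p \<delta>' f x - hopf_lax0 p (q T) f x\<bar> \<le> e / 2"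
      using hopf_lax0_continuous[OF exponents(1,5) f q0, of "e / 2" T] e by auto
    obtain \<eta>2 where \<eta>2: "0 < \<eta>2"
      "\<And>\<tau> z. 0 \<le> \<tau> \<Longrightarrow> \<bar>\<tau> - T\<bar> < \<eta>2 \<Longrightarrow> dist z (\<gamma> (\<rho> T)) < \<eta>2 \<Longrightarrow> \<bar>kernel_op P \<tau> F z - kernel_op P T F (\<gamma> (\<rho> T))\<bar> < e / 2"
      using kernel_op_jointly_continuous[OF H FBL T0, of "e / 2" "\<gamma> (\<rho> T)"] e by auto
    define D where "D = dist (\<gamma> 0) (\<gamma> 1)"
    have D: "0 \<le> D" unfolding D_def by simp
    obtain d1 where d1: "0 < d1" "\<And>T'. T' \<in> {s..t} \<Longrightarrow> dist T' T < d1 \<Longrightarrow> dist (q T') (q T) < \<eta>1"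
      using cq[unfolded continuous_on_iff, rule_format, OF T \<eta>1(1)] by blast
    have "0 < \<eta>2 / (D + 1)" using \<eta>2 D by simp
    then obtain d2 where d2: "0 < d2" "\<And>T'. T' \<in> {s..t} \<Longrightarrow> dist T' T < d2 \<Longrightarrow> dist (\<rho> T') (\<rho> T) < \<eta>2 / (D + 1)"
      using c\<rho>[unfolded continuous_on_iff, rule_format, OF T] by blast
    show "\<exists>d>0. \<forall>T'\<in>{s..t}. dist T' T < d \<longrightarrow> dist (u T') (u T) < e"
    proof (intro exI[of _ "min (min d1 d2) \<eta>2"] conjI ballI impI)
      show "0 < min (min d1 d2) \<eta>2" using d1 d2 \<eta>2 by simp
      fix T' assume T': "T' \<in> {s..t}" "dist T' T < min (min d1 d2) \<eta>2"
      have T'0: "0 \<le> T'" using T' st by simp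
      have G: "hopf_lax0 p (q T') f \<in> bounded_lipschitz"
        by (rule hopf_lax0_bounded_lipschitz[OF exponents(1,5) f q0])
      have "\<bar>hopf_lax0 p (q T') f z - F z\<bar> \<le> e / 2" for z
        unfolding F_def using d1(2)[of T'] T' q0 by (intro \<eta>1(2)) (auto simp: dist_real_def)
      then have 1: "\<bar>u T' - kernel_op P T' F (\<gamma> (\<rho> T'))\<bar> \<le> e / 2"
        unfolding u_def kernel_op_def
        by (rule abs_integral_diff_le[OF kernel_prob[OF T'0] kernel_integrable[OF T'0 G] kernel_integrable[OF T'0 FBL]])
      have "dist (\<gamma> (\<rho> T')) (\<gamma> (\<rho> T)) = \<bar>\<rho> T' - \<rho> T\<bar> * D"
        unfolding D_def by (rule minimal_geodesicD[OF \<gamma>(1) \<rho>01[OF T'(1)] \<rho>01[OF T]])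
      also have "\<dots> \<le> \<bar>\<rho> T' - \<rho> T\<bar> * (D + 1)" by (intro mult_left_mono) auto
      also have "\<dots> < \<eta>2" using d2(2)[of T'] T' D by (simp add: dist_real_def field_simps)
      finally have "\<bar>kernel_op P T' F (\<gamma> (\<rho> T')) - kernel_op P T F (\<gamma> (\<rho> T))\<bar> < e / 2"
        using T' T'0 by (intro \<eta>2(2)) (auto simp: dist_real_def)
      then show "dist (u T') (u T) < e" using 1 unfolding u_def F_def dist_real_def by linarith
    qed
  qed
  then have cv: "continuous_on {s..t} (\<lambda>T. u T - w powr p / p * q T)" using cq by (intro continuous_intros)
  have "u t - w powr p / p * q t \<le> u s - w powr p / p * q s"
  proof (rule Dini_nonincreasing[OF st(2) cv])
    fix T e :: real assume "s < T" "T < t" "0 < e"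
    then show "\<exists>\<eta>>0. \<forall>h. 0 < h \<and> h < \<eta> \<longrightarrow> u (T + h) - w powr p / p * q (T + h) - (u T - w powr p / p * q T) \<le> e * h"
      using hopf_lax_flow_Dini[OF H f st(1) _ _ \<gamma>(1) _ q_def \<rho>_def, of T e w u] w u_def \<gamma> by simp
  qed
  then show ?thesis unfolding u_def q01 hopf_lax0_def \<gamma> by simp
qed

text \<open>The pointwise bound \<open>hopf_lax_flow_le\<close> is integrated against a coupling of
  cost at most \<open>v\<close>. A nonlinear function of the distance cannot be integrated directly,
  so it is bounded by an affine function of \<open>dist x y powr p\<close> that is exact at distance
  \<open>v\<close>; finally \<open>v\<close> decreases to the Wasserstein distance.\<close>

lemma increment_bound_imp_control:
  assumes H: hopf_lax_increment_bound
  shows "wasserstein_control P a b p \<beta>"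
  unfolding wasserstein_control_def
proof (intro ballI allI impI)
  fix \<mu>\<^sub>0 \<mu>\<^sub>1 :: "'a measure" and s t :: real
  assume \<mu>: "\<mu>\<^sub>0 \<in> borel_probs" "\<mu>\<^sub>1 \<in> borel_probs" and "0 \<le> s \<and> s < t"
  then have st: "0 \<le> s" "s < t" "0 \<le> t" by auto
  define A where "A = J s t / Ja s t"
  have Jst: "0 < J s t" and I: "0 < Ja s t" using st by (auto intro: J_pos Ja_pos)
  then have A: "0 < A" unfolding A_def by simp
  have coef: "(1 / measure (time_measure b) {s..t} * (LINT r:{s..t}|time_measure b. 1 / a r)) powr (- \<beta>) = A powr \<beta>"
  proof -
    have "1 / J s t * Ja s t = inverse A" unfolding A_def by simp
    then have "(1 / J s t * Ja s t) powr (- \<beta>) = A powr \<beta>" using A by (simp add: inverse_powr powr_minus)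
    then show ?thesis unfolding measure_time_measure dJa_integrable(2)[OF st(1)] Ja_def .
  qed
  define \<nu>0 where "\<nu>0 = \<mu>\<^sub>0 \<bind> P s"
  define \<nu>1 where "\<nu>1 = \<mu>\<^sub>1 \<bind> P t"
  have \<nu>: "\<nu>0 \<in> borel_probs" "\<nu>1 \<in> borel_probs"
    unfolding \<nu>0_def \<nu>1_def
    by (rule bind_borel_probs[OF \<mu>(1) kernel_measurable[OF st(1)]] bind_borel_probs[OF \<mu>(2) kernel_measurable[OF st(3)]])+
  define w where "w v = ((A * v) powr \<beta> + J s t powr \<beta>) powr (1 / \<beta>)" for v
  have main: "wasserstein p \<nu>0 \<nu>1 \<le> ennreal (w v)" if v: "0 < v" "wasserstein p \<mu>\<^sub>0 \<mu>\<^sub>1 < ennreal v" for v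
  proof (rule wasserstein_le_dual[OF \<nu> exponents(1)])
    show "0 \<le> w v" unfolding w_def by simp
    fix f :: "'a \<Rightarrow> real" assume f: "f \<in> bounded_lipschitz"
    obtain B where B: "\<forall>x. \<bar>f x\<bar> \<le> B" using f by (rule bounded_lipschitzE)
    define G where "G = hopf_lax p 1 f"
    have GBL: "G \<in> bounded_lipschitz"
      unfolding G_def by (rule hopf_lax_bounded_lipschitz[OF exponents(1,5) B]) simp
    have GB: "\<forall>x. \<bar>G x\<bar> \<le> B" unfolding G_def using hopf_lax_bound[OF exponents(1,5) B] by simp
    obtain \<pi> where \<pi>: "\<pi> \<in> couplings \<mu>\<^sub>0 \<mu>\<^sub>1" "(\<integral>\<^sup>+ z. ennreal (dist (fst z) (snd z) powr p) \<partial>\<pi>) \<le> ennreal (v powr p)"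
      using wasserstein_lessD[OF v(2) p_pos] v(1) by auto
    have \<pi>P: "\<pi> \<in> borel_probs" using \<pi>(1) unfolding couplings_def by simp
    interpret prob_space \<pi> using borel_probsD(1)[OF \<pi>P] .
    have [measurable_cong]: "sets \<pi> = sets borel" using borel_probsD(2)[OF \<pi>P] .
    define g0 where "g0 x = kernel_op P s f x" for x
    define g1 where "g1 x = kernel_op P t G x" for x
    have g0: "g0 \<in> borel_measurable borel" "(\<integral>x. f x \<partial>\<nu>0) = (\<integral>x. g0 x \<partial>\<mu>\<^sub>0)"
      unfolding g0_def kernel_op_def \<nu>0_def
      using integral_bind_bounded[OF \<mu>(1) kernel_measurable[OF st(1)] bounded_lipschitz_measurable[OF f] B] by auto
    have g1: "g1 \<in> borel_measurable borel" "(\<integral>x. G x \<partial>\<nu>1) = (\<integral>x. g1 x \<partial>\<mu>\<^sub>1)"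
      unfolding g1_def kernel_op_def \<nu>1_def
      using integral_bind_bounded[OF \<mu>(2) kernel_measurable[OF st(3)] bounded_lipschitz_measurable[OF GBL] GB] by auto
    have gB: "\<bar>g0 x\<bar> \<le> B" "\<bar>g1 x\<bar> \<le> B" for x
      unfolding g0_def g1_def kernel_op_def
      using abs_integral_diff_le[OF kernel_prob[OF st(1)] kernel_integrable[OF st(1) f], of x "\<lambda>_. 0" B]
        abs_integral_diff_le[OF kernel_prob[OF st(3)] kernel_integrable[OF st(3) GBL], of x "\<lambda>_. 0" B] B GB by auto
    note m [measurable] = g0(1) g1(1)
    have int: "integrable \<pi> (\<lambda>z. g1 (snd z))" "integrable \<pi> (\<lambda>z. g0 (fst z))"
      using gB by (intro integrable_borel_prob[OF \<pi>P, of _ B]; simp)+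
    have di: "integrable \<pi> (\<lambda>z. dist (fst z) (snd z) powr p)"
      using \<pi>(2) by (intro integrableI_bounded) (auto simp: top_unique intro: le_less_trans)
    have dle: "(\<integral>z. dist (fst z) (snd z) powr p \<partial>\<pi>) \<le> v powr p"
      using \<pi>(2) unfolding nn_integral_eq_integral[OF di AE_I2[OF powr_ge_zero]] by simp
    define S where "S = (A * v) powr \<beta> + J s t powr \<beta>"
    have Av: "0 < (A * v) powr \<beta>" "0 < J s t powr \<beta>" using A v Jst by auto
    then have S: "0 < S" unfolding S_def by (rule add_pos_pos)
    \<comment> \<open>The weight for which \<open>powr_add_le_weighted\<close> is an equality when
      the distance equals \<open>v\<close>.\<close>
    define l where "l = (A * v) powr \<beta> / S"
    have AvS: "(A * v) powr \<beta> < S" unfolding S_def using Av by linarith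
    have l: "0 < l" "l < 1" unfolding l_def using Av(1) S AvS by (simp_all only: divide_pos_pos divide_less_eq_1_pos)
    have l1: "1 - l = J s t powr \<beta> / S" unfolding l_def using S by (simp add: S_def field_simps)
    \<comment> \<open>\<open>\<beta> \<le> p\<close> makes this exponent at least \<open>1\<close>,
      as the convexity inequality requires.\<close>
    define r where "r = p / \<beta>"
    have r: "1 \<le> r" "\<beta> * r = p" unfolding r_def using exponents \<beta>_pos by (auto simp: le_divide_eq)
    define c where "c = l powr (1 - r)"
    define c' where "c' = (1 - l) powr (1 - r)"
    have point: "g1 (snd z) - g0 (fst z) \<le> (c * (A powr p * dist (fst z) (snd z) powr p) + c' * J s t powr p) / p" for z
    proof -
      define d where "d = dist (fst z) (snd z)"
      define W where "W = ((d * A) powr \<beta> + J s t powr \<beta>) powr (1 / \<beta>)"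
      have "g1 (snd z) - g0 (fst z) \<le> W powr p / p"
        unfolding g0_def g1_def G_def W_def d_def A_def by (rule hopf_lax_flow_le[OF H f st(1,2) refl])
      also have "W powr p = ((d * A) powr \<beta> + J s t powr \<beta>) powr r" unfolding W_def r_def by (simp add: powr_powr)
      also have "\<dots> \<le> c * ((d * A) powr \<beta>) powr r + c' * (J s t powr \<beta>) powr r"
        unfolding c_def c'_def using r l by (intro powr_add_le_weighted) auto
      also have "\<dots> = c * (A powr p * d powr p) + c' * J s t powr p"
        by (simp add: powr_powr r powr_mult mult.commute)
      finally show ?thesis unfolding d_def using p_pos by (simp add: divide_right_mono)
    qed
    have "(\<integral>x. G x \<partial>\<nu>1) - (\<integral>x. f x \<partial>\<nu>0) = (\<integral>z. g1 (snd z) - g0 (fst z) \<partial>\<pi>)"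
      unfolding g0(2) g1(2) using couplingD[OF \<pi>(1) g0(1)] couplingD[OF \<pi>(1) g1(1)] int by simp
    also have "\<dots> \<le> (\<integral>z. (c * (A powr p * dist (fst z) (snd z) powr p) + c' * J s t powr p) / p \<partial>\<pi>)"
      using di int point by (intro integral_mono) auto
    also have "\<dots> = (c * (A powr p * (\<integral>z. dist (fst z) (snd z) powr p \<partial>\<pi>)) + c' * J s t powr p) / p"
      using di by (simp add: prob_space)
    also have "\<dots> \<le> (c * (A powr p * v powr p) + c' * J s t powr p) / p"
      using dle p_pos unfolding c_def by (intro divide_right_mono add_right_mono mult_left_mono) auto
    \<comment> \<open>By the choice of \<open>l\<close> each summand is its share of
      \<open>S\<close> times \<open>S powr (r - 1)\<close>, so nothing is lost.\<close>
    also have "c * (A powr p * v powr p) + c' * J s t powr p = S powr r"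
    proof -
      have e1: "y powr r * (y / S) powr (1 - r) = y * S powr (r - 1)" if "0 < y" for y
      proof -
        have "y powr r * (y / S) powr (1 - r) = (y powr r * y powr (1 - r)) / S powr (1 - r)"
          using that S by (simp add: powr_divide)
        also have "\<dots> = y / S powr (1 - r)" using that by (simp flip: powr_add)
        also have "S powr (1 - r) = inverse (S powr (r - 1))" by (simp flip: powr_minus)
        finally show ?thesis by (simp add: divide_inverse)
      qed
      have "A powr p * v powr p = ((A * v) powr \<beta>) powr r" "J s t powr p = (J s t powr \<beta>) powr r"
        using A v by (simp_all add: powr_powr r powr_mult)
      then have "c * (A powr p * v powr p) + c' * J s t powr p = (A * v) powr \<beta> * S powr (r - 1) + J s t powr \<beta> * S powr (r - 1)"
        unfolding c_def c'_def l1 unfolding l_def using e1[OF Av(1)] e1[OF Av(2)] by (simp only: mult.commute)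
      also have "\<dots> = S * S powr (r - 1)" unfolding S_def by (simp only: distrib_right)
      also have "\<dots> = S powr r" using S by (simp add: powr_diff)
      finally show ?thesis .
    qed
    also have "S powr r = w v powr p" unfolding w_def S_def r_def by (simp add: powr_powr)
    finally show "(\<integral>x. hopf_lax p 1 f x \<partial>\<nu>1) - (\<integral>x. f x \<partial>\<nu>0) \<le> w v powr p / p"
      unfolding G_def .
  qed
  show "epowr (wasserstein p (\<mu>\<^sub>0 \<bind> P s) (\<mu>\<^sub>1 \<bind> P t)) \<beta>
        \<le> ennreal ((1 / measure (time_measure b) {s..t} * (LINT r:{s..t}|time_measure b. 1 / a r)) powr (- \<beta>)) *
            epowr (wasserstein p \<mu>\<^sub>0 \<mu>\<^sub>1) \<beta> + ennreal (measure (time_measure b) {s..t} powr \<beta>)"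
    unfolding coef unfolding measure_time_measure \<nu>0_def[symmetric] \<nu>1_def[symmetric]
  proof (cases "wasserstein p \<mu>\<^sub>0 \<mu>\<^sub>1")
    case top
    then show "epowr (wasserstein p \<nu>0 \<nu>1) \<beta> \<le> ennreal (A powr \<beta>) * epowr (wasserstein p \<mu>\<^sub>0 \<mu>\<^sub>1) \<beta> + ennreal (J s t powr \<beta>)"
      using A by (simp add: ennreal_mult_top)
  next
    case (real w0)
    have "epowr (wasserstein p \<nu>0 \<nu>1) \<beta> \<le> ennreal ((A * w0) powr \<beta> + J s t powr \<beta>)"
    proof -
      have le: "epowr (wasserstein p \<nu>0 \<nu>1) \<beta> \<le> ennreal ((A * v) powr \<beta> + J s t powr \<beta>)" if v: "w0 < v" for v
      proof -
        have "wasserstein p \<nu>0 \<nu>1 \<le> ennreal (w v)" using real v by (intro main) (auto simp: ennreal_less_iff)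
        then show ?thesis unfolding w_def using \<beta>_pos by (subst epowr_le_ennreal_iff) auto
      qed
      have "((\<lambda>v. (A * v) powr \<beta> + J s t powr \<beta>) \<longlongrightarrow> (A * w0) powr \<beta> + J s t powr \<beta>) (at_right w0)"
      proof (intro tendsto_add tendsto_const tendsto_powr' tendsto_mult tendsto_ident_at)
        have "eventually (\<lambda>v. 0 \<le> A * v) (at_right w0)"
          using eventually_at_right_less by eventually_elim (use real A in auto)
        then show "A * w0 \<noteq> 0 \<or> 0 < \<beta> \<and> eventually (\<lambda>v. 0 \<le> A * v) (at_right w0)" using \<beta>_pos by simp
      qed
      then have "((\<lambda>v. ennreal ((A * v) powr \<beta> + J s t powr \<beta>)) \<longlongrightarrow> ennreal ((A * w0) powr \<beta> + J s t powr \<beta>)) (at_right w0)"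
        by (rule tendsto_ennrealI)
      moreover have "eventually (\<lambda>v. epowr (wasserstein p \<nu>0 \<nu>1) \<beta> \<le> ennreal ((A * v) powr \<beta> + J s t powr \<beta>)) (at_right w0)"
        using eventually_at_right_less by eventually_elim (rule le)
      ultimately show ?thesis by (rule tendsto_lowerbound) simp
    qed
    also have "\<dots> = ennreal (A powr \<beta>) * epowr (wasserstein p \<mu>\<^sub>0 \<mu>\<^sub>1) \<beta> + ennreal (J s t powr \<beta>)"
      using real A by (simp add: powr_mult ennreal_mult)
    finally show "epowr (wasserstein p \<nu>0 \<nu>1) \<beta> \<le> ennreal (A powr \<beta>) * epowr (wasserstein p \<mu>\<^sub>0 \<mu>\<^sub>1) \<beta> + ennreal (J s t powr \<beta>)" .
  qed
qed

section \<open>The gradient estimate\<close>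

text \<open>Compare \<open>P\<^sub>t f\<close> at \<open>y\<close> with \<open>P\<^sub>t\<^sub>+\<^sub>\<sigma> f\<close> at \<open>x\<close>, where \<open>\<sigma> = \<plusminus>\<lambda> d(x, y)\<close> has the sign for which
  the increments in space and time add up.\<close>

lemma increment_bound_space_time_slope:
  assumes H: hopf_lax_increment_bound and t: "0 < t" and \<delta>: "0 < \<delta>"
    and g: "g \<in> bounded_lipschitz" and f: "f = hopf_lax p \<delta> g" and l: "0 < l"
  shows "lip (kernel_op P t f) x + l * \<bar>gen_semigroup P f t x\<bar>
    \<le> (a t powr \<beta> + (l * d\<^sub>J t) powr \<beta>) powr (1 / \<beta>) * (\<integral>y. lip f y powr p' \<partial>P t x) powr (1 / p')"
    (is "?X + l * \<bar>?Y\<bar> \<le> ?A")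
proof -
  obtain B where B: "\<forall>x. \<bar>g x\<bar> \<le> B" using g by (rule bounded_lipschitzE) blast
  have fBL: "f \<in> bounded_lipschitz"
    unfolding f by (rule hopf_lax_bounded_lipschitz[OF exponents(1,5) B \<delta>])
  have t0: "0 \<le> t" using t by simp
  define n where "n = (\<integral>y. lip f y powr p' \<partial>P t x)"
  have n0: "0 \<le> n" unfolding n_def by simp
  have at0: "0 < a t" using a(2) t by simp
  have lJ: "0 \<le> l * d\<^sub>J t" using l dJ_nonneg by simp
  have main: "\<exists>r>0. \<forall>y. 0 < dist x y \<longrightarrow> dist x y < r \<longrightarrow>
      \<bar>kernel_op P t f y - kernel_op P t f x\<bar> \<le> (K - l * \<bar>?Y\<bar>) * dist x y" if K: "?A < K" for K
  proof -
    define A where "A = ?A"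
    \<comment> \<open>Half of the slack absorbs the perturbation of the increment bound, the other
      half, through \<open>\<kappa>\<close>, the error of the generator quotient over the time
      \<open>l * d\<close>.\<close>
    define K' where "K' = (A + K) / 2"
    have "A < K" unfolding A_def by (rule K)
    then have K': "A < K'" "K' < K" unfolding K'_def by auto
    have "eventually (\<lambda>e. ((a t + e * 1) powr \<beta> + (l * d\<^sub>J t + e) powr \<beta>) powr (1 / \<beta>) * (n + e) powr (1 / p') < K') (at_right 0)"
      using at0 lJ n0 K'(1)[unfolded A_def, folded n_def]
      by (intro order_tendstoD(2)[OF root_perturbed_tendsto]) auto
    then obtain e where e: "0 < e" "((a t + e * 1) powr \<beta> + (l * d\<^sub>J t + e) powr \<beta>) powr (1 / \<beta>) * (n + e) powr (1 / p') < K'"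
      unfolding eventually_at_right_field using dense by blast
    note e = e(1) e(2)[unfolded mult_1_right]
    define w where "w = ((a t + e) powr \<beta> + (l * d\<^sub>J t + e) powr \<beta>) powr (1 / \<beta>)"
    obtain \<eta>1 where \<eta>1: "0 < \<eta>1"
      "\<And>\<delta>' \<tau> z. \<delta> \<le> \<delta>' \<Longrightarrow> \<delta>' < \<delta> + \<eta>1 \<Longrightarrow> 0 \<le> \<tau> \<Longrightarrow> \<bar>\<tau> - t\<bar> < \<eta>1 \<Longrightarrow> dist z x < \<eta>1 \<Longrightarrow>
        (\<integral>y. lip (hopf_lax p \<delta>' g) y powr p' \<partial>P \<tau> z) \<le> n + e"
      using slope_moment_upper_semicontinuous[OF H g t0 \<delta>, of x "n + e"] e(1) unfolding n_def f by auto
    define \<kappa> where "\<kappa> = (K - K') / l"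
    have \<kappa>: "0 < \<kappa>" "\<kappa> * l = K - K'" unfolding \<kappa>_def using K' l by auto
    have "eventually (\<lambda>s. dist (gen_quotient P f t x s) ?Y < \<kappa>) (at 0)"
      using generator_tendsto[OF fBL t] \<kappa>(1) by (rule tendstoD)
    then obtain \<eta>2 where \<eta>2: "0 < \<eta>2" "\<And>s. s \<noteq> 0 \<Longrightarrow> \<bar>s\<bar> < \<eta>2 \<Longrightarrow> \<bar>gen_quotient P f t x s - ?Y\<bar> < \<kappa>"
      unfolding eventually_at dist_real_def by auto
    obtain \<eta>3 where \<eta>3: "0 < \<eta>3" "\<And>r. 0 \<le> r \<Longrightarrow> \<bar>r - t\<bar> < \<eta>3 \<Longrightarrow> a r < a t + e"
      using a_near[OF t0, of "a t + e"] e(1) by auto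
    \<comment> \<open>The excess \<open>e / l\<close> becomes \<open>e\<close> after multiplication
      by the time rate \<open>l\<close>.\<close>
    obtain \<eta>4 where \<eta>4: "0 < \<eta>4" "\<And>r. \<bar>r - t\<bar> < \<eta>4 \<Longrightarrow> d\<^sub>J r < d\<^sub>J t + e / l"
      using dJ_near[OF t, of "d\<^sub>J t + e / l"] e(1) l by auto
    \<comment> \<open>The entry \<open>t\<close> keeps the earlier time \<open>t - l * d\<close>
      positive.\<close>
    define \<eta> where "\<eta> = min (min \<eta>1 \<eta>2) (min (min \<eta>3 \<eta>4) t)"
    have \<eta>: "0 < \<eta>" "\<eta> \<le> \<eta>1" "\<eta> \<le> \<eta>2" "\<eta> \<le> \<eta>3" "\<eta> \<le> \<eta>4" "\<eta> \<le> t"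
      unfolding \<eta>_def using \<eta>1 \<eta>2 \<eta>3 \<eta>4 t by auto
    show ?thesis
    proof (intro exI[of _ "min \<eta>1 (\<eta> / l)"] conjI allI impI)
      show "0 < min \<eta>1 (\<eta> / l)" using \<eta>1 \<eta> l by simp
      fix y assume y: "0 < dist x y" "dist x y < min \<eta>1 (\<eta> / l)"
      define d where "d = dist x y"
      have d: "0 < d" "d < \<eta>1" "l * d < \<eta>" using y l unfolding d_def by (auto simp: field_simps)
      define \<Delta> where "\<Delta> = kernel_op P t f x - kernel_op P t f y"
      define \<sigma> where "\<sigma> = (if 0 \<le> \<Delta> * ?Y then l * d else - (l * d))"
      have \<sigma>: "\<bar>\<sigma>\<bar> = l * d" "\<sigma> \<noteq> 0" unfolding \<sigma>_def using l d by (auto simp: abs_mult)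
      have abs: "\<bar>\<Delta> + \<sigma> * ?Y\<bar> = \<bar>\<Delta>\<bar> + l * d * \<bar>?Y\<bar>"
      proof -
        have "0 \<le> \<Delta> * (\<sigma> * ?Y)"
        proof (cases "0 \<le> \<Delta> * ?Y")
          case True
          then have "0 \<le> (l * d) * (\<Delta> * ?Y)" using l d by simp
          then show ?thesis unfolding \<sigma>_def using True by (simp add: mult_ac)
        next
          case False
          then have "0 \<le> - ((l * d) * (\<Delta> * ?Y))" using l d by (simp add: mult_nonneg_nonpos)
          then show ?thesis unfolding \<sigma>_def using False by (simp add: mult_ac)
        qed
        then have "\<bar>\<Delta> + \<sigma> * ?Y\<bar> = \<bar>\<Delta>\<bar> + \<bar>\<sigma> * ?Y\<bar>"
          by (auto simp: zero_le_mult_iff)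
        then show ?thesis using \<sigma>(1) by (simp add: abs_mult)
      qed
      \<comment> \<open>The increment bound runs forward in time only. A positive
        \<open>\<sigma>\<close> is served by \<open>\<tau> = t\<close> with a geodesic from
        \<open>y\<close> to \<open>x\<close>, a negative one by \<open>\<tau> = t - l * d\<close>
        with a geodesic from \<open>x\<close> to \<open>y\<close>.\<close>
      have incr: "\<bar>kernel_op P (\<tau> + l * d) f (\<gamma> 1) - kernel_op P \<tau> f (\<gamma> 0)\<bar> \<le> w * d * (n + e) powr (1 / p')"
        if \<gamma>: "minimal_geodesic \<gamma>" "dist (\<gamma> 0) (\<gamma> 1) = d" "\<gamma> 0 = x \<or> \<gamma> 1 = x"
          and \<tau>: "0 < \<tau>" "\<tau> \<le> t" "t \<le> \<tau> + l * d" for \<tau> \<gamma>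
      proof -
        have "\<bar>kernel_op P (\<tau> + l * d) f (\<gamma> 1) - kernel_op P \<tau> f (\<gamma> 0)\<bar>
          \<le> (((a t + e) * dist (\<gamma> 0) (\<gamma> 1)) powr \<beta> + ((\<tau> + l * d - \<tau>) * (d\<^sub>J t + e / l)) powr \<beta>) powr (1 / \<beta>) * (n + e) powr (1 / p')"
          unfolding f
        proof (rule H[unfolded hopf_lax_increment_bound_def Let_def, rule_format, OF g \<delta> \<gamma>(1) \<tau>(1)])
          show "\<tau> < \<tau> + l * d" using l d by simp
          fix r :: real assume r: "r \<in> {0..1}"
          define \<xi> where "\<xi> = r * (\<tau> + l * d) + (1 - r) * \<tau>"
          have "\<xi> = \<tau> + r * (l * d)" unfolding \<xi>_def by (simp add: algebra_simps)
          moreover have "0 \<le> r * (l * d)" "r * (l * d) \<le> l * d" using r l d mult_left_le_one_le[of "l * d" r] by auto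
          ultimately have \<xi>: "\<bar>\<xi> - t\<bar> < \<eta>" "0 \<le> \<xi>" using \<tau> d by auto
          have "dist (\<gamma> r) x \<le> d"
            using minimal_geodesicD[OF \<gamma>(1), of r 0] minimal_geodesicD[OF \<gamma>(1), of r 1] \<gamma>(2,3) r d
            by (auto simp: mult_left_le_one_le)
          then have "(\<integral>y. lip (hopf_lax p \<delta> g) y powr p' \<partial>P \<xi> (\<gamma> r)) \<le> n + e"
            using \<eta>1(1) \<eta> \<xi> d by (intro \<eta>1(2)) auto
          moreover have "a \<xi> \<le> a t + e" "d\<^sub>J \<xi> \<le> d\<^sub>J t + e / l"
            using \<eta>3(2)[of \<xi>] \<eta>4(2)[of \<xi>] \<xi> \<eta> by (auto intro: less_imp_le)
          ultimately show "a (r * (\<tau> + l * d) + (1 - r) * \<tau>) \<le> a t + e \<and> d\<^sub>J (r * (\<tau> + l * d) + (1 - r) * \<tau>) \<le> d\<^sub>J t + e / l \<and>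
              (\<integral>y. lip (hopf_lax p \<delta> g) y powr p' \<partial>P (r * (\<tau> + l * d) + (1 - r) * \<tau>) (\<gamma> r)) \<le> n + e"
            unfolding \<xi>_def by simp
        qed
        also have "(\<tau> + l * d - \<tau>) * (d\<^sub>J t + e / l) = (l * d\<^sub>J t + e) * d" using l by (simp add: field_simps)
        also have "(((a t + e) * dist (\<gamma> 0) (\<gamma> 1)) powr \<beta> + ((l * d\<^sub>J t + e) * d) powr \<beta>) powr (1 / \<beta>) = w * d"
          unfolding \<gamma>(2) powr_mult[of _ d] distrib_right[symmetric] w_def
          unfolding powr_mult[of _ "d powr \<beta>"] using d \<beta>_pos by (simp add: powr_powr)
        finally show ?thesis .
      qed
      have "\<bar>kernel_op P (t + \<sigma>) f x - kernel_op P t f y\<bar> \<le> w * d * (n + e) powr (1 / p')"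
      proof (cases "0 < \<sigma>")
        case True
        obtain \<gamma> where \<gamma>: "minimal_geodesic \<gamma>" "\<gamma> 0 = y" "\<gamma> 1 = x" using geodesic by blast
        then show ?thesis using incr[of \<gamma> t] True \<sigma> t l d by (simp add: d_def dist_commute)
      next
        case False
        obtain \<gamma> where \<gamma>: "minimal_geodesic \<gamma>" "\<gamma> 0 = x" "\<gamma> 1 = y" using geodesic by blast
        have "\<sigma> = - (l * d)" using False \<sigma> by linarith
        then show ?thesis using incr[of \<gamma> "t - l * d"] \<gamma> \<eta> l d by (simp add: d_def abs_minus_commute)
      qed
      also have "\<dots> = w * (n + e) powr (1 / p') * d" by (simp only: mult_ac)
      also have "\<dots> \<le> K' * d" using e(2) d unfolding w_def by (intro mult_right_mono) auto
      finally have 1: "\<bar>kernel_op P (t + \<sigma>) f x - kernel_op P t f y\<bar> \<le> K' * d" .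
      have "\<bar>gen_quotient P f t x \<sigma> - ?Y\<bar> < \<kappa>" using \<sigma> d \<eta> by (intro \<eta>2(2)) auto
      then have qle: "\<bar>\<sigma>\<bar> * \<bar>gen_quotient P f t x \<sigma> - ?Y\<bar> \<le> \<bar>\<sigma>\<bar> * \<kappa>" by (intro mult_left_mono) auto
      have qeq: "\<sigma> * (gen_quotient P f t x \<sigma> - ?Y) = kernel_op P (t + \<sigma>) f x - kernel_op P t f x - \<sigma> * ?Y"
      proof -
        have "\<sigma> * gen_quotient P f t x \<sigma> = kernel_op P (t + \<sigma>) f x - kernel_op P t f x"
          unfolding gen_quotient_def using \<sigma>(2) by simp
        then show ?thesis by (simp add: right_diff_distrib)
      qed
      have "\<bar>kernel_op P (t + \<sigma>) f x - kernel_op P t f x - \<sigma> * ?Y\<bar> \<le> l * d * \<kappa>"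
        using qle unfolding qeq[symmetric] abs_mult \<sigma>(1) .
      also have "l * d * \<kappa> = (K - K') * d" using \<kappa>(2) by (simp add: mult_ac)
      finally have 2: "\<bar>kernel_op P (t + \<sigma>) f x - kernel_op P t f x - \<sigma> * ?Y\<bar> \<le> (K - K') * d" .
      have "\<bar>\<Delta> + \<sigma> * ?Y\<bar> \<le> K' * d + (K - K') * d"
        using 1 2 unfolding \<Delta>_def by linarith
      also have "\<dots> = K * d" by (simp add: field_simps)
      finally have "\<bar>\<Delta>\<bar> \<le> (K - l * \<bar>?Y\<bar>) * d" unfolding abs by (simp add: algebra_simps)
      then show "\<bar>kernel_op P t f y - kernel_op P t f x\<bar> \<le> (K - l * \<bar>?Y\<bar>) * dist x y"
        unfolding \<Delta>_def d_def by (simp add: abs_minus_commute)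
    qed
  qed
  show ?thesis
  proof (rule dense_ge)
    fix K assume K: "?A < K"
    have "0 \<le> ?A" by simp
    then have K0: "0 \<le> K" using less_imp_le[OF K] by (rule order_trans)
    obtain r where r: "0 < r" "\<And>y. 0 < dist x y \<Longrightarrow> dist x y < r \<Longrightarrow>
      \<bar>kernel_op P t f y - kernel_op P t f x\<bar> \<le> (K - l * \<bar>?Y\<bar>) * dist x y"
      using main[OF K] by blast
    \<comment> \<open>A negative bound would be truncated to \<open>0\<close> by
      \<open>ennreal\<close>. The sign is read off from any \<open>y \<noteq> x\<close> close to
      \<open>x\<close>; if there is none, the space is a single point and the generator
      vanishes.\<close>
    have KY: "0 \<le> K - l * \<bar>?Y\<bar>"
    proof (rule singleton_or_near[of x])
      assume "\<And>y. y = x"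
      then have "?Y = 0" by (rule generator_singleton[OF _ fBL t])
      then show ?thesis using K0 by simp
    next
      assume "\<And>r. 0 < r \<Longrightarrow> \<exists>y. 0 < dist x y \<and> dist x y < r"
      then obtain y where y: "0 < dist x y" "dist x y < r" using r(1) by blast
      have "0 \<le> (K - l * \<bar>?Y\<bar>) * dist x y" using r(2)[OF y] abs_ge_zero order_trans by blast
      then show ?thesis using y(1) by (simp add: zero_le_mult_iff)
    qed
    have "local_lip (kernel_op P t f) x \<le> ennreal (K - l * \<bar>?Y\<bar>)"
    proof (rule local_lip_leI)
      fix K' assume K': "K - l * \<bar>?Y\<bar> < K'"
      have "\<bar>kernel_op P t f y - kernel_op P t f x\<bar> \<le> K' * dist x y" if "dist x y < r" for y
      proof (cases "x = y")
        case False
        then have "\<bar>kernel_op P t f y - kernel_op P t f x\<bar> \<le> (K - l * \<bar>?Y\<bar>) * dist x y" using r(2)[of y] that by simp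
        also have "\<dots> \<le> K' * dist x y" using K' by (intro mult_right_mono) auto
        finally show ?thesis .
      qed simp
      then show "\<exists>r>0. \<forall>y. dist x y < r \<longrightarrow> \<bar>kernel_op P t f y - kernel_op P t f x\<bar> \<le> K' * dist x y"
        using r(1) by blast
    qed
    then have "?X \<le> K - l * \<bar>?Y\<bar>" unfolding lip_def using KY by (rule enn2real_leI[rotated])
    then show "?X + l * \<bar>?Y\<bar> \<le> K" by simp
  qed
qed

text \<open>The slope inequality for all \<open>l > 0\<close> is a family of linear bounds on the
  pair \<open>(X / a t, b t * Y)\<close>. The choices \<open>s = u / a t\<close> and
  \<open>l = v * b t / s\<close> realise every direction \<open>(u, v)\<close>, and
  \<open>dual_norm_two_terms\<close> converts the family into a bound on the dual norm.\<close>

lemma increment_bound_imp_gradient: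
  assumes H: hopf_lax_increment_bound
  shows "hopf_lax_gradient_estimate P a b p p' \<beta>'"
  unfolding hopf_lax_gradient_estimate_def
proof (intro allI ballI impI)
  fix t :: real and x :: 'a and \<delta> :: real and g f :: "'a \<Rightarrow> real"
  assume t: "0 < t" and \<delta>: "0 < \<delta>" and g: "g \<in> bounded_lipschitz" and f: "f = hopf_lax p \<delta> g"
  have t0: "0 \<le> t" using t by simp
  obtain B where B: "\<forall>x. \<bar>g x\<bar> \<le> B" using g by (rule bounded_lipschitzE) blast
  have fBL: "f \<in> bounded_lipschitz"
    unfolding f by (rule hopf_lax_bounded_lipschitz[OF exponents(1,5) B \<delta>])
  obtain L where L: "L-lipschitz_on UNIV f" using fBL by (rule bounded_lipschitzE)
  note L0 = lipschitz_on_nonneg[OF L]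
  define X where "X = lip (kernel_op P t f) x"
  define Y where "Y = \<bar>gen_semigroup P f t x\<bar>"
  define n where "n = (\<integral>y. lip f y powr p' \<partial>P t x)"
  have at0: "0 < a t" and bt0: "0 < b t" using a(2) b(2) t by auto
  have n0: "0 \<le> n" unfolding n_def by simp
  have X0: "0 \<le> X" and Y0: "0 \<le> Y" unfolding X_def Y_def by auto
  have "(X / a t) powr \<beta>' + (b t * Y) powr \<beta>' \<le> (n powr (1 / p')) powr \<beta>'"
  proof (rule dual_norm_two_terms[OF exponents(3,4,6)])
    fix u v :: real assume u: "0 < u" and v: "0 < v"
    define s where "s = u / a t"
    define l where "l = v * b t / s"
    have s: "0 < s" and l: "0 < l" unfolding s_def l_def using u v at0 bt0 by auto
    have "X + l * Y \<le> (a t powr \<beta> + (l * d\<^sub>J t) powr \<beta>) powr (1 / \<beta>) * n powr (1 / p')"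
      using increment_bound_space_time_slope[OF H t \<delta> g f l] unfolding X_def Y_def n_def .
    then have "s * (X + l * Y) \<le> s * ((a t powr \<beta> + (l * d\<^sub>J t) powr \<beta>) powr (1 / \<beta>) * n powr (1 / p'))"
      using s by (intro mult_left_mono) auto
    moreover have "s * (X + l * Y) = u * (X / a t) + v * (b t * Y)"
    proof -
      have "s * l = v * b t" unfolding l_def using s by simp
      moreover have "s * X = u * (X / a t)" unfolding s_def by simp
      ultimately show ?thesis by (simp add: distrib_left mult.assoc[symmetric])
    qed
    moreover have "s * (a t powr \<beta> + (l * d\<^sub>J t) powr \<beta>) powr (1 / \<beta>) = (u powr \<beta> + v powr \<beta>) powr (1 / \<beta>)"
    proof -
      have "u powr \<beta> = s powr \<beta> * a t powr \<beta>"
        using s at0 by (subst powr_mult[symmetric]) (auto simp: s_def)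
      moreover have "v powr \<beta> = s powr \<beta> * (l * d\<^sub>J t) powr \<beta>"
        using s l bt0 by (subst powr_mult[symmetric]) (auto simp: l_def dJ_eq[OF t])
      ultimately have "(u powr \<beta> + v powr \<beta>) powr (1 / \<beta>) = (s powr \<beta> * (a t powr \<beta> + (l * d\<^sub>J t) powr \<beta>)) powr (1 / \<beta>)"
        by (simp only: distrib_left)
      also have "\<dots> = (s powr \<beta>) powr (1 / \<beta>) * (a t powr \<beta> + (l * d\<^sub>J t) powr \<beta>) powr (1 / \<beta>)"
        by (rule powr_mult)
      finally show ?thesis using s \<beta>_pos by (simp add: powr_powr)
    qed
    ultimately show "u * (X / a t) + v * (b t * Y) \<le> (u powr \<beta> + v powr \<beta>) powr (1 / \<beta>) * n powr (1 / p')"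
      by (simp add: mult.assoc[symmetric])
  qed (use X0 Y0 at0 bt0 in auto)
  then have "X powr \<beta>' / a t powr \<beta>' + b t powr \<beta>' * Y powr \<beta>' \<le> n powr (\<beta>' / p')"
    using X0 Y0 at0 bt0 by (simp add: powr_divide powr_mult powr_powr)
  then have "X powr \<beta>' / a t powr \<beta>' \<le> n powr (\<beta>' / p') - b t powr \<beta>' * Y powr \<beta>'" by simp
  then have XY: "X powr \<beta>' \<le> a t powr \<beta>' * (n powr (\<beta>' / p') - b t powr \<beta>' * Y powr \<beta>')"
    using at0 by (simp add: divide_le_eq mult.commute)
  have Ptf: "((a t + 1) * L)-lipschitz_on UNIV (kernel_op P t f)"
    unfolding f by (rule increment_bound_lipschitz[OF H t \<delta> g]) (use L f in auto)
  have "enn2ereal (epowr (local_lip (kernel_op P t f) x) \<beta>') = ereal (X powr \<beta>')"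
    unfolding local_lip_eq_lip[OF Ptf] X_def[symmetric] using X0 by (simp add: enn2ereal_ennreal)
  moreover have "enn2ereal (epowr (\<integral>\<^sup>+ y. epowr (local_lip f y) p' \<partial>P t x) (\<beta>' / p')) = ereal (n powr (\<beta>' / p'))"
    unfolding epowr_nn_integral_local_lip[OF kernel_prob[OF t0] L p'_pos] n_def[symmetric]
    using n0 by (simp add: enn2ereal_ennreal)
  ultimately show "enn2ereal (epowr (local_lip (kernel_op P t f) x) \<beta>')
      \<le> ereal (a t powr \<beta>') * (enn2ereal (epowr (\<integral>\<^sup>+ y. epowr (local_lip f y) p' \<partial>P t x) (\<beta>' / p'))
          - ereal (b t powr \<beta>' * \<bar>gen_semigroup P f t x\<bar> powr \<beta>'))"
    using XY unfolding Y_def by simp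
qed

end

theorem theorem2p1:
  fixes P :: "real \<Rightarrow> 'a::polish_space \<Rightarrow> 'a measure"
    and a b :: "real \<Rightarrow> real"
    and p p' \<beta> \<beta>' :: real
  assumes geodesic: "\<forall>x y :: 'a. \<exists>\<gamma>. minimal_geodesic \<gamma> \<and> \<gamma> 0 = x \<and> \<gamma> 1 = y"
    and semigroup: "markov_semigroup P"
    and exponents: "1 < p" "1 < p'" "1 < \<beta>" "1 < \<beta>'"
      "1 / p + 1 / p' = 1" "1 / \<beta> + 1 / \<beta>' = 1" "\<beta> \<le> p"
    and a: "continuous_on {0..} a" "\<forall>r\<ge>0. a r > 0"
    and b: "continuous_on {0<..} b" "\<forall>r>0. b r > 0"
    and J_finite: "\<forall>\<delta>>0. emeasure (time_measure b) {0..<\<delta>} < \<infinity>"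
    and generator: "\<forall>f\<in>bounded_lipschitz. \<forall>t>0. \<forall>x. \<exists>L. (gen_quotient P f t x \<longlongrightarrow> L) (at 0)"
  shows "(wasserstein_control P a b p \<beta> \<longleftrightarrow> hopf_lax_gradient_estimate P a b p p' \<beta>') \<and>
         (hopf_lax_gradient_estimate P a b p p' \<beta>' \<longleftrightarrow> geodesic_space_time_estimate P a b p' \<beta>)"
proof -
  interpret space_time P a b p p' \<beta> \<beta>'
    using assms by unfold_locales
  show ?thesis
    using increment_bound_imp_gradient control_imp_geodesic gradient_imp_increment_bound
      geodesic_imp_increment_bound increment_bound_imp_control by blast
qed

end
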